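(* Assume that $s>d/2$ and that the functions $p_\alpha$ belong to $C^\infty(\Omega)$. Let $a_m>0$ be a positive eigenvalue of the operator $C\mathscr{O}_nC$ on $L^2([-2L,2L]^d)$, with eigenfunction $v_m$. Then $v_m=a_m^{-1}Cw_m$ for some $w_m\in H^s_{\mathrm{per}}([-2L,2L]^d)$ satisfying, for every test function $\phi\in H^s_{\mathrm{per}}([-2L,2L]^d)$, \[\lambda_n\sum_{|\alpha|\le s}\int_{[-2L,2L]^d}\partial^\alpha w_m\,\partial^\alpha\phi+\mu_n\int_\Omega\mathscr{D}(w_m)\,\mathscr{D}(\phi)=a_m^{-1}\int_\Omega w_m\phi.\tag{W}\] Moreover, any solution $w_m\in H^s_{\mathrm{per}}([-2L,2L]^d)$ of (W) satisfies: (i) $w_m\in C^\infty(\Omega)$ and for all $x\in\Omega$, $\lambda_n\sum_{|\alpha|\le s}(-1)^{|\alpha|}\partial^{2\alpha}w_m(x)+\mu_n\mathscr{D}^\ast\mathscr{D}w_m(x)=a_m^{-1}w_m(x)$, where $\mathscr{D}^\ast(f)=\sum_{|\alpha|\le s}(-1)^{|\alpha|}\partial^\alpha(p_\alpha f)$; (ii) $w_m\in C^\infty([-2L,2L]^d\setminus\bar\Omega)$ and for all $x\in[-2L,2L]^d\setminus\bar\Omega$, $\sum_{|\alpha|\le s}(-1)^{|\alpha|}\partial^{2\alpha}w_m(x)=0$.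
   Context: Let $d\ge1$, $L>0$, $\Omega\subseteq[-L,L]^d$ a bounded Lipschitz domain, $s$ a positive integer, $\lambda_n>0$, $\mu_n\ge0$. $H^s_{\mathrm{per}}([-2L,2L]^d)$ is the set of $f\in L^2([-2L,2L]^d)$ whose $4L$-periodic extension to $[-4L,4L]^d$ lies in $H^s([-4L,4L]^d)$, normed by $\sum_{|\alpha|\le s}\int_{[-2L,2L]^d}|\partial^\alpha f|^2$. $\mathscr{D}(f)=\sum_{|\alpha|\le s}p_\alpha\partial^\alpha f$ with $p_\alpha:\Omega\to\mathbb{R}$, $\max_\alpha\|p_\alpha\|_\infty<\infty$. With $B[u,v]=\lambda_n\sum_{|\alpha|\le s}\int_{[-2L,2L]^d}\partial^\alpha u\partial^\alpha v+\mu_n\int_\Omega\mathscr{D}u\,\mathscr{D}v$, $\mathscr{O}_n$ maps $f\in L^2([-2L,2L]^d)$ to the unique $w\in H^s_{\mathrm{per}}$ with $B[w,\phi]=\int_{[-2L,2L]^d}\phi f$ for all $\phi\in H^s_{\mathrm{per}}$. $C$ is the operator $Cf=f\mathbf{1}_\Omega$ on $L^2([-2L,2L]^d)$; $\partial^{2\alpha}$ denotes $\partial^\beta$ with $\beta=2\alpha$. *)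

theory Defs
  imports "HOL-Analysis.Analysis" "HOL-Library.Multiset"
begin

text \<open>Points of R^d are vectors of type real^'n with d = CARD('n).
  Multi-indices are functions 'n => nat.\<close>

definition mi_order :: "('n::finite \<Rightarrow> nat) \<Rightarrow> nat" where
  "mi_order \<alpha> = (\<Sum>i\<in>UNIV. \<alpha> i)"

definition multi_indices :: "nat \<Rightarrow> ('n::finite \<Rightarrow> nat) set" where
  "multi_indices s = {\<alpha>. mi_order \<alpha> \<le> s}"

definition cpartial :: "'n::finite \<Rightarrow> (real^'n \<Rightarrow> real) \<Rightarrow> real^'n \<Rightarrow> real" where
  "cpartial i f x = deriv (\<lambda>t. f (x + t *\<^sub>R axis i 1)) 0"

fun dlist :: "'n::finite list \<Rightarrow> (real^'n \<Rightarrow> real) \<Rightarrow> real^'n \<Rightarrow> real" where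
  "dlist [] f = f"
| "dlist (i # is) f = cpartial i (dlist is f)"

definition alpha_list :: "('n::finite \<Rightarrow> nat) \<Rightarrow> 'n list" where
  "alpha_list \<alpha> = (SOME l. \<forall>i. count (mset l) i = \<alpha> i)"

text \<open>Classical derivative of multi-index alpha (order irrelevant for smooth functions).\<close>
definition cderiv :: "('n::finite \<Rightarrow> nat) \<Rightarrow> (real^'n \<Rightarrow> real) \<Rightarrow> real^'n \<Rightarrow> real" where
  "cderiv \<alpha> f = dlist (alpha_list \<alpha>) f"

definition smooth_on :: "(real^'n::finite) set \<Rightarrow> (real^'n \<Rightarrow> real) \<Rightarrow> bool" where
  "smooth_on U f \<longleftrightarrow>
     (\<forall>l. continuous_on U (dlist l f) \<and>
          (\<forall>i. \<forall>x\<in>U. (\<lambda>t. dlist l f (x + t *\<^sub>R axis i 1)) differentiable (at 0)))"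

definition test_fn :: "(real^'n::finite) set \<Rightarrow> (real^'n \<Rightarrow> real) \<Rightarrow> bool" where
  "test_fn U \<phi> \<longleftrightarrow> smooth_on UNIV \<phi> \<and> compact (closure {x. \<phi> x \<noteq> 0})
                      \<and> closure {x. \<phi> x \<noteq> 0} \<subseteq> U"

definition loc_integrable :: "(real^'n::finite) set \<Rightarrow> (real^'n \<Rightarrow> real) \<Rightarrow> bool" where
  "loc_integrable U f \<longleftrightarrow> (\<forall>K. compact K \<and> K \<subseteq> U \<longrightarrow> integrable (lebesgue_on K) f)"

definition is_weak_deriv ::
  "(real^'n::finite) set \<Rightarrow> ('n \<Rightarrow> nat) \<Rightarrow> (real^'n \<Rightarrow> real) \<Rightarrow> (real^'n \<Rightarrow> real) \<Rightarrow> bool" where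
  "is_weak_deriv U \<alpha> f g \<longleftrightarrow> loc_integrable U f \<and> loc_integrable U g \<and>
     (\<forall>\<phi>. test_fn U \<phi> \<longrightarrow>
        integral\<^sup>L (lebesgue_on U) (\<lambda>x. f x * cderiv \<alpha> \<phi> x)
        = (-1) ^ mi_order \<alpha> * integral\<^sup>L (lebesgue_on U) (\<lambda>x. g x * \<phi> x))"

text \<open>The weak derivative (unique up to null sets).\<close>
definition wd :: "(real^'n::finite) set \<Rightarrow> ('n \<Rightarrow> nat) \<Rightarrow> (real^'n \<Rightarrow> real) \<Rightarrow> real^'n \<Rightarrow> real" where
  "wd U \<alpha> f = (SOME g. is_weak_deriv U \<alpha> f g)"

definition L2 :: "(real^'n::finite) set \<Rightarrow> (real^'n \<Rightarrow> real) \<Rightarrow> bool" where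
  "L2 U f \<longleftrightarrow> f \<in> borel_measurable (lebesgue_on U) \<and> integrable (lebesgue_on U) (\<lambda>x. (f x)\<^sup>2)"

definition sobolev :: "nat \<Rightarrow> (real^'n::finite) set \<Rightarrow> (real^'n \<Rightarrow> real) \<Rightarrow> bool" where
  "sobolev s U f \<longleftrightarrow> L2 U f \<and> (\<forall>\<alpha>\<in>multi_indices s. \<exists>g. is_weak_deriv U \<alpha> f g \<and> L2 U g)"

definition ccube :: "real \<Rightarrow> (real^'n::finite) set" where
  "ccube r = {x. \<forall>i. - r \<le> x $ i \<and> x $ i \<le> r}"

definition ocube :: "real \<Rightarrow> (real^'n::finite) set" where
  "ocube r = {x. \<forall>i. - r < x $ i \<and> x $ i < r}"

definition per_ext :: "real \<Rightarrow> (real^'n::finite \<Rightarrow> real) \<Rightarrow> real^'n \<Rightarrow> real" where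
  "per_ext L f x = f (\<chi> i. x $ i - 4 * L * of_int \<lfloor>(x $ i + 2 * L) / (4 * L)\<rfloor>)"

definition Hs_per :: "nat \<Rightarrow> real \<Rightarrow> (real^'n::finite \<Rightarrow> real) set" where
  "Hs_per s L = {f. L2 (ccube (2 * L)) f \<and> sobolev s (ocube (4 * L)) (per_ext L f)}"

definition pder :: "real \<Rightarrow> ('n::finite \<Rightarrow> nat) \<Rightarrow> (real^'n \<Rightarrow> real) \<Rightarrow> real^'n \<Rightarrow> real" where
  "pder L \<alpha> f = wd (ocube (4 * L)) \<alpha> (per_ext L f)"

definition Dop :: "nat \<Rightarrow> real \<Rightarrow> (('n::finite \<Rightarrow> nat) \<Rightarrow> real^'n \<Rightarrow> real) \<Rightarrow>
                   (real^'n \<Rightarrow> real) \<Rightarrow> real^'n \<Rightarrow> real" where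
  "Dop s L p f x = (\<Sum>\<alpha>\<in>multi_indices s. p \<alpha> x * pder L \<alpha> f x)"

definition Bform :: "nat \<Rightarrow> real \<Rightarrow> (real^'n::finite) set \<Rightarrow> (('n \<Rightarrow> nat) \<Rightarrow> real^'n \<Rightarrow> real) \<Rightarrow>
                     real \<Rightarrow> real \<Rightarrow> (real^'n \<Rightarrow> real) \<Rightarrow> (real^'n \<Rightarrow> real) \<Rightarrow> real" where
  "Bform s L \<Omega> p lam mu u v =
     lam * (\<Sum>\<alpha>\<in>multi_indices s.
            integral\<^sup>L (lebesgue_on (ccube (2 * L))) (\<lambda>x. pder L \<alpha> u x * pder L \<alpha> v x))
     + mu * integral\<^sup>L (lebesgue_on \<Omega>) (\<lambda>x. Dop s L p u x * Dop s L p v x)"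

text \<open>O_rel f w: w = O_n f, i.e. w in H^s_per and B[w,phi] = int phi f for all phi.\<close>
definition O_rel :: "nat \<Rightarrow> real \<Rightarrow> (real^'n::finite) set \<Rightarrow> (('n \<Rightarrow> nat) \<Rightarrow> real^'n \<Rightarrow> real) \<Rightarrow>
                     real \<Rightarrow> real \<Rightarrow> (real^'n \<Rightarrow> real) \<Rightarrow> (real^'n \<Rightarrow> real) \<Rightarrow> bool" where
  "O_rel s L \<Omega> p lam mu f w \<longleftrightarrow> L2 (ccube (2 * L)) f \<and> w \<in> Hs_per s L \<and>
     (\<forall>\<phi>\<in>Hs_per s L. Bform s L \<Omega> p lam mu w \<phi>
        = integral\<^sup>L (lebesgue_on (ccube (2 * L))) (\<lambda>x. \<phi> x * f x))"

definition Cop :: "(real^'n::finite) set \<Rightarrow> (real^'n \<Rightarrow> real) \<Rightarrow> real^'n \<Rightarrow> real" where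
  "Cop \<Omega> f x = indicator \<Omega> x * f x"

definition Dc :: "nat \<Rightarrow> (('n::finite \<Rightarrow> nat) \<Rightarrow> real^'n \<Rightarrow> real) \<Rightarrow> (real^'n \<Rightarrow> real) \<Rightarrow> real^'n \<Rightarrow> real" where
  "Dc s p f x = (\<Sum>\<alpha>\<in>multi_indices s. p \<alpha> x * cderiv \<alpha> f x)"

definition Dstar :: "nat \<Rightarrow> (('n::finite \<Rightarrow> nat) \<Rightarrow> real^'n \<Rightarrow> real) \<Rightarrow> (real^'n \<Rightarrow> real) \<Rightarrow> real^'n \<Rightarrow> real" where
  "Dstar s p f x = (\<Sum>\<alpha>\<in>multi_indices s. (-1) ^ mi_order \<alpha> * cderiv \<alpha> (\<lambda>y. p \<alpha> y * f y) x)"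

text \<open>Bounded Lipschitz domain: bounded, open, connected, and near every boundary point
  the domain is the strict supergraph (in some unit direction e) of a Lipschitz function
  that depends only on the components orthogonal to e.\<close>
definition lipschitz_domain :: "(real^'n::finite) set \<Rightarrow> bool" where
  "lipschitz_domain \<Omega> \<longleftrightarrow> open \<Omega> \<and> connected \<Omega> \<and> bounded \<Omega> \<and> \<Omega> \<noteq> {} \<and>
     (\<forall>x\<in>frontier \<Omega>. \<exists>r>0. \<exists>e::real^'n. \<exists>\<gamma>. \<exists>M. norm e = 1 \<and>
        M-lipschitz_on UNIV \<gamma> \<and> (\<forall>y t. \<gamma> (y + t *\<^sub>R e) = \<gamma> y) \<and>
        \<Omega> \<inter> ball x r = {y\<in>ball x r. y \<bullet> e > \<gamma> y})"

end

theory Submission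
  imports Defs
begin

text \<open>The weak equation exhibits an eigenfunction as the restriction of a weak solution \<open>w\<close> of an
  equation whose form dominates the full \<open>H\<^sup>s\<close> inner product, so the only issue is local regularity.
  Let \<open>w\<^sub>\<epsilon>\<close> be the mollification of \<open>w\<close> and \<open>\<eta>\<close> a cutoff. Testing the mollified equation with
  \<open>\<eta> \<partial>\<^sub>i w\<^sub>\<epsilon>\<close>, Friedrichs' commutator lemma bounds the form by the \<open>H\<^sup>s\<close> norm of the test function, and
  coercivity then bounds \<open>\<eta> \<partial>\<^sub>i w\<^sub>\<epsilon>\<close> in \<open>H\<^sup>s\<close> uniformly in \<open>\<epsilon>\<close>: one derivative is gained. Differentiating
  the equation and repeating gains all of them. Derivatives of \<open>w\<close> are treated throughout as functionals
  on test functions that are bounded in \<open>L\<^sup>2\<close>. The inequality \<open>sup \<bar>u\<bar> \<le> \<integral>\<bar>\<partial>\<^sub>1 \<dots> \<partial>\<^sub>d u\<bar>\<close> for test functions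
  makes all derivatives of \<open>w\<^sub>\<epsilon>\<close> converge locally uniformly, and the limit is a smooth representative of
  \<open>w\<close>. Faces of the cube \<open>[-2L, 2L]\<^sup>d\<close> are interior for the periodic extension: a test function
  supported in \<open>]-3L, 3L[\<^sup>d\<close> is made admissible by summing its \<open>4L\<close>-translates.\<close>

section \<open>Calculus of smooth functions\<close>

text \<open>The coefficients are smooth only inside \<Omega>, and their derivatives may be unbounded
  near its boundary. Bounds are therefore stated for test functions supported in a fixed compact
  \<open>K\<close>, with constants independent of the mollification parameter; how small that
  parameter must be depends on \<open>K\<close>, since mollifying enlarges supports.

  The order count that closes the iteration: if \<open>T m\<close> is bounded up to order
  \<open>s + k\<close>, the commutators created by differentiating the equation consume
  \<open>s\<close> of these orders and are bounded up to order \<open>k\<close>, just what the next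
  step asks of a right-hand side. Coercivity needs no lower order correction because the form
  contains the derivative of order 0.

  Uniform bounds alone would give convergence of subsequences only. An explicit rate, the square of
  the \<open>L\<^sup>2\<close> distance of two mollifications being at most a constant times
  \<open>e + d\<close>, gives a Cauchy sequence without any compactness theorem.

  Iterated derivatives are lists of directions rather than multi-indices: product rule and
  integration by parts peel off one direction at a time, and the symmetry of mixed derivatives
  returns to multi-indices where needed.\<close>

definition has_partial :: "'n::finite \<Rightarrow> (real^'n \<Rightarrow> real) \<Rightarrow> real^'n \<Rightarrow> real \<Rightarrow> bool" where
  "has_partial i f x D \<longleftrightarrow> ((\<lambda>t. f (x + t *\<^sub>R axis i 1)) has_real_derivative D) (at 0)"

lemma cpartial_eqI: "has_partial i f x D \<Longrightarrow> cpartial i f x = D"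
  by (simp add: has_partial_def cpartial_def DERIV_imp_deriv)

lemma has_partial_iff:
  "has_partial i f x (cpartial i f x) \<longleftrightarrow> (\<lambda>t. f (x + t *\<^sub>R axis i 1)) differentiable (at 0)"
  unfolding has_partial_def cpartial_def
  using DERIV_deriv_iff_real_differentiable by blast

lemma eventually_line_in_open:
  fixes U :: "(real^'n::finite) set"
  assumes "open U" "x \<in> U"
  shows "eventually (\<lambda>t. x + t *\<^sub>R v \<in> U) (nhds (0::real))"
proof -
  have "((\<lambda>t. x + t *\<^sub>R v) \<longlongrightarrow> x + 0 *\<^sub>R v) (nhds 0)"
    by (intro tendsto_intros filterlim_ident)
  then show ?thesis
    using assms by (auto simp: tendsto_def)
qed

lemma has_partial_cong:
  assumes "open U" "x \<in> U" "\<And>y. y \<in> U \<Longrightarrow> f y = g y"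
  shows "has_partial i f x D \<longleftrightarrow> has_partial i g x D"
  unfolding has_partial_def
proof (rule DERIV_cong_ev)
  show "eventually (\<lambda>t. f (x + t *\<^sub>R axis i 1) = g (x + t *\<^sub>R axis i 1)) (nhds 0)"
    using eventually_line_in_open[OF assms(1,2)] by eventually_elim (use assms in auto)
qed auto

lemma cpartial_cong:
  assumes "open U" "x \<in> U" "\<And>y. y \<in> U \<Longrightarrow> f y = g y"
  shows "cpartial i f x = cpartial i g x"
  unfolding cpartial_def
proof (rule deriv_cong_ev)
  show "eventually (\<lambda>t. f (x + t *\<^sub>R axis i 1) = g (x + t *\<^sub>R axis i 1)) (nhds 0)"
    using eventually_line_in_open[OF assms(1,2)] by eventually_elim (use assms in auto)
qed auto

lemma dlist_cong:
  assumes "open U" "\<And>y. y \<in> U \<Longrightarrow> f y = g y" "x \<in> U"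
  shows "dlist l f x = dlist l g x"
  using assms(3)
proof (induction l arbitrary: x)
  case (Cons i l)
  then show ?case by (auto intro: cpartial_cong[OF assms(1)])
qed (use assms in auto)

lemma dlist_append: "dlist (l @ m) f = dlist l (dlist m f)"
  by (induction l) auto

lemma smooth_on_continuous: "smooth_on U f \<Longrightarrow> continuous_on U (dlist l f)"
  by (simp add: smooth_on_def)

lemma smooth_on_continuous0: "smooth_on U f \<Longrightarrow> continuous_on U f"
  using smooth_on_continuous[of U f "[]"] by simp

lemma smooth_on_has_partial:
  "smooth_on U f \<Longrightarrow> x \<in> U \<Longrightarrow> has_partial i f x (cpartial i f x)"
  unfolding has_partial_iff smooth_on_def by (metis dlist.simps(1))

lemma smooth_on_dlist: "smooth_on U f \<Longrightarrow> smooth_on U (dlist l f)"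
  unfolding smooth_on_def by (metis dlist_append)

lemma smooth_on_cpartial: "smooth_on U f \<Longrightarrow> smooth_on U (cpartial i f)"
  using smooth_on_dlist[of U f "[i]"] by simp

lemma smooth_on_subset: "smooth_on U f \<Longrightarrow> V \<subseteq> U \<Longrightarrow> smooth_on V f"
  unfolding smooth_on_def by (meson continuous_on_subset subset_iff)

text \<open>\<open>smooth_on\<close> speaks about all iterated derivatives at once. If a class
  \<open>P\<close> of continuous functions is closed under partial derivatives, every
  \<open>dlist l f\<close> agrees on \<open>U\<close> with a member of \<open>P\<close>. Agreement
  on \<open>U\<close> alone is enough for differentiating again because \<open>U\<close> is
  open.\<close>

lemma smooth_on_coinduct:
  assumes U: "open U" and "P f"
    and step: "\<And>f. P f \<Longrightarrow> continuous_on U f \<and> (\<forall>i. \<exists>g. P g \<and> (\<forall>x\<in>U. has_partial i f x (g x)))"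
  shows "smooth_on U f"
proof -
  have *: "\<exists>h. P h \<and> (\<forall>x\<in>U. dlist l f x = h x)" for l
  proof (induction l)
    case Nil then show ?case using assms(2) by auto
  next
    case (Cons i l)
    then obtain h where h: "P h" "\<forall>x\<in>U. dlist l f x = h x" by auto
    obtain g where g: "P g" "\<forall>x\<in>U. has_partial i h x (g x)"
      using conjunct2[OF step[OF h(1)], THEN spec[of _ i]] by (elim exE conjE)
    have "dlist (i # l) f x = g x" if "x \<in> U" for x
      using cpartial_cong[OF U that, of "dlist l f" h i] h(2) cpartial_eqI[OF g(2)[rule_format, OF that]] by simp
    then show ?case using g(1) by auto
  qed
  show ?thesis unfolding smooth_on_def
  proof (intro allI conjI ballI)
    fix l
    obtain h where h: "P h" "\<forall>x\<in>U. dlist l f x = h x" using * by blast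
    show "continuous_on U (dlist l f)"
      using step[OF h(1)] h(2) continuous_on_cong[of U U "dlist l f" h] by auto
    fix i x assume x: "x \<in> U"
    obtain g where "has_partial i h x g"
      using conjunct2[OF step[OF h(1)], THEN spec[of _ i]] x by (elim exE conjE) auto
    then have "has_partial i (dlist l f) x g"
      using has_partial_cong[OF U x, of "dlist l f" h] h(2) by auto
    then show "(\<lambda>t. dlist l f (x + t *\<^sub>R axis i 1)) differentiable at 0"
      unfolding has_partial_def real_differentiable_def by blast
  qed
qed

lemma has_partial_add:
  "has_partial i f x D \<Longrightarrow> has_partial i g x E \<Longrightarrow> has_partial i (\<lambda>x. f x + g x) x (D + E)"
  unfolding has_partial_def by (rule DERIV_add)

lemma has_partial_mult:
  "has_partial i f x D \<Longrightarrow> has_partial i g x E \<Longrightarrow> has_partial i (\<lambda>x. f x * g x) x (D * g x + f x * E)"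
  unfolding has_partial_def using DERIV_mult[of "\<lambda>t. f (x + t *\<^sub>R axis i 1)" D 0 UNIV "\<lambda>t. g (x + t *\<^sub>R axis i 1)" E]
  by (simp add: mult.commute)

lemma has_partial_const: "has_partial i (\<lambda>x. c) x 0"
  unfolding has_partial_def by simp

lemma has_partial_cmult: "has_partial i f x D \<Longrightarrow> has_partial i (\<lambda>x. c * f x) x (c * D)"
  using has_partial_mult[OF has_partial_const, of i f x D c] by simp

lemma smooth_on_cong:
  assumes "open U" "smooth_on U f" "\<And>y. y \<in> U \<Longrightarrow> f y = g y"
  shows "smooth_on U g"
proof (rule smooth_on_coinduct[where P = "\<lambda>g. \<exists>f. smooth_on U f \<and> (\<forall>y\<in>U. f y = g y)"])
  fix h assume "\<exists>f. smooth_on U f \<and> (\<forall>y\<in>U. f y = h y)"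
  then obtain f where f: "smooth_on U f" "\<forall>y\<in>U. f y = h y" by auto
  have "continuous_on U h"
    using smooth_on_continuous0[OF f(1)] continuous_on_cong[of U U f h] f by auto
  moreover have "\<exists>g. (\<exists>f. smooth_on U f \<and> (\<forall>y\<in>U. f y = g y)) \<and> (\<forall>x\<in>U. has_partial i h x (g x))" for i
    using smooth_on_cpartial[OF f(1), of i] smooth_on_has_partial[OF f(1), of _ i] has_partial_cong[OF assms(1), of _ f h i] f(2)
    by (intro exI[of _ "cpartial i f"] conjI) auto
  ultimately show "continuous_on U h \<and> (\<forall>i. \<exists>g. (\<exists>f. smooth_on U f \<and> (\<forall>y\<in>U. f y = g y)) \<and> (\<forall>x\<in>U. has_partial i h x (g x)))"
    by blast
qed (use assms in auto)

lemma smooth_on_const: "open U \<Longrightarrow> smooth_on U (\<lambda>x. c)"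
  by (rule smooth_on_coinduct[where P = "\<lambda>f. \<exists>c. f = (\<lambda>x. c)"]) (auto intro: has_partial_const)

text \<open>Single products are not closed under differentiation, finite sums of products are. Kept
  as lists of factor pairs they form the class for the coinduction; the product and the sum of two
  functions are the lists of length one and two.\<close>

lemma smooth_on_mult_sums:
  assumes U: "open U" and "\<forall>(f, g)\<in>set ps. smooth_on U f \<and> smooth_on U g"
  shows "smooth_on U (\<lambda>x. \<Sum>(f, g)\<leftarrow>ps. f x * g x)"
proof -
  define Q where "Q ps \<longleftrightarrow> (\<forall>(f, g)\<in>set ps. smooth_on U f \<and> smooth_on U g)" for ps
  show ?thesis
  proof (rule smooth_on_coinduct[OF U, where P = "\<lambda>F. \<exists>ps. Q ps \<and> F = (\<lambda>x. \<Sum>(f, g)\<leftarrow>ps. f x * g x)"])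
    show "\<exists>ps'. Q ps' \<and> (\<lambda>x. \<Sum>(f, g)\<leftarrow>ps. f x * g x) = (\<lambda>x. \<Sum>(f, g)\<leftarrow>ps'. f x * g x)"
      using assms Q_def by blast
  next
    fix F assume "\<exists>ps. Q ps \<and> F = (\<lambda>x. \<Sum>(f, g)\<leftarrow>ps. f x * g x)"
    then obtain ps where ps: "Q ps" and F: "F = (\<lambda>x. \<Sum>(f, g)\<leftarrow>ps. f x * g x)" by blast
    have "continuous_on U (\<lambda>x. \<Sum>(f, g)\<leftarrow>ps. f x * g x) \<and>
      (\<forall>i. \<exists>qs. Q qs \<and> (\<forall>x\<in>U. has_partial i (\<lambda>x. \<Sum>(f, g)\<leftarrow>ps. f x * g x) x (\<Sum>(f, g)\<leftarrow>qs. f x * g x)))"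
      using ps
    proof (induction ps)
      case Nil
      have "Q []" by (simp add: Q_def)
      then show ?case by (auto intro!: exI[of _ "[]"] has_partial_const)
    next
      case (Cons p ps)
      obtain f g where p: "p = (f, g)" by fastforce
      have s: "smooth_on U f" "smooth_on U g" "Q ps" using Cons.prems by (auto simp: Q_def p)
      show ?case
      proof (intro conjI allI)
        show "continuous_on U (\<lambda>x. \<Sum>(f, g)\<leftarrow>p # ps. f x * g x)"
          using Cons.IH[OF s(3)] smooth_on_continuous0[OF s(1)] smooth_on_continuous0[OF s(2)]
          by (auto simp: p intro!: continuous_intros)
        fix i
        obtain qs where qs: "Q qs" "\<forall>x\<in>U. has_partial i (\<lambda>x. \<Sum>(f, g)\<leftarrow>ps. f x * g x) x (\<Sum>(f, g)\<leftarrow>qs. f x * g x)"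
          using Cons.IH[OF s(3)] by blast
        have "Q ((cpartial i f, g) # (f, cpartial i g) # qs)"
          using qs(1) s smooth_on_cpartial by (auto simp: Q_def)
        moreover have "has_partial i (\<lambda>x. \<Sum>(f, g)\<leftarrow>p # ps. f x * g x) x
           (\<Sum>(f, g)\<leftarrow>(cpartial i f, g) # (f, cpartial i g) # qs. f x * g x)" if "x \<in> U" for x
          using has_partial_add[OF has_partial_mult[OF smooth_on_has_partial[OF s(1) that] smooth_on_has_partial[OF s(2) that]]
             qs(2)[rule_format, OF that]] by (simp add: p add.assoc)
        ultimately show "\<exists>qs. Q qs \<and> (\<forall>x\<in>U. has_partial i (\<lambda>x. \<Sum>(f, g)\<leftarrow>p # ps. f x * g x) x (\<Sum>(f, g)\<leftarrow>qs. f x * g x))"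
          by blast
      qed
    qed
    then show "continuous_on U F \<and> (\<forall>i. \<exists>g. (\<exists>ps. Q ps \<and> g = (\<lambda>x. \<Sum>(f, g)\<leftarrow>ps. f x * g x)) \<and> (\<forall>x\<in>U. has_partial i F x (g x)))"
      unfolding F by blast
  qed
qed

lemma smooth_on_mult:
  assumes "open U" "smooth_on U f" "smooth_on U g" shows "smooth_on U (\<lambda>x. f x * g x)"
  using smooth_on_mult_sums[of U "[(f, g)]"] assms by simp

lemma smooth_on_add:
  assumes "open U" "smooth_on U f" "smooth_on U g" shows "smooth_on U (\<lambda>x. f x + g x)"
  using smooth_on_mult_sums[of U "[(f, \<lambda>x. 1), (g, \<lambda>x. 1)]"] assms smooth_on_const[of U 1] by simp

lemma smooth_on_cmult:
  assumes "open U" "smooth_on U f" shows "smooth_on U (\<lambda>x. c * f x)"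
  using smooth_on_mult[OF assms(1) smooth_on_const assms(2)] assms(1) by auto

lemma smooth_on_diff:
  assumes "open U" "smooth_on U f" "smooth_on U g" shows "smooth_on U (\<lambda>x. f x - g x)"
  using smooth_on_add[OF assms(1,2) smooth_on_cmult[OF assms(1,3), of "-1"]] by simp

lemma smooth_on_sum:
  assumes "open U" "\<And>j. j \<in> J \<Longrightarrow> smooth_on U (f j)" shows "smooth_on U (\<lambda>x. \<Sum>j\<in>J. f j x)"
  using assms(2)
proof (induction J rule: infinite_finite_induct)
  case (insert j J)
  then show ?case using smooth_on_add[OF assms(1), of "f j"] by simp
qed (use smooth_on_const assms in auto)

lemma smooth_on_prod:
  assumes "open U" "\<And>j. j \<in> J \<Longrightarrow> smooth_on U (f j)" shows "smooth_on U (\<lambda>x. \<Prod>j\<in>J. f j x)"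
  using assms(2)
proof (induction J rule: infinite_finite_induct)
  case (insert j J)
  then show ?case using smooth_on_mult[OF assms(1), of "f j"] by simp
qed (use smooth_on_const assms in auto)

lemma cpartial_mult:
  "smooth_on U f \<Longrightarrow> smooth_on U g \<Longrightarrow> x \<in> U \<Longrightarrow>
    cpartial i (\<lambda>x. f x * g x) x = cpartial i f x * g x + f x * cpartial i g x"
  by (intro cpartial_eqI has_partial_mult smooth_on_has_partial)

lemma cpartial_add:
  "smooth_on U f \<Longrightarrow> smooth_on U g \<Longrightarrow> x \<in> U \<Longrightarrow>
    cpartial i (\<lambda>x. f x + g x) x = cpartial i f x + cpartial i g x"
  by (intro cpartial_eqI has_partial_add smooth_on_has_partial)

lemma cpartial_cmult:
  "smooth_on U f \<Longrightarrow> x \<in> U \<Longrightarrow> cpartial i (\<lambda>x. c * f x) x = c * cpartial i f x"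
  by (intro cpartial_eqI has_partial_cmult smooth_on_has_partial)

lemma dlist_add:
  assumes "open U" "smooth_on U f" "smooth_on U g" "x \<in> U"
  shows "dlist l (\<lambda>x. f x + g x) x = dlist l f x + dlist l g x"
  using assms(4)
proof (induction l arbitrary: x)
  case (Cons i l)
  have "dlist (i # l) (\<lambda>x. f x + g x) x = cpartial i (\<lambda>x. dlist l f x + dlist l g x) x"
    using cpartial_cong[OF assms(1) Cons.prems, of "dlist l (\<lambda>x. f x + g x)"] Cons.IH by auto
  then show ?case
    using cpartial_add[OF smooth_on_dlist smooth_on_dlist] assms Cons.prems by auto
qed auto

lemma dlist_cmult:
  assumes "open U" "smooth_on U f" "x \<in> U"
  shows "dlist l (\<lambda>x. c * f x) x = c * dlist l f x"
  using assms(3)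
proof (induction l arbitrary: x)
  case (Cons i l)
  have "dlist (i # l) (\<lambda>x. c * f x) x = cpartial i (\<lambda>x. c * dlist l f x) x"
    using cpartial_cong[OF assms(1) Cons.prems, of "dlist l (\<lambda>x. c * f x)"] Cons.IH by auto
  then show ?case
    using cpartial_cmult[OF smooth_on_dlist] assms Cons.prems by auto
qed auto

lemma dlist_diff:
  assumes "open U" "smooth_on U f" "smooth_on U g" "x \<in> U"
  shows "dlist l (\<lambda>x. f x - g x) x = dlist l f x - dlist l g x"
  using dlist_add[OF assms(1,2) smooth_on_cmult[OF assms(1,3), of "-1"] assms(4)]
    dlist_cmult[OF assms(1,3,4), of l "-1"] by simp

lemma dlist_const0: "dlist l (\<lambda>x. 0) x = 0"
  using dlist_cmult[of UNIV "\<lambda>x. 0" x l 0] smooth_on_const[of UNIV 0] by simp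

lemma dlist_sum:
  assumes "open U" "\<And>j. j \<in> J \<Longrightarrow> smooth_on U (f j)" "x \<in> U"
  shows "dlist l (\<lambda>x. \<Sum>j\<in>J. f j x) x = (\<Sum>j\<in>J. dlist l (f j) x)"
  using assms(2)
proof (induction J rule: infinite_finite_induct)
  case (insert j J)
  then show ?case
    using dlist_add[OF assms(1), of "f j" "\<lambda>x. \<Sum>j\<in>J. f j x" x l] smooth_on_sum[OF assms(1), of J f] assms(3)
    by simp
qed (use dlist_const0 in auto)

text \<open>Invariance under the affine maps \<open>x \<mapsto> r x + c\<close> covers translations, reflections and dilations.\<close>

lemma has_partial_affine:
  assumes "has_partial i f (r *\<^sub>R x + c) D"
  shows "has_partial i (\<lambda>x. f (r *\<^sub>R x + c)) x (r * D)"
proof -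
  have 1: "((\<lambda>t::real. r * t) has_real_derivative r) (at 0)"
    using DERIV_cmult_Id[of r] by simp
  have 2: "((\<lambda>t. f ((r *\<^sub>R x + c) + t *\<^sub>R axis i 1)) has_real_derivative D) (at (r * 0))"
    using assms by (simp add: has_partial_def)
  have "((\<lambda>t. f ((r *\<^sub>R x + c) + (r * t) *\<^sub>R axis i 1)) has_real_derivative D * r) (at 0)"
    by (rule DERIV_chain2[OF 2 1])
  moreover have "(r *\<^sub>R x + c) + (r * t) *\<^sub>R axis i 1 = r *\<^sub>R (x + t *\<^sub>R axis i 1) + c" for t
    by (simp add: algebra_simps)
  ultimately show ?thesis
    unfolding has_partial_def by (simp only: mult.commute)
qed

lemma smooth_on_affine:
  fixes f :: "real^'n::finite \<Rightarrow> real"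
  assumes "smooth_on UNIV f" shows "smooth_on UNIV (\<lambda>x. k * f (r *\<^sub>R x + c))"
proof (rule smooth_on_coinduct[where P = "\<lambda>F. \<exists>f k. smooth_on UNIV f \<and> F = (\<lambda>x. k * f (r *\<^sub>R x + c))"])
  fix F :: "real^'n \<Rightarrow> real" assume "\<exists>f k. smooth_on UNIV f \<and> F = (\<lambda>x. k * f (r *\<^sub>R x + c))"
  then obtain f k where f: "smooth_on UNIV f" "F = (\<lambda>x. k * f (r *\<^sub>R x + c))" by auto
  have c: "continuous_on UNIV F" unfolding f(2)
    by (intro continuous_intros continuous_on_compose2[OF smooth_on_continuous0[OF f(1)]]) auto
  have d: "has_partial i F x ((k * r) * cpartial i f (r *\<^sub>R x + c))" for i x
    unfolding f(2) mult.assoc by (intro has_partial_cmult has_partial_affine smooth_on_has_partial[OF f(1)]) auto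
  show "continuous_on UNIV F \<and> (\<forall>i. \<exists>g. (\<exists>f k. smooth_on UNIV f \<and> g = (\<lambda>x. k * f (r *\<^sub>R x + c))) \<and> (\<forall>x\<in>UNIV. has_partial i F x (g x)))"
  proof (intro conjI allI c)
    fix i
    show "\<exists>g. (\<exists>f k. smooth_on UNIV f \<and> g = (\<lambda>x. k * f (r *\<^sub>R x + c))) \<and> (\<forall>x\<in>UNIV. has_partial i F x (g x))"
      using d smooth_on_cpartial[OF f(1), of i] by (intro exI[of _ "\<lambda>x. (k * r) * cpartial i f (r *\<^sub>R x + c)"]) blast
  qed
qed (use assms in auto)

lemma cpartial_affine:
  assumes "smooth_on UNIV f"
  shows "cpartial i (\<lambda>x. k * f (r *\<^sub>R x + c)) x = k * r * cpartial i f (r *\<^sub>R x + c)"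
  using cpartial_eqI[OF has_partial_cmult[OF has_partial_affine[OF smooth_on_has_partial[OF assms, of "r *\<^sub>R x + c" i]]]]
  by (simp add: mult.assoc)

lemma dlist_translate:
  assumes "smooth_on UNIV f"
  shows "dlist l (\<lambda>x. f (x + c)) x = dlist l f (x + c)"
proof (induction l arbitrary: x)
  case (Cons i l)
  have "dlist (i # l) (\<lambda>x. f (x + c)) x = cpartial i (\<lambda>x. dlist l f (x + c)) x"
    using ext[of "dlist l (\<lambda>x. f (x + c))" "\<lambda>x. dlist l f (x + c)", OF Cons.IH] by simp
  then show ?case using cpartial_affine[OF smooth_on_dlist[OF assms], of i 1 l 1 c x] by simp
qed auto

section \<open>Symmetry of mixed partial derivatives and the bookkeeping of multi-indices\<close>

lemma has_partial_line:
  assumes "has_partial i f (x + t *\<^sub>R axis i 1) D"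
  shows "((\<lambda>t. f (x + t *\<^sub>R axis i 1)) has_real_derivative D) (at t)"
proof -
  have "((\<lambda>u. f (x + t *\<^sub>R axis i 1 + u *\<^sub>R axis i 1)) has_real_derivative D) (at (t - t))"
    using assms by (simp add: has_partial_def)
  moreover have "((\<lambda>u. u - t) has_real_derivative 1) (at t)"
    by (auto intro!: derivative_eq_intros)
  ultimately have "((\<lambda>u. f (x + t *\<^sub>R axis i 1 + (u - t) *\<^sub>R axis i 1)) has_real_derivative D * 1) (at t)"
    by (rule DERIV_chain2)
  then show ?thesis by (simp add: algebra_simps)
qed

lemma smooth_line_deriv:
  assumes "smooth_on UNIV f"
  shows "((\<lambda>t. f (x + t *\<^sub>R axis i 1)) has_real_derivative cpartial i f (x + t *\<^sub>R axis i 1)) (at t)"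
  by (rule has_partial_line[OF smooth_on_has_partial[OF assms UNIV_I]])

text \<open>The mixed second difference of \<open>f\<close> over a square of side \<open>h\<close>
  does not change when \<open>i\<close> and \<open>j\<close> are exchanged. The mean value theorem,
  applied twice, turns it into \<open>h * h\<close> times either mixed derivative at some point near
  \<open>x\<close>, and both mixed derivatives are continuous.\<close>

lemma partials_commute:
  assumes f: "smooth_on UNIV f"
  shows "cpartial i (cpartial j f) x = cpartial j (cpartial i f) x"
proof -
  define E where "E = (\<lambda>i::'a. axis i (1::real))"
  have mvt: "\<exists>a\<in>{0..h}. \<exists>b\<in>{0..h}. f (x + h *\<^sub>R E i + h *\<^sub>R E j) - f (x + h *\<^sub>R E i) - f (x + h *\<^sub>R E j) + f x
       = h * h * cpartial j (cpartial i f) (x + a *\<^sub>R E i + b *\<^sub>R E j)" if h: "h > 0" for h i j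
  proof -
    \<comment> \<open>The difference in direction \<open>j\<close> is treated as a function of the
      step in direction \<open>i\<close>; the second mean value step then acts on
      \<open>cpartial i f\<close> in direction \<open>j\<close>.\<close>
    define G where "G t = f (x + h *\<^sub>R E j + t *\<^sub>R E i) - f (x + t *\<^sub>R E i)" for t
    have dG: "DERIV G t :> cpartial i f (x + h *\<^sub>R E j + t *\<^sub>R E i) - cpartial i f (x + t *\<^sub>R E i)" for t
      unfolding G_def E_def by (intro DERIV_diff smooth_line_deriv[OF f])
    obtain a where a: "a > 0" "a < h" "G h - G 0 = (h - 0) * (cpartial i f (x + h *\<^sub>R E j + a *\<^sub>R E i) - cpartial i f (x + a *\<^sub>R E i))"
      using MVT2[OF h dG] by (elim exE conjE)
    define H where "H t = cpartial i f (x + a *\<^sub>R E i + t *\<^sub>R E j)" for t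
    have dH: "DERIV H t :> cpartial j (cpartial i f) (x + a *\<^sub>R E i + t *\<^sub>R E j)" for t
      unfolding H_def E_def by (intro smooth_line_deriv smooth_on_cpartial[OF f])
    obtain b where b: "b > 0" "b < h" "H h - H 0 = (h - 0) * cpartial j (cpartial i f) (x + a *\<^sub>R E i + b *\<^sub>R E j)"
      using MVT2[OF h dH] by (elim exE conjE)
    have "f (x + h *\<^sub>R E i + h *\<^sub>R E j) - f (x + h *\<^sub>R E i) - f (x + h *\<^sub>R E j) + f x = G h - G 0"
      by (simp add: G_def algebra_simps)
    also have "\<dots> = h * (H h - H 0)" using a(3) by (simp add: H_def algebra_simps)
    also have "\<dots> = h * h * cpartial j (cpartial i f) (x + a *\<^sub>R E i + b *\<^sub>R E j)" using b(3) by simp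
    finally show ?thesis using a b by (intro bexI[of _ a] bexI[of _ b]) auto
  qed
  have lim: "((\<lambda>n. cpartial j (cpartial i f) (x + A n *\<^sub>R E i + B n *\<^sub>R E j)) \<longlonglongrightarrow> cpartial j (cpartial i f) x)"
    if A: "\<And>n. A n \<in> {0..1 / Suc n}" and B: "\<And>n. B n \<in> {0..1 / Suc n}" for A B i j
  proof -
    have z: "(\<lambda>n. 1 / real (Suc n)) \<longlonglongrightarrow> 0" by (rule LIMSEQ_inverse_real_of_nat[unfolded inverse_eq_divide])
    have A0: "A \<longlonglongrightarrow> 0" by (rule tendsto_sandwich[OF _ _ tendsto_const z]) (use A in auto)
    have B0: "B \<longlonglongrightarrow> 0" by (rule tendsto_sandwich[OF _ _ tendsto_const z]) (use B in auto)
    have "(\<lambda>n. x + A n *\<^sub>R E i + B n *\<^sub>R E j) \<longlonglongrightarrow> x + 0 *\<^sub>R E i + 0 *\<^sub>R E j"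
      by (intro tendsto_intros A0 B0)
    then have l: "(\<lambda>n. x + A n *\<^sub>R E i + B n *\<^sub>R E j) \<longlonglongrightarrow> x" by simp
    have "isCont (cpartial j (cpartial i f)) x"
      using smooth_on_continuous0[OF smooth_on_cpartial[OF smooth_on_cpartial[OF f]]]
      by (simp add: continuous_on_eq_continuous_at)
    then show ?thesis using l isCont_tendsto_compose by blast
  qed
  have mvt_seq: "\<exists>A B. (\<forall>n. A n \<in> {0..1 / Suc n}) \<and> (\<forall>n. B n \<in> {0..1 / Suc n}) \<and>
    (\<forall>n. f (x + (1 / Suc n) *\<^sub>R E i + (1 / Suc n) *\<^sub>R E j) - f (x + (1 / Suc n) *\<^sub>R E i) - f (x + (1 / Suc n) *\<^sub>R E j) + f x
       = (1 / Suc n) * (1 / Suc n) * cpartial j (cpartial i f) (x + A n *\<^sub>R E i + B n *\<^sub>R E j))" for i j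
  proof -
    have "\<forall>n. \<exists>a b. a \<in> {0..1 / real (Suc n)} \<and> b \<in> {0..1 / real (Suc n)} \<and>
      f (x + (1 / Suc n) *\<^sub>R E i + (1 / Suc n) *\<^sub>R E j) - f (x + (1 / Suc n) *\<^sub>R E i) - f (x + (1 / Suc n) *\<^sub>R E j) + f x
       = (1 / Suc n) * (1 / Suc n) * cpartial j (cpartial i f) (x + a *\<^sub>R E i + b *\<^sub>R E j)"
    proof
      fix n :: nat
      have "1 / real (Suc n) > 0" by simp
      from mvt[OF this, of i j] show "\<exists>a b. a \<in> {0..1 / real (Suc n)} \<and> b \<in> {0..1 / real (Suc n)} \<and>
      f (x + (1 / Suc n) *\<^sub>R E i + (1 / Suc n) *\<^sub>R E j) - f (x + (1 / Suc n) *\<^sub>R E i) - f (x + (1 / Suc n) *\<^sub>R E j) + f x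
       = (1 / Suc n) * (1 / Suc n) * cpartial j (cpartial i f) (x + a *\<^sub>R E i + b *\<^sub>R E j)" by blast
    qed
    from choice[OF this] obtain A where 2: "\<forall>n. \<exists>b. A n \<in> {0..1 / real (Suc n)} \<and> b \<in> {0..1 / real (Suc n)} \<and>
      f (x + (1 / Suc n) *\<^sub>R E i + (1 / Suc n) *\<^sub>R E j) - f (x + (1 / Suc n) *\<^sub>R E i) - f (x + (1 / Suc n) *\<^sub>R E j) + f x
       = (1 / Suc n) * (1 / Suc n) * cpartial j (cpartial i f) (x + A n *\<^sub>R E i + b *\<^sub>R E j)"
      by (elim exE)
    from choice[OF 2] obtain B where 3: "\<forall>n. A n \<in> {0..1 / real (Suc n)} \<and> B n \<in> {0..1 / real (Suc n)} \<and>
      f (x + (1 / Suc n) *\<^sub>R E i + (1 / Suc n) *\<^sub>R E j) - f (x + (1 / Suc n) *\<^sub>R E i) - f (x + (1 / Suc n) *\<^sub>R E j) + f x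
       = (1 / Suc n) * (1 / Suc n) * cpartial j (cpartial i f) (x + A n *\<^sub>R E i + B n *\<^sub>R E j)"
      by (elim exE)
    show ?thesis by (rule exI[of _ A], rule exI[of _ B]) (use 3 in \<open>simp only: simp_thms all_conj_distrib\<close>)
  qed
  obtain A B where AB: "\<And>n. A n \<in> {0..1 / Suc n}" "\<And>n. B n \<in> {0..1 / Suc n}"
    "\<And>n. f (x + (1 / Suc n) *\<^sub>R E i + (1 / Suc n) *\<^sub>R E j) - f (x + (1 / Suc n) *\<^sub>R E i) - f (x + (1 / Suc n) *\<^sub>R E j) + f x
       = (1 / Suc n) * (1 / Suc n) * cpartial j (cpartial i f) (x + A n *\<^sub>R E i + B n *\<^sub>R E j)"
    using mvt_seq[of i j] by (elim exE conjE) (rule that, (elim allE, assumption)+)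
  obtain A' B' where AB': "\<And>n. A' n \<in> {0..1 / Suc n}" "\<And>n. B' n \<in> {0..1 / Suc n}"
    "\<And>n. f (x + (1 / Suc n) *\<^sub>R E j + (1 / Suc n) *\<^sub>R E i) - f (x + (1 / Suc n) *\<^sub>R E j) - f (x + (1 / Suc n) *\<^sub>R E i) + f x
       = (1 / Suc n) * (1 / Suc n) * cpartial i (cpartial j f) (x + A' n *\<^sub>R E j + B' n *\<^sub>R E i)"
    using mvt_seq[of j i] by (elim exE conjE) (rule that, (elim allE, assumption)+)
  have "cpartial j (cpartial i f) (x + A n *\<^sub>R E i + B n *\<^sub>R E j) = cpartial i (cpartial j f) (x + A' n *\<^sub>R E j + B' n *\<^sub>R E i)" for n
  proof -
    define e where "e = 1 / real (Suc n)"
    have "e > 0" by (simp add: e_def)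
    have "e * e * cpartial j (cpartial i f) (x + A n *\<^sub>R E i + B n *\<^sub>R E j) = e * e * cpartial i (cpartial j f) (x + A' n *\<^sub>R E j + B' n *\<^sub>R E i)"
      using AB(3)[of n] AB'(3)[of n] unfolding e_def[symmetric] by (simp add: algebra_simps)
    then show ?thesis using \<open>e > 0\<close> by simp
  qed
  then show ?thesis
    using LIMSEQ_unique[OF lim[OF AB'(1,2), where i=j and j=i]] lim[OF AB(1,2), where i=i and j=j] by simp
qed

lemma dlist_commute1:
  assumes "smooth_on UNIV f" shows "dlist (l @ [i]) f x = dlist (i # l) f x"
proof (induction l arbitrary: x)
  case (Cons j l)
  have "dlist ((j # l) @ [i]) f x = cpartial j (cpartial i (dlist l f)) x"
    using Cons.IH by (metis append_Cons dlist.simps(2) ext)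
  then show ?case using partials_commute[OF smooth_on_dlist[OF assms]] by simp
qed auto

text \<open>Any two orderings are linked by moving one direction at a time to the front. This makes
  the arbitrary choice inside \<open>alpha_list\<close> harmless for smooth functions.\<close>

lemma dlist_mset:
  assumes "smooth_on UNIV f" "mset l = mset m" shows "dlist l f x = dlist m f x"
  using assms(2)
proof (induction l arbitrary: m x)
  case (Cons i l)
  then have "i \<in> set m" by (metis list.set_intros(1) set_mset_mset)
  then obtain a b where m: "m = a @ i # b" by (meson split_list)
  have ms: "mset l = mset (a @ b)" using Cons.prems m by simp
  have "dlist m f x = dlist (a @ [i]) (dlist b f) x"
    unfolding m dlist_append[symmetric] by simp
  also have "\<dots> = dlist (i # a) (dlist b f) x"
    by (rule dlist_commute1[OF smooth_on_dlist[OF assms(1)]])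
  also have "\<dots> = cpartial i (dlist (a @ b) f) x" by (simp add: dlist_append)
  also have "dlist (a @ b) f = dlist l f" using Cons.IH[OF ms] by auto
  finally show ?case by simp
qed auto

text \<open>The choice in \<open>alpha_list\<close> is made from a nonempty set: over a finite index
  type every function is the count function of some multiset.\<close>

lemma count_alpha_list: "count (mset (alpha_list \<alpha>)) i = \<alpha> (i::'n::finite)"
proof -
  have "\<exists>l. \<forall>i. count (mset l) i = \<alpha> i"
  proof -
    obtain l where "mset l = Abs_multiset \<alpha>" using ex_mset by blast
    then show ?thesis by (intro exI[of _ l]) (simp add: count_Abs_multiset)
  qed
  then show ?thesis unfolding alpha_list_def by (rule someI2_ex) auto
qed

lemma length_alpha_list: "length (alpha_list \<alpha>) = mi_order \<alpha>"
proof -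
  have "length (alpha_list \<alpha>) = size (mset (alpha_list \<alpha>))" by simp
  also have "\<dots> = (\<Sum>i\<in>UNIV. count (mset (alpha_list \<alpha>)) i)"
    unfolding size_multiset_overloaded_eq
    by (rule sum.mono_neutral_left) (auto simp: not_in_iff)
  finally show ?thesis by (simp add: count_alpha_list mi_order_def)
qed

lemma dlist_eq_cderiv:
  assumes "smooth_on UNIV f" shows "dlist l f x = cderiv (count (mset l)) f x"
  unfolding cderiv_def
  by (rule dlist_mset[OF assms]) (simp add: multiset_eq_iff count_alpha_list)

lemma mi_order_count: "mi_order (count (mset l)) = length l"
proof -
  have "mset (alpha_list (count (mset l))) = mset l"
    by (simp add: multiset_eq_iff count_alpha_list)
  then have "length (alpha_list (count (mset l))) = length l"
    by (rule mset_eq_length)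
  then show ?thesis by (simp add: length_alpha_list)
qed

lemma finite_multi_indices: "finite (multi_indices s :: ('n::finite \<Rightarrow> nat) set)"
proof -
  have "multi_indices s \<subseteq> (\<lambda>l. count (mset l)) ` {l :: 'n list. set l \<subseteq> UNIV \<and> length l \<le> s}"
  proof
    fix \<alpha> :: "'n \<Rightarrow> nat" assume "\<alpha> \<in> multi_indices s"
    then have "length (alpha_list \<alpha>) \<le> s" by (simp add: multi_indices_def length_alpha_list)
    moreover have "\<alpha> = count (mset (alpha_list \<alpha>))" by (auto simp: count_alpha_list)
    ultimately show "\<alpha> \<in> (\<lambda>l. count (mset l)) ` {l :: 'n list. set l \<subseteq> UNIV \<and> length l \<le> s}" by blast
  qed
  then show ?thesis by (rule finite_subset) (intro finite_imageI finite_lists_length_le finite)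
qed

section \<open>Test functions and integration\<close>

text \<open>In contrast to \<open>test_fn\<close> the set carrying the support is an explicit
  argument, so that an estimate can be uniform over all test functions living in one and the same
  \<open>K\<close>. Compactness of \<open>K\<close> is assumed separately.\<close>

definition tfn :: "(real^'n::finite) set \<Rightarrow> (real^'n \<Rightarrow> real) \<Rightarrow> bool" where
  "tfn K \<phi> \<longleftrightarrow> smooth_on UNIV \<phi> \<and> (\<forall>x. x \<notin> K \<longrightarrow> \<phi> x = 0)"

lemma tfn_smooth: "tfn K \<phi> \<Longrightarrow> smooth_on UNIV \<phi>"
  by (simp add: tfn_def)

lemma tfn_zero: "tfn K \<phi> \<Longrightarrow> x \<notin> K \<Longrightarrow> \<phi> x = 0"
  by (simp add: tfn_def)

lemma tfn_dlist:
  assumes "closed K" "tfn K \<phi>" shows "tfn K (dlist l \<phi>)"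
proof -
  have "dlist l \<phi> x = 0" if "x \<notin> K" for x
  proof -
    have "dlist l \<phi> x = dlist l (\<lambda>x. 0) x"
      by (rule dlist_cong[where U = "- K"]) (use assms that in \<open>auto simp: tfn_zero\<close>)
    then show ?thesis by (simp add: dlist_const0)
  qed
  then show ?thesis using assms smooth_on_dlist by (auto simp: tfn_def)
qed

lemma tfn_cpartial: "closed K \<Longrightarrow> tfn K \<phi> \<Longrightarrow> tfn K (cpartial i \<phi>)"
  using tfn_dlist[of K \<phi> "[i]"] by simp

lemma smooth_on_Un:
  assumes "open U" "open V" "smooth_on U f" "smooth_on V f" shows "smooth_on (U \<union> V) f"
  using assms continuous_on_open_Un unfolding smooth_on_def by blast

text \<open>Outside \<open>V\<close> the total function \<open>a\<close> has arbitrary values, but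
  there the product is zero. It is smooth on \<open>V\<close> and on the complement of
  \<open>K\<close>, and these two open sets cover the space.\<close>

lemma tfn_mult_on:
  assumes "compact K" "K \<subseteq> V" "open V" "smooth_on V a" "tfn K \<phi>"
  shows "tfn K (\<lambda>x. a x * \<phi> x)"
proof -
  have cl: "open (- K)" using assms(1) compact_imp_closed by blast
  have 1: "smooth_on V (\<lambda>x. a x * \<phi> x)"
    by (intro smooth_on_mult assms smooth_on_subset[OF tfn_smooth[OF assms(5)]]) auto
  have 2: "smooth_on (- K) (\<lambda>x. a x * \<phi> x)"
    by (rule smooth_on_cong[OF cl smooth_on_const[OF cl, of 0]]) (use assms tfn_zero in auto)
  have "V \<union> - K = UNIV" using assms by auto
  then show ?thesis using smooth_on_Un[OF assms(3) cl 1 2] assms(5) by (auto simp: tfn_def)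
qed

lemma tfn_mult: "smooth_on UNIV a \<Longrightarrow> tfn K \<phi> \<Longrightarrow> tfn K (\<lambda>x. a x * \<phi> x)"
  by (auto simp: tfn_def intro: smooth_on_mult)

lemma tfn_mult2: "tfn K \<phi> \<Longrightarrow> smooth_on UNIV a \<Longrightarrow> tfn K (\<lambda>x. \<phi> x * a x)"
  by (auto simp: tfn_def intro: smooth_on_mult)

lemma tfn_diff: "tfn K \<phi> \<Longrightarrow> tfn K \<psi> \<Longrightarrow> tfn K (\<lambda>x. \<phi> x - \<psi> x)"
  by (auto simp: tfn_def intro: smooth_on_diff)

lemma tfn_cmult: "tfn K \<phi> \<Longrightarrow> tfn K (\<lambda>x. c * \<phi> x)"
  by (auto simp: tfn_def intro: smooth_on_cmult)

lemma tfn_sum: "(\<And>j. j \<in> J \<Longrightarrow> tfn K (f j)) \<Longrightarrow> tfn K (\<lambda>x. \<Sum>j\<in>J. f j x)"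
  unfolding tfn_def by (auto intro: smooth_on_sum)

lemma smooth_measurable: "smooth_on UNIV \<phi> \<Longrightarrow> \<phi> \<in> borel_measurable borel"
  by (intro borel_measurable_continuous_onI smooth_on_continuous0)

lemma tfn_measurable: "tfn K \<phi> \<Longrightarrow> \<phi> \<in> borel_measurable borel"
  by (intro smooth_measurable tfn_smooth)

lemma tfn_bounded:
  assumes "compact K" "tfn K \<phi>" obtains B where "B \<ge> 0" "\<And>x. \<bar>\<phi> x\<bar> \<le> B"
proof -
  have "continuous_on K \<phi>"
    using smooth_on_continuous0[OF tfn_smooth[OF assms(2)]] continuous_on_subset by blast
  then have "bounded (\<phi> ` K)" using compact_continuous_image assms(1) compact_imp_bounded by blast
  then obtain B where B: "\<forall>x\<in>K. \<bar>\<phi> x\<bar> \<le> B" by (auto simp: bounded_iff)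
  have "\<bar>\<phi> x\<bar> \<le> \<bar>B\<bar>" for x
    using B tfn_zero[OF assms(2), of x] by (cases "x \<in> K") force+
  then show ?thesis by (intro that[of "\<bar>B\<bar>"]) auto
qed

lemma tfn_integrable:
  assumes "compact K" "tfn K \<phi>" shows "integrable lborel \<phi>"
proof -
  have "integrable lborel (\<lambda>x. indicator K x *\<^sub>R \<phi> x)"
    using smooth_on_continuous0[OF tfn_smooth[OF assms(2)]] continuous_on_subset
    by (intro borel_integrable_compact assms(1)) blast
  moreover have "(\<lambda>x. indicator K x *\<^sub>R \<phi> x) = \<phi>"
    using tfn_zero[OF assms(2)] by (auto simp: indicator_def fun_eq_iff)
  ultimately show ?thesis by simp
qed

lemma integrable_mult_bounded:
  fixes w \<phi> :: "'a::euclidean_space \<Rightarrow> real"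
  assumes "integrable lborel w" "\<phi> \<in> borel_measurable borel" "\<And>x. \<bar>\<phi> x\<bar> \<le> B"
  shows "integrable lborel (\<lambda>x. w x * \<phi> x)"
proof (rule Bochner_Integration.integrable_bound[of lborel "\<lambda>x. B * w x"])
  show "AE x in lborel. norm (w x * \<phi> x) \<le> norm (B * w x)"
  proof (rule AE_I2)
    fix x
    have "\<bar>\<phi> x\<bar> \<le> \<bar>B\<bar>" using assms(3)[of x] by linarith
    from mult_right_mono[OF this, of "\<bar>w x\<bar>"] show "norm (w x * \<phi> x) \<le> norm (B * w x)"
      by (simp add: abs_mult mult.commute)
  qed
qed (use assms in \<open>auto intro: borel_measurable_integrable\<close>)

lemma integrable_mult_tfn:
  assumes "integrable lborel w" "compact K" "tfn K \<phi>" shows "integrable lborel (\<lambda>x. w x * \<phi> x)"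
proof -
  obtain B where "\<And>x. \<bar>\<phi> x\<bar> \<le> B" using tfn_bounded[OF assms(2,3)] by blast
  then show ?thesis by (rule integrable_mult_bounded[OF assms(1) tfn_measurable[OF assms(3)]])
qed

lemma integrable_smooth_mult_tfn:
  assumes "smooth_on UNIV f" "compact K" "tfn K \<phi>"
  shows "integrable lborel (\<lambda>x. f x * \<phi> x)"
  by (rule tfn_integrable[OF assms(2) tfn_mult[OF assms(1,3)]])

section \<open>Affine changes of variables for Lebesgue measure\<close>

lemma lborel_integral_affine:
  fixes f :: "'a::euclidean_space \<Rightarrow> real"
  assumes "c \<noteq> 0" and [measurable]: "f \<in> borel_measurable borel"
  shows "(\<integral>x. f x \<partial>lborel) = \<bar>c\<bar> ^ DIM('a) * (\<integral>x. f (t + c *\<^sub>R x) \<partial>lborel)"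
proof -
  have "(\<integral>x. f x \<partial>lborel) = (\<integral>x. f x \<partial>density (distr lborel borel (\<lambda>x. t + c *\<^sub>R x)) (\<lambda>_. ennreal (\<bar>c\<bar>^DIM('a))))"
    using lborel_affine[OF assms(1), of t] by (simp add: ennreal_power)
  also have "\<dots> = (\<integral>x. (\<bar>c\<bar>^DIM('a)) *\<^sub>R f x \<partial>distr lborel borel (\<lambda>x. t + c *\<^sub>R x))"
    by (rule integral_density) auto
  also have "\<dots> = (\<integral>x. (\<bar>c\<bar>^DIM('a)) *\<^sub>R f (t + c *\<^sub>R x) \<partial>lborel)"
    by (rule integral_distr) auto
  finally show ?thesis by simp
qed

lemma lborel_integral_translate:
  fixes f :: "'a::euclidean_space \<Rightarrow> real"
  assumes "f \<in> borel_measurable borel"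
  shows "(\<integral>x. f (t + x) \<partial>lborel) = (\<integral>x. f x \<partial>lborel)"
  using lborel_integral_affine[OF _ assms, of 1 t] by simp

lemma lborel_integral_reflect:
  fixes f :: "'a::euclidean_space \<Rightarrow> real"
  assumes "f \<in> borel_measurable borel"
  shows "(\<integral>x. f (t - x) \<partial>lborel) = (\<integral>x. f x \<partial>lborel)"
  using lborel_integral_affine[OF _ assms, of "-1" t] by simp

lemma lborel_nn_integral_affine:
  fixes f :: "'a::euclidean_space \<Rightarrow> ennreal"
  assumes "c \<noteq> 0" and [measurable]: "f \<in> borel_measurable borel"
  shows "(\<integral>\<^sup>+x. f x \<partial>lborel) = ennreal (\<bar>c\<bar> ^ DIM('a)) * (\<integral>\<^sup>+x. f (t + c *\<^sub>R x) \<partial>lborel)"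
proof -
  have "(\<integral>\<^sup>+x. f x \<partial>lborel) = (\<integral>\<^sup>+x. f x \<partial>density (distr lborel borel (\<lambda>x. t + c *\<^sub>R x)) (\<lambda>_. ennreal (\<bar>c\<bar>^DIM('a))))"
    using lborel_affine[OF assms(1), of t] by (simp add: ennreal_power)
  also have "\<dots> = (\<integral>\<^sup>+x. ennreal (\<bar>c\<bar>^DIM('a)) * f x \<partial>distr lborel borel (\<lambda>x. t + c *\<^sub>R x))"
    by (rule nn_integral_density) auto
  also have "\<dots> = (\<integral>\<^sup>+x. ennreal (\<bar>c\<bar>^DIM('a)) * f (t + c *\<^sub>R x) \<partial>lborel)"
    by (rule nn_integral_distr) auto
  finally show ?thesis by (simp add: nn_integral_cmult)
qed

lemma lborel_nn_integral_translate:
  fixes f :: "'a::euclidean_space \<Rightarrow> ennreal"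
  assumes "f \<in> borel_measurable borel"
  shows "(\<integral>\<^sup>+x. f (x - t) \<partial>lborel) = (\<integral>\<^sup>+x. f x \<partial>lborel)"
  using lborel_nn_integral_affine[OF _ assms, of 1 "-t"] by (simp add: algebra_simps)

lemma integrable_reflect:
  fixes f :: "'a::euclidean_space \<Rightarrow> real"
  assumes "integrable lborel f"
  shows "integrable lborel (\<lambda>x. f (t - x))"
proof -
  have [measurable]: "f \<in> borel_measurable borel" using assms by auto
  have "(\<integral>\<^sup>+x. norm (f (t - x)) \<partial>lborel) = (\<integral>\<^sup>+x. norm (f x) \<partial>lborel)"
    using lborel_nn_integral_affine[of "-1" "\<lambda>x. ennreal (norm (f x))" t] by simp
  then show ?thesis using assms by (simp add: integrable_iff_bounded)
qed

section \<open>Convolution\<close>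

definition conv :: "(real^'n::finite \<Rightarrow> real) \<Rightarrow> (real^'n \<Rightarrow> real) \<Rightarrow> real^'n \<Rightarrow> real" where
  "conv f g x = (\<integral>y. f y * g (x - y) \<partial>lborel)"

lemma conv_commute:
  assumes [measurable]: "f \<in> borel_measurable borel" "g \<in> borel_measurable borel"
  shows "conv f g x = conv g f x"
  unfolding conv_def using lborel_integral_reflect[of "\<lambda>y. f y * g (x - y)" x]
  by (simp add: mult.commute)

lemma tfn_diff_quotient:
  assumes K: "compact K" and g: "tfn K g" and B: "\<And>x. \<bar>cpartial i g x\<bar> \<le> B"
  shows "\<bar>g (x + t *\<^sub>R axis i 1) - g x\<bar> \<le> B * \<bar>t\<bar>"
proof -
  have "\<bar>g (x + t *\<^sub>R axis i 1) - g (x + 0 *\<^sub>R axis i 1)\<bar> \<le> B * \<bar>t - 0\<bar>"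
    using field_differentiable_bound[of UNIV "\<lambda>t. g (x + t *\<^sub>R axis i 1)" "\<lambda>t. cpartial i g (x + t *\<^sub>R axis i 1)" B 0 t]
      smooth_line_deriv[OF tfn_smooth[OF g]] B by auto
  then show ?thesis by simp
qed

text \<open>Differentiation under the integral. The difference quotients of \<open>g\<close> are
  bounded by the supremum \<open>B\<close> of \<open>cpartial i g\<close>, so
  \<open>B * \<bar>f y\<bar>\<close> is a majorant; sequences of increments are used because
  dominated convergence is a statement about sequences.\<close>

lemma conv_has_partial:
  assumes f: "integrable lborel f" and K: "compact K" and g: "tfn K g"
  shows "has_partial i (conv f g) x (conv f (cpartial i g) x)"
  unfolding has_partial_def DERIV_def tendsto_at_iff_sequentially
proof (intro allI impI)
  fix h :: "nat \<Rightarrow> real" assume hn: "\<forall>n. h n \<in> UNIV - {0}" and h0: "h \<longlonglongrightarrow> 0"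
  have gi: "tfn K (cpartial i g)" using tfn_cpartial[OF compact_imp_closed[OF K] g] .
  obtain B where B: "B \<ge> 0" "\<And>x. \<bar>cpartial i g x\<bar> \<le> B" using tfn_bounded[OF K gi] by blast
  have [measurable]: "f \<in> borel_measurable borel" "g \<in> borel_measurable borel" "cpartial i g \<in> borel_measurable borel"
    using f tfn_measurable[OF g] tfn_measurable[OF gi] by auto
  obtain B0 where B0: "\<And>x. \<bar>g x\<bar> \<le> B0" using tfn_bounded[OF K g] by blast
  have int: "integrable lborel (\<lambda>y. f y * g (z - y))" for z
    by (rule integrable_mult_bounded[OF f, of _ B0]) (use B0 in auto)
  define q where "q n y = f y * ((g (x + h n *\<^sub>R axis i 1 - y) - g (x - y)) / h n)" for n y
  have "(\<lambda>n. \<integral>y. q n y \<partial>lborel) \<longlonglongrightarrow> (\<integral>y. f y * cpartial i g (x - y) \<partial>lborel)"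
  proof (rule integral_dominated_convergence[where w = "\<lambda>y. B * \<bar>f y\<bar>"])
    show "integrable lborel (\<lambda>y. B * \<bar>f y\<bar>)" using f by auto
    show "q n \<in> borel_measurable lborel" for n unfolding q_def by measurable
    show "AE y in lborel. (\<lambda>n. q n y) \<longlonglongrightarrow> f y * cpartial i g (x - y)"
    proof (rule AE_I2)
      fix y
      have "((\<lambda>t. g ((x - y) + t *\<^sub>R axis i 1)) has_real_derivative cpartial i g (x - y)) (at 0)"
        using smooth_on_has_partial[OF tfn_smooth[OF g], of "x - y" i] by (simp add: has_partial_def)
      then have "((\<lambda>n. (g ((x - y) + (0 + h n) *\<^sub>R axis i 1) - g ((x - y) + 0 *\<^sub>R axis i 1)) / h n) \<longlonglongrightarrow> cpartial i g (x - y))"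
        unfolding DERIV_def tendsto_at_iff_sequentially using hn h0 by (auto simp: o_def)
      then show "(\<lambda>n. q n y) \<longlonglongrightarrow> f y * cpartial i g (x - y)"
        unfolding q_def by (intro tendsto_mult tendsto_const) (simp add: algebra_simps)
    qed
    show "AE y in lborel. norm (q n y) \<le> B * \<bar>f y\<bar>" for n
    proof (rule AE_I2)
      fix y
      have "\<bar>g ((x - y) + h n *\<^sub>R axis i 1) - g (x - y)\<bar> \<le> B * \<bar>h n\<bar>"
        by (rule tfn_diff_quotient[OF K g B(2)])
      then have "\<bar>(g (x + h n *\<^sub>R axis i 1 - y) - g (x - y)) / h n\<bar> \<le> B"
        using hn by (auto simp: abs_divide divide_le_eq algebra_simps)
      from mult_left_mono[OF this, of "\<bar>f y\<bar>"] show "norm (q n y) \<le> B * \<bar>f y\<bar>" unfolding q_def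
        by (simp add: abs_mult mult.commute)
    qed
  qed auto
  moreover have "(\<integral>y. q n y \<partial>lborel) = (conv f g (x + h n *\<^sub>R axis i 1) - conv f g x) / h n" for n
  proof -
    have "q n = (\<lambda>y. (f y * g (x + h n *\<^sub>R axis i 1 - y) - f y * g (x - y)) / h n)"
      by (auto simp: q_def right_diff_distrib)
    then show ?thesis unfolding conv_def using int by simp
  qed
  ultimately show "((\<lambda>ha. (conv f g (x + (0 + ha) *\<^sub>R axis i 1) - conv f g (x + 0 *\<^sub>R axis i 1)) / ha) \<circ> h) \<longlonglongrightarrow> conv f (cpartial i g) x"
    by (simp add: o_def conv_def)
qed

lemma conv_continuous:
  fixes f g :: "real^'n::finite \<Rightarrow> real"
  assumes f: "integrable lborel f" and K: "compact K" and g: "tfn K g"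
  shows "continuous_on UNIV (conv f g)"
  unfolding continuous_on_sequentially o_def
proof (intro ballI allI impI)
  fix x :: "real^'n" and u assume "(\<forall>n. u n \<in> UNIV) \<and> u \<longlonglongrightarrow> x"
  then have u: "u \<longlonglongrightarrow> x" by simp
  obtain B where B: "B \<ge> 0" "\<And>x. \<bar>g x\<bar> \<le> B" using tfn_bounded[OF K g] by blast
  have [measurable]: "f \<in> borel_measurable borel" "g \<in> borel_measurable borel"
    using f tfn_measurable[OF g] by auto
  show "(\<lambda>n. conv f g (u n)) \<longlonglongrightarrow> conv f g x" unfolding conv_def
  proof (rule integral_dominated_convergence[where w = "\<lambda>y. B * \<bar>f y\<bar>"])
    show "AE y in lborel. (\<lambda>n. f y * g (u n - y)) \<longlonglongrightarrow> f y * g (x - y)"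
    proof (rule AE_I2)
      fix y
      have "isCont g (x - y)" using smooth_on_continuous0[OF tfn_smooth[OF g]]
        by (simp add: continuous_on_eq_continuous_at)
      then show "(\<lambda>n. f y * g (u n - y)) \<longlonglongrightarrow> f y * g (x - y)"
        by (intro tendsto_intros isCont_tendsto_compose[of _ g] u)
    qed
    show "AE y in lborel. norm (f y * g (u n - y)) \<le> B * \<bar>f y\<bar>" for n
      by (rule AE_I2) (use mult_left_mono[OF B(2), of "\<bar>f _\<bar>"] in \<open>simp add: abs_mult mult.commute\<close>)
  qed (use f in auto)
qed

lemma conv_smooth:
  assumes f: "integrable lborel f" and K: "compact K" and g: "tfn K g"
  shows "smooth_on UNIV (conv f g)"
proof (rule smooth_on_coinduct[where P = "\<lambda>h. \<exists>g. tfn K g \<and> h = conv f g"])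
  fix h assume "\<exists>g. tfn K g \<and> h = conv f g"
  then obtain g where g: "tfn K g" "h = conv f g" by auto
  have "\<exists>h'. (\<exists>g. tfn K g \<and> h' = conv f g) \<and> (\<forall>x\<in>UNIV. has_partial i h x (h' x))" for i
    using conv_has_partial[OF f K g(1), of i] tfn_cpartial[OF compact_imp_closed[OF K] g(1), of i]
    unfolding g(2) by (intro exI[of _ "conv f (cpartial i g)"]) auto
  then show "continuous_on UNIV h \<and> (\<forall>i. \<exists>h'. (\<exists>g. tfn K g \<and> h' = conv f g) \<and> (\<forall>x\<in>UNIV. has_partial i h x (h' x)))"
    using conv_continuous[OF f K g(1)] g(2) by simp
qed (use g in auto)

lemma cpartial_conv_right:
  assumes "integrable lborel f" "compact K" "tfn K g"
  shows "cpartial i (conv f g) = conv f (cpartial i g)"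
  using cpartial_eqI[OF conv_has_partial[OF assms]] by auto

text \<open>Both factors are test functions, so symmetry of the convolution moves the derivative to
  the other side. It is this version that lets derivatives of test functions pass through
  mollification.\<close>

lemma cpartial_conv_left:
  assumes "compact K" "tfn K f" "compact K'" "tfn K' g"
  shows "cpartial i (conv f g) = conv (cpartial i f) g"
proof -
  have [measurable]: "f \<in> borel_measurable borel" "g \<in> borel_measurable borel" "cpartial i f \<in> borel_measurable borel"
    using assms tfn_measurable tfn_cpartial[OF compact_imp_closed] by blast+
  have "conv f g = conv g f" "conv (cpartial i f) g = conv g (cpartial i f)"
    by (auto intro!: ext conv_commute)
  then show ?thesis using cpartial_conv_right[OF tfn_integrable[OF assms(3,4)] assms(1,2)] by simp
qed

lemma dlist_conv_left:
  assumes "compact K" "tfn K f" "compact K'" "tfn K' g"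
  shows "dlist l (conv f g) = conv (dlist l f) g"
proof (induction l)
  case (Cons i l)
  then show ?case using cpartial_conv_left[OF assms(1) tfn_dlist[OF compact_imp_closed[OF assms(1)] assms(2)] assms(3,4)] by simp
qed auto

lemma conv_zero:
  assumes "\<And>y. y \<notin> K \<Longrightarrow> f y = 0" "\<And>y. y \<notin> K' \<Longrightarrow> g y = 0" "\<And>a b. a \<in> K \<Longrightarrow> b \<in> K' \<Longrightarrow> x \<noteq> a + b"
  shows "conv f g x = 0"
proof -
  have "f y * g (x - y) = 0" for y
    using assms(1)[of y] assms(2)[of "x - y"] assms(3)[of y "x - y"] by (cases "y \<in> K") auto
  then have "(\<lambda>y. f y * g (x - y)) = (\<lambda>y. 0)" by auto
  then show ?thesis unfolding conv_def by simp
qed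

lemma tfn_conv:
  assumes f: "integrable lborel f" "\<And>y. y \<notin> A \<Longrightarrow> f y = 0" and g: "tfn (cball 0 e) g"
    and K: "\<And>x a. a \<in> A \<Longrightarrow> dist a x \<le> e \<Longrightarrow> x \<in> K"
  shows "tfn K (conv f g)"
  unfolding tfn_def
proof (intro conjI allI impI)
  show "smooth_on UNIV (conv f g)" by (rule conv_smooth[OF f(1) compact_cball g])
  fix x assume "x \<notin> K"
  then show "conv f g x = 0"
    by (intro conv_zero[of A f "cball 0 e" g]) (use f K g in \<open>auto simp: tfn_zero dist_norm norm_minus_commute\<close>)
qed

text \<open>Convolving \<open>g\<close> with the indicator of a large ball gives, near the origin,
  the constant function with value the integral of \<open>g\<close>. Its derivative vanishes there,
  and the derivative is the same convolution formed with \<open>cpartial i g\<close>.\<close>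

lemma integral_cpartial:
  assumes K: "compact K" and g: "tfn K g"
  shows "(\<integral>x. cpartial i g x \<partial>lborel) = 0"
proof -
  obtain R where R: "R > 0" "\<And>x. x \<in> K \<Longrightarrow> norm x \<le> R"
    using compact_imp_bounded[OF K] unfolding bounded_pos by auto
  \<comment> \<open>The extra 1 leaves room for \<open>x\<close> in the unit ball:
    \<open>x - y \<in> K\<close> then forces \<open>norm y \<le> R + 1\<close>.\<close>
  define f :: "real^'a \<Rightarrow> real" where "f = indicator (cball 0 (R + 1))"
  have f: "integrable lborel f"
    unfolding f_def by (intro integrable_real_indicator) (auto intro: emeasure_lborel_cball_finite[unfolded infinity_ennreal_def])
  have gi: "tfn K (cpartial i g)" using tfn_cpartial[OF compact_imp_closed[OF K] g] .
  have eq: "conv f h x = (\<integral>y. h y \<partial>lborel)" if "tfn K h" "norm x < 1" for h x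
  proof -
    have "f y * h (x - y) = h (x - y)" for y
    proof (cases "x - y \<in> K")
      case True
      then have "norm y \<le> R + 1" using R(2)[OF True] that(2) norm_triangle_ineq4[of x "x - y"] by simp
      then show ?thesis by (simp add: f_def)
    qed (use tfn_zero[OF that(1)] in auto)
    then have "(\<lambda>y. f y * h (x - y)) = (\<lambda>y. h (x - y))" by (rule ext)
    then show ?thesis unfolding conv_def using lborel_integral_reflect[OF tfn_measurable[OF that(1)], of x] by simp
  qed
  have "cpartial i (conv f g) 0 = conv f (cpartial i g) 0"
    by (rule cpartial_eqI[OF conv_has_partial[OF f K g]])
  moreover have "has_partial i (conv f g) 0 0 = has_partial i (\<lambda>x. \<integral>y. g y \<partial>lborel) 0 0"
    by (rule has_partial_cong[where U = "ball 0 1"]) (use eq[OF g] in auto)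
  ultimately have "conv f (cpartial i g) 0 = 0"
    using has_partial_const[of i "\<integral>y. g y \<partial>lborel" 0] cpartial_eqI[of i "conv f g" 0 0] by simp
  then show ?thesis using eq[OF gi, of 0] by simp
qed

lemma integration_by_parts:
  assumes f: "smooth_on UNIV f" and K: "compact K" and g: "tfn K g"
  shows "(\<integral>x. cpartial i f x * g x \<partial>lborel) = - (\<integral>x. f x * cpartial i g x \<partial>lborel)"
proof -
  have t: "tfn K (\<lambda>x. f x * g x)" by (rule tfn_mult[OF f g])
  have gi: "tfn K (cpartial i g)" using tfn_cpartial[OF compact_imp_closed[OF K] g] .
  have "0 = (\<integral>x. cpartial i (\<lambda>x. f x * g x) x \<partial>lborel)" using integral_cpartial[OF K t] by simp
  also have "\<dots> = (\<integral>x. cpartial i f x * g x + f x * cpartial i g x \<partial>lborel)"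
    using cpartial_mult[OF f tfn_smooth[OF g]] by simp
  also have "\<dots> = (\<integral>x. cpartial i f x * g x \<partial>lborel) + (\<integral>x. f x * cpartial i g x \<partial>lborel)"
    by (intro Bochner_Integration.integral_add integrable_smooth_mult_tfn[OF smooth_on_cpartial[OF f] K g] integrable_smooth_mult_tfn[OF f K gi])
  finally show ?thesis by linarith
qed

text \<open>The outermost derivative of \<open>f\<close> is moved first and so ends up innermost on
  \<open>g\<close>; hence the reversed list.\<close>

lemma integration_by_parts_list:
  assumes f: "smooth_on UNIV f" and K: "compact K" and g: "tfn K g"
  shows "(\<integral>x. dlist l f x * g x \<partial>lborel) = (-1) ^ length l * (\<integral>x. f x * dlist (rev l) g x \<partial>lborel)"
  using g
proof (induction l arbitrary: g)
  case (Cons i l)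
  have gi: "tfn K (cpartial i g)" using tfn_cpartial[OF compact_imp_closed[OF K] Cons.prems] .
  have "(\<integral>x. dlist (i # l) f x * g x \<partial>lborel) = - (\<integral>x. dlist l f x * cpartial i g x \<partial>lborel)"
    using integration_by_parts[OF smooth_on_dlist[OF f] K Cons.prems] by simp
  also have "\<dots> = - ((-1) ^ length l * (\<integral>x. f x * dlist (rev l) (cpartial i g) x \<partial>lborel))"
    using Cons.IH[OF gi] by simp
  finally show ?case by (simp add: dlist_append)
qed auto

text \<open>Fubini's theorem: convolution with an even kernel is its own adjoint. Mollifying
  \<open>w\<close> can thus be traded for mollifying the test function.\<close>

lemma integral_conv_swap:
  assumes f: "integrable lborel f" and g: "compact K'" "tfn K' g" "\<And>x. g (- x) = g x"
    and p: "compact K" "tfn K p"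
  shows "(\<integral>x. conv f g x * p x \<partial>lborel) = (\<integral>y. f y * conv p g y \<partial>lborel)"
proof -
  have [measurable]: "f \<in> borel_measurable borel" "g \<in> borel_measurable borel" "p \<in> borel_measurable borel"
    using f tfn_measurable[OF g(2)] tfn_measurable[OF p(2)] by auto
  obtain B where B: "B \<ge> 0" "\<And>x. \<bar>g x\<bar> \<le> B" using tfn_bounded[OF g(1,2)] by blast
  define k where "k = (\<lambda>(x, y). f y * g (x - y) * p x)"
  have [measurable]: "k \<in> borel_measurable (lborel \<Otimes>\<^sub>M lborel)" unfolding k_def by measurable
  have ix: "integrable lborel (\<lambda>y. f y * g (x - y) * p x)" for x
    using integrable_mult_bounded[OF f, of "\<lambda>y. g (x - y)" B] B by auto
  have "integrable (lborel \<Otimes>\<^sub>M lborel) k"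
  proof (rule lborel_pair.Fubini_integrable)
    show "AE x in lborel. integrable lborel (\<lambda>y. k (x, y))" unfolding k_def using ix by simp
    show "integrable lborel (\<lambda>x. \<integral>y. norm (k (x, y)) \<partial>lborel)"
    proof (rule Bochner_Integration.integrable_bound[of lborel "\<lambda>x. (B * (\<integral>y. \<bar>f y\<bar> \<partial>lborel)) * p x"])
      show "integrable lborel (\<lambda>x. (B * (\<integral>y. \<bar>f y\<bar> \<partial>lborel)) * p x)" using tfn_integrable[OF p] by auto
      show "AE x in lborel. norm (\<integral>y. norm (k (x, y)) \<partial>lborel) \<le> norm ((B * (\<integral>y. \<bar>f y\<bar> \<partial>lborel)) * p x)"
      proof (rule AE_I2)
        fix x
        have "(\<integral>y. norm (k (x, y)) \<partial>lborel) \<le> (\<integral>y. (B * \<bar>p x\<bar>) * \<bar>f y\<bar> \<partial>lborel)"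
        proof (rule integral_mono)
          show "integrable lborel (\<lambda>y. norm (k (x, y)))" using ix[of x] unfolding k_def by auto
          show "integrable lborel (\<lambda>y. (B * \<bar>p x\<bar>) * \<bar>f y\<bar>)" using f by auto
          fix y
          have "\<bar>g (x - y)\<bar> * (\<bar>f y\<bar> * \<bar>p x\<bar>) \<le> B * (\<bar>f y\<bar> * \<bar>p x\<bar>)"
            by (intro mult_right_mono B) auto
          then show "norm (k (x, y)) \<le> (B * \<bar>p x\<bar>) * \<bar>f y\<bar>" by (simp add: k_def abs_mult mult_ac)
        qed
        also have "\<dots> = (B * (\<integral>y. \<bar>f y\<bar> \<partial>lborel)) * \<bar>p x\<bar>" by simp
        finally show "norm (\<integral>y. norm (k (x, y)) \<partial>lborel) \<le> norm ((B * (\<integral>y. \<bar>f y\<bar> \<partial>lborel)) * p x)"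
          using B(1) by (simp add: abs_mult)
      qed
    qed measurable
  qed measurable
  then have "(\<integral>x. (\<integral>y. k (x, y) \<partial>lborel) \<partial>lborel) = (\<integral>y. (\<integral>x. k (x, y) \<partial>lborel) \<partial>lborel)"
    using lborel_pair.Fubini_integral[of "\<lambda>x y. k (x, y)"] by simp
  moreover have "(\<integral>y. k (x, y) \<partial>lborel) = conv f g x * p x" for x
    by (simp add: k_def conv_def)
  moreover have "(\<integral>x. k (x, y) \<partial>lborel) = f y * conv p g y" for y
  proof -
    have "g (x - y) = g (y - x)" for x using g(3)[of "y - x"] by simp
    then have "(\<lambda>x. k (x, y)) = (\<lambda>x. f y * (p x * g (y - x)))" by (auto simp: k_def)
    then show ?thesis by (simp add: conv_def)
  qed
  ultimately show ?thesis by simp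
qed

section \<open>The \<open>L\<^sup>2\<close> norm\<close>

definition nrm :: "(real^'n::finite \<Rightarrow> real) \<Rightarrow> real" where
  "nrm f = sqrt (\<integral>x. (f x)\<^sup>2 \<partial>lborel)"

lemma nrm_nonneg: "nrm f \<ge> 0"
  by (simp add: nrm_def)

lemma nrm_sq: "(nrm f)\<^sup>2 = (\<integral>x. (f x)\<^sup>2 \<partial>lborel)"
  by (simp add: nrm_def)

lemma quadratic_nonneg_discriminant:
  fixes A B C :: real
  assumes "\<And>t. A + 2 * t * B + t\<^sup>2 * C \<ge> 0" "C \<ge> 0"
  shows "B\<^sup>2 \<le> A * C"
proof (cases "C = 0")
  case True
  have "B = 0"
  proof (rule ccontr)
    assume "B \<noteq> 0"
    \<comment> \<open>With \<open>C = 0\<close> the quadratic is affine in \<open>t\<close>, and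
      this \<open>t\<close> gives it the value -1.\<close>
    then show False using assms(1)[of "- (A + 1) / (2 * B)"] True by (simp add: field_simps)
  qed
  then show ?thesis using True by simp
next
  case False
  then have "C > 0" using assms by simp
  \<comment> \<open>\<open>- B / C\<close> minimises the quadratic.\<close>
  have "A + 2 * (- B / C) * B + (- B / C)\<^sup>2 * C = A - B\<^sup>2 / C"
    using \<open>C > 0\<close> by (simp add: power2_eq_square field_simps)
  then have "A - B\<^sup>2 / C \<ge> 0" using assms(1)[of "- B / C"] by simp
  then show ?thesis using \<open>C > 0\<close> by (simp add: field_simps)
qed

lemma integrable_mult_L2:
  fixes f g :: "'a \<Rightarrow> real"
  assumes "f \<in> borel_measurable M" "g \<in> borel_measurable M"
    and "integrable M (\<lambda>x. (f x)\<^sup>2)" "integrable M (\<lambda>x. (g x)\<^sup>2)"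
  shows "integrable M (\<lambda>x. f x * g x)"
proof (rule Bochner_Integration.integrable_bound[of M "\<lambda>x. (f x)\<^sup>2 + (g x)\<^sup>2"])
  show "AE x in M. norm (f x * g x) \<le> norm ((f x)\<^sup>2 + (g x)\<^sup>2)"
  proof (rule AE_I2)
    fix x
    have "2 * \<bar>f x\<bar> * \<bar>g x\<bar> \<le> \<bar>f x\<bar>\<^sup>2 + \<bar>g x\<bar>\<^sup>2" by (rule sum_squares_bound)
    then have "2 * \<bar>f x * g x\<bar> \<le> (f x)\<^sup>2 + (g x)\<^sup>2" by (simp add: abs_mult)
    moreover have "\<bar>f x * g x\<bar> \<ge> 0" by simp
    ultimately show "norm (f x * g x) \<le> norm ((f x)\<^sup>2 + (g x)\<^sup>2)" by simp
  qed
qed (use assms in auto)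

lemma Cauchy_Schwarz_integral:
  fixes f g :: "'a \<Rightarrow> real"
  assumes "f \<in> borel_measurable M" "g \<in> borel_measurable M"
    and f: "integrable M (\<lambda>x. (f x)\<^sup>2)" and g: "integrable M (\<lambda>x. (g x)\<^sup>2)"
  shows "(\<integral>x. f x * g x \<partial>M)\<^sup>2 \<le> (\<integral>x. (f x)\<^sup>2 \<partial>M) * (\<integral>x. (g x)\<^sup>2 \<partial>M)"
proof (rule quadratic_nonneg_discriminant)
  have fg: "integrable M (\<lambda>x. f x * g x)" by (rule integrable_mult_L2[OF assms])
  fix t
  have "0 \<le> (\<integral>x. (f x + t * g x)\<^sup>2 \<partial>M)" by simp
  also have "(\<lambda>x. (f x + t * g x)\<^sup>2) = (\<lambda>x. (f x)\<^sup>2 + ((2 * t) * (f x * g x) + t\<^sup>2 * (g x)\<^sup>2))"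
    by (auto simp: power2_eq_square algebra_simps)
  also have "(\<integral>x. (f x)\<^sup>2 + ((2 * t) * (f x * g x) + t\<^sup>2 * (g x)\<^sup>2) \<partial>M)
     = (\<integral>x. (f x)\<^sup>2 \<partial>M) + ((2 * t) * (\<integral>x. f x * g x \<partial>M) + t\<^sup>2 * (\<integral>x. (g x)\<^sup>2 \<partial>M))"
    using f g fg by simp
  finally show "0 \<le> (\<integral>x. (f x)\<^sup>2 \<partial>M) + 2 * t * (\<integral>x. f x * g x \<partial>M) + t\<^sup>2 * (\<integral>x. (g x)\<^sup>2 \<partial>M)"
    by simp
qed simp

lemma tfn_sq_integrable:
  assumes "compact K" "tfn K f" shows "integrable lborel (\<lambda>x. (f x)\<^sup>2)"
  unfolding power2_eq_square by (rule integrable_smooth_mult_tfn[OF tfn_smooth[OF assms(2)] assms])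

lemma Cauchy_Schwarz_tfn:
  assumes "f \<in> borel_measurable lborel" "integrable lborel (\<lambda>x. (f x)\<^sup>2)" "compact K" "tfn K g"
  shows "\<bar>\<integral>x. f x * g x \<partial>lborel\<bar> \<le> nrm f * nrm g"
proof -
  have "(\<integral>x. f x * g x \<partial>lborel)\<^sup>2 \<le> (nrm f * nrm g)\<^sup>2"
    using Cauchy_Schwarz_integral[OF assms(1) _ assms(2) tfn_sq_integrable[OF assms(3,4)]] tfn_measurable[OF assms(4)]
    by (simp add: power_mult_distrib nrm_sq)
  then show ?thesis using abs_le_square_iff[of _ "nrm f * nrm g"] nrm_nonneg[of f] nrm_nonneg[of g] by simp
qed

lemma nrm_mono:
  assumes "compact K" "tfn K g" "\<And>x. \<bar>f x\<bar> \<le> \<bar>g x\<bar>" "f \<in> borel_measurable borel"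
  shows "nrm f \<le> nrm g"
  unfolding nrm_def
proof (rule real_sqrt_le_mono, rule integral_mono)
  show g: "integrable lborel (\<lambda>x. (g x)\<^sup>2)" by (rule tfn_sq_integrable[OF assms(1,2)])
  show "(f x)\<^sup>2 \<le> (g x)\<^sup>2" for x using assms(3)[of x] by (simp add: abs_le_square_iff)
  then show "integrable lborel (\<lambda>x. (f x)\<^sup>2)"
    using assms(4) by (intro Bochner_Integration.integrable_bound[OF g]) auto
qed

lemma nrm_cmult: "nrm (\<lambda>x. c * f x) = \<bar>c\<bar> * nrm f"
  by (simp add: nrm_def power_mult_distrib real_sqrt_mult)

lemma nrm_mult_bound:
  assumes "compact K" "tfn K g" "smooth_on UNIV a" "\<And>x. \<bar>a x\<bar> \<le> B"
  shows "nrm (\<lambda>x. a x * g x) \<le> B * nrm g"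
proof -
  have "B \<ge> 0" using assms(4)[of 0] by linarith
  have "nrm (\<lambda>x. a x * g x) \<le> nrm (\<lambda>x. B * g x)"
  proof (rule nrm_mono[OF assms(1) tfn_cmult[OF assms(2)]])
    show "\<bar>a x * g x\<bar> \<le> \<bar>B * g x\<bar>" for x
      using mult_right_mono[OF assms(4)[of x], of "\<bar>g x\<bar>"] \<open>B \<ge> 0\<close> by (simp add: abs_mult)
    show "(\<lambda>x. a x * g x) \<in> borel_measurable borel"
      by (rule smooth_measurable[OF tfn_smooth[OF tfn_mult[OF assms(3,2)]]])
  qed
  then show ?thesis using \<open>B \<ge> 0\<close> by (simp add: nrm_cmult)
qed

text \<open>Schur's test for a convolution kernel. Writing \<open>H\<close> as the product of its
  square root with itself, the Cauchy-Schwarz inequality bounds \<open>F\<close> squared by the mass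
  of \<open>H\<close> times \<open>H\<close> convolved with the square of \<open>th\<close>;
  integrating in \<open>x\<close> yields the mass once more. Only a pointwise majorant of
  \<open>F\<close> is asked for, so that \<open>F\<close> may be a commutator.\<close>

lemma Young_L2:
  fixes F H th :: "real^'n::finite \<Rightarrow> real"
  assumes H: "integrable lborel H" "\<And>x. H x \<ge> 0" "(\<integral>x. H x \<partial>lborel) \<le> C"
    and th: "compact K" "tfn K th"
    and F: "F \<in> borel_measurable borel" "\<And>x. \<bar>F x\<bar> \<le> (\<integral>y. H (x - y) * \<bar>th y\<bar> \<partial>lborel)"
  shows "nrm F \<le> C * nrm th"
proof -
  have [measurable]: "H \<in> borel_measurable borel" "th \<in> borel_measurable borel" "F \<in> borel_measurable borel"
    using H tfn_measurable[OF th(2)] F by auto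
  obtain B where B: "B \<ge> 0" "\<And>x. \<bar>th x\<bar> \<le> B" using tfn_bounded[OF th] by blast
  define I where "I = (\<integral>x. H x \<partial>lborel)"
  have I: "I \<ge> 0" "I \<le> C" unfolding I_def using H by auto
  have iH: "integrable lborel (\<lambda>y. H (x - y))" for x by (rule integrable_reflect[OF H(1)])
  have i2: "integrable lborel (\<lambda>y. H (x - y) * (th y)\<^sup>2)" for x
  proof (rule integrable_mult_bounded[OF iH])
    show "\<bar>(th y)\<^sup>2\<bar> \<le> B\<^sup>2" for y using B(2)[of y] B(1) by (simp add: abs_le_square_iff[symmetric])
  qed auto
  have pt: "(F x)\<^sup>2 \<le> I * (\<integral>y. H (x - y) * (th y)\<^sup>2 \<partial>lborel)" for x
  proof -
    have "(F x)\<^sup>2 \<le> (\<integral>y. sqrt (H (x - y)) * (sqrt (H (x - y)) * \<bar>th y\<bar>) \<partial>lborel)\<^sup>2"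
    proof -
      have "\<bar>F x\<bar>\<^sup>2 \<le> (\<integral>y. H (x - y) * \<bar>th y\<bar> \<partial>lborel)\<^sup>2" by (intro power_mono F) auto
      moreover have "(\<lambda>y. sqrt (H (x - y)) * (sqrt (H (x - y)) * \<bar>th y\<bar>)) = (\<lambda>y. H (x - y) * \<bar>th y\<bar>)"
        using H(2) by (auto simp flip: mult.assoc)
      ultimately show ?thesis by simp
    qed
    also have "\<dots> \<le> (\<integral>y. (sqrt (H (x - y)))\<^sup>2 \<partial>lborel) * (\<integral>y. (sqrt (H (x - y)) * \<bar>th y\<bar>)\<^sup>2 \<partial>lborel)"
      by (rule Cauchy_Schwarz_integral) (use H(2) iH i2 in \<open>auto simp: power_mult_distrib\<close>)
    also have "\<dots> = I * (\<integral>y. H (x - y) * (th y)\<^sup>2 \<partial>lborel)"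
      using H(2) lborel_integral_reflect[of H x] by (simp add: power_mult_distrib I_def)
    finally show ?thesis .
  qed
  \<comment> \<open>Extended nonnegative integrals permit exchanging the order of integration before
    \<open>F\<close> is known to be square integrable; that is a result of the estimate.\<close>
  have "(\<integral>\<^sup>+x. ennreal ((F x)\<^sup>2) \<partial>lborel) \<le> (\<integral>\<^sup>+x. ennreal I * (\<integral>\<^sup>+y. ennreal (H (x - y) * (th y)\<^sup>2) \<partial>lborel) \<partial>lborel)"
  proof (rule nn_integral_mono)
    fix x
    have "ennreal ((F x)\<^sup>2) \<le> ennreal (I * (\<integral>y. H (x - y) * (th y)\<^sup>2 \<partial>lborel))"
      using pt by (rule ennreal_leI)
    also have "\<dots> = ennreal I * (\<integral>\<^sup>+y. ennreal (H (x - y) * (th y)\<^sup>2) \<partial>lborel)"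
      using i2[of x] H(2) I by (subst nn_integral_eq_integral) (auto simp: ennreal_mult)
    finally show "ennreal ((F x)\<^sup>2) \<le> ennreal I * (\<integral>\<^sup>+y. ennreal (H (x - y) * (th y)\<^sup>2) \<partial>lborel)" .
  qed
  also have "\<dots> = ennreal I * (\<integral>\<^sup>+x. (\<integral>\<^sup>+y. ennreal (H (x - y) * (th y)\<^sup>2) \<partial>lborel) \<partial>lborel)"
    by (rule nn_integral_cmult) measurable
  also have "(\<integral>\<^sup>+x. (\<integral>\<^sup>+y. ennreal (H (x - y) * (th y)\<^sup>2) \<partial>lborel) \<partial>lborel)
      = (\<integral>\<^sup>+y. (\<integral>\<^sup>+x. ennreal (H (x - y) * (th y)\<^sup>2) \<partial>lborel) \<partial>lborel)"
    by (rule lborel_pair.Fubini'[symmetric]) measurable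
  also have "\<dots> = (\<integral>\<^sup>+y. ennreal ((th y)\<^sup>2) * ennreal I \<partial>lborel)"
  proof (rule nn_integral_cong)
    fix y
    have "(\<integral>\<^sup>+x. ennreal (H (x - y) * (th y)\<^sup>2) \<partial>lborel) = (\<integral>\<^sup>+x. ennreal ((th y)\<^sup>2) * ennreal (H (x - y)) \<partial>lborel)"
      using H(2) by (intro nn_integral_cong) (simp add: ennreal_mult mult.commute)
    also have "\<dots> = ennreal ((th y)\<^sup>2) * (\<integral>\<^sup>+x. ennreal (H (x - y)) \<partial>lborel)"
      by (rule nn_integral_cmult) measurable
    also have "(\<integral>\<^sup>+x. ennreal (H (x - y)) \<partial>lborel) = (\<integral>\<^sup>+x. ennreal (H x) \<partial>lborel)"
      by (rule lborel_nn_integral_translate[of "\<lambda>x. ennreal (H x)"]) measurable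
    also have "\<dots> = ennreal I" unfolding I_def using H by (intro nn_integral_eq_integral) auto
    finally show "(\<integral>\<^sup>+x. ennreal (H (x - y) * (th y)\<^sup>2) \<partial>lborel) = ennreal ((th y)\<^sup>2) * ennreal I" .
  qed
  also have "\<dots> = (\<integral>\<^sup>+y. ennreal ((th y)\<^sup>2) \<partial>lborel) * ennreal I"
    by (rule nn_integral_multc) measurable
  also have "(\<integral>\<^sup>+y. ennreal ((th y)\<^sup>2) \<partial>lborel) = ennreal ((nrm th)\<^sup>2)"
    unfolding nrm_sq using tfn_sq_integrable[OF th] by (intro nn_integral_eq_integral) auto
  finally have le: "(\<integral>\<^sup>+x. ennreal ((F x)\<^sup>2) \<partial>lborel) \<le> ennreal I * (ennreal ((nrm th)\<^sup>2) * ennreal I)" .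
  have "ennreal I * (ennreal ((nrm th)\<^sup>2) * ennreal I) = ennreal ((I * nrm th)\<^sup>2)"
    using I by (simp add: power_mult_distrib ennreal_mult[symmetric] power2_eq_square mult_ac)
  with le have le': "(\<integral>\<^sup>+x. ennreal ((F x)\<^sup>2) \<partial>lborel) \<le> ennreal ((I * nrm th)\<^sup>2)" by simp
  have "integrable lborel (\<lambda>x. (F x)\<^sup>2)"
    by (rule integrableI_bounded) (use le' in \<open>auto intro: le_less_trans\<close>)
  then have "ennreal ((nrm F)\<^sup>2) \<le> ennreal ((I * nrm th)\<^sup>2)"
    using le' unfolding nrm_sq by (subst (asm) nn_integral_eq_integral) auto
  then have "(nrm F)\<^sup>2 \<le> (I * nrm th)\<^sup>2" by (simp add: ennreal_le_iff)
  then have "nrm F \<le> I * nrm th"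
    using I nrm_nonneg by (meson mult_nonneg_nonneg power2_le_imp_le)
  also have "\<dots> \<le> C * nrm th" using I nrm_nonneg by (intro mult_right_mono) auto
  finally show ?thesis .
qed

text \<open>The coordinates are changed one after the other. The explicit constant matters: applied
  to functions depending on the mollification parameter, it gives a Lipschitz bound uniform in
  it.\<close>

lemma Lipschitz_of_partials:
  fixes a :: "real^'n::finite \<Rightarrow> real"
  assumes K: "compact K" and a: "tfn K a" and B: "\<And>i x. \<bar>cpartial i a x\<bar> \<le> B i"
  shows "\<bar>a x - a y\<bar> \<le> (\<Sum>i\<in>UNIV. B i) * norm (x - y)"
proof -
  have B0: "B i \<ge> 0" for i using B[of i 0] by linarith
  have step: "\<bar>a (x + (\<Sum>i\<in>S. h i *\<^sub>R axis i 1)) - a x\<bar> \<le> (\<Sum>i\<in>S. B i * \<bar>h i\<bar>)" if "finite S" for S x and h :: "'n \<Rightarrow> real"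
    using that
  proof induction
    case (insert j S)
    have "\<bar>a ((x + (\<Sum>i\<in>S. h i *\<^sub>R axis i 1)) + h j *\<^sub>R axis j 1) - a (x + (\<Sum>i\<in>S. h i *\<^sub>R axis i 1))\<bar> \<le> B j * \<bar>h j\<bar>"
      by (rule tfn_diff_quotient[OF K a B])
    then show ?case using insert by (simp add: algebra_simps)
  qed auto
  have "x = y + (\<Sum>i\<in>UNIV. (x - y) $ i *\<^sub>R axis i 1)"
    using basis_expansion[of "x - y"] by (simp add: scalar_mult_eq_scaleR)
  then have "\<bar>a x - a y\<bar> \<le> (\<Sum>i\<in>UNIV. B i * \<bar>(x - y) $ i\<bar>)"
    using step[of UNIV y "\<lambda>i. (x - y) $ i"] by simp
  also have "\<dots> \<le> (\<Sum>i\<in>UNIV. B i * norm (x - y))"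
    by (intro sum_mono mult_left_mono component_le_norm_cart B0)
  finally show ?thesis by (simp add: sum_distrib_right)
qed

lemma tfn_Lipschitz:
  fixes a :: "real^'n::finite \<Rightarrow> real"
  assumes K: "compact K" and a: "tfn K a"
  obtains M where "M \<ge> 0" "\<And>x y. \<bar>a x - a y\<bar> \<le> M * norm (x - y)"
proof -
  have "\<forall>i. \<exists>B. B \<ge> 0 \<and> (\<forall>x. \<bar>cpartial i a x\<bar> \<le> B)"
    using tfn_bounded[OF K tfn_cpartial[OF compact_imp_closed[OF K] a]] by metis
  then obtain B where B: "\<And>i. B i \<ge> 0" "\<And>i x. \<bar>cpartial i a x\<bar> \<le> B i" by metis
  show ?thesis
    by (rule that[OF _ Lipschitz_of_partials[OF K a B(2)]]) (intro sum_nonneg B)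
qed

section \<open>Mollifiers\<close>

text \<open>The functions \<open>t ^ (-k) * exp (- 1 / t)\<close>, continued by zero. The whole
  family is introduced because its span is closed under differentiation, whereas
  \<open>flat 0\<close> alone is the classical flat function.\<close>

definition flat :: "nat \<Rightarrow> real \<Rightarrow> real" where
  "flat k t = (if t > 0 then (1 / t) ^ k * exp (- (1 / t)) else 0)"

lemma flat_deriv: "(flat k has_real_derivative (flat (k + 2) t - real k * flat (k + 1) t)) (at t)"
proof (cases "t = 0")
  case False
  show ?thesis
  proof (cases "t > 0")
    case True
    have "((\<lambda>t. (1 / t) ^ k * exp (- (1 / t))) has_real_derivative
       (real k * (1 / t) ^ (k - 1) * (- (1 / t\<^sup>2)) * exp (- (1 / t)) + (1 / t) ^ k * (exp (- (1 / t)) * (1 / t\<^sup>2)))) (at t)"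
      using True by (auto intro!: derivative_eq_intros simp: power2_eq_square)
    moreover have "real k * (1 / t) ^ (k - 1) * (- (1 / t\<^sup>2)) * exp (- (1 / t)) + (1 / t) ^ k * (exp (- (1 / t)) * (1 / t\<^sup>2))
        = flat (k + 2) t - real k * flat (k + 1) t"
      using True by (cases k) (auto simp: flat_def power2_eq_square field_simps)
    ultimately have "((\<lambda>t. (1 / t) ^ k * exp (- (1 / t))) has_real_derivative flat (k + 2) t - real k * flat (k + 1) t) (at t)"
      by simp
    then show ?thesis
      by (rule DERIV_cong_ev[THEN iffD1, rotated -1, OF _])
        (use True in \<open>auto simp: flat_def intro!: eventually_mono[OF eventually_nhds_in_open[of "{0<..}" t]]\<close>)
  next
    case f: False
    then have "t < 0" using False by simp
    have "((\<lambda>t. 0) has_real_derivative 0) (at t)" by simp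
    then have "(flat k has_real_derivative 0) (at t)"
      by (rule DERIV_cong_ev[THEN iffD1, rotated -1, OF _])
        (use \<open>t < 0\<close> in \<open>auto simp: flat_def intro!: eventually_mono[OF eventually_nhds_in_open[of "{..<0}" t]]\<close>)
    then show ?thesis using f by (simp add: flat_def)
  qed
next
  case True
  \<comment> \<open>With \<open>u = 1 / h\<close> the quotient is
    \<open>u ^ (k + 1) / exp u\<close>, which tends to zero as \<open>u\<close> grows.\<close>
  have 1: "((\<lambda>h. flat k h / h) \<longlongrightarrow> 0) (at_right 0)"
  proof -
    have "((\<lambda>u. u ^ (k + 1) / exp u) \<longlongrightarrow> (0::real)) at_top" by (rule tendsto_power_div_exp_0)
    then have "((\<lambda>h. (inverse h) ^ (k + 1) / exp (inverse h)) \<longlongrightarrow> (0::real)) (at_right 0)"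
      by (rule filterlim_compose[OF _ filterlim_inverse_at_top_right])
    then show ?thesis
      by (rule Lim_transform_eventually)
        (auto simp: flat_def eventually_at_filter exp_minus field_simps)
  qed
  have 2: "((\<lambda>h. flat k h / h) \<longlongrightarrow> 0) (at_left 0)"
    by (rule Lim_transform_eventually[OF tendsto_const]) (auto simp: flat_def eventually_at_filter)
  have "((\<lambda>h. flat k h / h) \<longlongrightarrow> 0) (at 0)"
    using filterlim_split_at[OF 2 1] .
  then show ?thesis using True by (simp add: DERIV_def flat_def)
qed

text \<open>By \<open>flat_deriv\<close> the partial derivatives stay among linear combinations of
  the \<open>flat k\<close>; these combinations, as lists of coefficient and index, are the class
  for the coinduction.\<close>

lemma flat_coordinate_smooth: "smooth_on UNIV (\<lambda>x::real^'n::finite. flat 0 (c + r * x $ i))"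
proof -
  have "smooth_on UNIV (\<lambda>x::real^'n. \<Sum>(a, k)\<leftarrow>[(1, 0)]. a * flat k (c + r * x $ i))"
  proof (rule smooth_on_coinduct[where P = "\<lambda>F. \<exists>ps. F = (\<lambda>x. \<Sum>(a, k)\<leftarrow>ps. a * flat k (c + r * x $ i))"])
    fix F :: "real^'n \<Rightarrow> real" assume "\<exists>ps. F = (\<lambda>x. \<Sum>(a, k)\<leftarrow>ps. a * flat k (c + r * x $ i))"
    then obtain ps where F: "F = (\<lambda>x. \<Sum>(a, k)\<leftarrow>ps. a * flat k (c + r * x $ i))" by auto
    have cf: "continuous_on UNIV (flat k)" for k
      using flat_deriv DERIV_isCont by (metis continuous_at_imp_continuous_on)
    have hp: "has_partial j (\<lambda>x. flat k (c + r * x $ i)) x (axis j 1 $ i * r * (flat (k + 2) (c + r * x $ i) - real k * flat (k + 1) (c + r * x $ i)))" for j k x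
    proof -
      have 1: "((\<lambda>t. c + r * (x + t *\<^sub>R axis j 1) $ i) has_real_derivative (r * axis j 1 $ i)) (at 0)"
        by (auto intro!: derivative_eq_intros)
      have 2: "(flat k has_real_derivative (flat (k + 2) (c + r * x $ i) - real k * flat (k + 1) (c + r * x $ i))) (at (c + r * (x + 0 *\<^sub>R axis j 1) $ i))"
        using flat_deriv[of k "c + r * x $ i"] by simp
      show ?thesis unfolding has_partial_def using DERIV_chain2[OF 2 1] by (simp add: mult_ac)
    qed
    have "continuous_on UNIV (\<lambda>x::real^'n. \<Sum>(a, k)\<leftarrow>ps. a * flat k (c + r * x $ i)) \<and>
       (\<forall>j. \<exists>qs. \<forall>x::real^'n. has_partial j (\<lambda>x. \<Sum>(a, k)\<leftarrow>ps. a * flat k (c + r * x $ i)) x (\<Sum>(a, k)\<leftarrow>qs. a * flat k (c + r * x $ i)))"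
    proof (induction ps)
      case Nil
      then show ?case by (auto intro!: exI[of _ "[]"] has_partial_const)
    next
      case (Cons p ps)
      obtain a k where p: "p = (a, k)" by fastforce
      show ?case
      proof (intro conjI allI)
        show "continuous_on UNIV (\<lambda>x::real^'n. \<Sum>(a, k)\<leftarrow>p # ps. a * flat k (c + r * x $ i))"
          using Cons by (auto simp: p intro!: continuous_intros continuous_on_compose2[OF cf])
        fix j :: 'n
        obtain qs where qs: "\<forall>x::real^'n. has_partial j (\<lambda>x. \<Sum>(a, k)\<leftarrow>ps. a * flat k (c + r * x $ i)) x (\<Sum>(a, k)\<leftarrow>qs. a * flat k (c + r * x $ i))"
          using Cons by blast
        define m where "m = a * (axis j 1 $ i * r)"
        have "has_partial j (\<lambda>x. \<Sum>(a, k)\<leftarrow>p # ps. a * flat k (c + r * x $ i)) x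
           (\<Sum>(a, k)\<leftarrow>(m, k + 2) # (- m * real k, k + 1) # qs. a * flat k (c + r * x $ i))" for x :: "real^'n"
          using has_partial_add[OF has_partial_cmult[OF hp[of j k x], of a] qs[rule_format, of x]]
          by (simp add: p m_def algebra_simps)
        then show "\<exists>qs. \<forall>x::real^'n. has_partial j (\<lambda>x. \<Sum>(a, k)\<leftarrow>p # ps. a * flat k (c + r * x $ i)) x (\<Sum>(a, k)\<leftarrow>qs. a * flat k (c + r * x $ i))"
          by blast
      qed
    qed
    then show "continuous_on UNIV F \<and> (\<forall>j. \<exists>g. (\<exists>ps. g = (\<lambda>x. \<Sum>(a, k)\<leftarrow>ps. a * flat k (c + r * x $ i))) \<and> (\<forall>x\<in>UNIV. has_partial j F x (g x)))"
      unfolding F by blast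
  qed (auto intro!: exI[of _ "[(1, 0)]"])
  then show ?thesis by simp
qed

text \<open>A product over coordinates instead of a radial function, so that smoothness reduces to
  one real variable. It is supported in the cube \<open>[-1, 1]^n\<close>, hence in the ball of
  radius \<open>CARD('n)\<close>. The factors \<open>1 *\<close> and \<open>(-1) *\<close> give both
  parts the shape \<open>c + r * x $ i\<close> of the smoothness lemma.\<close>

definition bump :: "real^'n::finite \<Rightarrow> real" where
  "bump x = (\<Prod>i\<in>UNIV. flat 0 (1 + 1 * x $ i) * flat 0 (1 + (-1) * x $ i))"

lemma flat_nonneg: "flat k t \<ge> 0" by (simp add: flat_def)

lemma bump_nonneg: "bump x \<ge> 0"
  unfolding bump_def by (intro prod_nonneg ballI mult_nonneg_nonneg flat_nonneg)

lemma bump_even: "bump (- x) = bump x"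
  unfolding bump_def by (simp add: mult.commute)

lemma norm_le_card: "(\<And>i. \<bar>x $ i\<bar> \<le> 1) \<Longrightarrow> norm (x::real^'n::finite) \<le> real CARD('n)"
  using norm_le_l1_cart[of x] sum_bounded_above[of UNIV "\<lambda>i. \<bar>x $ i\<bar>" 1] by force

lemma bump_tfn: "tfn (cball 0 (real CARD('n))) (bump :: real^'n::finite \<Rightarrow> real)"
  unfolding tfn_def
proof (intro conjI allI impI)
  show "smooth_on UNIV (bump :: real^'n \<Rightarrow> real)" unfolding bump_def
    by (intro smooth_on_prod smooth_on_mult flat_coordinate_smooth) auto
  fix x :: "real^'n" assume "x \<notin> cball 0 (real CARD('n))"
  then have "\<not> (\<forall>i. \<bar>x $ i\<bar> \<le> 1)" using norm_le_card[of x] by auto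
  then obtain i where "\<bar>x $ i\<bar> > 1" by (auto simp: not_le)
  then have "flat 0 (1 + 1 * x $ i) * flat 0 (1 + (-1) * x $ i) = 0" by (auto simp: flat_def)
  then show "bump x = 0" unfolding bump_def by (intro prod_zero) auto
qed

lemma bump_integral_pos: "(\<integral>x. bump (x::real^'n::finite) \<partial>lborel) > (0::real)"
proof (rule ccontr)
  assume neg: "\<not> (\<integral>x. bump (x::real^'n::finite) \<partial>lborel) > (0::real)"
  have int: "integrable lborel (bump :: real^'n \<Rightarrow> real)" by (rule tfn_integrable[OF _ bump_tfn]) simp
  have "(\<integral>x. bump (x::real^'n) \<partial>lborel) \<ge> 0"
    by (rule Bochner_Integration.integral_nonneg) (rule bump_nonneg)
  with neg have "(\<integral>x. bump (x::real^'n) \<partial>lborel) = 0" by linarith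
  then have "AE x in lborel. bump (x::real^'n) = 0"
    using integral_nonneg_eq_0_iff_AE[OF int] bump_nonneg by auto
  then have "{x. bump (x::real^'n) \<noteq> 0} \<in> null_sets lborel"
    using AE_iff_null_sets[of "{x. bump (x::real^'n) \<noteq> 0}" lborel]
      borel_open[OF open_Collect_neq[OF smooth_on_continuous0[OF tfn_smooth[OF bump_tfn]] continuous_on_const[of UNIV 0]]]
    by simp
  then have "negligible {x. bump (x::real^'n) \<noteq> 0}"
    using null_sets_completionI negligible_iff_null_sets by blast
  moreover have "ball 0 1 \<subseteq> {x. bump (x::real^'n) \<noteq> 0}"
  proof
    fix x :: "real^'n" assume "x \<in> ball 0 1"
    then have x: "\<bar>x $ i\<bar> < 1" for i using component_le_norm_cart[of x i] by simp
    have "flat 0 (1 + 1 * x $ i) * flat 0 (1 + (-1) * x $ i) > 0" for i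
      using x[of i] by (auto simp: flat_def abs_less_iff)
    then have "bump x > 0" unfolding bump_def by (intro prod_pos) auto
    then show "x \<in> {x. bump x \<noteq> 0}" by simp
  qed
  ultimately have "negligible (ball (0::real^'n) 1)" by (rule negligible_subset)
  then show False using open_not_negligible[of "ball (0::real^'n) 1"] by simp
qed

text \<open>The dilation by \<open>CARD('n) / e\<close> shrinks the ball of radius
  \<open>CARD('n)\<close> to radius \<open>e\<close>, and the prefactor restores unit mass. The
  summand \<open>+ 0\<close> is the translation part of the affine maps treated above.\<close>

definition moll :: "real \<Rightarrow> real^'n::finite \<Rightarrow> real" where
  "moll e x = (real CARD('n) / e) ^ CARD('n) / (\<integral>x. bump (x::real^'n) \<partial>lborel) * bump ((real CARD('n) / e) *\<^sub>R x + 0)"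

lemma moll_nonneg: "e > 0 \<Longrightarrow> moll e x \<ge> 0"
  unfolding moll_def using less_imp_le[OF bump_integral_pos] by (intro mult_nonneg_nonneg divide_nonneg_nonneg bump_nonneg) auto

lemma moll_even: "moll e (- x) = moll e x"
  using bump_even[of "(real CARD('a) / e) *\<^sub>R x"] by (simp add: moll_def)

lemma moll_tfn: 
  assumes "e > 0" shows "tfn (cball 0 e) (moll e :: real^'n::finite \<Rightarrow> real)"
  unfolding tfn_def
proof (intro conjI allI impI)
  show "smooth_on UNIV (moll e :: real^'n \<Rightarrow> real)"
    unfolding moll_def by (intro smooth_on_affine tfn_smooth[OF bump_tfn])
  fix x :: "real^'n" assume "x \<notin> cball 0 e"
  then have "(real CARD('n) / e) *\<^sub>R x \<notin> cball 0 (real CARD('n))"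
    using assms by (simp add: field_simps)
  from tfn_zero[OF bump_tfn this] show "moll e x = 0" by (simp add: moll_def)
qed

lemma moll_integral:
  assumes "e > 0" shows "(\<integral>x. moll e (x::real^'n::finite) \<partial>lborel) = 1"
proof -
  define r where "r = real CARD('n) / e"
  have r: "r > 0" using assms by (simp add: r_def)
  have "(\<integral>x. bump (x::real^'n) \<partial>lborel) = r ^ CARD('n) * (\<integral>x. bump (r *\<^sub>R (x::real^'n)) \<partial>lborel)"
    using lborel_integral_affine[OF _ tfn_measurable[OF bump_tfn], of r 0] r by simp
  then show ?thesis using bump_integral_pos[where 'n='n] r
    unfolding moll_def r_def[symmetric] by (auto simp: zero_less_mult_iff)
qed

text \<open>This moment is invariant under dilation: differentiation gains a factor
  \<open>1 / e\<close>, the weight \<open>norm x\<close> loses it. Summing over all directions makes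
  the constant independent of \<open>i\<close> as well as of \<open>e\<close>.\<close>

lemma moll_moment:
  obtains C where "\<And>e i. e > 0 \<Longrightarrow> (\<integral>x. norm x * \<bar>cpartial i (moll e) (x::real^'n::finite)\<bar> \<partial>lborel) \<le> C"
proof -
  define I where "I = (\<integral>x. bump (x::real^'n) \<partial>lborel)"
  define C where "C = (\<Sum>i\<in>UNIV. (\<integral>x. norm x * \<bar>cpartial i bump (x::real^'n)\<bar> \<partial>lborel) / I)"
  have I: "I > 0" unfolding I_def by (rule bump_integral_pos)
  have "(\<integral>x. norm x * \<bar>cpartial i (moll e) (x::real^'n)\<bar> \<partial>lborel) \<le> C" if e: "e > 0" for e i
  proof -
    define r where "r = real CARD('n) / e"
    have r: "r > 0" using e by (simp add: r_def)
    have m: "cpartial i bump \<in> borel_measurable (borel :: (real^'n) measure)"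
      by (rule tfn_measurable[OF tfn_cpartial[OF _ bump_tfn]]) simp
    have "cpartial i (moll e) x = (r ^ CARD('n) / I) * r * cpartial i bump (r *\<^sub>R x + 0)" for x :: "real^'n"
      using cpartial_affine[OF tfn_smooth[OF bump_tfn], of i "r ^ CARD('n) / I" r 0 x]
      unfolding moll_def[abs_def] r_def[symmetric] I_def[symmetric] by simp
    then have "(\<lambda>x. norm x * \<bar>cpartial i (moll e) (x::real^'n)\<bar>) = (\<lambda>x. (r ^ CARD('n) / I) * (norm (r *\<^sub>R x) * \<bar>cpartial i bump (r *\<^sub>R x)\<bar>))"
      using r I by (auto simp: abs_mult mult_ac)
    then have "(\<integral>x. norm x * \<bar>cpartial i (moll e) (x::real^'n)\<bar> \<partial>lborel)
       = (r ^ CARD('n) * (\<integral>x. norm (r *\<^sub>R x) * \<bar>cpartial i bump (r *\<^sub>R (x::real^'n))\<bar> \<partial>lborel)) / I"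
      by simp
    also have "r ^ CARD('n) * (\<integral>x. norm (r *\<^sub>R x) * \<bar>cpartial i bump (r *\<^sub>R (x::real^'n))\<bar> \<partial>lborel)
       = (\<integral>x. norm x * \<bar>cpartial i bump (x::real^'n)\<bar> \<partial>lborel)"
      using lborel_integral_affine[of r "\<lambda>x. norm x * \<bar>cpartial i bump (x::real^'n)\<bar>" 0] r m by simp
    also have "(\<integral>x. norm x * \<bar>cpartial i bump (x::real^'n)\<bar> \<partial>lborel) / I \<le> C"
      unfolding C_def by (rule member_le_sum) (use I in auto)
    finally show ?thesis .
  qed
  then show ?thesis by (rule that)
qed

abbreviation mo :: "real \<Rightarrow> (real^'n::finite \<Rightarrow> real) \<Rightarrow> real^'n \<Rightarrow> real" where
  "mo e f \<equiv> conv f (moll e)"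

text \<open>Young's inequality for a nonnegative kernel of mass one.\<close>

lemma nrm_mo:
  assumes "e > 0" "compact K" "tfn K th" shows "nrm (mo e th) \<le> nrm th"
proof -
  have "nrm (mo e th) \<le> 1 * nrm th"
  proof (rule Young_L2[OF tfn_integrable[OF _ moll_tfn[OF assms(1)]] moll_nonneg[OF assms(1)] _ assms(2,3)])
    show "mo e th \<in> borel_measurable borel"
      by (intro smooth_measurable conv_smooth[OF tfn_integrable[OF assms(2,3)] _ moll_tfn[OF assms(1)]]) simp
    fix x
    have "\<bar>mo e th x\<bar> \<le> (\<integral>y. \<bar>th y * moll e (x - y)\<bar> \<partial>lborel)"
      unfolding conv_def by (rule integral_abs_bound)
    also have "(\<lambda>y. \<bar>th y * moll e (x - y)\<bar>) = (\<lambda>y. moll e (x - y) * \<bar>th y\<bar>)"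
      by (auto simp: abs_mult mult.commute fun_eq_iff abs_of_nonneg[OF moll_nonneg[OF assms(1)]])
    finally show "\<bar>mo e th x\<bar> \<le> (\<integral>y. moll e (x - y) * \<bar>th y\<bar> \<partial>lborel)" .
  qed (auto simp: moll_integral[OF assms(1)])
  then show ?thesis by simp
qed

text \<open>Friedrichs' lemma: the singularity of the differentiated mollifier is compensated by
  \<open>a y - a x = O(\<bar>x - y\<bar>)\<close>.\<close>

lemma Friedrichs_commutator:
  fixes a :: "real^'n::finite \<Rightarrow> real"
  assumes Ka: "compact Ka" "tfn Ka a"
  obtains C where "C \<ge> 0" "\<And>e i K th. e > 0 \<Longrightarrow> compact K \<Longrightarrow> tfn K th \<Longrightarrow>
      nrm (\<lambda>x. cpartial i (mo e (\<lambda>x. a x * th x)) x - a x * cpartial i (mo e th) x) \<le> C * nrm th"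
proof -
  obtain M where M: "M \<ge> 0" "\<And>x y. \<bar>a x - a y\<bar> \<le> M * norm (x - y)" using tfn_Lipschitz[OF Ka] by blast
  obtain C where C: "\<And>e i. e > 0 \<Longrightarrow> (\<integral>x. norm x * \<bar>cpartial i (moll e) (x::real^'n)\<bar> \<partial>lborel) \<le> C"
    by (rule moll_moment[where ?'n='n]) blast
  have "C \<ge> 0" by (rule order_trans[OF _ C[of 1 undefined]]) auto
  have "nrm (\<lambda>x. cpartial i (mo e (\<lambda>x. a x * th x)) x - a x * cpartial i (mo e th) x) \<le> (M * C) * nrm th"
    if e: "e > 0" and K: "compact K" and th: "tfn K th" for e i K th
  proof -
    note mt = moll_tfn[OF e, where 'n='n]
    have ath: "tfn K (\<lambda>x. a x * th x)" by (rule tfn_mult[OF tfn_smooth[OF Ka(2)] th])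
    have dm: "tfn (cball 0 e) (cpartial i (moll e) :: real^'n \<Rightarrow> real)" by (rule tfn_cpartial[OF _ mt]) simp
    obtain B where B: "\<And>x. \<bar>cpartial i (moll e) (x::real^'n)\<bar> \<le> B" using tfn_bounded[OF _ dm] by auto
    have [measurable]: "cpartial i (moll e) \<in> borel_measurable (borel :: (real^'n) measure)"
       "th \<in> borel_measurable borel" "a \<in> borel_measurable borel"
      using tfn_measurable[OF dm] tfn_measurable[OF th] tfn_measurable[OF Ka(2)] by auto
    \<comment> \<open>The kernel for Young's inequality: the Lipschitz constant of \<open>a\<close>
      times the density of the first moment of the differentiated mollifier. Its mass is at most
      \<open>M * C\<close> for every \<open>e\<close>.\<close>
    define H where "H z = M * (norm z * \<bar>cpartial i (moll e) z\<bar>)" for z :: "real^'n"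
    have hi: "integrable lborel (\<lambda>z. norm z * \<bar>cpartial i (moll e) (z::real^'n)\<bar>)"
    proof (rule Bochner_Integration.integrable_bound[of lborel "\<lambda>z. e * cpartial i (moll e) z"])
      show "integrable lborel (\<lambda>z::real^'n. e * cpartial i (moll e) z)" using tfn_integrable[OF _ dm] by auto
      show "AE z in lborel. norm (norm z * \<bar>cpartial i (moll e) (z::real^'n)\<bar>) \<le> norm (e * cpartial i (moll e) z)"
      proof (rule AE_I2)
        fix z :: "real^'n"
        show "norm (norm z * \<bar>cpartial i (moll e) z\<bar>) \<le> norm (e * cpartial i (moll e) z)"
          using tfn_zero[OF dm, of z] e by (cases "z \<in> cball 0 e") (auto simp: abs_mult intro: mult_right_mono)
      qed
    qed measurable
    show ?thesis
    proof (rule Young_L2[of H, OF _ _ _ K th])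
      show "integrable lborel H" unfolding H_def using hi by simp
      show "H x \<ge> 0" for x unfolding H_def using M by simp
      show "(\<integral>x. H x \<partial>lborel) \<le> M * C" unfolding H_def using C[OF e, of i] M(1) by (simp add: mult_left_mono)
      have "smooth_on UNIV (\<lambda>x. cpartial i (mo e (\<lambda>x. a x * th x)) x - a x * cpartial i (mo e th) x)"
        using conv_smooth[OF tfn_integrable[OF K ath] compact_cball mt] conv_smooth[OF tfn_integrable[OF K th] compact_cball mt] tfn_smooth[OF Ka(2)]
        by (intro smooth_on_diff smooth_on_mult smooth_on_cpartial) auto
      then show "(\<lambda>x. cpartial i (mo e (\<lambda>x. a x * th x)) x - a x * cpartial i (mo e th) x) \<in> borel_measurable borel"
        by (rule smooth_measurable)
      fix x
      have i1: "integrable lborel (\<lambda>y. (a y * th y) * cpartial i (moll e) (x - y))"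
        by (rule integrable_mult_bounded[OF tfn_integrable[OF K ath], of _ B]) (use B in auto)
      have i2: "integrable lborel (\<lambda>y. th y * cpartial i (moll e) (x - y))"
        by (rule integrable_mult_bounded[OF tfn_integrable[OF K th], of _ B]) (use B in auto)
      have "cpartial i (mo e (\<lambda>x. a x * th x)) x - a x * cpartial i (mo e th) x
         = (\<integral>y. (a y * th y) * cpartial i (moll e) (x - y) \<partial>lborel) - (\<integral>y. a x * (th y * cpartial i (moll e) (x - y)) \<partial>lborel)"
        using cpartial_conv_right[OF tfn_integrable[OF K ath] _ mt] cpartial_conv_right[OF tfn_integrable[OF K th] _ mt]
        by (simp add: conv_def)
      also have "\<dots> = (\<integral>y. (a y - a x) * (th y * cpartial i (moll e) (x - y)) \<partial>lborel)"
        using i1 i2 by (subst Bochner_Integration.integral_diff[symmetric]) (auto simp: algebra_simps)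
      finally have "\<bar>cpartial i (mo e (\<lambda>x. a x * th x)) x - a x * cpartial i (mo e th) x\<bar>
         \<le> (\<integral>y. \<bar>(a y - a x) * (th y * cpartial i (moll e) (x - y))\<bar> \<partial>lborel)"
        using integral_abs_bound by simp
      also have "\<dots> \<le> (\<integral>y. H (x - y) * \<bar>th y\<bar> \<partial>lborel)"
      proof (rule integral_mono)
        have "integrable lborel (\<lambda>y. a y * th y * cpartial i (moll e) (x - y) - a x * (th y * cpartial i (moll e) (x - y)))"
          using i1 i2 by (intro Bochner_Integration.integrable_diff) auto
        then show "integrable lborel (\<lambda>y. \<bar>(a y - a x) * (th y * cpartial i (moll e) (x - y))\<bar>)"
          by (intro integrable_abs) (simp add: algebra_simps)
        obtain T where "\<And>x. \<bar>th x\<bar> \<le> T" using tfn_bounded[OF K th] by blast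
        then show "integrable lborel (\<lambda>y. H (x - y) * \<bar>th y\<bar>)"
          by (intro integrable_mult_bounded[OF integrable_reflect[OF \<open>integrable lborel H\<close>], of _ T]) auto
        fix y
        show "\<bar>(a y - a x) * (th y * cpartial i (moll e) (x - y))\<bar> \<le> H (x - y) * \<bar>th y\<bar>"
          using mult_right_mono[OF M(2)[of y x], of "\<bar>th y\<bar> * \<bar>cpartial i (moll e) (x - y)\<bar>"]
          by (simp add: H_def abs_mult mult_ac norm_minus_commute)
      qed
      finally show "\<bar>cpartial i (mo e (\<lambda>x. a x * th x)) x - a x * cpartial i (mo e th) x\<bar> \<le> (\<integral>y. H (x - y) * \<bar>th y\<bar> \<partial>lborel)" .
    qed
  qed
  then show ?thesis using M(1) \<open>C \<ge> 0\<close> by (intro that[of "M * C"]) auto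
qed

text \<open>The mollifier has mass one and only shifts of length at most \<open>e\<close>
  contribute. The linear rate in \<open>e\<close> is what later gives a Cauchy sequence.\<close>

lemma mo_uniform_error:
  fixes p :: "real^'n::finite \<Rightarrow> real"
  assumes e: "e > 0" and K: "compact K" and p: "tfn K p" and M: "\<And>x y. \<bar>p x - p y\<bar> \<le> M * norm (x - y)" "M \<ge> 0"
  shows "\<bar>mo e p x - p x\<bar> \<le> M * e"
proof -
  note mt = moll_tfn[OF e, where 'n='n]
  have [measurable]: "p \<in> borel_measurable borel" "moll e \<in> borel_measurable (borel::(real^'n) measure)"
    using tfn_measurable[OF p] tfn_measurable[OF mt] by auto
  obtain B where B: "\<And>x. \<bar>p x\<bar> \<le> B" using tfn_bounded[OF K p] by blast
  have mi: "integrable lborel (moll e :: real^'n \<Rightarrow> real)" by (rule tfn_integrable[OF _ mt]) simp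
  have i1: "integrable lborel (\<lambda>z. moll e z * p (x - z))"
    by (rule integrable_mult_bounded[OF mi, of _ B]) (use B in auto)
  have "mo e p x - p x = (\<integral>z. moll e z * p (x - z) \<partial>lborel) - (\<integral>z. moll e (z::real^'n) * p x \<partial>lborel)"
    using conv_commute[of p "moll e" x] moll_integral[OF e, where 'n='n] by (simp add: conv_def)
  also have "\<dots> = (\<integral>z. moll e z * (p (x - z) - p x) \<partial>lborel)"
    using i1 mi by (subst Bochner_Integration.integral_diff[symmetric]) (auto simp: algebra_simps)
  finally have "\<bar>mo e p x - p x\<bar> \<le> (\<integral>z. \<bar>moll e z * (p (x - z) - p x)\<bar> \<partial>lborel)"
    using integral_abs_bound by simp
  also have "\<dots> \<le> (\<integral>z. (M * e) * moll e (z::real^'n) \<partial>lborel)"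
  proof (rule integral_mono)
    have "integrable lborel (\<lambda>z. moll e z * p (x - z) - moll e z * p x)"
      using i1 mi by (intro Bochner_Integration.integrable_diff) auto
    then show "integrable lborel (\<lambda>z. \<bar>moll e z * (p (x - z) - p x)\<bar>)"
      by (intro integrable_abs) (simp add: algebra_simps)
    show "integrable lborel (\<lambda>z::real^'n. M * e * moll e z)" using mi by simp
    fix z :: "real^'n"
    show "\<bar>moll e z * (p (x - z) - p x)\<bar> \<le> M * e * moll e z"
    proof (cases "z \<in> cball 0 e")
      case True
      have "\<bar>p (x - z) - p x\<bar> \<le> M * norm z" using M(1)[of "x - z" x] by simp
      also have "\<dots> \<le> M * e" using True M(2) by (intro mult_left_mono) auto
      finally have "moll e z * \<bar>p (x - z) - p x\<bar> \<le> moll e z * (M * e)"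
        by (intro mult_left_mono moll_nonneg e)
      then show ?thesis using moll_nonneg[OF e, of z] by (simp add: abs_mult mult_ac)
    qed (use tfn_zero[OF mt] in auto)
  qed
  also have "\<dots> = M * e" using moll_integral[OF e, where 'n='n] by simp
  finally show ?thesis .
qed

section \<open>Smooth cutoff functions\<close>

lemma closed_nbhd_compact:
  fixes K :: "(real^'n::finite) set"
  assumes "compact K" shows "compact (\<Union>x\<in>K. cball x d)"
proof -
  have "(\<Union>x\<in>K. cball x d) = {x + y |x y. x \<in> K \<and> y \<in> cball 0 d}"
  proof (intro set_eqI iffI)
    fix z assume "z \<in> (\<Union>x\<in>K. cball x d)"
    then obtain x where "x \<in> K" "dist x z \<le> d" by auto
    then show "z \<in> {x + y |x y. x \<in> K \<and> y \<in> cball 0 d}"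
      by (intro CollectI exI[of _ x] exI[of _ "z - x"]) (auto simp: dist_norm norm_minus_commute)
  next
    fix z assume "z \<in> {x + y |x y. x \<in> K \<and> y \<in> cball 0 d}"
    then obtain x y where "z = x + y" "x \<in> K" "norm y \<le> d" by auto
    then show "z \<in> (\<Union>x\<in>K. cball x d)" by (intro UN_I[of x]) (auto simp: dist_norm)
  qed
  then show ?thesis using compact_sums[OF assms compact_cball[of 0 d]] by simp
qed

lemma tfn_mo:
  assumes "e > 0" "compact K" "tfn K p" "(\<Union>x\<in>K. cball x e) \<subseteq> K'"
  shows "tfn K' (mo e p)"
proof (rule tfn_conv[OF tfn_integrable[OF assms(2,3)] _ moll_tfn[OF assms(1)]])
  show "p y = 0" if "y \<notin> K" for y by (rule tfn_zero[OF assms(3) that])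
  show "x \<in> K'" if "a \<in> K" "dist a x \<le> e" for x a using assms(4) that unfolding subset_iff UN_iff mem_cball by blast
qed

text \<open>The indicator of the neighbourhood of width \<open>2 * d\<close> is mollified at scale
  \<open>d\<close>: the result is 1 at distance less than \<open>d\<close> from \<open>K\<close> and
  0 beyond \<open>3 * d\<close>. That it is 1 on an open set \<open>U\<close> containing
  \<open>K\<close>, not merely on \<open>K\<close>, lets all derivatives on \<open>K\<close> ignore
  the cutoff.\<close>

lemma cutoff_exists:
  fixes K V :: "(real^'n::finite) set"
  assumes K: "compact K" "K \<subseteq> V" "open V"
  obtains \<eta> K' U where "compact K'" "K' \<subseteq> V" "tfn K' \<eta>" "open U" "K \<subseteq> U" "U \<subseteq> K'" "\<And>x. x \<in> U \<Longrightarrow> \<eta> x = 1"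
    "\<And>x. 0 \<le> \<eta> x" "\<And>x. \<eta> x \<le> 1"
proof -
  obtain d0 where d0: "d0 > 0" "(\<Union>x\<in>K. cball x d0) \<subseteq> V"
    using compact_subset_open_imp_cball_epsilon_subset[OF K(1,3,2)] by blast
  \<comment> \<open>One third of the available room for each of: the region where the cutoff is 1,
    the mollification, and the decay to 0.\<close>
  define d where "d = d0 / 3"
  have d: "d > 0" using d0 by (simp add: d_def)
  note mt = moll_tfn[OF d, where 'n='n]
  define A where "A = (\<Union>x\<in>K. cball x (2 * d))"
  define \<eta> where "\<eta> = conv (indicator A) (moll d)"
  have A: "compact A" unfolding A_def by (rule closed_nbhd_compact[OF K(1)])
  then have iA: "integrable lborel (indicator A :: _ \<Rightarrow> real)"
    using emeasure_compact_finite[OF A] compact_imp_closed[OF A] by (intro integrable_real_indicator) auto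
  define K' where "K' = (\<Union>x\<in>K. cball x d0)"
  have t: "tfn K' \<eta>" unfolding \<eta>_def
  proof (rule tfn_conv[OF iA _ mt])
    fix x a assume "a \<in> A" "dist a x \<le> d"
    then obtain y where "y \<in> K" "dist y a \<le> 2 * d" by (auto simp: A_def)
    then have "dist y x \<le> d0" using dist_triangle[of y x a] \<open>dist a x \<le> d\<close> by (simp add: d_def)
    then show "x \<in> K'" using \<open>y \<in> K\<close> by (auto simp: K'_def)
  qed auto
  define U where "U = (\<Union>x\<in>K. ball x d)"
  have one: "\<eta> x = 1" if "x \<in> U" for x
  proof -
    obtain y where y: "y \<in> K" "dist y x < d" using \<open>x \<in> U\<close> unfolding U_def by (elim UN_E) auto
    have "indicator A z * moll d (x - z) = moll d (x - z)" for z
    proof (cases "x - z \<in> cball 0 d")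
      case True
      then have "dist y z \<le> 2 * d" using y dist_triangle[of y z x] by (simp add: dist_norm norm_minus_commute[of z x])
      then have "z \<in> A" using y by (auto simp: A_def)
      then show ?thesis by simp
    qed (use tfn_zero[OF mt] in auto)
    then have "(\<lambda>z. indicator A z * moll d (x - z)) = (\<lambda>z. moll d (x - z))" by (rule ext)
    then show ?thesis unfolding \<eta>_def conv_def
      using lborel_integral_reflect[OF tfn_measurable[OF mt], of x] moll_integral[OF d, where 'n='n] by simp
  qed
  have mi: "integrable lborel (\<lambda>z. moll d (x - z))" for x :: "real^'n"
    by (rule integrable_reflect[OF tfn_integrable[OF _ mt]]) simp
  have ub: "\<eta> x \<le> 1" for x
  proof -
    have "\<eta> x \<le> (\<integral>z. moll d (x - z) \<partial>lborel)" unfolding \<eta>_def conv_def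
    proof (rule integral_mono[OF _ mi])
      show "integrable lborel (\<lambda>y. indicator A y * moll d (x - y))"
        using integrable_mult_bounded[OF mi, of "indicator A" 1 x] iA by (simp add: mult.commute indicator_def)
    qed (auto simp: indicator_def moll_nonneg[OF d])
    then show ?thesis
      using lborel_integral_reflect[OF tfn_measurable[OF mt], of x] moll_integral[OF d, where 'n='n] by simp
  qed
  have lb: "\<eta> x \<ge> 0" for x unfolding \<eta>_def conv_def
    by (rule Bochner_Integration.integral_nonneg) (auto simp: moll_nonneg[OF d])
  have "U \<subseteq> K'" unfolding U_def K'_def d_def using d0(1) by (intro UN_mono) (auto simp: dist_norm)
  moreover have "K \<subseteq> U" unfolding U_def using d by auto
  moreover have "compact K'" unfolding K'_def by (rule closed_nbhd_compact[OF K(1)])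
  moreover have "open U" unfolding U_def by auto
  ultimately show ?thesis using d0(2) t one lb ub by (intro that[of K' \<eta> U]) (auto simp: K'_def)
qed

section \<open>Uniformly bounded families of functionals\<close>

text \<open>The constant is chosen before \<open>e\<close>, and at each \<open>e\<close> the bound
  holds for all test functions at once; so the test function may itself depend on \<open>e\<close>.
  The measuring functional \<open>N\<close> is a parameter because \<open>L\<^sup>2\<close> norms
  and two versions of the \<open>H\<^sup>s\<close> norm occur.\<close>

definition ubd :: "(real^'n::finite) set \<Rightarrow> ((real^'n \<Rightarrow> real) \<Rightarrow> real) \<Rightarrow> (real \<Rightarrow> (real^'n \<Rightarrow> real) \<Rightarrow> real) \<Rightarrow> bool" where
  "ubd K N S \<longleftrightarrow> (\<exists>C\<ge>0. \<forall>\<^sub>F e in at_right 0. \<forall>\<theta>. tfn K \<theta> \<longrightarrow> \<bar>S e \<theta>\<bar> \<le> C * N \<theta>)"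

lemma ubd_zero: "ubd K N (\<lambda>e \<theta>. 0)"
  unfolding ubd_def by (rule exI[of _ 0]) auto

lemma ubd_add:
  assumes "ubd K N S" "ubd K N S'" shows "ubd K N (\<lambda>e \<theta>. S e \<theta> + S' e \<theta>)"
proof -
  obtain C C' where C: "C \<ge> 0" "\<forall>\<^sub>F e in at_right 0. \<forall>\<theta>. tfn K \<theta> \<longrightarrow> \<bar>S e \<theta>\<bar> \<le> C * N \<theta>"
    and C': "C' \<ge> 0" "\<forall>\<^sub>F e in at_right 0. \<forall>\<theta>. tfn K \<theta> \<longrightarrow> \<bar>S' e \<theta>\<bar> \<le> C' * N \<theta>"
    using assms unfolding ubd_def by blast
  have "\<forall>\<^sub>F e in at_right 0. \<forall>\<theta>. tfn K \<theta> \<longrightarrow> \<bar>S e \<theta> + S' e \<theta>\<bar> \<le> (C + C') * N \<theta>"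
    using C(2) C'(2)
  proof eventually_elim
    case (elim e)
    show ?case
    proof (intro allI impI)
      fix \<theta> assume t: "tfn K \<theta>"
      have "\<bar>S e \<theta> + S' e \<theta>\<bar> \<le> \<bar>S e \<theta>\<bar> + \<bar>S' e \<theta>\<bar>" by simp
      also have "\<dots> \<le> C * N \<theta> + C' * N \<theta>" using elim t by (intro add_mono) auto
      finally show "\<bar>S e \<theta> + S' e \<theta>\<bar> \<le> (C + C') * N \<theta>" by (simp add: distrib_right)
    qed
  qed
  then show ?thesis unfolding ubd_def using C(1) C'(1) by (intro exI[of _ "C + C'"]) auto
qed

lemma ubd_cmult:
  assumes "ubd K N S" shows "ubd K N (\<lambda>e \<theta>. c * S e \<theta>)"
proof -
  obtain C where C: "C \<ge> 0" "\<forall>\<^sub>F e in at_right 0. \<forall>\<theta>. tfn K \<theta> \<longrightarrow> \<bar>S e \<theta>\<bar> \<le> C * N \<theta>"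
    using assms unfolding ubd_def by blast
  have "\<forall>\<^sub>F e in at_right 0. \<forall>\<theta>. tfn K \<theta> \<longrightarrow> \<bar>c * S e \<theta>\<bar> \<le> (\<bar>c\<bar> * C) * N \<theta>"
    using C(2) by eventually_elim (auto simp: abs_mult mult.assoc intro: mult_left_mono)
  then show ?thesis unfolding ubd_def using C(1) by (intro exI[of _ "\<bar>c\<bar> * C"]) auto
qed

lemma ubd_minus: "ubd K N S \<Longrightarrow> ubd K N (\<lambda>e \<theta>. - S e \<theta>)"
  using ubd_cmult[of K N S "-1"] by simp

lemma ubd_diff: "ubd K N S \<Longrightarrow> ubd K N S' \<Longrightarrow> ubd K N (\<lambda>e \<theta>. S e \<theta> - S' e \<theta>)"
  using ubd_add[OF _ ubd_minus, of K N S S'] by simp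

lemma ubd_sum:
  "(\<And>j. j \<in> J \<Longrightarrow> ubd K N (S j)) \<Longrightarrow> ubd K N (\<lambda>e \<theta>. \<Sum>j\<in>J. S j e \<theta>)"
proof (induction J rule: infinite_finite_induct)
  case (insert j J)
  then show ?case using ubd_add[of K N "S j" "\<lambda>e \<theta>. \<Sum>j\<in>J. S j e \<theta>"] by simp
qed (auto intro: ubd_zero)

lemma ubd_sum_list:
  "(\<And>j. j \<in> set J \<Longrightarrow> ubd K N (S j)) \<Longrightarrow> ubd K N (\<lambda>e \<theta>. \<Sum>j\<leftarrow>J. S j e \<theta>)"
proof (induction J)
  case (Cons j J)
  then show ?case using ubd_add[of K N "S j" "\<lambda>e \<theta>. \<Sum>j\<leftarrow>J. S j e \<theta>"] by simp
qed (auto intro: ubd_zero)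

lemma ubd_cong:
  assumes "ubd K N S" "\<And>e \<theta>. e > 0 \<Longrightarrow> tfn K \<theta> \<Longrightarrow> S' e \<theta> = S e \<theta>"
  shows "ubd K N S'"
proof -
  obtain C where C: "C \<ge> 0" "\<forall>\<^sub>F e in at_right 0. \<forall>\<theta>. tfn K \<theta> \<longrightarrow> \<bar>S e \<theta>\<bar> \<le> C * N \<theta>"
    using assms(1) unfolding ubd_def by blast
  have "\<forall>\<^sub>F e in at_right 0. \<forall>\<theta>. tfn K \<theta> \<longrightarrow> \<bar>S' e \<theta>\<bar> \<le> C * N \<theta>"
    using C(2) eventually_at_right_less[of 0] by eventually_elim (use assms(2) in auto)
  then show ?thesis unfolding ubd_def using C(1) by blast
qed

text \<open>Precomposition with operators \<open>R e\<close> that are bounded uniformly in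
  \<open>e\<close>. The set may grow from \<open>K\<close> to \<open>K'\<close>, as it does when
  \<open>R e\<close> is mollification.\<close>

lemma ubd_comp:
  assumes "ubd K' N' S" "D \<ge> 0"
    and "\<forall>\<^sub>F e in at_right 0. \<forall>\<theta>. tfn K \<theta> \<longrightarrow> tfn K' (R e \<theta>) \<and> N' (R e \<theta>) \<le> D * N \<theta>"
  shows "ubd K N (\<lambda>e \<theta>. S e (R e \<theta>))"
proof -
  obtain C where C: "C \<ge> 0" "\<forall>\<^sub>F e in at_right 0. \<forall>\<theta>. tfn K' \<theta> \<longrightarrow> \<bar>S e \<theta>\<bar> \<le> C * N' \<theta>"
    using assms(1) unfolding ubd_def by blast
  have "\<forall>\<^sub>F e in at_right 0. \<forall>\<theta>. tfn K \<theta> \<longrightarrow> \<bar>S e (R e \<theta>)\<bar> \<le> (C * D) * N \<theta>"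
    using C(2) assms(3)
  proof eventually_elim
    case (elim e)
    show ?case
    proof (intro allI impI)
      fix \<theta> assume t: "tfn K \<theta>"
      have "\<bar>S e (R e \<theta>)\<bar> \<le> C * N' (R e \<theta>)" using elim t by auto
      also have "\<dots> \<le> C * (D * N \<theta>)" using elim t C(1) by (intro mult_left_mono) auto
      finally show "\<bar>S e (R e \<theta>)\<bar> \<le> (C * D) * N \<theta>" by (simp add: mult.assoc)
    qed
  qed
  then show ?thesis unfolding ubd_def using C(1) assms(2) by (intro exI[of _ "C * D"]) auto
qed

text \<open>The analogue of local Sobolev regularity of order \<open>k\<close> for a family of functionals.\<close>

definition bnd :: "(real^'n::finite) set \<Rightarrow> nat \<Rightarrow> (real \<Rightarrow> (real^'n \<Rightarrow> real) \<Rightarrow> real) \<Rightarrow> bool" where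
  "bnd V k S \<longleftrightarrow> (\<forall>l K. length l \<le> k \<and> compact K \<and> K \<subseteq> V \<longrightarrow> ubd K nrm (\<lambda>e \<theta>. S e (dlist l \<theta>)))"

lemma bndD: "bnd V k S \<Longrightarrow> length l \<le> k \<Longrightarrow> compact K \<Longrightarrow> K \<subseteq> V \<Longrightarrow> ubd K nrm (\<lambda>e \<theta>. S e (dlist l \<theta>))"
  by (simp add: bnd_def)

lemma bnd_mono: "bnd V k S \<Longrightarrow> j \<le> k \<Longrightarrow> bnd V j S"
  by (simp add: bnd_def)

section \<open>Smooth coefficients and the Leibniz rule\<close>

definition lin :: "(real^'n::finite) set \<Rightarrow> ((real^'n \<Rightarrow> real) \<Rightarrow> real) \<Rightarrow> bool" where
  "lin V T \<longleftrightarrow> (\<forall>K \<phi> \<psi>. compact K \<and> K \<subseteq> V \<and> tfn K \<phi> \<and> tfn K \<psi> \<longrightarrow>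
     T (\<lambda>x. \<phi> x + \<psi> x) = T \<phi> + T \<psi> \<and> T (\<lambda>x. \<phi> x - \<psi> x) = T \<phi> - T \<psi>)"

lemma lin_diff: "lin V T \<Longrightarrow> compact K \<Longrightarrow> K \<subseteq> V \<Longrightarrow> tfn K \<phi> \<Longrightarrow> tfn K \<psi> \<Longrightarrow> T (\<lambda>x. \<phi> x - \<psi> x) = T \<phi> - T \<psi>"
  unfolding lin_def by blast

lemma lin_add: "lin V T \<Longrightarrow> compact K \<Longrightarrow> K \<subseteq> V \<Longrightarrow> tfn K \<phi> \<Longrightarrow> tfn K \<psi> \<Longrightarrow> T (\<lambda>x. \<phi> x + \<psi> x) = T \<phi> + T \<psi>"
  unfolding lin_def by blast

text \<open>Coefficients are smooth on \<open>V\<close> only and carry no bounds. Near a compact set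
  they are exchanged for compactly supported functions, which are bounded together with all
  derivatives and can be differentiated everywhere.\<close>

lemma smooth_extension:
  assumes "open V" "smooth_on V a" "compact K" "K \<subseteq> V"
  obtains b K' U where "compact K'" "K' \<subseteq> V" "tfn K' b" "open U" "K \<subseteq> U" "\<And>x. x \<in> U \<Longrightarrow> b x = a x"
proof -
  obtain \<eta> K' U where c: "compact K'" "K' \<subseteq> V" "tfn K' \<eta>" "open U" "K \<subseteq> U" "\<And>x. x \<in> U \<Longrightarrow> \<eta> x = 1"
    using cutoff_exists[OF assms(3,4,1)] by metis
  show ?thesis
    by (rule that[of K' "\<lambda>x. a x * \<eta> x" U]) (use c assms tfn_mult_on in auto)
qed

lemma mult_tfn_extension:
  assumes "tfn K \<theta>" "\<And>x. x \<in> K \<Longrightarrow> b x = a x"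
  shows "(\<lambda>x. a x * \<theta> x) = (\<lambda>x. b x * \<theta> x)"
  using assms tfn_zero[OF assms(1)] by (metis mult_zero_right)

lemma dlist_eq_fun:
  assumes "\<And>x. f x = g x" shows "dlist l f = dlist l g"
  using assms by presburger

text \<open>The identity \<open>a * D i g = D i (a * g) - D i a * g\<close> frees the test function
  of one derivative at a time; \<open>m\<close> collects those already pulled out in front. When
  \<open>l\<close> is used up, at most \<open>k\<close> derivatives stand in front of a function
  whose \<open>L\<^sup>2\<close> norm is controlled.\<close>

lemma bnd_mult_aux:
  assumes S: "\<And>e. lin V (S e)" "bnd V k S" and K: "compact K" "K \<subseteq> V"
    and a: "compact Ka" "tfn Ka a" and l: "length l + length m \<le> k"
  shows "ubd K nrm (\<lambda>e \<theta>. S e (dlist m (\<lambda>x. a x * dlist l \<theta> x)))"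
  using a(2) l
proof (induction l arbitrary: a m)
  case Nil
  obtain B where B: "B \<ge> 0" "\<And>x. \<bar>a x\<bar> \<le> B" using tfn_bounded[OF a(1) Nil(1)] by blast
  have "ubd K nrm (\<lambda>e \<theta>. S e (dlist m \<theta>))" using bndD[OF S(2) _ K] Nil by simp
  then have "ubd K nrm (\<lambda>e \<theta>. S e (dlist m ((\<lambda>e \<theta> x. a x * \<theta> x) e \<theta>)))"
    by (rule ubd_comp[where R = "\<lambda>e \<theta> x. a x * \<theta> x", OF _ B(1)])
      (intro always_eventually allI impI conjI tfn_mult nrm_mult_bound[OF K(1) _ _ B(2)] tfn_smooth[OF Nil(1)])
  then show ?case by simp
next
  case (Cons i l)
  note sa = tfn_smooth[OF Cons.prems(1)]
  have da: "tfn Ka (cpartial i a)" by (rule tfn_cpartial[OF compact_imp_closed[OF a(1)] Cons.prems(1)])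
  have cK: "closed K" by (rule compact_imp_closed[OF K(1)])
  have 1: "ubd K nrm (\<lambda>e \<theta>. S e (dlist (m @ [i]) (\<lambda>x. a x * dlist l \<theta> x)))"
    using Cons.IH[OF Cons.prems(1), of "m @ [i]"] Cons.prems by simp
  have 2: "ubd K nrm (\<lambda>e \<theta>. S e (dlist m (\<lambda>x. cpartial i a x * dlist l \<theta> x)))"
    using Cons.IH[OF da, of m] Cons.prems by simp
  show ?case
  proof (rule ubd_cong[OF ubd_diff[OF 1 2]])
    fix e and \<theta> :: "real^'a \<Rightarrow> real" assume t: "tfn K \<theta>"
    have tl: "tfn K (dlist l \<theta>)" by (rule tfn_dlist[OF cK t])
    have t1: "tfn K (\<lambda>x. a x * dlist l \<theta> x)" by (rule tfn_mult[OF sa tl])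
    have t2: "tfn K (\<lambda>x. cpartial i a x * dlist l \<theta> x)" by (rule tfn_mult[OF smooth_on_cpartial[OF sa] tl])
    have "dlist m (\<lambda>x. a x * dlist (i # l) \<theta> x) = dlist m (\<lambda>x. cpartial i (\<lambda>x. a x * dlist l \<theta> x) x - cpartial i a x * dlist l \<theta> x)"
      using cpartial_mult[OF sa tfn_smooth[OF tl]] by (intro dlist_eq_fun) simp
    also have "\<dots> = (\<lambda>x. dlist m (cpartial i (\<lambda>x. a x * dlist l \<theta> x)) x - dlist m (\<lambda>x. cpartial i a x * dlist l \<theta> x) x)"
      by (rule ext, rule dlist_diff[of UNIV, OF _ tfn_smooth[OF tfn_cpartial[OF cK t1]] tfn_smooth[OF t2]]) auto
    finally have "dlist m (\<lambda>x. a x * dlist (i # l) \<theta> x) =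
      (\<lambda>x. dlist (m @ [i]) (\<lambda>x. a x * dlist l \<theta> x) x - dlist m (\<lambda>x. cpartial i a x * dlist l \<theta> x) x)"
      by (simp add: dlist_append)
    then show "S e (dlist m (\<lambda>x. a x * dlist (i # l) \<theta> x)) =
       S e (dlist (m @ [i]) (\<lambda>x. a x * dlist l \<theta> x)) - S e (dlist m (\<lambda>x. cpartial i a x * dlist l \<theta> x))"
      using lin_diff[OF S(1) K tfn_dlist[OF cK t1] tfn_dlist[OF cK t2]] by simp
  qed
qed

lemma bnd_mult:
  assumes "open V" "smooth_on V a" "\<And>e. lin V (S e)" "bnd V k S"
  shows "bnd V k (\<lambda>e \<theta>. S e (\<lambda>x. a x * \<theta> x))"
  unfolding bnd_def
proof (intro allI impI, elim conjE)
  fix l :: "'a list" and K assume l: "length l \<le> k" and K: "compact K" "K \<subseteq> V"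
  obtain b Kb U where b: "compact Kb" "tfn Kb b" "K \<subseteq> U" "\<And>x. x \<in> U \<Longrightarrow> b x = a x"
    using smooth_extension[OF assms(1,2) K] by metis
  have "ubd K nrm (\<lambda>e \<theta>. S e (dlist [] (\<lambda>x. b x * dlist l \<theta> x)))"
    by (rule bnd_mult_aux[OF assms(3,4) K b(1,2)]) (use l in auto)
  then show "ubd K nrm (\<lambda>e \<theta>. S e (\<lambda>x. a x * dlist l \<theta> x))"
  proof (rule ubd_cong)
    fix e and \<theta> :: "real^'a \<Rightarrow> real" assume t: "tfn K \<theta>"
    have "(\<lambda>x. a x * dlist l \<theta> x) = (\<lambda>x. b x * dlist l \<theta> x)"
      by (rule mult_tfn_extension[OF tfn_dlist[OF compact_imp_closed[OF K(1)] t]]) (use b in auto)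
    then show "S e (\<lambda>x. a x * dlist l \<theta> x) = S e (dlist [] (\<lambda>x. b x * dlist l \<theta> x))" by simp
  qed
qed

text \<open>Here the derivatives already stand outside the product, so a bound for the extended
  coefficient is enough.\<close>

lemma bnd_mult_dlist:
  assumes "open V" "smooth_on V b" "bnd V k S" "length r \<le> k" "compact K" "K \<subseteq> V"
  shows "ubd K nrm (\<lambda>e \<theta>. S e (dlist r (\<lambda>x. b x * \<theta> x)))"
proof -
  obtain c Kc U where c: "compact Kc" "tfn Kc c" "K \<subseteq> U" "\<And>x. x \<in> U \<Longrightarrow> c x = b x"
    using smooth_extension[OF assms(1,2,5,6)] by metis
  obtain B where B: "B \<ge> 0" "\<And>x. \<bar>c x\<bar> \<le> B" using tfn_bounded[OF c(1,2)] by blast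
  have "ubd K nrm (\<lambda>e \<theta>. S e (dlist r ((\<lambda>e \<theta> x. c x * \<theta> x) e \<theta>)))"
    by (rule ubd_comp[where R = "\<lambda>e \<theta> x. c x * \<theta> x", OF bndD[OF assms(3,4,5,6)] B(1)])
      (intro always_eventually allI impI conjI tfn_mult nrm_mult_bound[OF assms(5) _ _ B(2)] tfn_smooth[OF c(2)])
  then show ?thesis
  proof (rule ubd_cong)
    fix e and \<theta> :: "real^'a \<Rightarrow> real" assume t: "tfn K \<theta>"
    have "(\<lambda>x. b x * \<theta> x) = (\<lambda>x. c x * \<theta> x)"
      by (rule mult_tfn_extension[OF t]) (use c in auto)
    then show "S e (dlist r (\<lambda>x. b x * \<theta> x)) = S e (dlist r (\<lambda>x. c x * \<theta> x))" by simp
  qed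
qed

lemma nrm_triangle:
  assumes "compact K" "tfn K f" "tfn K g"
  shows "nrm (\<lambda>x. f x + g x) \<le> nrm f + nrm g"
proof (rule power2_le_imp_le)
  have f2: "integrable lborel (\<lambda>x. (f x)\<^sup>2)" and g2: "integrable lborel (\<lambda>x. (g x)\<^sup>2)"
    using tfn_sq_integrable[OF assms(1)] assms by auto
  have fg: "integrable lborel (\<lambda>x. f x * g x)"
    by (rule integrable_smooth_mult_tfn[OF tfn_smooth[OF assms(2)] assms(1,3)])
  have "(nrm (\<lambda>x. f x + g x))\<^sup>2 = (\<integral>x. (f x)\<^sup>2 + (2 * (f x * g x) + (g x)\<^sup>2) \<partial>lborel)"
    unfolding nrm_sq by (simp add: power2_eq_square algebra_simps)
  also have "\<dots> = (nrm f)\<^sup>2 + (2 * (\<integral>x. f x * g x \<partial>lborel) + (nrm g)\<^sup>2)"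
    unfolding nrm_sq using f2 g2 fg by simp
  also have "\<dots> \<le> (nrm f)\<^sup>2 + (2 * (nrm f * nrm g) + (nrm g)\<^sup>2)"
    using Cauchy_Schwarz_tfn[OF _ f2 assms(1,3)] tfn_measurable[OF assms(2)] by (auto simp: abs_le_iff)
  also have "\<dots> = (nrm f + nrm g)\<^sup>2" by (simp add: power2_eq_square algebra_simps)
  finally show "(nrm (\<lambda>x. f x + g x))\<^sup>2 \<le> (nrm f + nrm g)\<^sup>2" .
qed (simp add: nrm_nonneg)

text \<open>The list \<open>ps\<close> is found before \<open>f\<close>: it depends only on the
  cutoff and on \<open>l\<close>. Hence the same list serves the mollified solution for all
  \<open>e\<close>, and the test function too.\<close>

lemma Leibniz_lower_order:
  assumes "compact K" "tfn K \<eta>"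
  obtains ps where "\<forall>(c, q)\<in>set ps. tfn K c \<and> length q < length l"
    "\<And>f x. smooth_on UNIV f \<Longrightarrow> dlist l (\<lambda>x. \<eta> x * f x) x = \<eta> x * dlist l f x + (\<Sum>(c, q)\<leftarrow>ps. c x * dlist q f x)"
proof -
  have "\<exists>ps. (\<forall>(c, q)\<in>set ps. tfn K c \<and> length q < length l) \<and>
    (\<forall>f x. smooth_on UNIV f \<longrightarrow> dlist l (\<lambda>x. \<eta> x * f x) x = \<eta> x * dlist l f x + (\<Sum>(c, q)\<leftarrow>ps. c x * dlist q f x))"
    using assms(2)
  proof (induction l arbitrary: \<eta> rule: rev_induct)
    case Nil
    then show ?case by (intro exI[of _ "[]"]) simp
  next
    case (snoc i l)
    have de: "tfn K (cpartial i \<eta>)" by (rule tfn_cpartial[OF compact_imp_closed[OF assms(1)] snoc.prems])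
    note se = tfn_smooth[OF snoc.prems]
    obtain ps where ps: "\<forall>(c, q)\<in>set ps. tfn K c \<and> length q < length l"
      "\<And>f x. smooth_on UNIV f \<Longrightarrow> dlist l (\<lambda>x. \<eta> x * f x) x = \<eta> x * dlist l f x + (\<Sum>(c, q)\<leftarrow>ps. c x * dlist q f x)"
      using snoc.IH[OF snoc.prems] by auto
    obtain qs where qs: "\<forall>(c, q)\<in>set qs. tfn K c \<and> length q < length l"
      "\<And>f x. smooth_on UNIV f \<Longrightarrow> dlist l (\<lambda>x. cpartial i \<eta> x * f x) x = cpartial i \<eta> x * dlist l f x + (\<Sum>(c, q)\<leftarrow>qs. c x * dlist q f x)"
      using snoc.IH[OF de] by auto
    define rs where "rs = (cpartial i \<eta>, l) # qs @ map (\<lambda>(c, q). (c, q @ [i])) ps"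
    have 1: "\<forall>(c, q)\<in>set rs. tfn K c \<and> length q < length (l @ [i])"
      unfolding rs_def using ps(1) qs(1) de by fastforce
    have 2: "dlist (l @ [i]) (\<lambda>x. \<eta> x * f x) x = \<eta> x * dlist (l @ [i]) f x + (\<Sum>(c, q)\<leftarrow>rs. c x * dlist q f x)"
      if f: "smooth_on UNIV f" for f x
    proof -
      have "dlist (l @ [i]) (\<lambda>x. \<eta> x * f x) x = dlist l (\<lambda>x. cpartial i \<eta> x * f x + \<eta> x * cpartial i f x) x"
        unfolding dlist_append using cpartial_mult[OF se f] by (intro fun_cong[OF dlist_eq_fun]) simp
      also have "dlist l (\<lambda>x. cpartial i \<eta> x * f x + \<eta> x * cpartial i f x) x
          = dlist l (\<lambda>x. cpartial i \<eta> x * f x) x + dlist l (\<lambda>x. \<eta> x * cpartial i f x) x"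
        by (rule dlist_add[of UNIV]) (use f se in \<open>auto intro!: smooth_on_mult smooth_on_cpartial\<close>)
      also have "\<dots> = cpartial i \<eta> x * dlist l f x + (\<Sum>(c, q)\<leftarrow>qs. c x * dlist q f x)
         + (\<eta> x * dlist l (cpartial i f) x + (\<Sum>(c, q)\<leftarrow>ps. c x * dlist q (cpartial i f) x))"
        using qs(2)[OF f] ps(2)[OF smooth_on_cpartial[OF f]] by simp
      also have "\<dots> = \<eta> x * dlist (l @ [i]) f x + (\<Sum>(c, q)\<leftarrow>rs. c x * dlist q f x)"
        unfolding rs_def by (simp add: dlist_append o_def case_prod_unfold)
      finally show ?thesis .
    qed
    show ?case using 1 2 by (intro exI[of _ rs]) blast
  qed
  then show ?thesis using that by blast
qed

text \<open>Multiplication by a fixed test function is bounded on Sobolev spaces; the constant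
  depends neither on the support set of \<open>f\<close> nor on \<open>f\<close>.\<close>

lemma Leibniz_norm:
  assumes "compact Ka" "tfn Ka a"
  obtains C where "C \<ge> 0" "\<And>K f. compact K \<Longrightarrow> tfn K f \<Longrightarrow>
    nrm (dlist l (\<lambda>x. a x * f x)) \<le> C * (\<Sum>q | length q \<le> length l. nrm (dlist q f))"
proof -
  have fin: "finite {q :: 'a list. length q \<le> n}" for n
    using finite_lists_length_le[of "UNIV :: 'a set" n] by simp
  have "\<exists>C\<ge>0. \<forall>K f. compact K \<longrightarrow> tfn K f \<longrightarrow>
    nrm (dlist l (\<lambda>x. a x * f x)) \<le> C * (\<Sum>q | length q \<le> length l. nrm (dlist q f))"
    using assms(2)
  proof (induction l arbitrary: a rule: rev_induct)
    case Nil
    obtain B where B: "B \<ge> 0" "\<And>x. \<bar>a x\<bar> \<le> B" using tfn_bounded[OF assms(1) Nil] by blast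
    have "nrm (\<lambda>x. a x * f x) \<le> B * nrm f" if "compact K" "tfn K f" for K f
      by (rule nrm_mult_bound[OF that tfn_smooth[OF Nil] B(2)])
    moreover have "{q::'a list. length q \<le> 0} = {[]}" by auto
    ultimately show ?case using B(1) by (intro exI[of _ B]) auto
  next
    case (snoc i l)
    have da: "tfn Ka (cpartial i a)" by (rule tfn_cpartial[OF compact_imp_closed[OF assms(1)] snoc.prems])
    note sa = tfn_smooth[OF snoc.prems]
    obtain C1 where C1: "C1 \<ge> 0" "\<And>K f. compact K \<Longrightarrow> tfn K f \<Longrightarrow> nrm (dlist l (\<lambda>x. cpartial i a x * f x)) \<le> C1 * (\<Sum>q | length q \<le> length l. nrm (dlist q f))"
      using snoc.IH[OF da] by blast
    obtain C2 where C2: "C2 \<ge> 0" "\<And>K f. compact K \<Longrightarrow> tfn K f \<Longrightarrow> nrm (dlist l (\<lambda>x. a x * f x)) \<le> C2 * (\<Sum>q | length q \<le> length l. nrm (dlist q f))"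
      using snoc.IH[OF snoc.prems] by blast
    have "nrm (dlist (l @ [i]) (\<lambda>x. a x * f x)) \<le> (C1 + C2) * (\<Sum>q | length q \<le> length (l @ [i]). nrm (dlist q f))"
      if K: "compact K" and f: "tfn K f" for K f
    proof -
      have cK: "closed K" by (rule compact_imp_closed[OF K])
      note sf = tfn_smooth[OF f]
      have df: "tfn K (cpartial i f)" by (rule tfn_cpartial[OF cK f])
      have "dlist (l @ [i]) (\<lambda>x. a x * f x) = dlist l (\<lambda>x. cpartial i a x * f x + a x * cpartial i f x)"
        unfolding dlist_append using cpartial_mult[OF sa sf] by (intro dlist_eq_fun) simp
      also have "\<dots> = (\<lambda>x. dlist l (\<lambda>x. cpartial i a x * f x) x + dlist l (\<lambda>x. a x * cpartial i f x) x)"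
        by (rule ext, rule dlist_add[of UNIV]) (use sf sa in \<open>auto intro!: smooth_on_mult smooth_on_cpartial\<close>)
      finally have "nrm (dlist (l @ [i]) (\<lambda>x. a x * f x)) \<le> nrm (dlist l (\<lambda>x. cpartial i a x * f x)) + nrm (dlist l (\<lambda>x. a x * cpartial i f x))"
        using nrm_triangle[OF K tfn_dlist[OF cK tfn_mult[OF smooth_on_cpartial[OF sa] f]] tfn_dlist[OF cK tfn_mult[OF sa df]]] by simp
      also have "\<dots> \<le> C1 * (\<Sum>q | length q \<le> length l. nrm (dlist q f)) + C2 * (\<Sum>q | length q \<le> length l. nrm (dlist q (cpartial i f)))"
        by (intro add_mono C1(2)[OF K f] C2(2)[OF K df])
      also have "\<dots> \<le> C1 * (\<Sum>q | length q \<le> length (l @ [i]). nrm (dlist q f)) + C2 * (\<Sum>q | length q \<le> length (l @ [i]). nrm (dlist q f))"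
      proof (intro add_mono mult_left_mono C1(1) C2(1))
        show "(\<Sum>q | length q \<le> length l. nrm (dlist q f)) \<le> (\<Sum>q | length q \<le> length (l @ [i]). nrm (dlist q f))"
          by (rule sum_mono2[OF fin]) (auto simp: nrm_nonneg)
        have "(\<Sum>q | length q \<le> length l. nrm (dlist q (cpartial i f))) = (\<Sum>q\<in>(\<lambda>q. q @ [i]) ` {q. length q \<le> length l}. nrm (dlist q f))"
          by (subst sum.reindex) (auto simp: inj_on_def dlist_append)
        also have "\<dots> \<le> (\<Sum>q | length q \<le> length (l @ [i]). nrm (dlist q f))"
          by (rule sum_mono2[OF fin]) (auto simp: nrm_nonneg)
        finally show "(\<Sum>q | length q \<le> length l. nrm (dlist q (cpartial i f))) \<le> (\<Sum>q | length q \<le> length (l @ [i]). nrm (dlist q f))" .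
      qed
      finally show ?thesis by (simp add: distrib_right)
    qed
    then show ?case using C1(1) C2(1) by (intro exI[of _ "C1 + C2"]) auto
  qed
  then show ?thesis using that by blast
qed

section \<open>Interior regularity\<close>

lemma ubd_cong_eventually:
  assumes "ubd K N S" "\<forall>\<^sub>F e in at_right 0. \<forall>\<theta>. tfn K \<theta> \<longrightarrow> S e \<theta> = S' e \<theta>"
  shows "ubd K N S'"
proof -
  obtain C where C: "C \<ge> 0" "\<forall>\<^sub>F e in at_right 0. \<forall>\<theta>. tfn K \<theta> \<longrightarrow> \<bar>S e \<theta>\<bar> \<le> C * N \<theta>"
    using assms(1) unfolding ubd_def by blast
  have "\<forall>\<^sub>F e in at_right 0. \<forall>\<theta>. tfn K \<theta> \<longrightarrow> \<bar>S' e \<theta>\<bar> \<le> C * N \<theta>"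
    using C(2) assms(2) by eventually_elim auto
  then show ?thesis unfolding ubd_def using C(1) by blast
qed

text \<open>Room for mollification: one compact \<open>K'\<close> inside \<open>V\<close> contains
  the supports of all mollified test functions from \<open>K\<close>, once \<open>e\<close> is
  small.\<close>

lemma nbhd_eventually:
  fixes K V :: "(real^'n::finite) set"
  assumes K: "compact K" "K \<subseteq> V" "open V"
  obtains K' where "compact K'" "K' \<subseteq> V" "K \<subseteq> K'" "\<forall>\<^sub>F e in at_right 0. e > 0 \<and> (\<Union>x\<in>K. cball x e) \<subseteq> K'"
proof -
  obtain d where d: "d > 0" "(\<Union>x\<in>K. cball x d) \<subseteq> V"
    using compact_subset_open_imp_cball_epsilon_subset[OF K(1,3,2)] by blast
  have "\<forall>\<^sub>F e in at_right 0. e \<in> {0<..<d}" by (rule eventually_at_right_real[OF d(1)])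
  then have ev: "\<forall>\<^sub>F e in at_right 0. e > 0 \<and> (\<Union>x\<in>K. cball x e) \<subseteq> (\<Union>x\<in>K. cball x d)"
    by eventually_elim (auto intro: order_trans)
  have "K \<subseteq> (\<Union>x\<in>K. cball x d)" using d(1) by (auto intro!: bexI)
  then show ?thesis using that[OF closed_nbhd_compact[OF K(1), of d] d(2) _ ev] by blast
qed

text \<open>\<open>M\<close> contains, up to order of the entries, every list of at most
  \<open>s\<close> directions, so the sum over \<open>M\<close> controls the full
  \<open>H\<^sup>s\<close> norm. Coercivity is asked only for test functions inside
  \<open>V\<close>. Global integrability of \<open>w\<close> makes its mollification defined
  everywhere, so no domain has to be tracked for it.\<close>

locale elliptic_form =
  fixes V :: "(real^'n::finite) set" and s :: nat and M :: "'n list set"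
    and a :: "'n list \<Rightarrow> 'n list \<Rightarrow> real^'n \<Rightarrow> real" and lam :: real and w :: "real^'n \<Rightarrow> real"
  assumes openV: "open V" and finM: "finite M" and lenM: "l \<in> M \<Longrightarrow> length l \<le> s"
    and coverM: "length l \<le> s \<Longrightarrow> \<exists>m\<in>M. mset m = mset l"
    and a_smooth: "l \<in> M \<Longrightarrow> k \<in> M \<Longrightarrow> smooth_on V (a l k)"
    and lam_pos: "lam > 0"
    and coercive: "compact K \<Longrightarrow> K \<subseteq> V \<Longrightarrow> tfn K \<phi> \<Longrightarrow>
       lam * (\<Sum>l\<in>M. (nrm (dlist l \<phi>))\<^sup>2) \<le> (\<Sum>l\<in>M. \<Sum>k\<in>M. \<integral>x. dlist l \<phi> x * (a l k x * dlist k \<phi> x) \<partial>lborel)"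
    and w_int: "integrable lborel w"
begin

text \<open>\<open>T m\<close> is the distributional derivative of \<open>w\<close> along the list \<open>m\<close>; \<open>z m e\<close> is the same derivative
  of the mollification of \<open>w\<close>.\<close>

definition T :: "'n list \<Rightarrow> (real^'n \<Rightarrow> real) \<Rightarrow> real" where
  "T m \<phi> = (-1) ^ length m * (\<integral>x. w x * dlist m \<phi> x \<partial>lborel)"

definition NS :: "(real^'n \<Rightarrow> real) \<Rightarrow> real" where
  "NS \<psi> = sqrt (\<Sum>l\<in>M. (nrm (dlist l \<psi>))\<^sup>2)"

definition z :: "'n list \<Rightarrow> real \<Rightarrow> real^'n \<Rightarrow> real" where
  "z m e = dlist m (mo e w)"

text \<open>The smooth function \<open>z m e\<close> viewed as a functional, the form in which it
  can be compared with \<open>T m\<close>.\<close>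

definition S :: "'n list \<Rightarrow> real \<Rightarrow> (real^'n \<Rightarrow> real) \<Rightarrow> real" where
  "S m e \<psi> = (\<integral>x. z m e x * \<psi> x \<partial>lborel)"

lemma NS_nonneg: "NS \<psi> \<ge> 0"
  unfolding NS_def by (simp add: sum_nonneg)

lemma nrm_le_NS:
  assumes "smooth_on UNIV \<psi>" "length l \<le> s" shows "nrm (dlist l \<psi>) \<le> NS \<psi>"
proof -
  obtain m where m: "m \<in> M" "mset m = mset l" using coverM[OF assms(2)] by blast
  have "dlist l \<psi> = dlist m \<psi>" by (intro ext dlist_mset[OF assms(1)]) (simp add: m(2))
  then have "(nrm (dlist l \<psi>))\<^sup>2 \<le> (\<Sum>l\<in>M. (nrm (dlist l \<psi>))\<^sup>2)"
    using member_le_sum[OF m(1), of "\<lambda>l. (nrm (dlist l \<psi>))\<^sup>2"] finM by simp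
  then show ?thesis unfolding NS_def by (rule real_le_rsqrt)
qed

lemma T_lin: "lin V (T m)"
  unfolding lin_def
proof (intro allI impI, elim conjE)
  fix K and \<phi> \<psi> :: "real^'n \<Rightarrow> real" assume K: "compact K" and p: "tfn K \<phi>" and q: "tfn K \<psi>"
  note cK = compact_imp_closed[OF K]
  have i: "integrable lborel (\<lambda>x. w x * dlist m \<phi> x)" "integrable lborel (\<lambda>x. w x * dlist m \<psi> x)"
    using integrable_mult_tfn[OF w_int K] tfn_dlist[OF cK] p q by auto
  have "dlist m (\<lambda>x. \<phi> x + \<psi> x) = (\<lambda>x. dlist m \<phi> x + dlist m \<psi> x)"
    "dlist m (\<lambda>x. \<phi> x - \<psi> x) = (\<lambda>x. dlist m \<phi> x - dlist m \<psi> x)"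
    by (rule ext, rule dlist_add[OF _ tfn_smooth[OF p] tfn_smooth[OF q]], auto)
      (rule ext, rule dlist_diff[OF _ tfn_smooth[OF p] tfn_smooth[OF q]], auto)
  then show "T m (\<lambda>x. \<phi> x + \<psi> x) = T m \<phi> + T m \<psi> \<and> T m (\<lambda>x. \<phi> x - \<psi> x) = T m \<phi> - T m \<psi>"
    using i unfolding T_def by (simp add: distrib_left right_diff_distrib)
qed

lemma z_smooth: "e > 0 \<Longrightarrow> smooth_on UNIV (z m e)"
  unfolding z_def by (intro smooth_on_dlist conv_smooth[OF w_int compact_cball moll_tfn])

lemma dlist_rev: "smooth_on UNIV f \<Longrightarrow> dlist (rev l) f = dlist l f"
  by (intro ext dlist_mset) auto

lemma dlist_mo:
  assumes "e > 0" "compact K" "tfn K \<psi>"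
  shows "dlist l (mo e \<psi>) = mo e (dlist l \<psi>)"
  by (rule dlist_conv_left[OF assms(2,3) compact_cball moll_tfn[OF assms(1)]])

text \<open>All derivatives are moved to the test function, the even mollifier follows them, and it
  commutes with the derivatives there. Bounds for \<open>T m\<close> hence become bounds for the
  mollified functionals.\<close>

lemma S_eq:
  assumes e: "e > 0" and K: "compact K" and p: "tfn K \<psi>"
  shows "S m e \<psi> = T m (mo e \<psi>)"
proof -
  have sm: "smooth_on UNIV (mo e w)" by (rule conv_smooth[OF w_int compact_cball moll_tfn[OF e]])
  have tl: "tfn K (dlist m \<psi>)" by (rule tfn_dlist[OF compact_imp_closed[OF K] p])
  have "S m e \<psi> = (-1) ^ length m * (\<integral>x. mo e w x * dlist (rev m) \<psi> x \<partial>lborel)"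
    unfolding S_def z_def by (rule integration_by_parts_list[OF sm K p])
  also have "dlist (rev m) \<psi> = dlist m \<psi>" by (rule dlist_rev[OF tfn_smooth[OF p]])
  also have "(\<integral>x. mo e w x * dlist m \<psi> x \<partial>lborel) = (\<integral>y. w y * mo e (dlist m \<psi>) y \<partial>lborel)"
    by (rule integral_conv_swap[OF w_int compact_cball moll_tfn[OF e] moll_even K tl])
  also have "mo e (dlist m \<psi>) = dlist m (mo e \<psi>)" by (rule dlist_mo[OF e K p, symmetric])
  finally show ?thesis by (simp add: T_def)
qed

lemma S_add:
  assumes e: "e > 0" and K: "compact K" "tfn K \<phi>" "tfn K \<psi>"
  shows "S m e (\<lambda>x. \<phi> x + \<psi> x) = S m e \<phi> + S m e \<psi>"
  unfolding S_def using integrable_smooth_mult_tfn[OF z_smooth[OF e, of m] K(1)] K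
  by (simp add: distrib_left)

text \<open>Mollification does not increase the \<open>L\<^sup>2\<close> norm, so the constant of
  \<open>T m\<close> on the larger set \<open>K'\<close> works for all small
  \<open>e\<close>.\<close>

lemma bnd_S:
  assumes "bnd V j (\<lambda>_. T m)" shows "bnd V j (S m)"
  unfolding bnd_def
proof (intro allI impI, elim conjE)
  fix l :: "'n list" and K assume l: "length l \<le> j" and K: "compact K" "K \<subseteq> V"
  obtain K' where K': "compact K'" "K' \<subseteq> V" "K \<subseteq> K'" "\<forall>\<^sub>F e in at_right 0. e > 0 \<and> (\<Union>x\<in>K. cball x e) \<subseteq> K'"
    by (rule nbhd_eventually[OF K openV])
  have "ubd K nrm (\<lambda>e \<theta>. T m (dlist l (mo e \<theta>)))"
  proof (rule ubd_comp[OF bndD[OF assms l K'(1,2)], of 1])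
    show "\<forall>\<^sub>F e in at_right 0. \<forall>\<theta>. tfn K \<theta> \<longrightarrow> tfn K' (mo e \<theta>) \<and> nrm (mo e \<theta>) \<le> 1 * nrm \<theta>"
      using K'(4) by eventually_elim (use tfn_mo[OF _ K(1)] nrm_mo[OF _ K(1)] in auto)
  qed simp
  then show "ubd K nrm (\<lambda>e \<theta>. S m e (dlist l \<theta>))"
    by (rule ubd_cong) (simp add: S_eq[OF _ K(1) tfn_dlist[OF compact_imp_closed[OF K(1)]]] dlist_mo[OF _ K(1)])
qed

lemma S_by_parts:
  assumes "e > 0" "compact K" "tfn K g"
  shows "(\<integral>x. dlist r (z m e) x * g x \<partial>lborel) = (-1) ^ length r * S m e (dlist (rev r) g)"
  unfolding S_def by (rule integration_by_parts_list[OF z_smooth[OF assms(1)] assms(2,3)])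

lemma ubd_nrm_NS:
  assumes "ubd K nrm F" "compact K" "length k \<le> s"
  shows "ubd K NS (\<lambda>e \<psi>. F e (dlist k \<psi>))"
  by (rule ubd_comp[where R = "\<lambda>e \<psi>. dlist k \<psi>" and D = 1, OF assms(1)])
    (use nrm_le_NS[OF tfn_smooth assms(3)] tfn_dlist[OF compact_imp_closed[OF assms(2)]] in auto)

text \<open>\<open>q\<close> together with \<open>i\<close> makes at most \<open>s\<close>
  derivatives on \<open>z m e\<close>, which the assumed order of \<open>S m\<close> absorbs
  entirely; the remaining factor \<open>dlist k \<psi>\<close> is bounded by
  \<open>NS\<close>.\<close>

lemma lower_order_left_bounded:
  assumes S: "bnd V s (S m)" and K: "compact K" "K \<subseteq> V" and b: "smooth_on V b"
    and "length q < s" "length k \<le> s"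
  shows "ubd K NS (\<lambda>e \<psi>. \<integral>x. dlist q (cpartial i (z m e)) x * (b x * dlist k \<psi> x) \<partial>lborel)"
proof -
  have "ubd K nrm (\<lambda>e \<theta>. S m e (dlist (rev (q @ [i])) (\<lambda>x. b x * \<theta> x)))"
    by (rule bnd_mult_dlist[OF openV b S _ K]) (use assms in auto)
  from ubd_cmult[OF ubd_nrm_NS[OF this K(1) assms(6)], of "(-1) ^ length (q @ [i])"] show ?thesis
  proof (rule ubd_cong)
    fix e :: real and \<psi> :: "real^'n \<Rightarrow> real" assume e: "e > 0" and p: "tfn K \<psi>"
    have "tfn K (\<lambda>x. b x * dlist k \<psi> x)"
      by (rule tfn_mult_on[OF K openV b tfn_dlist[OF compact_imp_closed[OF K(1)] p]])
    from S_by_parts[OF e K(1) this, of "q @ [i]" m]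
    show "(\<integral>x. dlist q (cpartial i (z m e)) x * (b x * dlist k \<psi> x) \<partial>lborel)
       = (-1) ^ length (q @ [i]) * S m e (dlist (rev (q @ [i])) (\<lambda>x. b x * dlist k \<psi> x))"
      by (simp add: dlist_append)
  qed
qed

lemma cpartial_mult_on:
  assumes K: "compact K" "K \<subseteq> V" and b: "smooth_on V b" and t: "tfn K \<theta>"
  shows "cpartial j (\<lambda>x. b x * \<theta> x) = (\<lambda>x. cpartial j b x * \<theta> x + b x * cpartial j \<theta> x)"
proof
  fix x
  note cK = compact_imp_closed[OF K(1)]
  show "cpartial j (\<lambda>x. b x * \<theta> x) x = cpartial j b x * \<theta> x + b x * cpartial j \<theta> x"
  proof (cases "x \<in> V")
    case True
    show ?thesis by (rule cpartial_mult[OF b smooth_on_subset[OF tfn_smooth[OF t]] True]) simp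
  next
    case False
    then have "x \<notin> K" using K by auto
    then show ?thesis
      using tfn_zero[OF tfn_cpartial[OF cK tfn_mult_on[OF K openV b t]]] tfn_zero[OF t] tfn_zero[OF tfn_cpartial[OF cK t]] by simp
  qed
qed

text \<open>Of the \<open>length l + 1 \<le> s + 1\<close> derivatives on \<open>z\<close> at least one must be moved to the lower order factor.\<close>

lemma lower_order_right_bounded:
  assumes S: "bnd V s (S m)" and K: "compact K" "K \<subseteq> V" and b: "smooth_on V b"
    and "length l \<le> s" "length q < s"
  shows "ubd K NS (\<lambda>e \<psi>. \<integral>x. dlist l (cpartial i (z m e)) x * (b x * dlist q \<psi> x) \<partial>lborel)"
proof -
  note cK = compact_imp_closed[OF K(1)]
  \<comment> \<open>The list is nonempty because of \<open>i\<close>. Its split-off entry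
    \<open>j\<close> is the one derivative that falls on \<open>b * dlist q \<psi>\<close>, leaving
    at most \<open>s\<close> for \<open>S m\<close>; since \<open>length q < s\<close>,
    \<open>j # q\<close> is still of order at most \<open>s\<close>.\<close>
  obtain r j where rj: "rev (l @ [i]) = r @ [j]"
    by (metis append_is_Nil_conv not_Cons_self2 rev_exhaust rev_is_Nil_conv)
  have "length (rev (l @ [i])) = length (r @ [j])" using rj by simp
  then have r: "length r \<le> s" using assms by simp
  have "ubd K nrm (\<lambda>e \<theta>. S m e (dlist r (\<lambda>x. cpartial j b x * \<theta> x)))"
    by (rule bnd_mult_dlist[OF openV smooth_on_cpartial[OF b] S r K])
  then have 1: "ubd K NS (\<lambda>e \<psi>. S m e (dlist r (\<lambda>x. cpartial j b x * dlist q \<psi> x)))"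
    by (rule ubd_nrm_NS[OF _ K(1)]) (use assms in auto)
  have "ubd K nrm (\<lambda>e \<theta>. S m e (dlist r (\<lambda>x. b x * \<theta> x)))"
    by (rule bnd_mult_dlist[OF openV b S r K])
  then have 2: "ubd K NS (\<lambda>e \<psi>. S m e (dlist r (\<lambda>x. b x * dlist (j # q) \<psi> x)))"
    by (rule ubd_nrm_NS[OF _ K(1)]) (use assms in auto)
  from ubd_cmult[OF ubd_add[OF 1 2], of "(-1) ^ length (l @ [i])"] show ?thesis
  proof (rule ubd_cong)
    fix e :: real and \<psi> :: "real^'n \<Rightarrow> real" assume e: "e > 0" and p: "tfn K \<psi>"
    have tq: "tfn K (dlist q \<psi>)" by (rule tfn_dlist[OF cK p])
    have t0: "tfn K (\<lambda>x. b x * dlist q \<psi> x)" by (rule tfn_mult_on[OF K openV b tq])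
    have t1: "tfn K (\<lambda>x. cpartial j b x * dlist q \<psi> x)" by (rule tfn_mult_on[OF K openV smooth_on_cpartial[OF b] tq])
    have t2: "tfn K (\<lambda>x. b x * dlist (j # q) \<psi> x)" by (rule tfn_mult_on[OF K openV b tfn_dlist[OF cK p]])
    have "dlist (r @ [j]) (\<lambda>x. b x * dlist q \<psi> x) = dlist r (\<lambda>x. cpartial j b x * dlist q \<psi> x + b x * dlist (j # q) \<psi> x)"
      using cpartial_mult_on[OF K b tq, of j] by (simp add: dlist_append)
    also have "\<dots> = (\<lambda>x. dlist r (\<lambda>x. cpartial j b x * dlist q \<psi> x) x + dlist r (\<lambda>x. b x * dlist (j # q) \<psi> x) x)"
      by (rule ext, rule dlist_add[OF _ tfn_smooth[OF t1] tfn_smooth[OF t2]]) auto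
    finally have "S m e (dlist (r @ [j]) (\<lambda>x. b x * dlist q \<psi> x))
        = S m e (dlist r (\<lambda>x. cpartial j b x * dlist q \<psi> x)) + S m e (dlist r (\<lambda>x. b x * dlist (j # q) \<psi> x))"
      using S_add[OF e K(1) tfn_dlist[OF cK t1] tfn_dlist[OF cK t2]] by simp
    then show "(\<integral>x. dlist l (cpartial i (z m e)) x * (b x * dlist q \<psi> x) \<partial>lborel)
       = (-1) ^ length (l @ [i]) * (S m e (dlist r (\<lambda>x. cpartial j b x * dlist q \<psi> x)) + S m e (dlist r (\<lambda>x. b x * dlist (j # q) \<psi> x)))"
      using S_by_parts[OF e K(1) t0, of "l @ [i]" m] unfolding rj by (simp add: dlist_append)
  qed
qed

text \<open>The equation satisfied by \<open>T m\<close>; the commutators produced by differentiating the original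
  equation are collected in \<open>f\<close>.\<close>

definition weak_eq :: "'n list \<Rightarrow> ('n list \<Rightarrow> (real^'n \<Rightarrow> real) \<Rightarrow> real) \<Rightarrow> bool" where
  "weak_eq m f \<longleftrightarrow> (\<forall>K \<phi>. compact K \<and> K \<subseteq> V \<and> tfn K \<phi> \<longrightarrow>
     (\<Sum>l\<in>M. \<Sum>k\<in>M. (-1) ^ length l * T m (dlist l (\<lambda>x. a l k x * dlist k \<phi> x))) = (\<Sum>k\<in>M. f k (dlist k \<phi>)))"

text \<open>Another \<open>H\<^sup>s\<close> norm, as a plain sum: it dominates each
  \<open>nrm (dlist k \<phi>)\<close>, so sums over \<open>k\<close> are bounded term by term.
  \<open>NS\<close> is the Hilbert space norm that coercivity produces.\<close>

definition NM :: "(real^'n \<Rightarrow> real) \<Rightarrow> real" where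
  "NM \<phi> = (\<Sum>k\<in>M. nrm (dlist k \<phi>))"

lemma ubd_nrm_NM:
  assumes "ubd K nrm F" "compact K" "k \<in> M"
  shows "ubd K NM (\<lambda>e \<psi>. F e (dlist k \<psi>))"
proof (rule ubd_comp[where R = "\<lambda>e \<psi>. dlist k \<psi>" and D = 1, OF assms(1)])
  have "nrm (dlist k \<psi>) \<le> 1 * NM \<psi>" for \<psi>
    unfolding NM_def using member_le_sum[OF assms(3), of "\<lambda>k. nrm (dlist k \<psi>)"] finM nrm_nonneg by auto
  then show "\<forall>\<^sub>F e in at_right 0. \<forall>\<theta>. tfn K \<theta> \<longrightarrow> tfn K (dlist k \<theta>) \<and> nrm (dlist k \<theta>) \<le> 1 * NM \<theta>"
    using tfn_dlist[OF compact_imp_closed[OF assms(2)]] by (intro always_eventually) auto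
qed simp

text \<open>By Friedrichs' lemma the difference of the two arguments, before \<open>dlist l\<close>
  is applied, is bounded in \<open>L\<^sup>2\<close> by \<theta> although each contains a derivative
  of a mollification. So the \<open>l\<close> derivatives are all that \<open>T m\<close> has to
  absorb.\<close>

lemma mollifier_commutator_bounded:
  assumes T: "bnd V s (\<lambda>_. T m)" and K: "compact K" "K \<subseteq> V" and l: "length l \<le> s" and b: "smooth_on V b"
  shows "ubd K nrm (\<lambda>e \<theta>. T m (dlist l (cpartial i (mo e (\<lambda>x. b x * \<theta> x)))) - T m (dlist l (\<lambda>x. b x * cpartial i (mo e \<theta>) x)))"
proof -
  obtain K' where K': "compact K'" "K' \<subseteq> V" "K \<subseteq> K'" "\<forall>\<^sub>F e in at_right 0. e > 0 \<and> (\<Union>x\<in>K. cball x e) \<subseteq> K'"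
    by (rule nbhd_eventually[OF K openV])
  note cK' = compact_imp_closed[OF K'(1)]
  obtain c Kc U where c: "compact Kc" "tfn Kc c" "K' \<subseteq> U" "\<And>x. x \<in> U \<Longrightarrow> c x = b x"
    using smooth_extension[OF openV b K'(1,2)] by metis
  obtain C where C: "C \<ge> 0" "\<And>e th. e > 0 \<Longrightarrow> tfn K th \<Longrightarrow>
      nrm (\<lambda>x. cpartial i (mo e (\<lambda>x. c x * th x)) x - c x * cpartial i (mo e th) x) \<le> C * nrm th"
  proof (rule Friedrichs_commutator[OF c(1,2)])
    fix C assume 1: "C \<ge> 0" and 2: "\<And>e i K th. e > 0 \<Longrightarrow> compact K \<Longrightarrow> tfn K th \<Longrightarrow>
      nrm (\<lambda>x. cpartial i (mo e (\<lambda>x. c x * th x)) x - c x * cpartial i (mo e th) x) \<le> C * nrm th"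
    show thesis by (rule that[OF 1 2[OF _ K(1)]])
  qed
  have t: "tfn K' (cpartial i (mo e (\<lambda>x. c x * \<theta> x)))" "tfn K' (\<lambda>x. c x * cpartial i (mo e \<theta>) x)"
    if "e > 0" "(\<Union>x\<in>K. cball x e) \<subseteq> K'" "tfn K \<theta>" for e \<theta>
    using tfn_cpartial[OF cK' tfn_mo[OF that(1) K(1) tfn_mult[OF tfn_smooth[OF c(2)] that(3)] that(2)]]
      tfn_mult[OF tfn_smooth[OF c(2)] tfn_cpartial[OF cK' tfn_mo[OF that(1) K(1) that(3,2)]]] by auto
  have "ubd K nrm (\<lambda>e \<theta>. T m (dlist l (\<lambda>x. cpartial i (mo e (\<lambda>x. c x * \<theta> x)) x - c x * cpartial i (mo e \<theta>) x)))"
  proof (rule ubd_comp[OF bndD[OF T l K'(1,2)] C(1)])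
    show "\<forall>\<^sub>F e in at_right 0. \<forall>\<theta>. tfn K \<theta> \<longrightarrow> tfn K' (\<lambda>x. cpartial i (mo e (\<lambda>x. c x * \<theta> x)) x - c x * cpartial i (mo e \<theta>) x)
      \<and> nrm (\<lambda>x. cpartial i (mo e (\<lambda>x. c x * \<theta> x)) x - c x * cpartial i (mo e \<theta>) x) \<le> C * nrm \<theta>"
      using K'(4) by eventually_elim (intro allI impI conjI tfn_diff t C(2); simp)
  qed
  moreover have "\<forall>\<^sub>F e in at_right 0. \<forall>\<theta>. tfn K \<theta> \<longrightarrow>
     T m (dlist l (\<lambda>x. cpartial i (mo e (\<lambda>x. c x * \<theta> x)) x - c x * cpartial i (mo e \<theta>) x))
     = T m (dlist l (cpartial i (mo e (\<lambda>x. b x * \<theta> x)))) - T m (dlist l (\<lambda>x. b x * cpartial i (mo e \<theta>) x))"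
    using K'(4)
  proof eventually_elim
    case (elim e)
    show ?case
    proof (intro allI impI)
      fix \<theta> :: "real^'n \<Rightarrow> real" assume th: "tfn K \<theta>"
      have e: "e > 0" and sub: "(\<Union>x\<in>K. cball x e) \<subseteq> K'" using elim by auto
      have eq1: "(\<lambda>x. b x * \<theta> x) = (\<lambda>x. c x * \<theta> x)"
        by (rule mult_tfn_extension[OF th]) (use c K'(3) in auto)
      have eq2: "(\<lambda>x. b x * cpartial i (mo e \<theta>) x) = (\<lambda>x. c x * cpartial i (mo e \<theta>) x)"
        by (rule mult_tfn_extension[OF tfn_cpartial[OF cK' tfn_mo[OF e K(1) th sub]]]) (use c K'(3) in auto)
      have "dlist l (\<lambda>x. cpartial i (mo e (\<lambda>x. c x * \<theta> x)) x - c x * cpartial i (mo e \<theta>) x)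
          = (\<lambda>x. dlist l (cpartial i (mo e (\<lambda>x. c x * \<theta> x))) x - dlist l (\<lambda>x. c x * cpartial i (mo e \<theta>) x) x)"
        by (rule ext, rule dlist_diff[of UNIV]) (use t[OF e sub th] tfn_smooth in auto)
      then show "T m (dlist l (\<lambda>x. cpartial i (mo e (\<lambda>x. c x * \<theta> x)) x - c x * cpartial i (mo e \<theta>) x))
         = T m (dlist l (cpartial i (mo e (\<lambda>x. b x * \<theta> x)))) - T m (dlist l (\<lambda>x. b x * cpartial i (mo e \<theta>) x))"
        unfolding eq1 eq2 using lin_diff[OF T_lin K'(1,2) tfn_dlist[OF cK'] tfn_dlist[OF cK']] t[OF e sub th] by simp
    qed
  qed
  ultimately show ?thesis by (rule ubd_cong_eventually)
qed

text \<open>The equation for \<open>T m\<close> is tested with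
  \<open>cpartial i (mo e \<phi>)\<close>. It differs from the form of the differentiated
  mollification by commutators of mollifier and coefficients only. The extra derivative hits the
  right-hand side too, which is why \<open>f k\<close> must be bounded up to order 1.\<close>

lemma derivative_form_bounded:
  assumes T: "bnd V s (\<lambda>_. T m)" and f: "\<And>k. k \<in> M \<Longrightarrow> bnd V 1 (\<lambda>_. f k)" and eq: "weak_eq m f"
    and K: "compact K" "K \<subseteq> V"
  shows "ubd K NM (\<lambda>e \<phi>. \<Sum>l\<in>M. \<Sum>k\<in>M. \<integral>x. dlist l (cpartial i (z m e)) x * (a l k x * dlist k \<phi> x) \<partial>lborel)"
proof -
  note cK = compact_imp_closed[OF K(1)]
  obtain K' where K': "compact K'" "K' \<subseteq> V" "K \<subseteq> K'" "\<forall>\<^sub>F e in at_right 0. e > 0 \<and> (\<Union>x\<in>K. cball x e) \<subseteq> K'"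
    by (rule nbhd_eventually[OF K openV])
  note cK' = compact_imp_closed[OF K'(1)]
  define G where "G l k e \<theta> = T m (dlist l (cpartial i (mo e (\<lambda>x. a l k x * \<theta> x)))) - T m (dlist l (\<lambda>x. a l k x * cpartial i (mo e \<theta>) x))" for l k e \<theta>
  have 1: "ubd K NM (\<lambda>e \<phi>. \<Sum>l\<in>M. \<Sum>k\<in>M. (-1) ^ (length l + 1) * G l k e (dlist k \<phi>))"
    unfolding G_def
    by (intro ubd_sum ubd_cmult ubd_nrm_NM[OF mollifier_commutator_bounded[OF T K _ a_smooth] K(1)] lenM)
  have 2: "ubd K NM (\<lambda>e \<phi>. \<Sum>k\<in>M. f k (cpartial i (mo e (dlist k \<phi>))))"
  proof (intro ubd_sum)
    fix k assume k: "k \<in> M"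
    have "ubd K nrm (\<lambda>e \<theta>. f k (dlist [i] (mo e \<theta>)))"
    proof (rule ubd_comp[OF bndD[OF f[OF k] _ K'(1,2)], of _ 1])
      show "\<forall>\<^sub>F e in at_right 0. \<forall>\<theta>. tfn K \<theta> \<longrightarrow> tfn K' (mo e \<theta>) \<and> nrm (mo e \<theta>) \<le> 1 * nrm \<theta>"
        using K'(4) by eventually_elim (use tfn_mo[OF _ K(1)] nrm_mo[OF _ K(1)] in auto)
    qed auto
    from ubd_nrm_NM[OF this K(1) k] show "ubd K NM (\<lambda>e \<phi>. f k (cpartial i (mo e (dlist k \<phi>))))" by simp
  qed
  have "\<forall>\<^sub>F e in at_right 0. \<forall>\<phi>. tfn K \<phi> \<longrightarrow>
     (\<Sum>l\<in>M. \<Sum>k\<in>M. (-1) ^ (length l + 1) * G l k e (dlist k \<phi>)) - (\<Sum>k\<in>M. f k (cpartial i (mo e (dlist k \<phi>))))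
     = (\<Sum>l\<in>M. \<Sum>k\<in>M. \<integral>x. dlist l (cpartial i (z m e)) x * (a l k x * dlist k \<phi> x) \<partial>lborel)"
    using K'(4)
  proof eventually_elim
    case (elim e)
    show ?case
    proof (intro allI impI)
      fix \<phi> :: "real^'n \<Rightarrow> real" assume p: "tfn K \<phi>"
      have e: "e > 0" and sub: "(\<Union>x\<in>K. cball x e) \<subseteq> K'" using elim by auto
      note sp = tfn_smooth[OF tfn_mo[OF e K(1) p sub]]
      \<comment> \<open>Mollification and derivatives commute on \<phi>, so the equation shows
        \<open>dlist k \<phi>\<close> inside the mollifier, as the commutator does.\<close>
      have comm: "dlist k (cpartial i (mo e \<phi>)) = cpartial i (mo e (dlist k \<phi>))" for k
      proof -
        have "dlist k (cpartial i (mo e \<phi>)) = dlist (i # k) (mo e \<phi>)"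
          using dlist_commute1[OF sp, of k i] by (auto simp: dlist_append)
        then show ?thesis using dlist_mo[OF e K(1) p, of k] by simp
      qed
      have tm: "tfn K' (cpartial i (mo e \<phi>))" by (rule tfn_cpartial[OF cK' tfn_mo[OF e K(1) p sub]])
      have eq': "(\<Sum>l\<in>M. \<Sum>k\<in>M. (-1) ^ length l * T m (dlist l (\<lambda>x. a l k x * cpartial i (mo e (dlist k \<phi>)) x)))
         = (\<Sum>k\<in>M. f k (cpartial i (mo e (dlist k \<phi>))))"
        using eq[unfolded weak_eq_def, rule_format, of K' "cpartial i (mo e \<phi>)"] K' tm unfolding comm by blast
      \<comment> \<open>All derivatives go to the test side, and the mollifier with them.
        \<open>G\<close> measures the error made when the coefficient is taken out of the mollifier;
        what remains is a term of the equation.\<close>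
      have summand: "(\<integral>x. dlist l (cpartial i (z m e)) x * (a l k x * dlist k \<phi> x) \<partial>lborel)
        = (-1) ^ (length l + 1) * G l k e (dlist k \<phi>) - (-1) ^ length l * T m (dlist l (\<lambda>x. a l k x * cpartial i (mo e (dlist k \<phi>)) x))"
        if "l \<in> M" "k \<in> M" for l k
      proof -
        have tk: "tfn K (\<lambda>x. a l k x * dlist k \<phi> x)"
          by (rule tfn_mult_on[OF K openV a_smooth[OF that] tfn_dlist[OF cK p]])
        have "(\<integral>x. dlist l (cpartial i (z m e)) x * (a l k x * dlist k \<phi> x) \<partial>lborel)
           = (-1) ^ (length l + 1) * S m e (dlist (rev (l @ [i])) (\<lambda>x. a l k x * dlist k \<phi> x))"
          using S_by_parts[OF e K(1) tk, of "l @ [i]" m] by (simp add: dlist_append)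
        also have "dlist (rev (l @ [i])) (\<lambda>x. a l k x * dlist k \<phi> x) = dlist (l @ [i]) (\<lambda>x. a l k x * dlist k \<phi> x)"
          by (rule dlist_rev[OF tfn_smooth[OF tk]])
        also have "S m e (dlist (l @ [i]) (\<lambda>x. a l k x * dlist k \<phi> x)) = T m (dlist (l @ [i]) (mo e (\<lambda>x. a l k x * dlist k \<phi> x)))"
          using S_eq[OF e K(1) tfn_dlist[OF cK tk]] dlist_mo[OF e K(1) tk] by simp
        also have "\<dots> = G l k e (dlist k \<phi>) + T m (dlist l (\<lambda>x. a l k x * cpartial i (mo e (dlist k \<phi>)) x))"
          by (simp add: G_def dlist_append)
        finally show ?thesis by (simp add: algebra_simps)
      qed
      show "(\<Sum>l\<in>M. \<Sum>k\<in>M. (-1) ^ (length l + 1) * G l k e (dlist k \<phi>)) - (\<Sum>k\<in>M. f k (cpartial i (mo e (dlist k \<phi>))))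
         = (\<Sum>l\<in>M. \<Sum>k\<in>M. \<integral>x. dlist l (cpartial i (z m e)) x * (a l k x * dlist k \<phi> x) \<partial>lborel)"
        unfolding eq'[symmetric] using summand by (simp add: sum_subtractf)
    qed
  qed
  with ubd_diff[OF 1 2] show ?thesis by (rule ubd_cong_eventually)
qed

end

section \<open>Gaining one derivative and iterating the gain\<close>

lemma integral_sum_list:
  assumes "\<And>j. j \<in> set J \<Longrightarrow> integrable M (f j)"
  shows "integrable M (\<lambda>x. \<Sum>j\<leftarrow>J. f j x :: real)" "(\<integral>x. (\<Sum>j\<leftarrow>J. f j x) \<partial>M) = (\<Sum>j\<leftarrow>J. \<integral>x. f j x \<partial>M)"
  using assms by (induction J) auto

context elliptic_form
begin

lemma T_snoc: "T (m @ [i]) \<phi> = - T m (cpartial i \<phi>)"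
  by (simp add: T_def dlist_append)

text \<open>\<open>A\<close> bounds the Lipschitz constant of the differentiated test function and
  \<open>e\<close> is the width of the mollifier. Keeping both explicit serves the plain limit as
  well as the quantitative Cauchy estimate, where the test function varies with
  \<open>e\<close>.\<close>

lemma T_mollification_error:
  assumes e: "e > 0" and K: "compact K" and p: "tfn K \<psi>"
    and A: "A \<ge> 0" "\<And>x y. \<bar>dlist m \<psi> x - dlist m \<psi> y\<bar> \<le> A * norm (x - y)"
  shows "\<bar>T m (mo e \<psi>) - T m \<psi>\<bar> \<le> (\<integral>x. \<bar>w x\<bar> \<partial>lborel) * (A * e)"
proof -
  have tl: "tfn K (dlist m \<psi>)" by (rule tfn_dlist[OF compact_imp_closed[OF K] p])
  have t2: "tfn (\<Union>x\<in>K. cball x e) (mo e (dlist m \<psi>))"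
    by (rule tfn_mo[OF e K tl]) auto
  have i: "integrable lborel (\<lambda>x. w x * mo e (dlist m \<psi>) x)" "integrable lborel (\<lambda>x. w x * dlist m \<psi> x)"
    using integrable_mult_tfn[OF w_int closed_nbhd_compact[OF K] t2] integrable_mult_tfn[OF w_int K tl] by auto
  have "T m (mo e \<psi>) - T m \<psi> = (-1) ^ length m * (\<integral>x. w x * (mo e (dlist m \<psi>) x - dlist m \<psi> x) \<partial>lborel)"
    unfolding T_def dlist_mo[OF e K p] using i by (simp add: right_diff_distrib)
  then have "\<bar>T m (mo e \<psi>) - T m \<psi>\<bar> = \<bar>\<integral>x. w x * (mo e (dlist m \<psi>) x - dlist m \<psi> x) \<partial>lborel\<bar>"
    by (simp add: abs_mult)
  also have "\<dots> \<le> (\<integral>x. \<bar>w x * (mo e (dlist m \<psi>) x - dlist m \<psi> x)\<bar> \<partial>lborel)"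
    by (rule integral_abs_bound)
  also have "\<dots> \<le> (\<integral>x. \<bar>w x\<bar> * (A * e) \<partial>lborel)"
  proof (rule integral_mono)
    have "integrable lborel (\<lambda>x. w x * (mo e (dlist m \<psi>) x - dlist m \<psi> x))"
      using i by (simp add: right_diff_distrib)
    then show "integrable lborel (\<lambda>x. \<bar>w x * (mo e (dlist m \<psi>) x - dlist m \<psi> x)\<bar>)" by simp
    show "integrable lborel (\<lambda>x. \<bar>w x\<bar> * (A * e))" using w_int by simp
    fix x
    show "\<bar>w x * (mo e (dlist m \<psi>) x - dlist m \<psi> x)\<bar> \<le> \<bar>w x\<bar> * (A * e)"
      unfolding abs_mult by (intro mult_left_mono mo_uniform_error[OF e K tl A(2,1)]) auto
  qed
  finally show ?thesis by simp
qed

lemma T_limit: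
  assumes K: "compact K" and p: "tfn K \<psi>"
  shows "((\<lambda>e. T m (mo e \<psi>)) \<longlongrightarrow> T m \<psi>) (at_right 0)"
proof -
  obtain M where M: "M \<ge> 0" "\<And>x y. \<bar>dlist m \<psi> x - dlist m \<psi> y\<bar> \<le> M * norm (x - y)"
    using tfn_Lipschitz[OF K tfn_dlist[OF compact_imp_closed[OF K] p]] by blast
  define W where "W = (\<integral>x. \<bar>w x\<bar> \<partial>lborel)"
  have b: "\<forall>\<^sub>F e in at_right 0. norm (T m (mo e \<psi>) - T m \<psi>) \<le> W * (M * e)"
    using eventually_at_right_less[of 0]
    by eventually_elim (use T_mollification_error[OF _ K p M] in \<open>simp add: W_def\<close>)
  have "((\<lambda>e. W * (M * e)) \<longlongrightarrow> W * (M * 0)) (at_right 0)"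
    by (intro tendsto_intros)
  then have "((\<lambda>e. T m (mo e \<psi>) - T m \<psi>) \<longlongrightarrow> 0) (at_right 0)"
    using Lim_null_comparison[OF b] by simp
  then show ?thesis by (rule LIM_zero_cancel)
qed

text \<open>\<open>D\<close> sums the Leibniz constants of all \<open>k\<close> in \<open>M\<close>,
  each multiplied by the number of lists not longer than \<open>k\<close>.\<close>

lemma NM_cutoff:
  assumes "compact K" "tfn K \<eta>"
  obtains D where "D \<ge> 0" "\<And>\<psi>. tfn K \<psi> \<Longrightarrow> NM (\<lambda>x. \<eta> x * \<psi> x) \<le> D * NS \<psi>"
proof -
  have fin: "finite {q :: 'n list. length q \<le> n}" for n
    using finite_lists_length_le[of "UNIV :: 'n set" n] by simp
  have "\<exists>C. C \<ge> 0 \<and> (\<forall>\<psi>. tfn K \<psi> \<longrightarrow> nrm (dlist k (\<lambda>x. \<eta> x * \<psi> x)) \<le> C * NS \<psi>)" if k: "k \<in> M" for k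
  proof (rule Leibniz_norm[OF assms, of k])
    fix C assume C: "C \<ge> 0" and le: "\<And>K f. compact K \<Longrightarrow> tfn K f \<Longrightarrow>
      nrm (dlist k (\<lambda>x. \<eta> x * f x)) \<le> C * (\<Sum>q | length q \<le> length k. nrm (dlist q f))"
    define c where "c = real (card {q :: 'n list. length q \<le> length k})"
    show ?thesis
    proof (rule exI[of _ "C * c"], intro conjI allI impI)
      show "C * c \<ge> 0" using C by (simp add: c_def)
      fix \<psi> assume p: "tfn K \<psi>"
      have "(\<Sum>q | length q \<le> length k. nrm (dlist q \<psi>)) \<le> c * NS \<psi>"
        unfolding c_def by (rule sum_bounded_above) (use nrm_le_NS[OF tfn_smooth[OF p]] lenM[OF k] in auto)
      then have "C * (\<Sum>q | length q \<le> length k. nrm (dlist q \<psi>)) \<le> C * (c * NS \<psi>)"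
        using C by (rule mult_left_mono)
      with le[OF assms(1) p] show "nrm (dlist k (\<lambda>x. \<eta> x * \<psi> x)) \<le> C * c * NS \<psi>" by simp
    qed
  qed
  then obtain C where C: "\<And>k. k \<in> M \<Longrightarrow> C k \<ge> 0" "\<And>k \<psi>. k \<in> M \<Longrightarrow> tfn K \<psi> \<Longrightarrow> nrm (dlist k (\<lambda>x. \<eta> x * \<psi> x)) \<le> C k * NS \<psi>"
    by metis
  show ?thesis
  proof (rule that[of "\<Sum>k\<in>M. C k"])
    show "0 \<le> (\<Sum>k\<in>M. C k)" using C(1) by (rule sum_nonneg)
    fix \<psi> assume "tfn K \<psi>"
    then show "NM (\<lambda>x. \<eta> x * \<psi> x) \<le> (\<Sum>k\<in>M. C k) * NS \<psi>"
      unfolding NM_def sum_distrib_right by (intro sum_mono C(2))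
  qed
qed

text \<open>The cutoff is carried from the solution to the test function. Up to terms in which a
  derivative has fallen on the cutoff, the form of \<open>\<eta> * y\<close> against \<psi> is the
  form of \<open>y\<close> against \<open>\<eta> * \<psi>\<close>. \<open>E1\<close> collects the
  terms of lower order in \<open>y\<close>, \<open>E2\<close> those of lower order in
  \<psi>.\<close>

lemma cutoff_form_bounded:
  assumes T: "bnd V s (\<lambda>_. T m)" and f: "\<And>k. k \<in> M \<Longrightarrow> bnd V 1 (\<lambda>_. f k)" and eq: "weak_eq m f"
    and K: "compact K" "K \<subseteq> V" and h: "tfn K \<eta>"
  shows "ubd K NS (\<lambda>e \<psi>. \<Sum>l\<in>M. \<Sum>k\<in>M. \<integral>x. dlist l (\<lambda>x. \<eta> x * cpartial i (z m e) x) x * (a l k x * dlist k \<psi> x) \<partial>lborel)"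
proof -
  note cK = compact_imp_closed[OF K(1)]
  note bS = bnd_S[OF T]
  have "\<forall>l. \<exists>ps. (\<forall>(c, q)\<in>set ps. tfn K c \<and> length q < length l) \<and>
    (\<forall>f x. smooth_on UNIV f \<longrightarrow> dlist l (\<lambda>x. \<eta> x * f x) x = \<eta> x * dlist l f x + (\<Sum>(c, q)\<leftarrow>ps. c x * dlist q f x))"
    (is "\<forall>l. \<exists>ps. ?P l ps")
  proof
    fix l
    show "\<exists>ps. ?P l ps"
      by (rule Leibniz_lower_order[OF K(1) h, of l]) blast
  qed
  then obtain ps where ps: "\<And>l c q. (c, q) \<in> set (ps l) \<Longrightarrow> tfn K c \<and> length q < length l"
    and leib: "\<And>l f x. smooth_on UNIV f \<Longrightarrow> dlist l (\<lambda>x. \<eta> x * f x) x = \<eta> x * dlist l f x + (\<Sum>(c, q)\<leftarrow>ps l. c x * dlist q f x)"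
    by (rule choice[THEN exE]) fast
  have sac: "smooth_on V (\<lambda>x. a l k x * c x)" if "l \<in> M" "k \<in> M" "tfn K c" for l k c
    by (intro smooth_on_mult openV a_smooth that smooth_on_subset[OF tfn_smooth[OF that(3)]]) auto
  define E1 where "E1 e \<psi> = (\<Sum>l\<in>M. \<Sum>k\<in>M. \<Sum>(c, q)\<leftarrow>ps l. \<integral>x. dlist q (cpartial i (z m e)) x * ((a l k x * c x) * dlist k \<psi> x) \<partial>lborel)" for e \<psi>
  define E2 where "E2 e \<psi> = (\<Sum>l\<in>M. \<Sum>k\<in>M. \<Sum>(c, q)\<leftarrow>ps k. \<integral>x. dlist l (cpartial i (z m e)) x * ((a l k x * c x) * dlist q \<psi> x) \<partial>lborel)" for e \<psi>
  define B where "B e \<phi> = (\<Sum>l\<in>M. \<Sum>k\<in>M. \<integral>x. dlist l (cpartial i (z m e)) x * (a l k x * dlist k \<phi> x) \<partial>lborel)" for e \<phi>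
  have E1: "ubd K NS E1"
    unfolding E1_def
  proof (intro ubd_sum ubd_sum_list)
    fix l k p assume lk: "l \<in> M" "k \<in> M" and p: "p \<in> set (ps l)"
    obtain c q where cq: "p = (c, q)" by fastforce
    have "tfn K c" "length q < s" using ps[of c q l] p lenM[OF lk(1)] unfolding cq by auto
    then show "ubd K NS (\<lambda>e \<psi>. case p of (c, q) \<Rightarrow> \<integral>x. dlist q (cpartial i (z m e)) x * ((a l k x * c x) * dlist k \<psi> x) \<partial>lborel)"
      unfolding cq prod.case by (intro lower_order_left_bounded[OF bS K sac[OF lk]] lenM lk)
  qed
  have E2: "ubd K NS E2"
    unfolding E2_def
  proof (intro ubd_sum ubd_sum_list)
    fix l k p assume lk: "l \<in> M" "k \<in> M" and p: "p \<in> set (ps k)"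
    obtain c q where cq: "p = (c, q)" by fastforce
    have "tfn K c" "length q < s" using ps[of c q k] p lenM[OF lk(2)] unfolding cq by auto
    then show "ubd K NS (\<lambda>e \<psi>. case p of (c, q) \<Rightarrow> \<integral>x. dlist l (cpartial i (z m e)) x * ((a l k x * c x) * dlist q \<psi> x) \<partial>lborel)"
      unfolding cq prod.case by (intro lower_order_right_bounded[OF bS K sac[OF lk]] lenM lk)
  qed
  obtain D where D: "D \<ge> 0" "\<And>\<psi>. tfn K \<psi> \<Longrightarrow> NM (\<lambda>x. \<eta> x * \<psi> x) \<le> D * NS \<psi>"
    using NM_cutoff[OF K(1) h] by blast
  have Bm: "ubd K NS (\<lambda>e \<psi>. B e (\<lambda>x. \<eta> x * \<psi> x))"
    by (rule ubd_comp[where R = "\<lambda>e \<psi> x. \<eta> x * \<psi> x", OF derivative_form_bounded[OF T f eq K, of i, folded B_def] D(1)])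
      (use D(2) tfn_mult[OF tfn_smooth[OF h]] in auto)
  show ?thesis
  proof (rule ubd_cong[OF ubd_diff[OF ubd_add[OF Bm E1] E2]])
    fix e :: real and \<psi> :: "real^'n \<Rightarrow> real" assume e: "e > 0" and p: "tfn K \<psi>"
    define y where "y = cpartial i (z m e)"
    have sy: "smooth_on UNIV y" unfolding y_def by (rule smooth_on_cpartial[OF z_smooth[OF e]])
    \<comment> \<open>Leibniz is applied on both sides; the principal terms, with \<eta>
      undifferentiated, cancel.\<close>
    have summand: "(\<integral>x. dlist l (\<lambda>x. \<eta> x * y x) x * (a l k x * dlist k \<psi> x) \<partial>lborel)
       = (\<integral>x. dlist l y x * (a l k x * dlist k (\<lambda>x. \<eta> x * \<psi> x) x) \<partial>lborel)
        + (\<Sum>(c, q)\<leftarrow>ps l. \<integral>x. dlist q y x * ((a l k x * c x) * dlist k \<psi> x) \<partial>lborel)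
        - (\<Sum>(c, q)\<leftarrow>ps k. \<integral>x. dlist l y x * ((a l k x * c x) * dlist q \<psi> x) \<partial>lborel)"
      if lk: "l \<in> M" "k \<in> M" for l k
    proof -
      have t: "tfn K (\<lambda>x. a l k x * dlist k (\<lambda>x. \<eta> x * \<psi> x) x)"
        by (rule tfn_mult_on[OF K openV a_smooth[OF lk] tfn_dlist[OF cK tfn_mult[OF tfn_smooth[OF h] p]]])
      have tc: "tfn K (\<lambda>x. (a l k x * c x) * dlist q \<psi> x)" if "tfn K c" for c q
        by (rule tfn_mult_on[OF K openV sac[OF lk that] tfn_dlist[OF cK p]])
      have i0: "integrable lborel (\<lambda>x. dlist l y x * (a l k x * dlist k (\<lambda>x. \<eta> x * \<psi> x) x))"
        by (rule integrable_smooth_mult_tfn[OF smooth_on_dlist[OF sy] K(1) t])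
      have i1: "integrable lborel (case j of (c, q) \<Rightarrow> \<lambda>x. dlist q y x * ((a l k x * c x) * dlist k \<psi> x))" if "j \<in> set (ps l)" for j
      proof -
        obtain c q where j: "j = (c, q)" by fastforce
        then have "tfn K c" using ps[of c q l] that by blast
        then show ?thesis unfolding j prod.case by (intro integrable_smooth_mult_tfn[OF smooth_on_dlist[OF sy] K(1) tc])
      qed
      have i2: "integrable lborel (case j of (c, q) \<Rightarrow> \<lambda>x. dlist l y x * ((a l k x * c x) * dlist q \<psi> x))" if "j \<in> set (ps k)" for j
      proof -
        obtain c q where j: "j = (c, q)" by fastforce
        then have "tfn K c" using ps[of c q k] that by blast
        then show ?thesis unfolding j prod.case by (intro integrable_smooth_mult_tfn[OF smooth_on_dlist[OF sy] K(1) tc])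
      qed
      have "dlist l (\<lambda>x. \<eta> x * y x) x * (a l k x * dlist k \<psi> x)
         = dlist l y x * (a l k x * dlist k (\<lambda>x. \<eta> x * \<psi> x) x)
          + (\<Sum>j\<leftarrow>ps l. (case j of (c, q) \<Rightarrow> \<lambda>x. dlist q y x * ((a l k x * c x) * dlist k \<psi> x)) x)
          - (\<Sum>j\<leftarrow>ps k. (case j of (c, q) \<Rightarrow> \<lambda>x. dlist l y x * ((a l k x * c x) * dlist q \<psi> x)) x)" for x
      proof -
        have "(\<Sum>j\<leftarrow>ps l. (case j of (c, q) \<Rightarrow> \<lambda>x. dlist q y x * ((a l k x * c x) * dlist k \<psi> x)) x)
            = (\<Sum>(c, q)\<leftarrow>ps l. c x * dlist q y x) * (a l k x * dlist k \<psi> x)"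
          unfolding sum_list_mult_const[symmetric] by (rule arg_cong[of _ _ sum_list], rule map_cong) auto
        moreover have "(\<Sum>j\<leftarrow>ps k. (case j of (c, q) \<Rightarrow> \<lambda>x. dlist l y x * ((a l k x * c x) * dlist q \<psi> x)) x)
            = (\<Sum>(c, q)\<leftarrow>ps k. c x * dlist q \<psi> x) * (a l k x * dlist l y x)"
          unfolding sum_list_mult_const[symmetric] by (rule arg_cong[of _ _ sum_list], rule map_cong) auto
        ultimately show ?thesis
          unfolding leib[OF sy] leib[OF tfn_smooth[OF p]] by (simp add: algebra_simps)
      qed
      then have "(\<integral>x. dlist l (\<lambda>x. \<eta> x * y x) x * (a l k x * dlist k \<psi> x) \<partial>lborel)
         = (\<integral>x. dlist l y x * (a l k x * dlist k (\<lambda>x. \<eta> x * \<psi> x) x)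
          + (\<Sum>j\<leftarrow>ps l. (case j of (c, q) \<Rightarrow> \<lambda>x. dlist q y x * ((a l k x * c x) * dlist k \<psi> x)) x)
          - (\<Sum>j\<leftarrow>ps k. (case j of (c, q) \<Rightarrow> \<lambda>x. dlist l y x * ((a l k x * c x) * dlist q \<psi> x)) x) \<partial>lborel)"
        by presburger
      also have "\<dots> = (\<integral>x. dlist l y x * (a l k x * dlist k (\<lambda>x. \<eta> x * \<psi> x) x) \<partial>lborel)
          + (\<Sum>j\<leftarrow>ps l. \<integral>x. (case j of (c, q) \<Rightarrow> \<lambda>x. dlist q y x * ((a l k x * c x) * dlist k \<psi> x)) x \<partial>lborel)
          - (\<Sum>j\<leftarrow>ps k. \<integral>x. (case j of (c, q) \<Rightarrow> \<lambda>x. dlist l y x * ((a l k x * c x) * dlist q \<psi> x)) x \<partial>lborel)"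
        using i0 integral_sum_list[of "ps l", OF i1] integral_sum_list[of "ps k", OF i2] by simp
      finally show ?thesis by (simp add: case_prod_unfold)
    qed
    show "(\<Sum>l\<in>M. \<Sum>k\<in>M. \<integral>x. dlist l (\<lambda>x. \<eta> x * cpartial i (z m e) x) x * (a l k x * dlist k \<psi> x) \<partial>lborel)
       = B e (\<lambda>x. \<eta> x * \<psi> x) + E1 e \<psi> - E2 e \<psi>"
      unfolding B_def E1_def E2_def y_def[symmetric]
      by (simp add: summand sum.distrib sum_subtractf)
  qed
qed

text \<open>The bound holds for all \<psi> at each \<open>e\<close>, so \<psi> may be
  \<open>v e\<close> itself. Coercivity then makes a square at most linear in
  \<open>NS (v e)\<close>, which bounds \<open>NS (v e)\<close>; the limit in \<open>e\<close>
  passes the bound on to the functional.\<close>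

lemma regularity_step:
  assumes T: "bnd V s (\<lambda>_. T m)" and f: "\<And>k. k \<in> M \<Longrightarrow> bnd V 1 (\<lambda>_. f k)" and eq: "weak_eq m f"
  shows "bnd V s (\<lambda>_. T (m @ [i]))"
  unfolding bnd_def
proof (intro allI impI, elim conjE)
  fix l :: "'n list" and K assume l: "length l \<le> s" and K: "compact K" "K \<subseteq> V"
  note cK = compact_imp_closed[OF K(1)]
  obtain \<eta> K1 U where h: "compact K1" "K1 \<subseteq> V" "tfn K1 \<eta>" "open U" "K \<subseteq> U" "\<And>x. x \<in> U \<Longrightarrow> \<eta> x = 1"
    using cutoff_exists[OF K openV] by metis
  define v where "v e = (\<lambda>x. \<eta> x * cpartial i (z m e) x)" for e
  obtain C where C: "C \<ge> 0" "\<forall>\<^sub>F e in at_right 0. \<forall>\<psi>. tfn K1 \<psi> \<longrightarrow>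
      \<bar>\<Sum>l\<in>M. \<Sum>k\<in>M. \<integral>x. dlist l (v e) x * (a l k x * dlist k \<psi> x) \<partial>lborel\<bar> \<le> C * NS \<psi>"
    using cutoff_form_bounded[OF T f eq h(1,2,3), of i] unfolding ubd_def v_def by blast
  have ev: "\<forall>\<^sub>F e in at_right 0. e > 0 \<and> NS (v e) \<le> C / lam"
    using C(2) eventually_at_right_less[of 0]
  proof eventually_elim
    case (elim e)
    have tv: "tfn K1 (v e)" unfolding v_def
      by (rule tfn_mult2[OF h(3) smooth_on_cpartial[OF z_smooth]]) (use elim in auto)
    have "lam * (NS (v e))\<^sup>2 = lam * (\<Sum>l\<in>M. (nrm (dlist l (v e)))\<^sup>2)"
      by (simp add: NS_def sum_nonneg)
    also have "\<dots> \<le> (\<Sum>l\<in>M. \<Sum>k\<in>M. \<integral>x. dlist l (v e) x * (a l k x * dlist k (v e) x) \<partial>lborel)"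
      by (rule coercive[OF h(1,2) tv])
    also have "\<dots> \<le> C * NS (v e)" using elim tv by (auto simp: abs_le_iff)
    finally have le: "lam * (NS (v e))\<^sup>2 \<le> C * NS (v e)" .
    \<comment> \<open>Cancelling one factor \<open>NS (v e)\<close>; if it is zero the claim is the
      sign of \<open>C / lam\<close>.\<close>
    have "NS (v e) \<le> C / lam"
    proof (cases "NS (v e) = 0")
      case True
      then show ?thesis using C(1) lam_pos by simp
    next
      case False
      then have "NS (v e) > 0" using NS_nonneg[of "v e"] by simp
      then have "lam * NS (v e) \<le> C" using le by (simp add: power2_eq_square mult.assoc[symmetric])
      then show ?thesis using lam_pos by (simp add: field_simps)
    qed
    then show ?case using elim by simp
  qed
  have bound: "\<bar>T (m @ [i]) (dlist l \<theta>)\<bar> \<le> C / lam * nrm \<theta>" if t: "tfn K \<theta>" for \<theta>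
  proof -
    have tl: "tfn K (cpartial i (dlist l \<theta>))" by (rule tfn_cpartial[OF cK tfn_dlist[OF cK t]])
    have lim: "((\<lambda>e. \<bar>T m (mo e (cpartial i (dlist l \<theta>)))\<bar>) \<longlongrightarrow> \<bar>T m (cpartial i (dlist l \<theta>))\<bar>) (at_right 0)"
      by (intro tendsto_rabs T_limit[OF K(1) tl])
    have "\<forall>\<^sub>F e in at_right 0. \<bar>T m (mo e (cpartial i (dlist l \<theta>)))\<bar> \<le> C / lam * nrm \<theta>"
      using ev
    proof eventually_elim
      case (elim e)
      then have e: "e > 0" by simp
      have tv: "tfn K1 (v e)" unfolding v_def
        by (rule tfn_mult2[OF h(3) smooth_on_cpartial[OF z_smooth[OF e]]])
      have "T m (mo e (cpartial i (dlist l \<theta>))) = S m e (dlist (i # l) \<theta>)"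
        using S_eq[OF e K(1) tl] by simp
      then have "\<bar>T m (mo e (cpartial i (dlist l \<theta>)))\<bar> = \<bar>\<integral>x. dlist (rev l) (cpartial i (z m e)) x * \<theta> x \<partial>lborel\<bar>"
        using S_by_parts[OF e K(1) t, of "rev (i # l)" m] by (simp add: abs_mult dlist_append)
      \<comment> \<open>The cutoff is 1 on an open set around \<open>K\<close>, so on the support of
        \<theta> all derivatives of \<open>v e\<close> are those of
        \<open>cpartial i (z m e)\<close>.\<close>
      also have "(\<lambda>x. dlist (rev l) (cpartial i (z m e)) x * \<theta> x) = (\<lambda>x. dlist (rev l) (v e) x * \<theta> x)"
      proof
        fix x
        show "dlist (rev l) (cpartial i (z m e)) x * \<theta> x = dlist (rev l) (v e) x * \<theta> x"
        proof (cases "x \<in> K")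
          case True
          then have "dlist (rev l) (cpartial i (z m e)) x = dlist (rev l) (v e) x"
            by (intro dlist_cong[OF h(4)]) (use h in \<open>auto simp: v_def\<close>)
          then show ?thesis by simp
        qed (use tfn_zero[OF t] in simp)
      qed
      also have "\<bar>\<integral>x. dlist (rev l) (v e) x * \<theta> x \<partial>lborel\<bar> \<le> nrm (dlist (rev l) (v e)) * nrm \<theta>"
        using tfn_dlist[OF compact_imp_closed[OF h(1)] tv, of "rev l"]
        by (intro Cauchy_Schwarz_tfn[OF _ _ K(1) t] tfn_sq_integrable[OF h(1)]) (auto dest: tfn_measurable)
      also have "\<dots> \<le> C / lam * nrm \<theta>"
        using nrm_le_NS[OF tfn_smooth[OF tv], of "rev l"] l elim by (intro mult_right_mono nrm_nonneg) auto
      finally show ?case .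
    qed
    then have "\<bar>T m (cpartial i (dlist l \<theta>))\<bar> \<le> C / lam * nrm \<theta>"
      by (rule tendsto_upperbound[OF lim]) simp
    then show ?thesis by (simp add: T_snoc)
  qed
  show "ubd K nrm (\<lambda>e \<theta>. T (m @ [i]) (dlist l \<theta>))"
    unfolding ubd_def using bound C(1) lam_pos by (intro exI[of _ "C / lam"]) auto
qed

text \<open>Differentiating one term of the equation: the derivative on \<phi> becomes one on the
  functional, \<open>T (m @ [i])\<close>, and the product rule leaves a term with a differentiated
  coefficient.\<close>

lemma T_sum_cong: 
  assumes "compact K" "K \<subseteq> V" "l \<in> M" "k \<in> M" "tfn K \<phi>"
  shows "T m (dlist l (\<lambda>x. a l k x * dlist k (cpartial i \<phi>) x))
    = - T (m @ [i]) (dlist l (\<lambda>x. a l k x * dlist k \<phi> x)) - T m (dlist l (\<lambda>x. cpartial i (a l k) x * dlist k \<phi> x))"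
proof -
  note cK = compact_imp_closed[OF assms(1)]
  note sa = a_smooth[OF assms(3,4)]
  have tk: "tfn K (dlist k \<phi>)" by (rule tfn_dlist[OF cK assms(5)])
  have t0: "tfn K (\<lambda>x. a l k x * dlist k \<phi> x)" by (rule tfn_mult_on[OF assms(1,2) openV sa tk])
  have t1: "tfn K (\<lambda>x. cpartial i (a l k) x * dlist k \<phi> x)" by (rule tfn_mult_on[OF assms(1,2) openV smooth_on_cpartial[OF sa] tk])
  have t2: "tfn K (\<lambda>x. a l k x * cpartial i (dlist k \<phi>) x)" by (rule tfn_mult_on[OF assms(1,2) openV sa tfn_cpartial[OF cK tk]])
  have c1: "dlist k (cpartial i \<phi>) = cpartial i (dlist k \<phi>)"
    using dlist_commute1[OF tfn_smooth[OF assms(5)], of k i] by (auto simp: dlist_append)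
  have "dlist (l @ [i]) (\<lambda>x. a l k x * dlist k \<phi> x) = dlist l (\<lambda>x. cpartial i (a l k) x * dlist k \<phi> x + a l k x * cpartial i (dlist k \<phi>) x)"
    using cpartial_mult_on[OF assms(1,2) sa tk, of i] by (simp add: dlist_append)
  also have "\<dots> = (\<lambda>x. dlist l (\<lambda>x. cpartial i (a l k) x * dlist k \<phi> x) x + dlist l (\<lambda>x. a l k x * cpartial i (dlist k \<phi>) x) x)"
    by (rule ext, rule dlist_add[OF _ tfn_smooth[OF t1] tfn_smooth[OF t2]]) auto
  finally have e1: "T m (dlist (l @ [i]) (\<lambda>x. a l k x * dlist k \<phi> x)) =
      T m (dlist l (\<lambda>x. cpartial i (a l k) x * dlist k \<phi> x)) + T m (dlist l (\<lambda>x. a l k x * cpartial i (dlist k \<phi>) x))"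
    using lin_add[OF T_lin assms(1,2) tfn_dlist[OF cK t1] tfn_dlist[OF cK t2]] by simp
  have "dlist (l @ [i]) (\<lambda>x. a l k x * dlist k \<phi> x) = cpartial i (dlist l (\<lambda>x. a l k x * dlist k \<phi> x))"
    using dlist_commute1[OF tfn_smooth[OF t0], of l i] by auto
  then show ?thesis using e1 unfolding c1 T_snoc by simp
qed

text \<open>Induction on \<open>k\<close> with \<open>m\<close> and the right-hand side arbitrary,
  because the induction hypothesis is also applied to the equation for \<open>T (m @ [i])\<close>.
  That functional starts at order \<open>s\<close> by \<open>regularity_step\<close>.\<close>

lemma regularity_order:
  assumes "bnd V s (\<lambda>_. T m)" "\<And>l. l \<in> M \<Longrightarrow> bnd V k (\<lambda>_. f l)" "weak_eq m f"
  shows "bnd V (s + k) (\<lambda>_. T m)"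
  using assms
proof (induction k arbitrary: m f)
  case (Suc k)
  have Tk: "bnd V (s + k) (\<lambda>_. T m)"
    by (rule Suc.IH[OF Suc.prems(1) bnd_mono[OF Suc.prems(2)] Suc.prems(3)]) auto
  have step: "bnd V (s + k) (\<lambda>_. T (m @ [i]))" for i
  proof -
    \<comment> \<open>The right-hand side of the differentiated equation. \<open>f q\<close> loses
      one of its \<open>k + 1\<close> orders; the commutator uses \<open>s\<close> of the
      \<open>s + k\<close> orders of \<open>T m\<close> just obtained. Both are left with order
      \<open>k\<close>.\<close>
    define g where "g q \<theta> = - f q (cpartial i \<theta>) - (\<Sum>l\<in>M. (-1) ^ length l * T m (dlist l (\<lambda>x. cpartial i (a l q) x * \<theta> x)))" for q \<theta>
    have "bnd V k (\<lambda>_. g q)" if q: "q \<in> M" for q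
      unfolding bnd_def
    proof (intro allI impI, elim conjE)
      fix r :: "'n list" and K assume r: "length r \<le> k" and K: "compact K" "K \<subseteq> V"
      have 1: "ubd K nrm (\<lambda>e \<theta>. f q (dlist (i # r) \<theta>))"
        by (rule bndD[OF Suc.prems(2)[OF q] _ K]) (use r in simp)
      have 2: "ubd K nrm (\<lambda>e \<theta>. T m (dlist l (\<lambda>x. cpartial i (a l q) x * dlist r \<theta> x)))" if l: "l \<in> M" for l
      proof -
        have lin: "lin V (\<lambda>\<theta>. T m (dlist l \<theta>))"
          unfolding lin_def
        proof (intro allI impI, elim conjE)
          fix K and \<phi> \<psi> :: "real^'n \<Rightarrow> real" assume K: "compact K" "K \<subseteq> V" and p: "tfn K \<phi>" and p': "tfn K \<psi>"
          note cK = compact_imp_closed[OF K(1)]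
          have "dlist l (\<lambda>x. \<phi> x + \<psi> x) = (\<lambda>x. dlist l \<phi> x + dlist l \<psi> x)"
            by (rule ext, rule dlist_add[OF _ tfn_smooth[OF p] tfn_smooth[OF p']]) auto
          moreover have "dlist l (\<lambda>x. \<phi> x - \<psi> x) = (\<lambda>x. dlist l \<phi> x - dlist l \<psi> x)"
            by (rule ext, rule dlist_diff[OF _ tfn_smooth[OF p] tfn_smooth[OF p']]) auto
          ultimately show "T m (dlist l (\<lambda>x. \<phi> x + \<psi> x)) = T m (dlist l \<phi>) + T m (dlist l \<psi>) \<and>
              T m (dlist l (\<lambda>x. \<phi> x - \<psi> x)) = T m (dlist l \<phi>) - T m (dlist l \<psi>)"
            using lin_add[OF T_lin K tfn_dlist[OF cK p] tfn_dlist[OF cK p']]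
              lin_diff[OF T_lin K tfn_dlist[OF cK p] tfn_dlist[OF cK p']] by simp
        qed
        have "bnd V k (\<lambda>e \<theta>. T m (dlist l \<theta>))"
          unfolding bnd_def
        proof (intro allI impI, elim conjE)
          fix r :: "'n list" and K assume r: "length r \<le> k" and K: "compact K" "K \<subseteq> V"
          have "ubd K nrm (\<lambda>e \<theta>. T m (dlist (l @ r) \<theta>))"
            by (rule bndD[OF Tk _ K]) (use r lenM[OF l] in simp)
          then show "ubd K nrm (\<lambda>e \<theta>. T m (dlist l (dlist r \<theta>)))" by (simp add: dlist_append)
        qed
        from bndD[OF bnd_mult[OF openV smooth_on_cpartial[OF a_smooth[OF l q], of i] lin this] r K]
        show ?thesis .
      qed
      have "ubd K nrm (\<lambda>e \<theta>. - f q (dlist (i # r) \<theta>) - (\<Sum>l\<in>M. (-1) ^ length l * T m (dlist l (\<lambda>x. cpartial i (a l q) x * dlist r \<theta> x))))"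
        by (intro ubd_diff ubd_minus 1 ubd_sum ubd_cmult 2)
      then show "ubd K nrm (\<lambda>e \<theta>. g q (dlist r \<theta>))" by (simp add: g_def)
    qed
    moreover have "weak_eq (m @ [i]) g"
      unfolding weak_eq_def
    proof (intro allI impI, elim conjE)
      fix K \<phi> assume K: "compact K" "K \<subseteq> V" and p: "tfn K \<phi>"
      note cK = compact_imp_closed[OF K(1)]
      have c1: "dlist k (cpartial i \<phi>) = cpartial i (dlist k \<phi>)" for k
        using dlist_commute1[OF tfn_smooth[OF p], of k i] by (auto simp: dlist_append)
      have "(\<Sum>l\<in>M. \<Sum>k\<in>M. (-1) ^ length l * T m (dlist l (\<lambda>x. a l k x * dlist k (cpartial i \<phi>) x))) = (\<Sum>k\<in>M. f k (dlist k (cpartial i \<phi>)))"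
        using Suc.prems(3)[unfolded weak_eq_def, rule_format, of K "cpartial i \<phi>"] K tfn_cpartial[OF cK p] by blast
      then have "(\<Sum>l\<in>M. \<Sum>k\<in>M. - ((-1) ^ length l * T (m @ [i]) (dlist l (\<lambda>x. a l k x * dlist k \<phi> x)))
            - (-1) ^ length l * T m (dlist l (\<lambda>x. cpartial i (a l k) x * dlist k \<phi> x))) = (\<Sum>k\<in>M. f k (cpartial i (dlist k \<phi>)))"
        unfolding c1[symmetric] using T_sum_cong[OF K _ _ p, of _ _ m i] by (simp add: right_diff_distrib)
      then have "(\<Sum>l\<in>M. \<Sum>k\<in>M. (-1) ^ length l * T (m @ [i]) (dlist l (\<lambda>x. a l k x * dlist k \<phi> x)))
         = - (\<Sum>k\<in>M. f k (cpartial i (dlist k \<phi>))) - (\<Sum>l\<in>M. \<Sum>k\<in>M. (-1) ^ length l * T m (dlist l (\<lambda>x. cpartial i (a l k) x * dlist k \<phi> x)))"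
        by (simp add: sum_subtractf sum_negf)
      also have "(\<Sum>l\<in>M. \<Sum>k\<in>M. (-1) ^ length l * T m (dlist l (\<lambda>x. cpartial i (a l k) x * dlist k \<phi> x)))
          = (\<Sum>k\<in>M. \<Sum>l\<in>M. (-1) ^ length l * T m (dlist l (\<lambda>x. cpartial i (a l k) x * dlist k \<phi> x)))"
        by (rule sum.swap)
      finally show "(\<Sum>l\<in>M. \<Sum>k\<in>M. (-1) ^ length l * T (m @ [i]) (dlist l (\<lambda>x. a l k x * dlist k \<phi> x))) = (\<Sum>k\<in>M. g k (dlist k \<phi>))"
        by (simp add: g_def sum_subtractf sum_negf)
    qed
    moreover have "bnd V s (\<lambda>_. T (m @ [i]))"
      by (rule regularity_step[OF Suc.prems(1) bnd_mono[OF Suc.prems(2)] Suc.prems(3)]) auto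
    ultimately show ?thesis by (intro Suc.IH)
  qed
  \<comment> \<open>A nonempty list hands its first derivative to the functional, so the order
    \<open>s + k\<close> of all \<open>T (m @ [i])\<close> is the order \<open>s + k + 1\<close> of
    \<open>T m\<close>.\<close>
  show ?case unfolding bnd_def
  proof (intro allI impI, elim conjE)
    fix l :: "'n list" and K assume l: "length l \<le> s + Suc k" and K: "compact K" "K \<subseteq> V"
    show "ubd K nrm (\<lambda>e \<theta>. T m (dlist l \<theta>))"
    proof (cases l)
      case Nil
      then show ?thesis using bndD[OF Tk, of "[]" K] K by simp
    next
      case (Cons i l')
      then have "ubd K nrm (\<lambda>e \<theta>. T (m @ [i]) (dlist l' \<theta>))"
        using l by (intro bndD[OF step _ K]) simp
      from ubd_minus[OF this] show ?thesis by (simp add: T_snoc Cons)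
    qed
  qed
qed simp

text \<open>Bootstrapping: the right-hand side is a multiple of \<open>w\<close> itself, hence as
  regular as \<open>w\<close> is already known to be. Order \<open>k\<close> yields
  \<open>s + k\<close>, a real gain as \<open>s \<ge> 1\<close>.\<close>

lemma regularity_all_orders:
  assumes s: "s \<ge> 1" and T0: "bnd V s (\<lambda>_. T [])"
    and eq: "\<And>K \<phi>. compact K \<Longrightarrow> K \<subseteq> V \<Longrightarrow> tfn K \<phi> \<Longrightarrow>
       (\<Sum>l\<in>M. \<Sum>k\<in>M. (-1) ^ length l * T [] (dlist l (\<lambda>x. a l k x * dlist k \<phi> x))) = c * T [] \<phi>"
  shows "bnd V k (\<lambda>_. T [])"
proof (induction k)
  case 0
  show ?case by (rule bnd_mono[OF T0]) simp
next
  case (Suc k)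
  \<comment> \<open>The right-hand side contains \<phi> undifferentiated, so it sits in the
    component of the empty list.\<close>
  define f where "f l \<phi> = (if l = [] then c * T [] \<phi> else 0)" for l :: "'n list" and \<phi>
  have "[] \<in> M" using coverM[of "[]"] by auto
  have "weak_eq [] f" unfolding weak_eq_def
  proof (intro allI impI, elim conjE)
    fix K \<phi> assume K: "compact K" "K \<subseteq> V" and p: "tfn K \<phi>"
    have "(\<Sum>k\<in>M. f k (dlist k \<phi>)) = (\<Sum>k\<in>M. if k = [] then c * T [] \<phi> else 0)"
      by (rule sum.cong) (auto simp: f_def)
    also have "\<dots> = c * T [] \<phi>" using finM \<open>[] \<in> M\<close> by simp
    finally show "(\<Sum>l\<in>M. \<Sum>k\<in>M. (-1) ^ length l * T [] (dlist l (\<lambda>x. a l k x * dlist k \<phi> x))) = (\<Sum>k\<in>M. f k (dlist k \<phi>))"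
      using eq[OF K p] by simp
  qed
  moreover have "bnd V k (\<lambda>_. f l)" for l
  proof (cases "l = []")
    case True
    have "bnd V k (\<lambda>e \<phi>. c * T [] \<phi>)"
      using Suc unfolding bnd_def by (auto intro: ubd_cmult)
    then show ?thesis using True by (simp add: f_def[abs_def])
  next
    case False
    then show ?thesis by (simp add: f_def[abs_def] bnd_def ubd_zero)
  qed
  ultimately have "bnd V (s + k) (\<lambda>_. T [])" by (intro regularity_order[OF T0])
  then show ?case by (rule bnd_mono) (use s in simp)
qed

end

section \<open>The fundamental lemma of the calculus of variations\<close>

text \<open>Open sets are stable under intersection and generate the Borel sets, and the sets over
  which \<open>F\<close> integrates to zero are closed under complement and disjoint countable
  union. So the integral vanishes over all Borel sets, in particular where \<open>F\<close> is
  positive and where it is negative.\<close>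

lemma AE_zero_if_integral_zero_on_open:
  fixes F :: "'a::euclidean_space \<Rightarrow> real"
  assumes F: "integrable lborel F" and op: "\<And>U. open U \<Longrightarrow> (\<integral>x. indicator U x * F x \<partial>lborel) = 0"
  shows "AE x in lborel. F x = 0"
proof -
  have [measurable]: "F \<in> borel_measurable borel" using F by auto
  have int: "integrable lborel (\<lambda>x. indicator A x * F x)" if "A \<in> sets borel" for A
    using integrable_mult_bounded[OF F, of "indicator A" 1] that by (simp add: mult.commute indicator_def)
  have all: "(\<integral>x. indicator A x * F x \<partial>lborel) = 0" if "A \<in> sets borel" for A
  proof -
    have 1: "Int_stable {S::'a set. open S}" by (auto simp: Int_stable_def)
    have 2: "A \<in> sigma_sets UNIV {S. open S}" using that by (simp add: borel_def)
    have 0: "{S::'a set. open S} \<subseteq> Pow UNIV" by simp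
    from 1 0 2 show ?thesis
    proof (induction rule: sigma_sets_induct_disjoint)
      case (basic A)
      then show ?case using op by simp
    next
      case empty
      then show ?case by simp
    next
      case (compl A)
      have A: "A \<in> sets borel" using compl(1) by (simp add: borel_def)
      have "(\<lambda>x. indicator (UNIV - A) x * F x) = (\<lambda>x. indicator UNIV x * F x - indicator A x * F x)"
        by (auto simp: indicator_def)
      then show ?case using compl(2) op[of UNIV] int[OF A] F by simp
    next
      case (union A)
      have A: "\<And>i. A i \<in> sets borel" using union(2) by (auto simp: borel_def)
      have "(LINT x:(\<Union>i. A i)|lborel. F x) = (\<Sum>i. (LINT x:(A i)|lborel. F x))"
      proof (rule lebesgue_integral_countable_add)
        show "set_integrable lborel (\<Union>i. A i) F"
          unfolding set_integrable_def using int[of "\<Union>i. A i"] A by auto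
      qed (use A union(1) in \<open>auto simp: disjoint_family_on_def\<close>)
      then show ?case using union(3) by (simp add: set_lebesgue_integral_def)
    qed
  qed
  have pos: "AE x in lborel. \<not> F x > 0"
  proof -
    have m: "{x. F x > 0} \<in> sets borel" by measurable
    have "AE x in lborel. indicator {x. F x > 0} x * F x = 0"
      using integral_nonneg_eq_0_iff_AE[OF int[OF m]] all[OF m] by (auto simp: indicator_def)
    then show ?thesis by eventually_elim (auto simp: indicator_def split: if_splits)
  qed
  have neg: "AE x in lborel. \<not> F x < 0"
  proof -
    have m: "{x. F x < 0} \<in> sets borel" by measurable
    have i: "integrable lborel (\<lambda>x. - (indicator {x. F x < 0} x * F x))" using int[OF m] by simp
    have "AE x in lborel. - (indicator {x. F x < 0} x * F x) = 0"
      using integral_nonneg_eq_0_iff_AE[OF i] all[OF m] by (auto simp: indicator_def)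
    then show ?thesis by eventually_elim (auto simp: indicator_def split: if_splits)
  qed
  show ?thesis using pos neg by eventually_elim auto
qed

text \<open>Cutoffs for a compact exhaustion of \<open>U\<close>; being between 0 and 1 they allow
  dominated convergence.\<close>

lemma indicator_limit_of_tfn:
  fixes U :: "(real^'n::finite) set"
  assumes "open U"
  obtains \<eta> K where "\<And>j::nat. compact (K j)" "\<And>j. K j \<subseteq> U" "\<And>j. tfn (K j) (\<eta> j)" "\<And>j x. 0 \<le> \<eta> j x" "\<And>j x. \<eta> j x \<le> 1"
    "\<And>x. (\<lambda>j. \<eta> j x) \<longlonglongrightarrow> indicator U x"
proof -
  obtain C where C: "\<And>n::nat. compact (C n)" "\<And>n. C n \<subseteq> U" "\<Union>(range C) = U"
     "\<And>K. \<lbrakk>compact K; K \<subseteq> U\<rbrakk> \<Longrightarrow> \<exists>N. \<forall>n\<ge>N. K \<subseteq> (C n)"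
  proof (rule open_Union_compact_subsets[OF assms])
    fix C assume "\<And>n::nat. compact (C n)" "\<And>n. C n \<subseteq> U" "\<Union>(range C) = U"
      "\<And>K. \<lbrakk>compact K; K \<subseteq> U\<rbrakk> \<Longrightarrow> \<exists>N. \<forall>n\<ge>N. K \<subseteq> (C n)"
    then show thesis by (intro that[of C])
  qed
  have "\<exists>p. compact (fst p) \<and> fst p \<subseteq> U \<and> tfn (fst p) (snd p) \<and> (\<forall>x\<in>C j. snd p x = 1) \<and> (\<forall>x. 0 \<le> snd p x \<and> snd p x \<le> 1)" for j
  proof (rule cutoff_exists[OF C(1) C(2) assms, of j])
    fix \<eta> K' U'
    assume "compact K'" "K' \<subseteq> U" "tfn K' \<eta>" "C j \<subseteq> U'" "\<And>x. x \<in> U' \<Longrightarrow> \<eta> x = 1" "\<And>x. 0 \<le> \<eta> x" "\<And>x. \<eta> x \<le> 1"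
    then show ?thesis by (intro exI[of _ "(K', \<eta>)"]) auto
  qed
  then obtain p where p: "\<And>j. compact (fst (p j)) \<and> fst (p j) \<subseteq> U \<and> tfn (fst (p j)) (snd (p j)) \<and> (\<forall>x\<in>C j. snd (p j) x = 1) \<and> (\<forall>x. 0 \<le> snd (p j) x \<and> snd (p j) x \<le> 1)"
    by metis
  have lim: "(\<lambda>j. snd (p j) x) \<longlonglongrightarrow> indicator U x" for x
  proof (cases "x \<in> U")
    case True
    then obtain N where "\<forall>n\<ge>N. {x} \<subseteq> C n" using C(4)[of "{x}"] by auto
    then have "\<forall>\<^sub>F j in sequentially. snd (p j) x = indicator U x"
      using p True by (intro eventually_sequentiallyI[of N]) auto
    then show ?thesis by (rule tendsto_eventually)
  next
    case False
    then have "snd (p j) x = 0" for j using p[of j] tfn_zero[of "fst (p j)" "snd (p j)" x] by blast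
    then show ?thesis using False by simp
  qed
  show ?thesis by (rule that[of "\<lambda>j. fst (p j)" "\<lambda>j. snd (p j)"]) (use p lim in auto)
qed

text \<open>\<open>f\<close> is only locally integrable. Multiplied by a cutoff \<eta> it becomes
  integrable on the whole space; testing with products of \<eta> and approximations of indicators
  shows that its integral over every open set is zero. A compact exhaustion collects the null
  sets.\<close>

lemma fundamental_lemma:
  fixes f :: "real^'n::finite \<Rightarrow> real"
  assumes V: "open V" and f: "f \<in> borel_measurable borel"
    and li: "\<And>K. compact K \<Longrightarrow> K \<subseteq> V \<Longrightarrow> integrable lborel (\<lambda>x. indicator K x * f x)"
    and z: "\<And>K \<phi>. compact K \<Longrightarrow> K \<subseteq> V \<Longrightarrow> tfn K \<phi> \<Longrightarrow> (\<integral>x. f x * \<phi> x \<partial>lborel) = 0"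
  shows "AE x in lborel. x \<in> V \<longrightarrow> f x = 0"
proof -
  note [measurable] = f
  have one: "AE x in lborel. x \<in> K \<longrightarrow> f x = 0" if K: "compact K" "K \<subseteq> V" for K
  proof -
    obtain \<eta> K' U where h: "compact K'" "K' \<subseteq> V" "tfn K' \<eta>" "K \<subseteq> U" "\<And>x. x \<in> U \<Longrightarrow> \<eta> x = 1"
      using cutoff_exists[OF K V] by metis
    have hz: "\<eta> x = indicator K' x * \<eta> x" for x using tfn_zero[OF h(3), of x] by (auto simp: indicator_def)
    have F: "integrable lborel (\<lambda>x. f x * \<eta> x)"
    proof -
      obtain B where "\<And>x. \<bar>\<eta> x\<bar> \<le> B" using tfn_bounded[OF h(1,3)] by blast
      then have "integrable lborel (\<lambda>x. (indicator K' x * f x) * \<eta> x)"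
        by (rule integrable_mult_bounded[OF li[OF h(1,2)] tfn_measurable[OF h(3)]])
      moreover have "(\<lambda>x. (indicator K' x * f x) * \<eta> x) = (\<lambda>x. f x * \<eta> x)"
        using hz by (metis (no_types, opaque_lifting) mult.assoc mult.commute)
      ultimately show ?thesis by simp
    qed
    have "AE x in lborel. f x * \<eta> x = 0"
    proof (rule AE_zero_if_integral_zero_on_open[OF F])
      fix O' :: "(real^'n) set" assume O: "open O'"
      obtain \<zeta> C where c: "\<And>j::nat. compact (C j)" "\<And>j. C j \<subseteq> O'" "\<And>j. tfn (C j) (\<zeta> j)" "\<And>j x. 0 \<le> \<zeta> j x" "\<And>j x. \<zeta> j x \<le> 1"
        "\<And>x. (\<lambda>j. \<zeta> j x) \<longlonglongrightarrow> indicator O' x"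
      proof (rule indicator_limit_of_tfn[OF O])
        fix \<zeta> C
        assume "\<And>j::nat. compact (C j)" "\<And>j. C j \<subseteq> O'" "\<And>j. tfn (C j) (\<zeta> j)" "\<And>j x. 0 \<le> \<zeta> j x" "\<And>j x. \<zeta> j x \<le> 1"
          "\<And>x. (\<lambda>j. \<zeta> j x) \<longlonglongrightarrow> indicator O' x"
        then show thesis by (intro that)
      qed
      have [measurable]: "\<zeta> j \<in> borel_measurable borel" for j by (rule tfn_measurable[OF c(3)])
      have [measurable]: "\<eta> \<in> borel_measurable borel" "O' \<in> sets borel" using tfn_measurable[OF h(3)] O by auto
      have "(\<lambda>j. \<integral>x. \<zeta> j x * (f x * \<eta> x) \<partial>lborel) \<longlonglongrightarrow> (\<integral>x. indicator O' x * (f x * \<eta> x) \<partial>lborel)"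
      proof (rule integral_dominated_convergence[where w = "\<lambda>x. \<bar>f x * \<eta> x\<bar>"])
        show "(\<lambda>x. indicator O' x * (f x * \<eta> x)) \<in> borel_measurable lborel" by measurable
        show "AE x in lborel. (\<lambda>j. \<zeta> j x * (f x * \<eta> x)) \<longlonglongrightarrow> indicator O' x * (f x * \<eta> x)"
          by (intro AE_I2 tendsto_intros c(6))
        show "AE x in lborel. norm (\<zeta> j x * (f x * \<eta> x)) \<le> \<bar>f x * \<eta> x\<bar>" for j
        proof (rule AE_I2)
          fix x
          show "norm (\<zeta> j x * (f x * \<eta> x)) \<le> \<bar>f x * \<eta> x\<bar>"
            using mult_right_mono[of "\<bar>\<zeta> j x\<bar>" 1 "\<bar>f x * \<eta> x\<bar>"] c(4,5)[of j x] by (simp add: abs_mult)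
        qed
      qed (use F in auto)
      moreover have "(\<integral>x. \<zeta> j x * (f x * \<eta> x) \<partial>lborel) = 0" for j
        using z[OF h(1,2) tfn_mult[OF tfn_smooth[OF c(3)] h(3)], of j] by (simp add: mult.left_commute)
      ultimately show "(\<integral>x. indicator O' x * (f x * \<eta> x) \<partial>lborel) = 0" by (simp add: LIMSEQ_const_iff)
    qed
    then show ?thesis
    proof eventually_elim
      case (elim x)
      show ?case
      proof
        assume "x \<in> K"
        then have "\<eta> x = 1" using h(4,5) by auto
        then show "f x = 0" using elim by simp
      qed
    qed
  qed
  obtain C where C: "\<And>n::nat. compact (C n)" "\<And>n. C n \<subseteq> V" "\<Union>(range C) = V"
  proof (rule open_Union_compact_subsets[OF V])
    fix C assume "\<And>n::nat. compact (C n)" "\<And>n. C n \<subseteq> V" "\<Union>(range C) = V"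
    then show thesis by (intro that[of C])
  qed
  have "AE x in lborel. \<forall>n. x \<in> C n \<longrightarrow> f x = 0"
    unfolding AE_all_countable using one[OF C(1,2)] by blast
  then show ?thesis by eventually_elim (use C(3) in auto)
qed

section \<open>A Sobolev inequality\<close>

text \<open>The fundamental theorem of calculus from a point outside the support. The offset
  \<open>c\<close> is free; with \<open>c\<close> equal to the \<open>j\<close>-th coordinate of the
  base point, the integration variable \<open>r\<close> is the new coordinate itself.\<close>

lemma abs_le_line_integral:
  fixes v :: "real^'n::finite \<Rightarrow> real"
  assumes K: "compact K" and v: "tfn K v"
  shows "ennreal \<bar>v y\<bar> \<le> (\<integral>\<^sup>+r. ennreal \<bar>cpartial j v (y + (r - c) *\<^sub>R axis j 1)\<bar> \<partial>lborel)"
proof -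
  define y0 where "y0 = y - c *\<^sub>R axis j 1"
  have y0: "y + (r - c) *\<^sub>R axis j 1 = y0 + r *\<^sub>R axis j 1" for r by (simp add: y0_def algebra_simps)
  obtain R where R: "\<And>x. x \<in> K \<Longrightarrow> norm x \<le> R" using compact_imp_bounded[OF K] unfolding bounded_iff by auto
  \<comment> \<open>So far out in the negative direction that the line has left the support, and not
    beyond the upper limit \<open>c\<close>.\<close>
  define b where "b = - (\<bar>c\<bar> + norm y0 + \<bar>R\<bar> + 1)"
  have bc: "b \<le> c" unfolding b_def using norm_ge_zero[of y0] by linarith
  have "\<bar>b\<bar> \<le> norm (y0 + b *\<^sub>R axis j 1) + norm y0"
    using norm_triangle_ineq4[of "y0 + b *\<^sub>R axis j 1" y0] by simp
  then have "norm (y0 + b *\<^sub>R axis j 1) > R" unfolding b_def using norm_ge_zero[of y0] by linarith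
  then have vb: "v (y0 + b *\<^sub>R axis j 1) = 0" using R tfn_zero[OF v] by (meson not_less)
  define g where "g r = cpartial j v (y0 + r *\<^sub>R axis j 1)" for r
  have cg: "continuous_on UNIV g" unfolding g_def
    by (intro continuous_on_compose2[OF smooth_on_continuous0[OF smooth_on_cpartial[OF tfn_smooth[OF v]]]] continuous_intros) auto
  have "has_bochner_integral lborel (\<lambda>r. g r * indicator {b..c} r) (v (y0 + c *\<^sub>R axis j 1) - v (y0 + b *\<^sub>R axis j 1))"
  proof (rule has_bochner_integral_FTC_Icc_real[OF bc])
    show "DERIV (\<lambda>r. v (y0 + r *\<^sub>R axis j 1)) x :> g x" for x
      unfolding g_def by (rule smooth_line_deriv[OF tfn_smooth[OF v]])
    show "isCont g x" for x using cg by (simp add: continuous_on_eq_continuous_at)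
  qed
  then have i: "integrable lborel (\<lambda>r. g r * indicator {b..c} r)" and e: "(\<integral>r. g r * indicator {b..c} r \<partial>lborel) = v (y0 + c *\<^sub>R axis j 1)"
    using vb by (auto simp: has_bochner_integral_iff)
  have "y0 + c *\<^sub>R axis j 1 = y" by (simp add: y0_def)
  then have "ennreal \<bar>v y\<bar> = ennreal (norm (\<integral>r. g r * indicator {b..c} r \<partial>lborel))" using e by simp
  also have "\<dots> \<le> (\<integral>\<^sup>+r. ennreal (norm (g r * indicator {b..c} r)) \<partial>lborel)"
    by (rule integral_norm_bound_ennreal[OF i])
  also have "\<dots> \<le> (\<integral>\<^sup>+r. ennreal \<bar>g r\<bar> \<partial>lborel)"
    by (intro nn_integral_mono ennreal_leI) (auto simp: indicator_def)
  finally show ?thesis by (simp add: y0 g_def)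
qed

text \<open>The point \<open>x\<close> with its coordinates along the basis vectors in
  \<open>B\<close> replaced by those of \<open>t\<close>. Basis vectors serve as indices because
  Lebesgue measure is the image of the product measure over \<open>Basis\<close>.\<close>

definition replace_coords :: "real^'n::finite \<Rightarrow> (real^'n) set \<Rightarrow> (real^'n \<Rightarrow> real) \<Rightarrow> real^'n" where
  "replace_coords x B t = x + (\<Sum>b\<in>B. (t b - x \<bullet> b) *\<^sub>R b)"

lemma replace_coords_measurable:
  "finite B \<Longrightarrow> replace_coords x B \<in> borel_measurable (Pi\<^sub>M B (\<lambda>_. lborel))"
  unfolding replace_coords_def by measurable

text \<open>Each new direction adds one derivative and one integration: the line estimate is applied
  inside the integral over the coordinates treated before.\<close>

lemma abs_le_iterated_integral:
  fixes u :: "real^'n::finite \<Rightarrow> real"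
  assumes K: "compact K" and u: "tfn K u" and "distinct js"
  shows "ennreal \<bar>u x\<bar> \<le> (\<integral>\<^sup>+t. ennreal \<bar>dlist js u (replace_coords x ((\<lambda>j. axis j 1) ` set js) t)\<bar> \<partial>(Pi\<^sub>M ((\<lambda>j. axis j 1) ` set js) (\<lambda>_. lborel)))"
  using assms(3)
proof (induction js)
  case Nil
  interpret product_sigma_finite "\<lambda>_::real^'n. lborel::real measure" ..
  show ?case by (simp add: replace_coords_def PiM_empty)
next
  case (Cons j js)
  interpret product_sigma_finite "\<lambda>_::real^'n. lborel::real measure" ..
  define B where "B = (\<lambda>j. axis j (1::real)) ` set js"
  have B: "finite B" "axis j 1 \<notin> B" using Cons.prems by (auto simp: B_def axis_eq_axis)
  have tl: "tfn K (dlist js u)" by (rule tfn_dlist[OF compact_imp_closed[OF K] u])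
  have tl': "tfn K (dlist (j # js) u)" by (rule tfn_dlist[OF compact_imp_closed[OF K] u])
  have [measurable]: "dlist (j # js) u \<in> borel_measurable borel" by (rule tfn_measurable[OF tl'])
  have [measurable]: "replace_coords x (insert (axis j 1) B) \<in> borel_measurable (Pi\<^sub>M (insert (axis j 1) B) (\<lambda>_. lborel))"
    by (rule replace_coords_measurable) (use B in auto)
  have upd: "replace_coords x (insert (axis j 1) B) (t(axis j 1 := r)) = replace_coords x B t + (r - x $ j) *\<^sub>R axis j 1" for t r
  proof -
    have "(\<Sum>b\<in>B. ((t(axis j 1 := r)) b - x \<bullet> b) *\<^sub>R b) = (\<Sum>b\<in>B. (t b - x \<bullet> b) *\<^sub>R b)"
      using B(2) by (intro sum.cong) auto
    then show ?thesis using B by (simp add: replace_coords_def inner_axis algebra_simps)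
  qed
  have "ennreal \<bar>u x\<bar> \<le> (\<integral>\<^sup>+t. ennreal \<bar>dlist js u (replace_coords x B t)\<bar> \<partial>(Pi\<^sub>M B (\<lambda>_. lborel)))"
    using Cons by (simp add: B_def)
  also have "\<dots> \<le> (\<integral>\<^sup>+t. (\<integral>\<^sup>+r. ennreal \<bar>dlist (j # js) u (replace_coords x (insert (axis j 1) B) (t(axis j 1 := r)))\<bar> \<partial>lborel) \<partial>(Pi\<^sub>M B (\<lambda>_. lborel)))"
    unfolding upd dlist.simps by (intro nn_integral_mono abs_le_line_integral[OF K tl])
  also have "\<dots> = (\<integral>\<^sup>+t. ennreal \<bar>dlist (j # js) u (replace_coords x (insert (axis j 1) B) t)\<bar> \<partial>(Pi\<^sub>M (insert (axis j 1) B) (\<lambda>_. lborel)))"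
    by (rule product_nn_integral_insert[OF B, symmetric]) measurable
  finally show ?case by (simp add: B_def)
qed

text \<open>When every coordinate has been replaced, the base point \<open>x\<close> no longer
  occurs, and the iterated integral is an integral over the space.\<close>

lemma sup_le_L1:
  fixes u :: "real^'n::finite \<Rightarrow> real"
  assumes K: "compact K" and u: "tfn K u" and js: "distinct js" "set js = UNIV"
  shows "\<bar>u x\<bar> \<le> (\<integral>x. \<bar>dlist js u x\<bar> \<partial>lborel)"
proof -
  have tl: "tfn K (dlist js u)" by (rule tfn_dlist[OF compact_imp_closed[OF K] u])
  have [measurable]: "dlist js u \<in> borel_measurable borel" by (rule tfn_measurable[OF tl])
  have B: "(\<lambda>j. axis j 1) ` set js = (Basis :: (real^'n) set)"
    using js(2) by (auto simp: Basis_vec_def)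
  have rc: "replace_coords x Basis t = (\<Sum>b\<in>Basis. t b *\<^sub>R b)" for t
  proof -
    have "(\<Sum>b\<in>Basis. (x \<bullet> b) *\<^sub>R b) = x" by (rule euclidean_representation)
    then show ?thesis by (simp add: replace_coords_def scaleR_left_diff_distrib sum_subtractf)
  qed
  have "ennreal \<bar>u x\<bar> \<le> (\<integral>\<^sup>+t. ennreal \<bar>dlist js u (\<Sum>b\<in>Basis. t b *\<^sub>R b)\<bar> \<partial>(Pi\<^sub>M Basis (\<lambda>_. lborel)))"
    using abs_le_iterated_integral[OF K u js(1), of x] unfolding B rc .
  also have "\<dots> = (\<integral>\<^sup>+y. ennreal \<bar>dlist js u y\<bar> \<partial>(distr (\<Pi>\<^sub>M b\<in>Basis. lborel) borel (\<lambda>f. \<Sum>b\<in>Basis. f b *\<^sub>R b)))"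
    by (rule nn_integral_distr[symmetric]) measurable
  also have "\<dots> = (\<integral>\<^sup>+y. ennreal \<bar>dlist js u y\<bar> \<partial>lborel)" by (simp add: lborel_eq[symmetric])
  also have "\<dots> = ennreal (\<integral>y. \<bar>dlist js u y\<bar> \<partial>lborel)"
    using tfn_integrable[OF K tl] by (intro nn_integral_eq_integral) auto
  finally show ?thesis by (simp add: ennreal_le_iff)
qed

text \<open>Cauchy-Schwarz against a cutoff that is 1 on \<open>K\<close> turns the
  \<open>L\<^sup>1\<close> bound into an \<open>L\<^sup>2\<close> bound. It costs one derivative in
  each direction, which is affordable since bounds of every order are available.\<close>

lemma Sobolev_inequality:
  fixes K :: "(real^'n::finite) set"
  assumes K: "compact K"
  obtains C js where "C \<ge> 0" "\<And>u x. tfn K u \<Longrightarrow> \<bar>u x\<bar> \<le> C * nrm (dlist js u)"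
proof -
  obtain js :: "'n list" where js: "set js = UNIV" "distinct js" using finite_distinct_list[of "UNIV::'n set"] by auto
  obtain \<eta> K' U where h: "compact K'" "tfn K' \<eta>" "K \<subseteq> U" "\<And>x. x \<in> U \<Longrightarrow> \<eta> x = 1" "\<And>x. 0 \<le> \<eta> x"
    using cutoff_exists[OF K subset_UNIV open_UNIV] by metis
  have "\<bar>u x\<bar> \<le> nrm \<eta> * nrm (dlist js u)" if u: "tfn K u" for u x
  proof -
    have tl: "tfn K (dlist js u)" by (rule tfn_dlist[OF compact_imp_closed[OF K] u])
    have [measurable]: "dlist js u \<in> borel_measurable borel" "\<eta> \<in> borel_measurable borel"
      by (rule tfn_measurable[OF tl]) (rule tfn_measurable[OF h(2)])
    have eq: "(\<lambda>x. \<bar>dlist js u x\<bar>) = (\<lambda>x. \<eta> x * \<bar>dlist js u x\<bar>)"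
    proof
      fix x show "\<bar>dlist js u x\<bar> = \<eta> x * \<bar>dlist js u x\<bar>"
        using tfn_zero[OF tl, of x] h(3,4) by (cases "x \<in> K") auto
    qed
    have "(\<integral>x. \<eta> x * \<bar>dlist js u x\<bar> \<partial>lborel)\<^sup>2 \<le> (\<integral>x. (\<eta> x)\<^sup>2 \<partial>lborel) * (\<integral>x. \<bar>dlist js u x\<bar>\<^sup>2 \<partial>lborel)"
      by (rule Cauchy_Schwarz_integral) (use tfn_sq_integrable[OF h(1,2)] tfn_sq_integrable[OF K tl] in auto)
    also have "\<dots> = (nrm \<eta> * nrm (dlist js u))\<^sup>2" by (simp add: nrm_sq power_mult_distrib)
    finally have "(\<integral>x. \<eta> x * \<bar>dlist js u x\<bar> \<partial>lborel) \<le> nrm \<eta> * nrm (dlist js u)"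
      by (rule power2_le_imp_le) (simp add: nrm_nonneg)
    then show ?thesis using sup_le_L1[OF K u js(2,1), of x] eq by simp
  qed
  then show ?thesis using nrm_nonneg[of \<eta>] by (rule that[rotated])
qed

section \<open>From uniform bounds to smoothness\<close>

definition eps_seq :: "nat \<Rightarrow> real" where "eps_seq n = 1 / real (Suc n)"

lemma eps_seq_pos: "eps_seq n > 0" by (simp add: eps_seq_def)

lemma eps_seq_limit: "eps_seq \<longlonglongrightarrow> 0"
  unfolding eps_seq_def by (rule LIMSEQ_inverse_real_of_nat[unfolded inverse_eq_divide])

lemma eps_seq_at_right: "filterlim eps_seq (at_right 0) sequentially"
  using eps_seq_limit eps_seq_pos by (auto simp: filterlim_at less_imp_neq[symmetric])

lemma eps_seq_mono: "N \<le> n \<Longrightarrow> eps_seq n \<le> eps_seq N"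
  by (simp add: eps_seq_def frac_le)

context elliptic_form
begin

text \<open>For \<open>e \<le> 0\<close> nothing is known about the mollification, but the
  multiplication lemma wants linearity at every \<open>e\<close>. The zero functional fills the gap,
  and bounds for small positive \<open>e\<close> do not see it.\<close>

definition S' :: "real \<Rightarrow> (real^'n \<Rightarrow> real) \<Rightarrow> real" where
  "S' e = (if e > 0 then S [] e else (\<lambda>_. 0))"

lemma S'_lin: "lin V (S' e)"
  unfolding lin_def
proof (intro allI impI, elim conjE)
  fix K and \<phi> \<psi> :: "real^'n \<Rightarrow> real" assume K: "compact K" and p: "tfn K \<phi>" and q: "tfn K \<psi>"
  show "S' e (\<lambda>x. \<phi> x + \<psi> x) = S' e \<phi> + S' e \<psi> \<and> S' e (\<lambda>x. \<phi> x - \<psi> x) = S' e \<phi> - S' e \<psi>"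
  proof (cases "e > 0")
    case True
    note i = integrable_smooth_mult_tfn[OF z_smooth[OF True, of "[]"] K]
    show ?thesis using i[OF p] i[OF q] True by (simp add: S'_def S_def distrib_left right_diff_distrib)
  qed (simp add: S'_def)
qed

text \<open>Duality: the functional is tested with \<theta>, the derivative to be estimated.
  Integration by parts makes the square of its norm equal, up to sign, to \<open>S'\<close> at a
  function which is controlled by the norm of \<theta>; one factor cancels.\<close>

lemma cutoff_nrm_bounded:
  assumes all: "\<And>k. bnd V k (\<lambda>_. T [])" and K: "compact K" "K \<subseteq> V" and h: "tfn K \<eta>"
  shows "\<exists>C. \<forall>\<^sub>F e in at_right 0. nrm (dlist l (\<lambda>x. \<eta> x * z [] e x)) \<le> C"
proof -
  note cK = compact_imp_closed[OF K(1)]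
  have "bnd V (length l) S'"
    unfolding bnd_def
  proof (intro allI impI, elim conjE)
    fix r :: "'n list" and K assume "length r \<le> length l" "compact K" "K \<subseteq> V"
    then have "ubd K nrm (\<lambda>e \<theta>. S [] e (dlist r \<theta>))" by (rule bndD[OF bnd_S[OF all]])
    then show "ubd K nrm (\<lambda>e \<theta>. S' e (dlist r \<theta>))" by (rule ubd_cong) (simp add: S'_def)
  qed
  then have "ubd K nrm (\<lambda>e \<theta>. S' e (dlist [] (\<lambda>x. \<eta> x * dlist (rev l) \<theta> x)))"
    by (intro bnd_mult_aux[OF S'_lin _ K K(1) h]) auto
  then obtain C where C: "C \<ge> 0" "\<forall>\<^sub>F e in at_right 0. \<forall>\<theta>. tfn K \<theta> \<longrightarrow> \<bar>S' e (\<lambda>x. \<eta> x * dlist (rev l) \<theta> x)\<bar> \<le> C * nrm \<theta>"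
    unfolding ubd_def by auto
  have "\<forall>\<^sub>F e in at_right 0. nrm (dlist l (\<lambda>x. \<eta> x * z [] e x)) \<le> C"
    using C(2) eventually_at_right_less[of 0]
  proof eventually_elim
    case (elim e)
    then have e: "e > 0" by simp
    define u where "u = (\<lambda>x. \<eta> x * z [] e x)"
    define \<theta> where "\<theta> = dlist l u"
    have tu: "tfn K u" unfolding u_def by (rule tfn_mult2[OF h z_smooth[OF e]])
    have tt: "tfn K \<theta>" unfolding \<theta>_def by (rule tfn_dlist[OF cK tu])
    have "(nrm \<theta>)\<^sup>2 = (\<integral>x. dlist l u x * \<theta> x \<partial>lborel)" unfolding nrm_sq unfolding \<theta>_def power2_eq_square ..
    also have "\<dots> = (-1) ^ length l * (\<integral>x. u x * dlist (rev l) \<theta> x \<partial>lborel)"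
      by (rule integration_by_parts_list[OF tfn_smooth[OF tu] K(1) tt])
    also have "(\<integral>x. u x * dlist (rev l) \<theta> x \<partial>lborel) = S' e (\<lambda>x. \<eta> x * dlist (rev l) \<theta> x)"
      using e by (simp add: S'_def S_def u_def mult_ac)
    finally have "(nrm \<theta>)\<^sup>2 \<le> \<bar>S' e (\<lambda>x. \<eta> x * dlist (rev l) \<theta> x)\<bar>"
      by (cases "even (length l)") auto
    also have "\<dots> \<le> C * nrm \<theta>" using elim tt by simp
    finally have le: "nrm \<theta> * nrm \<theta> \<le> C * nrm \<theta>" by (simp add: power2_eq_square)
    show ?case
    proof (cases "nrm \<theta> = 0")
      case True
      then show ?thesis using C(1) by (simp add: \<theta>_def u_def)
    next
      case False
      then have "nrm \<theta> > 0" using nrm_nonneg[of \<theta>] by simp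
      then show ?thesis using le by (simp add: \<theta>_def u_def)
    qed
  qed
  then show ?thesis by blast
qed

lemma cutoff_sup_bounded:
  assumes all: "\<And>k. bnd V k (\<lambda>_. T [])" and K: "compact K" "K \<subseteq> V" and h: "tfn K \<eta>"
  shows "\<exists>B. \<forall>\<^sub>F e in at_right 0. \<forall>x. \<bar>dlist l (\<lambda>x. \<eta> x * z [] e x) x\<bar> \<le> B"
proof -
  note cK = compact_imp_closed[OF K(1)]
  obtain C js where C: "C \<ge> 0" "\<And>u x. tfn K u \<Longrightarrow> \<bar>u x\<bar> \<le> C * nrm (dlist js u)"
    using Sobolev_inequality[OF K(1)] by blast
  obtain D where D: "\<forall>\<^sub>F e in at_right 0. nrm (dlist (js @ l) (\<lambda>x. \<eta> x * z [] e x)) \<le> D"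
    using cutoff_nrm_bounded[OF all K h] by blast
  have "\<forall>\<^sub>F e in at_right 0. \<forall>x. \<bar>dlist l (\<lambda>x. \<eta> x * z [] e x) x\<bar> \<le> C * D"
    using D eventually_at_right_less[of 0]
  proof eventually_elim
    case (elim e)
    have tu: "tfn K (\<lambda>x. \<eta> x * z [] e x)" by (rule tfn_mult2[OF h z_smooth]) (use elim in simp)
    show ?case
    proof
      fix x
      have "\<bar>dlist l (\<lambda>x. \<eta> x * z [] e x) x\<bar> \<le> C * nrm (dlist (js @ l) (\<lambda>x. \<eta> x * z [] e x))"
        using C(2)[OF tfn_dlist[OF cK tu]] by (simp add: dlist_append)
      also have "\<dots> \<le> C * D" using elim C(1) by (intro mult_left_mono) auto
      finally show "\<bar>dlist l (\<lambda>x. \<eta> x * z [] e x) x\<bar> \<le> C * D" .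
    qed
  qed
  then show ?thesis by blast
qed

text \<open>With \<open>D\<close> the difference of two cut-off mollifications, the square of the
  norm of \<open>dlist l D\<close> is, up to sign, \<open>S [] e \<Psi> - S [] d \<Psi>\<close> for
  one test function \<Psi>. Both values are close to \<open>T [] \<Psi>\<close> with a linear rate,
  and the Lipschitz constant of \<Psi> is bounded uniformly by the supremum bounds.\<close>

lemma cutoff_nrm_Cauchy:
  assumes all: "\<And>k. bnd V k (\<lambda>_. T [])" and K: "compact K" "K \<subseteq> V" and h: "tfn K \<eta>"
  shows "\<exists>C e0. C \<ge> 0 \<and> e0 > 0 \<and> (\<forall>e d. 0 < e \<longrightarrow> e < e0 \<longrightarrow> 0 < d \<longrightarrow> d < e0 \<longrightarrow>
     (nrm (dlist l (\<lambda>x. \<eta> x * z [] e x - \<eta> x * z [] d x)))\<^sup>2 \<le> C * (e + d))"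
proof -
  note cK = compact_imp_closed[OF K(1)]
  \<comment> \<open>Twice the derivatives of \<open>l\<close>: those of \<open>dlist l D\<close> and
    those moved onto it by parts.\<close>
  define r where "r = rev l @ l"
  define u where "u e = (\<lambda>x. \<eta> x * z [] e x)" for e
  obtain B0 where B0: "\<forall>\<^sub>F e in at_right 0. \<forall>x. \<bar>dlist r (u e) x\<bar> \<le> B0"
    using cutoff_sup_bounded[OF all K h] unfolding u_def by blast
  have "\<forall>i. \<exists>B. \<forall>\<^sub>F e in at_right 0. \<forall>x. \<bar>dlist (i # r) (u e) x\<bar> \<le> B"
    using cutoff_sup_bounded[OF all K h] unfolding u_def by blast
  then obtain B1 where B1: "\<And>i. \<forall>\<^sub>F e in at_right 0. \<forall>x. \<bar>dlist (i # r) (u e) x\<bar> \<le> B1 i" by metis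
  have "\<forall>\<^sub>F e in at_right 0. \<forall>i\<in>UNIV. \<forall>x. \<bar>dlist (i # r) (u e) x\<bar> \<le> B1 i"
    by (rule eventually_ball_finite) (use B1 in auto)
  with B0 have "\<forall>\<^sub>F e in at_right 0. (\<forall>x. \<bar>dlist r (u e) x\<bar> \<le> B0) \<and> (\<forall>i x. \<bar>dlist (i # r) (u e) x\<bar> \<le> B1 i)"
    by eventually_elim auto
  then obtain e0 where e0: "e0 > 0" "\<And>e. 0 < e \<Longrightarrow> e < e0 \<Longrightarrow> (\<forall>x. \<bar>dlist r (u e) x\<bar> \<le> B0) \<and> (\<forall>i x. \<bar>dlist (i # r) (u e) x\<bar> \<le> B1 i)"
    unfolding eventually_at_right_field by blast
  obtain H0 where H0: "H0 \<ge> 0" "\<And>x. \<bar>\<eta> x\<bar> \<le> H0" using tfn_bounded[OF K(1) h] by blast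
  have "\<forall>i. \<exists>H. H \<ge> 0 \<and> (\<forall>x. \<bar>cpartial i \<eta> x\<bar> \<le> H)"
    using tfn_bounded[OF K(1) tfn_cpartial[OF cK h]] by metis
  then obtain H1 where H1: "\<And>i. H1 i \<ge> 0" "\<And>i x. \<bar>cpartial i \<eta> x\<bar> \<le> H1 i" by metis
  \<comment> \<open>A sample parameter, only to see that the suprema \<open>B0\<close> and
    \<open>B1 i\<close> are nonnegative.\<close>
  have e02: "e0 / 2 > 0" "e0 / 2 < e0" using e0(1) by auto
  have B0n: "B0 \<ge> 0" and B1n: "B1 i \<ge> 0" for i
    using e0(2)[OF e02] by (meson abs_ge_zero order_trans)+
  \<comment> \<open>The product rule for \<Psi>; the factors 2 come from its being built from a
    difference of two functions with equal bounds.\<close>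
  define M where "M = (\<Sum>i\<in>UNIV. H1 i * (2 * B0) + H0 * (2 * B1 i))"
  have Mn: "M \<ge> 0" unfolding M_def using H0 H1 B0n B1n by (intro sum_nonneg add_nonneg_nonneg mult_nonneg_nonneg) auto
  define W where "W = (\<integral>x. \<bar>w x\<bar> \<partial>lborel)"
  have Wn: "W \<ge> 0" by (simp add: W_def)
  have "(nrm (dlist l (\<lambda>x. u e x - u d x)))\<^sup>2 \<le> (W * M) * (e + d)"
    if e: "0 < e" "e < e0" and d: "0 < d" "d < e0" for e d
  proof -
    have tu: "tfn K (u e)" "tfn K (u d)" unfolding u_def using tfn_mult2[OF h z_smooth] e d by auto
    define D where "D = (\<lambda>x. u e x - u d x)"
    have tD: "tfn K D" unfolding D_def by (rule tfn_diff[OF tu])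
    define \<Psi> where "\<Psi> = (\<lambda>x. \<eta> x * dlist r D x)"
    have tr: "tfn K (dlist r D)" by (rule tfn_dlist[OF cK tD])
    have tP: "tfn K \<Psi>" unfolding \<Psi>_def by (rule tfn_mult[OF tfn_smooth[OF h] tr])
    have dD: "dlist q D x = dlist q (u e) x - dlist q (u d) x" for q x
      unfolding D_def by (rule dlist_diff[OF _ tfn_smooth[OF tu(1)] tfn_smooth[OF tu(2)]]) auto
    have part: "\<bar>cpartial i \<Psi> x\<bar> \<le> H1 i * (2 * B0) + H0 * (2 * B1 i)" for i x
    proof -
      have "\<bar>dlist r (u e) x\<bar> \<le> B0" "\<bar>dlist r (u d) x\<bar> \<le> B0"
        "\<bar>dlist (i # r) (u e) x\<bar> \<le> B1 i" "\<bar>dlist (i # r) (u d) x\<bar> \<le> B1 i"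
        using e0(2)[OF e] e0(2)[OF d] by blast+
      then have "\<bar>dlist r D x\<bar> \<le> 2 * B0" "\<bar>dlist (i # r) D x\<bar> \<le> 2 * B1 i"
        unfolding dD by linarith+
      then have "\<bar>cpartial i \<eta> x\<bar> * \<bar>dlist r D x\<bar> + \<bar>\<eta> x\<bar> * \<bar>dlist (i # r) D x\<bar> \<le> H1 i * (2 * B0) + H0 * (2 * B1 i)"
        using H0 H1 by (intro add_mono mult_mono) auto
      moreover have "cpartial i \<Psi> x = cpartial i \<eta> x * dlist r D x + \<eta> x * dlist (i # r) D x"
        unfolding \<Psi>_def using cpartial_mult[OF tfn_smooth[OF h] tfn_smooth[OF tr]] by simp
      ultimately show ?thesis
        using abs_triangle_ineq[of "cpartial i \<eta> x * dlist r D x" "\<eta> x * dlist (i # r) D x"] by (simp add: abs_mult)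
    qed
    have err: "\<bar>T [] (mo c \<Psi>) - T [] \<Psi>\<bar> \<le> W * (M * c)" if "c > 0" for c
      unfolding W_def using Lipschitz_of_partials[OF K(1) tP part]
      by (intro T_mollification_error[OF that K(1) tP Mn]) (simp add: M_def)
    have "(nrm (dlist l D))\<^sup>2 = (\<integral>x. dlist l D x * dlist l D x \<partial>lborel)" unfolding nrm_sq unfolding power2_eq_square ..
    also have "\<dots> = (-1) ^ length l * (\<integral>x. D x * dlist (rev l) (dlist l D) x \<partial>lborel)"
      by (rule integration_by_parts_list[OF tfn_smooth[OF tD] K(1) tfn_dlist[OF cK tD]])
    also have "(\<integral>x. D x * dlist (rev l) (dlist l D) x \<partial>lborel) = (\<integral>x. z [] e x * \<Psi> x - z [] d x * \<Psi> x \<partial>lborel)"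
      by (simp add: D_def[of] u_def \<Psi>_def r_def dlist_append algebra_simps)
    also have "\<dots> = S [] e \<Psi> - S [] d \<Psi>"
      unfolding S_def using integrable_smooth_mult_tfn[OF z_smooth K(1) tP] e d by simp
    also have "\<dots> = T [] (mo e \<Psi>) - T [] (mo d \<Psi>)" using S_eq[OF _ K(1) tP] e d by simp
    finally have "(nrm (dlist l D))\<^sup>2 \<le> \<bar>T [] (mo e \<Psi>) - T [] (mo d \<Psi>)\<bar>"
      by (cases "even (length l)") auto
    also have "\<dots> \<le> W * (M * e) + W * (M * d)" using err[OF e(1)] err[OF d(1)] by linarith
    finally show ?thesis by (simp add: D_def algebra_simps)
  qed
  then show ?thesis using Mn Wn e0(1) unfolding u_def
    by (intro exI[of _ "W * M"] exI[of _ e0]) auto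
qed

text \<open>The Sobolev inequality turns the \<open>L\<^sup>2\<close> rate for \<open>js @ l\<close>
  into a bound for the supremum of \<open>dlist l\<close>, valid on the whole space and so on any
  \<open>X\<close>.\<close>

lemma cutoff_uniformly_Cauchy:
  assumes all: "\<And>k. bnd V k (\<lambda>_. T [])" and K: "compact K" "K \<subseteq> V" and h: "tfn K \<eta>"
  shows "uniformly_Cauchy_on X (\<lambda>n. dlist l (\<lambda>x. \<eta> x * z [] (eps_seq n) x))"
proof (rule uniformly_Cauchy_onI)
  fix \<epsilon> :: real assume eps: "\<epsilon> > 0"
  note cK = compact_imp_closed[OF K(1)]
  define u where "u e = (\<lambda>x. \<eta> x * z [] e x)" for e
  obtain A js where A: "A \<ge> 0" "\<And>u x. tfn K u \<Longrightarrow> \<bar>u x\<bar> \<le> A * nrm (dlist js u)"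
    using Sobolev_inequality[OF K(1)] by blast
  obtain C e0 where C: "C \<ge> 0" "e0 > 0" "\<And>e d. 0 < e \<Longrightarrow> e < e0 \<Longrightarrow> 0 < d \<Longrightarrow> d < e0 \<Longrightarrow>
     (nrm (dlist (js @ l) (\<lambda>x. u e x - u d x)))\<^sup>2 \<le> C * (e + d)"
    using cutoff_nrm_Cauchy[OF all K h, of "js @ l"] unfolding u_def by blast
  \<comment> \<open>The rate is for the squared norm, hence the comparison with the square of the
    tolerance; 2 stands for the two parameters, each at most \<open>eps_seq N\<close>.\<close>
  have "(\<lambda>n. A\<^sup>2 * C * (2 * eps_seq n)) \<longlonglongrightarrow> A\<^sup>2 * C * (2 * 0)"
    by (intro tendsto_intros eps_seq_limit)
  then have "\<forall>\<^sub>F n in sequentially. A\<^sup>2 * C * (2 * eps_seq n) < \<epsilon>\<^sup>2"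
    using eps by (intro order_tendstoD(2)) auto
  moreover have "\<forall>\<^sub>F n in sequentially. eps_seq n < e0"
    using order_tendstoD(2)[OF eps_seq_limit C(2)] .
  ultimately have "\<forall>\<^sub>F n in sequentially. A\<^sup>2 * C * (2 * eps_seq n) < \<epsilon>\<^sup>2 \<and> eps_seq n < e0"
    by eventually_elim auto
  then obtain N where N: "A\<^sup>2 * C * (2 * eps_seq N) < \<epsilon>\<^sup>2" "eps_seq N < e0"
    by (auto simp: eventually_sequentially)
  show "\<exists>M. \<forall>x\<in>X. \<forall>m\<ge>M. \<forall>n\<ge>M. dist (dlist l (\<lambda>x. \<eta> x * z [] (eps_seq m) x) x) (dlist l (\<lambda>x. \<eta> x * z [] (eps_seq n) x) x) < \<epsilon>"
  proof (intro exI[of _ N] ballI allI impI)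
    fix x m n assume mn: "N \<le> m" "N \<le> n"
    let ?e = "eps_seq m" and ?d = "eps_seq n"
    have le: "?e \<le> eps_seq N" "?d \<le> eps_seq N" using eps_seq_mono mn by auto
    have tu: "tfn K (u ?e)" "tfn K (u ?d)" unfolding u_def using tfn_mult2[OF h z_smooth[OF eps_seq_pos]] by auto
    have dd: "dlist l (u ?e) x - dlist l (u ?d) x = dlist l (\<lambda>x. u ?e x - u ?d x) x"
      by (rule dlist_diff[symmetric, OF _ tfn_smooth[OF tu(1)] tfn_smooth[OF tu(2)]]) auto
    define q where "q = nrm (dlist (js @ l) (\<lambda>x. u ?e x - u ?d x))"
    have "\<bar>dlist l (u ?e) x - dlist l (u ?d) x\<bar> \<le> A * q"
      unfolding dd q_def using A(2)[OF tfn_dlist[OF cK tfn_diff[OF tu]]] by (simp add: dlist_append)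
    moreover have "A * q < \<epsilon>"
    proof (rule power_less_imp_less_base)
      have "(A * q)\<^sup>2 \<le> A\<^sup>2 * (C * (?e + ?d))"
        unfolding power_mult_distrib q_def using C(3)[OF eps_seq_pos _ eps_seq_pos, of m n] le N(2) by (intro mult_left_mono) auto
      also have "\<dots> \<le> A\<^sup>2 * (C * (2 * eps_seq N))" using le C(1) by (intro mult_left_mono) auto
      also have "\<dots> < \<epsilon>\<^sup>2" using N(1) by (simp add: mult.assoc)
      finally show "(A * q)\<^sup>2 < \<epsilon>\<^sup>2" .
    qed (use eps in simp)
    ultimately show "dist (dlist l (\<lambda>x. \<eta> x * z [] ?e x) x) (dlist l (\<lambda>x. \<eta> x * z [] ?d x) x) < \<epsilon>"
      by (simp add: dist_real_def u_def)
  qed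
qed

text \<open>A pointwise limit without any cutoff, so that no compatibility between different cutoffs
  has to be proved. It exists on \<open>V\<close>; elsewhere \<open>lim\<close> returns some value,
  in a measurable way.\<close>

definition G :: "'n list \<Rightarrow> real^'n \<Rightarrow> real" where
  "G l x = lim (\<lambda>n. dlist l (z [] (eps_seq n)) x)"

text \<open>Near \<open>K\<close> the cutoff is 1 and disappears. One neighbourhood \<open>U\<close>
  serves all lists \<open>l\<close>, as termwise differentiation requires.\<close>

lemma local_uniform_limit:
  assumes all: "\<And>k. bnd V k (\<lambda>_. T [])" and K: "compact K" "K \<subseteq> V"
  obtains U where "open U" "K \<subseteq> U" "\<And>l. uniform_limit U (\<lambda>n. dlist l (z [] (eps_seq n))) (G l) sequentially"
proof -
  obtain \<eta> K1 U where h: "compact K1" "K1 \<subseteq> V" "tfn K1 \<eta>" "open U" "K \<subseteq> U" "\<And>x. x \<in> U \<Longrightarrow> \<eta> x = 1"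
    using cutoff_exists[OF K openV] by metis
  have "uniform_limit U (\<lambda>n. dlist l (z [] (eps_seq n))) (G l) sequentially" for l
  proof -
    have eq: "dlist l (\<lambda>x. \<eta> x * z [] (eps_seq n) x) x = dlist l (z [] (eps_seq n)) x" if "x \<in> U" for n x
      by (rule dlist_cong[OF h(4) _ that]) (simp add: h(6))
    have "uniformly_Cauchy_on U (\<lambda>n. dlist l (\<lambda>x. \<eta> x * z [] (eps_seq n) x))"
      by (rule cutoff_uniformly_Cauchy[OF all h(1,2,3)])
    then have "uniformly_Cauchy_on U (\<lambda>n. dlist l (z [] (eps_seq n)))"
      unfolding uniformly_Cauchy_on_def using eq by simp
    then show ?thesis
      unfolding G_def uniformly_convergent_uniform_limit_iff[symmetric] by (rule Cauchy_uniformly_convergent)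
  qed
  then show ?thesis using h by (intro that[of U])
qed

lemma G_has_partial:
  assumes all: "\<And>k. bnd V k (\<lambda>_. T [])" and x: "x \<in> V"
  shows "has_partial i (G l) x (G (i # l) x)"
proof -
  obtain U where U: "open U" "{x} \<subseteq> U" "\<And>l. uniform_limit U (\<lambda>n. dlist l (z [] (eps_seq n))) (G l) sequentially"
    using local_uniform_limit[OF all, of "{x}"] x by auto
  obtain r where r: "r > 0" "ball x r \<subseteq> U" using U(1,2) openE by blast
  define I where "I = {-r<..<r}"
  have I: "x + t *\<^sub>R axis i 1 \<in> U" if "t \<in> I" for t
    using that r(2) by (auto simp: I_def dist_norm)
  define f where "f n t = dlist l (z [] (eps_seq n)) (x + t *\<^sub>R axis i 1)" for n t
  \<comment> \<open>Termwise differentiation on a segment through \<open>x\<close>: derivatives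
    converge uniformly, and the functions converge at \<open>t = 0\<close>. Its limit
    \<open>g\<close> is then identified with \<open>G l\<close> along the segment.\<close>
  have "\<exists>g. \<forall>t\<in>I. (\<lambda>n. f n t) \<longlonglongrightarrow> g t \<and> (g has_derivative (\<lambda>h. G (i # l) (x + t *\<^sub>R axis i 1) * h)) (at t within I)"
  proof (rule has_derivative_sequence[where ?x0.0 = 0 and l = "G l x"])
    show "convex I" by (simp add: I_def)
    show "0 \<in> I" using r by (simp add: I_def)
    have "uniform_limit {x} (\<lambda>n. dlist l (z [] (eps_seq n))) (G l) sequentially"
      by (rule uniform_limit_on_subset[OF U(3,2)])
    from tendsto_uniform_limitI[OF this, of x] show "(\<lambda>n. f n 0) \<longlonglongrightarrow> G l x" by (simp add: f_def)
    show "(f n has_derivative (\<lambda>h. dlist (i # l) (z [] (eps_seq n)) (x + t *\<^sub>R axis i 1) * h)) (at t within I)" for n t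
      unfolding f_def
      using smooth_line_deriv[OF smooth_on_dlist[OF z_smooth[OF eps_seq_pos, of "[]" n], of l], of x i t]
      by (simp add: has_field_derivative_def has_derivative_at_withinI)
    show "\<forall>\<^sub>F n in sequentially. \<forall>t\<in>I. \<forall>h. norm (dlist (i # l) (z [] (eps_seq n)) (x + t *\<^sub>R axis i 1) * h - G (i # l) (x + t *\<^sub>R axis i 1) * h) \<le> e * norm h"
      if e: "e > 0" for e
    proof -
      have "\<forall>\<^sub>F n in sequentially. \<forall>y\<in>U. dist (dlist (i # l) (z [] (eps_seq n)) y) (G (i # l) y) < e"
        using U(3)[of "i # l"] e unfolding uniform_limit_iff by blast
      then show ?thesis
      proof eventually_elim
        case (elim n)
        show ?case
        proof (intro ballI allI)
          fix t h assume "t \<in> I"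
          then have "\<bar>dlist (i # l) (z [] (eps_seq n)) (x + t *\<^sub>R axis i 1) - G (i # l) (x + t *\<^sub>R axis i 1)\<bar> \<le> e"
            using elim I by (auto simp: dist_real_def less_imp_le)
          from mult_right_mono[OF this, of "\<bar>h\<bar>"]
          show "norm (dlist (i # l) (z [] (eps_seq n)) (x + t *\<^sub>R axis i 1) * h - G (i # l) (x + t *\<^sub>R axis i 1) * h) \<le> e * norm h"
            by (simp add: left_diff_distrib[symmetric] abs_mult)
        qed
      qed
    qed
  qed
  then obtain g where g: "\<And>t. t \<in> I \<Longrightarrow> (\<lambda>n. f n t) \<longlonglongrightarrow> g t"
    "\<And>t. t \<in> I \<Longrightarrow> (g has_derivative (\<lambda>h. G (i # l) (x + t *\<^sub>R axis i 1) * h)) (at t within I)" by blast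
  have I0: "0 \<in> I" "open I" using r by (auto simp: I_def)
  have gG: "g t = G l (x + t *\<^sub>R axis i 1)" if "t \<in> I" for t
    using limI[OF g(1)[OF that]] by (simp add: G_def f_def)
  have ev: "\<forall>\<^sub>F t in nhds 0. g t = G l (x + t *\<^sub>R axis i 1)"
    by (rule eventually_mono[OF eventually_nhds_in_open[OF I0(2,1)] gG])
  have "(g has_real_derivative G (i # l) x) (at 0)"
    using g(2)[OF I0(1)] at_within_open[OF I0] by (simp add: has_field_derivative_def)
  then show ?thesis unfolding has_partial_def
    using DERIV_cong_ev[OF refl ev refl] by blast
qed

lemma G_continuous:
  assumes all: "\<And>k. bnd V k (\<lambda>_. T [])"
  shows "continuous_on V (G l)"
proof (rule continuous_at_imp_continuous_on, rule ballI)
  fix x assume x: "x \<in> V"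
  obtain U where U: "open U" "{x} \<subseteq> U" "\<And>l. uniform_limit U (\<lambda>n. dlist l (z [] (eps_seq n))) (G l) sequentially"
    using local_uniform_limit[OF all, of "{x}"] x by auto
  have "continuous_on U (dlist l (z [] (eps_seq n)))" for n
    using smooth_on_continuous[OF z_smooth[OF eps_seq_pos]] continuous_on_subset by blast
  then have "continuous_on U (G l)"
    by (intro uniform_limit_theorem[OF _ U(3)]) auto
  then show "isCont (G l) x" using U(1,2) by (simp add: continuous_on_eq_continuous_at)
qed

text \<open>The functions \<open>G l\<close> form a class closed under partial derivatives, so
  \<open>G []\<close> is smooth. It equals \<open>w\<close> almost everywhere because the
  mollifications, tested with \<phi>, converge to the integral of \<open>G [] * \<phi>\<close> and
  also to \<open>T [] \<phi>\<close>.\<close>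

theorem smooth_representative:
  assumes all: "\<And>k. bnd V k (\<lambda>_. T [])"
  shows "\<exists>g. smooth_on V g \<and> g \<in> borel_measurable borel \<and> (AE x in lborel. x \<in> V \<longrightarrow> g x = w x)"
proof (intro exI conjI)
  show "smooth_on V (G [])"
    by (rule smooth_on_coinduct[OF openV, where P = "\<lambda>f. \<exists>l. f = G l"])
      (use G_continuous[OF all] G_has_partial[OF all] in blast)+
  have zm: "z [] (eps_seq n) \<in> borel_measurable borel" for n
    by (rule smooth_measurable[OF z_smooth[OF eps_seq_pos]])
  show gm: "G [] \<in> borel_measurable borel" unfolding G_def dlist.simps
    by (rule borel_measurable_lim_metric) (rule zm)
  have wm: "w \<in> borel_measurable borel" using w_int by auto
  have gi: "integrable lborel (\<lambda>x. indicator K x * G [] x)" if K: "compact K" "K \<subseteq> V" for K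
    using borel_integrable_compact[OF K(1) continuous_on_subset[OF G_continuous[OF all] K(2)], of "[]"] by simp
  have wi: "integrable lborel (\<lambda>x. indicator K x * w x)" if K: "compact K" for K
    using integrable_mult_bounded[OF w_int, of "indicator K" 1] compact_imp_closed[OF K] by (simp add: mult.commute indicator_def)
  have "AE x in lborel. x \<in> V \<longrightarrow> G [] x - w x = 0"
  proof (rule fundamental_lemma[OF openV])
    show "(\<lambda>x. G [] x - w x) \<in> borel_measurable borel" using gm wm by measurable
    show "integrable lborel (\<lambda>x. indicator K x * (G [] x - w x))" if K: "compact K" "K \<subseteq> V" for K
      using gi[OF K] wi[OF K(1)] by (simp add: right_diff_distrib)
    fix K \<phi> assume K: "compact K" "K \<subseteq> V" and p: "tfn K \<phi>"
    obtain U where U: "open U" "K \<subseteq> U" "\<And>l. uniform_limit U (\<lambda>n. dlist l (z [] (eps_seq n))) (G l) sequentially"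
      using local_uniform_limit[OF all K] by blast
    obtain B where B: "B \<ge> 0" "\<And>x. \<bar>\<phi> x\<bar> \<le> B" using tfn_bounded[OF K(1) p] by blast
    have ip: "integrable lborel (\<lambda>x. \<bar>\<phi> x\<bar>)" using tfn_integrable[OF K(1) p] by simp
    have eqG: "(\<lambda>x. (indicator K x * G [] x) * \<phi> x) = (\<lambda>x. G [] x * \<phi> x)"
      using tfn_zero[OF p] by (auto simp: indicator_def fun_eq_iff)
    have iG: "integrable lborel (\<lambda>x. G [] x * \<phi> x)"
      using integrable_mult_bounded[OF gi[OF K] tfn_measurable[OF p] B(2)] unfolding eqG .
    have iz: "integrable lborel (\<lambda>x. z [] (eps_seq n) x * \<phi> x)" for n
      by (rule integrable_smooth_mult_tfn[OF z_smooth[OF eps_seq_pos] K(1) p])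
    have iw: "integrable lborel (\<lambda>x. w x * \<phi> x)" by (rule integrable_mult_tfn[OF w_int K(1) p])
    have "(\<lambda>n. \<integral>x. z [] (eps_seq n) x * \<phi> x \<partial>lborel) \<longlonglongrightarrow> (\<integral>x. G [] x * \<phi> x \<partial>lborel)"
    proof (rule LIMSEQ_I)
      fix r :: real assume r: "r > 0"
      define P where "P = (\<integral>x. \<bar>\<phi> x\<bar> \<partial>lborel)"
      have P: "P \<ge> 0" by (simp add: P_def)
      \<comment> \<open>The summand 1 protects against a test function with zero integral
        norm.\<close>
      define e where "e = r / (P + 1)"
      have e: "e > 0" using r P by (simp add: e_def)
      have "\<forall>\<^sub>F n in sequentially. \<forall>y\<in>U. dist (dlist [] (z [] (eps_seq n)) y) (G [] y) < e"
        using U(3)[of "[]"] e unfolding uniform_limit_iff by blast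
      then obtain N where N: "\<And>n y. n \<ge> N \<Longrightarrow> y \<in> U \<Longrightarrow> \<bar>z [] (eps_seq n) y - G [] y\<bar> < e"
        by (auto simp: eventually_sequentially dist_real_def)
      have "norm ((\<integral>x. z [] (eps_seq n) x * \<phi> x \<partial>lborel) - (\<integral>x. G [] x * \<phi> x \<partial>lborel)) < r" if n: "n \<ge> N" for n
      proof -
        have "(\<integral>x. z [] (eps_seq n) x * \<phi> x \<partial>lborel) - (\<integral>x. G [] x * \<phi> x \<partial>lborel)
           = (\<integral>x. z [] (eps_seq n) x * \<phi> x - G [] x * \<phi> x \<partial>lborel)" using iz iG by simp
        then have "norm ((\<integral>x. z [] (eps_seq n) x * \<phi> x \<partial>lborel) - (\<integral>x. G [] x * \<phi> x \<partial>lborel))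
           \<le> (\<integral>x. \<bar>z [] (eps_seq n) x * \<phi> x - G [] x * \<phi> x\<bar> \<partial>lborel)" using integral_abs_bound by simp
        also have "\<dots> \<le> (\<integral>x. e * \<bar>\<phi> x\<bar> \<partial>lborel)"
        proof (rule integral_mono)
          show "integrable lborel (\<lambda>x. \<bar>z [] (eps_seq n) x * \<phi> x - G [] x * \<phi> x\<bar>)" using iz iG by simp
          show "integrable lborel (\<lambda>x. e * \<bar>\<phi> x\<bar>)" using ip by simp
          fix x
          show "\<bar>z [] (eps_seq n) x * \<phi> x - G [] x * \<phi> x\<bar> \<le> e * \<bar>\<phi> x\<bar>"
          proof (cases "x \<in> K")
            case True
            then have "\<bar>z [] (eps_seq n) x - G [] x\<bar> \<le> e" using N[OF n, of x] U(2) by auto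
            from mult_right_mono[OF this, of "\<bar>\<phi> x\<bar>"] show ?thesis
              by (simp add: left_diff_distrib[symmetric] abs_mult)
          qed (use tfn_zero[OF p] in simp)
        qed
        also have "\<dots> = e * P" by (simp add: P_def)
        also have "\<dots> < r" using r P by (simp add: e_def field_simps)
        finally show ?thesis .
      qed
      then show "\<exists>N. \<forall>n\<ge>N. norm ((\<integral>x. z [] (eps_seq n) x * \<phi> x \<partial>lborel) - (\<integral>x. G [] x * \<phi> x \<partial>lborel)) < r" by blast
    qed
    moreover have "(\<lambda>n. \<integral>x. z [] (eps_seq n) x * \<phi> x \<partial>lborel) \<longlonglongrightarrow> T [] \<phi>"
      using filterlim_compose[OF T_limit[OF K(1) p, of "[]"] eps_seq_at_right] S_eq[OF eps_seq_pos K(1) p, of "[]"]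
      by (simp add: S_def)
    ultimately have "(\<integral>x. G [] x * \<phi> x \<partial>lborel) = (\<integral>x. w x * \<phi> x \<partial>lborel)"
      using LIMSEQ_unique by (force simp: T_def)
    then show "(\<integral>x. (G [] x - w x) * \<phi> x \<partial>lborel) = 0"
      using iG iw by (simp add: left_diff_distrib)
  qed
  then show "AE x in lborel. x \<in> V \<longrightarrow> G [] x = w x" by eventually_elim auto
qed

end

section \<open>The local regularity theorem\<close>

text \<open>A nonempty open set is not negligible.\<close>

lemma continuous_AE_zero:
  fixes E :: "'a::euclidean_space \<Rightarrow> real"
  assumes "open V" "continuous_on V E" "AE x in lborel. x \<in> V \<longrightarrow> E x = 0" "x \<in> V"
  shows "E x = 0"
proof (rule ccontr)
  assume "E x \<noteq> 0"
  define O' where "O' = V \<inter> E -` (- {0})"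
  have O: "open O'" unfolding O'_def
    using continuous_open_preimage[OF assms(2,1), of "- {0}"] by auto
  have "AE x in lborel. \<not> x \<in> O'" using assms(3) by eventually_elim (auto simp: O'_def)
  then have "O' \<in> null_sets lborel"
    using AE_iff_null_sets[of O' lborel] O by simp
  then have "negligible O'" using null_sets_completionI negligible_iff_null_sets by blast
  moreover have "x \<in> O'" using assms(4) \<open>E x \<noteq> 0\<close> by (simp add: O'_def)
  ultimately show False using open_not_negligible[OF O] by auto
qed

lemma inj_alpha_list: "inj_on alpha_list A"
proof (rule inj_onI)
  fix \<alpha> \<beta> :: "'a \<Rightarrow> nat" assume "alpha_list \<alpha> = alpha_list \<beta>"
  then show "\<alpha> = \<beta>" by (metis count_alpha_list ext)
qed

lemma count_alpha_list_eq: "count (mset (alpha_list \<alpha>)) = \<alpha>"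
  using count_alpha_list by (rule ext)

lemma tfn_cderiv: "compact K \<Longrightarrow> tfn K \<phi> \<Longrightarrow> tfn K (cderiv \<alpha> \<phi>)"
  unfolding cderiv_def by (rule tfn_dlist[OF compact_imp_closed])

text \<open>The equation free of periodicity: Borel functions on the whole space replace the chosen
  weak derivatives, and test functions live in \<open>V\<close>. It is instantiated once with the
  coefficients of the differential operator, and once with \<open>mu\<close>, \<open>c\<close> and
  all coefficients zero.\<close>

locale weak_solution =
  fixes V :: "(real^'n::finite) set" and s :: nat and lam mu c :: real
    and p :: "('n \<Rightarrow> nat) \<Rightarrow> real^'n \<Rightarrow> real" and w :: "real^'n \<Rightarrow> real" and gw :: "('n \<Rightarrow> nat) \<Rightarrow> real^'n \<Rightarrow> real"
  assumes openV: "open V" and s1: "s \<ge> 1" and lam: "lam > 0" and mu: "mu \<ge> 0"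
    and p: "\<And>\<alpha>. \<alpha> \<in> multi_indices s \<Longrightarrow> smooth_on V (p \<alpha>)"
    and w: "integrable lborel w"
    and gm: "\<And>\<alpha>. \<alpha> \<in> multi_indices s \<Longrightarrow> gw \<alpha> \<in> borel_measurable borel"
    and g2: "\<And>\<alpha>. \<alpha> \<in> multi_indices s \<Longrightarrow> integrable lborel (\<lambda>x. (gw \<alpha> x)\<^sup>2)"
    and wder: "\<And>\<alpha> K \<phi>. \<alpha> \<in> multi_indices s \<Longrightarrow> compact K \<Longrightarrow> K \<subseteq> V \<Longrightarrow> tfn K \<phi> \<Longrightarrow>
       (\<integral>x. w x * cderiv \<alpha> \<phi> x \<partial>lborel) = (-1) ^ mi_order \<alpha> * (\<integral>x. gw \<alpha> x * \<phi> x \<partial>lborel)"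
    and eq: "\<And>K \<phi>. compact K \<Longrightarrow> K \<subseteq> V \<Longrightarrow> tfn K \<phi> \<Longrightarrow>
       lam * (\<Sum>\<alpha>\<in>multi_indices s. \<integral>x. gw \<alpha> x * cderiv \<alpha> \<phi> x \<partial>lborel)
       + mu * (\<integral>x. (\<Sum>\<alpha>\<in>multi_indices s. p \<alpha> x * gw \<alpha> x) * (\<Sum>\<beta>\<in>multi_indices s. p \<beta> x * cderiv \<beta> \<phi> x) \<partial>lborel)
       = c * (\<integral>x. w x * \<phi> x \<partial>lborel)"
begin

abbreviation "MI \<equiv> multi_indices s :: ('n \<Rightarrow> nat) set"

definition LI :: "'n list set" where "LI = alpha_list ` MI"

text \<open>The form written as one double sum over derivatives of the two arguments:
  \<open>lam\<close> on the diagonal, and the product of coefficients that arises from expanding the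
  \<open>mu\<close> term.\<close>

definition coef :: "'n list \<Rightarrow> 'n list \<Rightarrow> real^'n \<Rightarrow> real" where
  "coef l k x = (if l = k then lam else 0) + mu * (p (count (mset l)) x * p (count (mset k)) x)"

lemma sum_LI: "(\<Sum>l\<in>LI. F l) = (\<Sum>\<alpha>\<in>MI. F (alpha_list \<alpha>))"
  unfolding LI_def by (rule sum.reindex_cong[OF inj_alpha_list]) auto

lemma coef_smooth: "l \<in> LI \<Longrightarrow> k \<in> LI \<Longrightarrow> smooth_on V (coef l k)"
  unfolding coef_def LI_def
  by (auto simp: count_alpha_list_eq intro!: smooth_on_add smooth_on_const smooth_on_cmult smooth_on_mult openV p)

lemma weak_deriv_mult_integrable: "\<alpha> \<in> MI \<Longrightarrow> compact K \<Longrightarrow> tfn K \<phi> \<Longrightarrow> integrable lborel (\<lambda>x. gw \<alpha> x * \<phi> x)"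
  by (rule integrable_mult_L2) (auto intro: gm g2 tfn_sq_integrable dest: tfn_measurable)

lemma tfn_coeff_cderiv:
  assumes "compact K" "K \<subseteq> V" "tfn K \<phi>" "\<alpha> \<in> MI" "\<beta> \<in> MI"
  shows "tfn K (\<lambda>x. p \<alpha> x * p \<beta> x * cderiv \<beta> \<phi> x)"
  by (rule tfn_mult_on[OF assms(1,2) openV _ tfn_cderiv]) (intro smooth_on_mult openV p assms)+

lemma integral_products:
  assumes K: "compact K" "K \<subseteq> V" and t: "tfn K \<phi>"
  shows "(\<integral>x. (\<Sum>\<alpha>\<in>MI. p \<alpha> x * gw \<alpha> x) * (\<Sum>\<beta>\<in>MI. p \<beta> x * cderiv \<beta> \<phi> x) \<partial>lborel)
     = (\<Sum>\<alpha>\<in>MI. \<Sum>\<beta>\<in>MI. \<integral>x. gw \<alpha> x * (p \<alpha> x * p \<beta> x * cderiv \<beta> \<phi> x) \<partial>lborel)"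
proof -
  have "(\<lambda>x. (\<Sum>\<alpha>\<in>MI. p \<alpha> x * gw \<alpha> x) * (\<Sum>\<beta>\<in>MI. p \<beta> x * cderiv \<beta> \<phi> x))
     = (\<lambda>x. \<Sum>\<alpha>\<in>MI. \<Sum>\<beta>\<in>MI. gw \<alpha> x * (p \<alpha> x * p \<beta> x * cderiv \<beta> \<phi> x))"
    by (simp add: sum_product mult_ac)
  then show ?thesis
    using weak_deriv_mult_integrable[OF _ K(1) tfn_coeff_cderiv[OF K t]] by (simp add: Bochner_Integration.integral_sum)
qed

lemma weak_dlist:
  assumes "\<alpha> \<in> MI" "compact K" "K \<subseteq> V" "tfn K \<phi>"
  shows "(-1) ^ mi_order \<alpha> * (\<integral>x. w x * dlist (alpha_list \<alpha>) \<phi> x \<partial>lborel) = (\<integral>x. gw \<alpha> x * \<phi> x \<partial>lborel)"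
  using wder[OF assms] by (simp add: cderiv_def mult.assoc[symmetric] power_mult_distrib[symmetric])

text \<open>Coercivity with constant \<open>lam\<close>: on the diagonal the form is
  \<open>lam\<close> times the sum of squared norms plus \<open>mu\<close> times the integral of the
  square of \<open>D\<close>, and the latter is nonnegative.\<close>

sublocale E: elliptic_form V s LI coef lam w
proof
  show "finite LI" unfolding LI_def by (intro finite_imageI finite_multi_indices)
  show "length l \<le> s" if "l \<in> LI" for l
    using that by (auto simp: LI_def length_alpha_list multi_indices_def)
  show "\<exists>m\<in>LI. mset m = mset l" if "length l \<le> s" for l :: "'n list"
  proof (rule bexI[of _ "alpha_list (count (mset l))"])
    show "mset (alpha_list (count (mset l))) = mset l" by (simp add: multiset_eq_iff count_alpha_list)
    show "alpha_list (count (mset l)) \<in> LI"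
      using that by (auto simp: LI_def multi_indices_def mi_order_count)
  qed
  show "smooth_on V (coef l k)" if "l \<in> LI" "k \<in> LI" for l k using that by (rule coef_smooth)
  fix K \<phi> assume K: "compact K" "K \<subseteq> V" and t: "tfn K \<phi>"
  define D where "D x = (\<Sum>\<alpha>\<in>MI. p \<alpha> x * cderiv \<alpha> \<phi> x)" for x
  have tD: "tfn K D" unfolding D_def
    by (intro tfn_sum tfn_mult_on[OF K openV] p tfn_cderiv[OF K(1) t])
  have dint: "integrable lborel (\<lambda>x. cderiv \<alpha> \<phi> x * (p \<alpha> x * p \<beta> x * cderiv \<beta> \<phi> x))" if "\<alpha> \<in> MI" "\<beta> \<in> MI" for \<alpha> \<beta>
    by (rule integrable_smooth_mult_tfn[OF tfn_smooth[OF tfn_cderiv[OF K(1) t]] K(1) tfn_coeff_cderiv[OF K t that]])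
  have dd: "integrable lborel (\<lambda>x. cderiv \<alpha> \<phi> x * cderiv \<beta> \<phi> x)" for \<alpha> \<beta>
    by (rule integrable_smooth_mult_tfn[OF tfn_smooth[OF tfn_cderiv[OF K(1) t]] K(1) tfn_cderiv[OF K(1) t]])
  have summand: "(\<integral>x. cderiv \<alpha> \<phi> x * (coef (alpha_list \<alpha>) (alpha_list \<beta>) x * cderiv \<beta> \<phi> x) \<partial>lborel)
     = (if \<alpha> = \<beta> then lam * (nrm (cderiv \<alpha> \<phi>))\<^sup>2 else 0) + mu * (\<integral>x. cderiv \<alpha> \<phi> x * (p \<alpha> x * p \<beta> x * cderiv \<beta> \<phi> x) \<partial>lborel)"
    if ab: "\<alpha> \<in> MI" "\<beta> \<in> MI" for \<alpha> \<beta>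
  proof -
    have "(\<lambda>x. cderiv \<alpha> \<phi> x * (coef (alpha_list \<alpha>) (alpha_list \<beta>) x * cderiv \<beta> \<phi> x))
      = (\<lambda>x. (if \<alpha> = \<beta> then lam else 0) * (cderiv \<alpha> \<phi> x * cderiv \<beta> \<phi> x) + mu * (cderiv \<alpha> \<phi> x * (p \<alpha> x * p \<beta> x * cderiv \<beta> \<phi> x)))"
      using inj_on_eq_iff[OF inj_alpha_list[of UNIV], of \<alpha> \<beta>] by (auto simp: coef_def count_alpha_list_eq algebra_simps)
    moreover have "(nrm (cderiv \<alpha> \<phi>))\<^sup>2 = (\<integral>x. cderiv \<alpha> \<phi> x * cderiv \<alpha> \<phi> x \<partial>lborel)"
      unfolding nrm_sq unfolding power2_eq_square ..
    ultimately show ?thesis using dd dint[OF ab] by (cases "\<alpha> = \<beta>") auto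
  qed
  have "(\<Sum>\<alpha>\<in>MI. \<Sum>\<beta>\<in>MI. \<integral>x. cderiv \<alpha> \<phi> x * (p \<alpha> x * p \<beta> x * cderiv \<beta> \<phi> x) \<partial>lborel) = (\<integral>x. D x * D x \<partial>lborel)"
  proof -
    have "(\<lambda>x. D x * D x) = (\<lambda>x. \<Sum>\<alpha>\<in>MI. \<Sum>\<beta>\<in>MI. cderiv \<alpha> \<phi> x * (p \<alpha> x * p \<beta> x * cderiv \<beta> \<phi> x))"
      by (simp add: D_def sum_product mult_ac)
    then show ?thesis using dint by (simp add: Bochner_Integration.integral_sum)
  qed
  then have "(\<Sum>l\<in>LI. \<Sum>k\<in>LI. \<integral>x. dlist l \<phi> x * (coef l k x * dlist k \<phi> x) \<partial>lborel)
     = lam * (\<Sum>l\<in>LI. (nrm (dlist l \<phi>))\<^sup>2) + mu * (\<integral>x. D x * D x \<partial>lborel)"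
    unfolding sum_LI cderiv_def[symmetric]
    by (simp add: summand sum.distrib sum_distrib_left[symmetric] finite_multi_indices)
  moreover have "mu * (\<integral>x. D x * D x \<partial>lborel) \<ge> 0" using mu by simp
  ultimately show "lam * (\<Sum>l\<in>LI. (nrm (dlist l \<phi>))\<^sup>2) \<le> (\<Sum>l\<in>LI. \<Sum>k\<in>LI. \<integral>x. dlist l \<phi> x * (coef l k x * dlist k \<phi> x) \<partial>lborel)"
    by linarith
qed (use openV lam w in auto)

text \<open>The defining property of the weak derivative \<open>gw\<close>, used with the test
  function \<open>coef * cderiv \<beta> \<phi>\<close>, moves all derivatives off \<open>w\<close>,
  so that only \<open>T []\<close> is left.\<close>

lemma weak_equation:
  assumes K: "compact K" "K \<subseteq> V" and t: "tfn K \<phi>"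
  shows "(\<Sum>l\<in>LI. \<Sum>k\<in>LI. (-1) ^ length l * E.T [] (dlist l (\<lambda>x. coef l k x * dlist k \<phi> x))) = c * E.T [] \<phi>"
proof -
  have summand: "(-1) ^ mi_order \<alpha> * (\<integral>x. w x * dlist (alpha_list \<alpha>) (\<lambda>x. coef (alpha_list \<alpha>) (alpha_list \<beta>) x * cderiv \<beta> \<phi> x) x \<partial>lborel)
     = (if \<alpha> = \<beta> then lam * (\<integral>x. gw \<alpha> x * cderiv \<alpha> \<phi> x \<partial>lborel) else 0)
       + mu * (\<integral>x. gw \<alpha> x * (p \<alpha> x * p \<beta> x * cderiv \<beta> \<phi> x) \<partial>lborel)"
    if ab: "\<alpha> \<in> MI" "\<beta> \<in> MI" for \<alpha> \<beta>
  proof -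
    have "tfn K (\<lambda>x. coef (alpha_list \<alpha>) (alpha_list \<beta>) x * cderiv \<beta> \<phi> x)"
      by (rule tfn_mult_on[OF K openV coef_smooth tfn_cderiv[OF K(1) t]]) (use ab in \<open>auto simp: LI_def\<close>)
    from weak_dlist[OF ab(1) K this]
    have "(-1) ^ mi_order \<alpha> * (\<integral>x. w x * dlist (alpha_list \<alpha>) (\<lambda>x. coef (alpha_list \<alpha>) (alpha_list \<beta>) x * cderiv \<beta> \<phi> x) x \<partial>lborel)
      = (\<integral>x. gw \<alpha> x * (coef (alpha_list \<alpha>) (alpha_list \<beta>) x * cderiv \<beta> \<phi> x) \<partial>lborel)" .
    also have "(\<lambda>x. gw \<alpha> x * (coef (alpha_list \<alpha>) (alpha_list \<beta>) x * cderiv \<beta> \<phi> x))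
       = (\<lambda>x. (if \<alpha> = \<beta> then lam else 0) * (gw \<alpha> x * cderiv \<beta> \<phi> x) + mu * (gw \<alpha> x * (p \<alpha> x * p \<beta> x * cderiv \<beta> \<phi> x)))"
      using inj_on_eq_iff[OF inj_alpha_list[of UNIV], of \<alpha> \<beta>] by (auto simp: coef_def count_alpha_list_eq algebra_simps)
    finally show ?thesis
      using weak_deriv_mult_integrable[OF ab(1) K(1) tfn_cderiv[OF K(1) t, of \<beta>]] weak_deriv_mult_integrable[OF ab(1) K(1) tfn_coeff_cderiv[OF K t ab]] by simp
  qed
  have "(\<Sum>l\<in>LI. \<Sum>k\<in>LI. (-1) ^ length l * E.T [] (dlist l (\<lambda>x. coef l k x * dlist k \<phi> x)))
    = (\<Sum>\<alpha>\<in>MI. \<Sum>\<beta>\<in>MI. (if \<alpha> = \<beta> then lam * (\<integral>x. gw \<alpha> x * cderiv \<alpha> \<phi> x \<partial>lborel) else 0)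
       + mu * (\<integral>x. gw \<alpha> x * (p \<alpha> x * p \<beta> x * cderiv \<beta> \<phi> x) \<partial>lborel))"
    unfolding sum_LI
  proof (intro sum.cong refl)
    fix \<alpha> \<beta> assume "\<alpha> \<in> MI" "\<beta> \<in> MI"
    from summand[OF this]
    show "(-1) ^ length (alpha_list \<alpha>) * E.T [] (dlist (alpha_list \<alpha>) (\<lambda>x. coef (alpha_list \<alpha>) (alpha_list \<beta>) x * dlist (alpha_list \<beta>) \<phi> x))
      = (if \<alpha> = \<beta> then lam * (\<integral>x. gw \<alpha> x * cderiv \<alpha> \<phi> x \<partial>lborel) else 0)
       + mu * (\<integral>x. gw \<alpha> x * (p \<alpha> x * p \<beta> x * cderiv \<beta> \<phi> x) \<partial>lborel)"
      by (simp add: length_alpha_list E.T_def cderiv_def)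
  qed
  also have "\<dots> = lam * (\<Sum>\<alpha>\<in>MI. \<integral>x. gw \<alpha> x * cderiv \<alpha> \<phi> x \<partial>lborel) + mu * (\<Sum>\<alpha>\<in>MI. \<Sum>\<beta>\<in>MI. \<integral>x. gw \<alpha> x * (p \<alpha> x * p \<beta> x * cderiv \<beta> \<phi> x) \<partial>lborel)"
    by (simp add: sum.distrib sum_distrib_left finite_multi_indices)
  finally show ?thesis using eq[OF K t] unfolding integral_products[OF K t] by (simp add: E.T_def)
qed

text \<open>This is where membership in \<open>H\<^sup>s\<close> enters: each derivative up to order
  \<open>s\<close> is a square integrable function, and Cauchy-Schwarz does the rest.\<close>

lemma initial_bound: "bnd V s (\<lambda>_. E.T [])"
  unfolding bnd_def
proof (intro allI impI, elim conjE)
  fix r :: "'n list" and K assume r: "length r \<le> s" and K: "compact K" "K \<subseteq> V"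
  define \<alpha> where "\<alpha> = count (mset r)"
  have a: "\<alpha> \<in> MI" using r by (simp add: \<alpha>_def multi_indices_def mi_order_count)
  have "\<bar>E.T [] (dlist r \<theta>)\<bar> \<le> nrm (gw \<alpha>) * nrm \<theta>" if t: "tfn K \<theta>" for \<theta>
  proof -
    have "dlist r \<theta> = cderiv \<alpha> \<theta>" unfolding \<alpha>_def using dlist_eq_cderiv[OF tfn_smooth[OF t]] by auto
    then have "\<bar>E.T [] (dlist r \<theta>)\<bar> = \<bar>\<integral>x. gw \<alpha> x * \<theta> x \<partial>lborel\<bar>"
      using wder[OF a K t] by (simp add: E.T_def abs_mult)
    also have "\<dots> \<le> nrm (gw \<alpha>) * nrm \<theta>"
      by (rule Cauchy_Schwarz_tfn[OF _ g2[OF a] K(1) t]) (use gm[OF a] in simp)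
    finally show ?thesis .
  qed
  then show "ubd K nrm (\<lambda>e \<theta>. E.T [] (dlist r \<theta>))"
    unfolding ubd_def by (intro exI[of _ "nrm (gw \<alpha>)"]) (auto simp: nrm_nonneg)
qed

text \<open>Once \<open>w\<close> has a smooth representative, integrating by parts back turns the
  weak equation into the statement that the defect \<open>Q\<close> of the pointwise equation
  integrates to zero against every test function. Being continuous, \<open>Q\<close> vanishes
  everywhere on \<open>V\<close>.\<close>

theorem regularity:
  obtains g where "smooth_on V g" "AE x in lborel. x \<in> V \<longrightarrow> g x = w x"
    "\<And>x. x \<in> V \<Longrightarrow> lam * (\<Sum>\<alpha>\<in>MI. (-1) ^ mi_order \<alpha> * cderiv (\<lambda>i. 2 * \<alpha> i) g x) + mu * Dstar s p (Dc s p g) x = c * g x"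
proof -
  have bk: "bnd V k (\<lambda>_. E.T [])" for k
    by (rule E.regularity_all_orders[OF s1 initial_bound]) (rule weak_equation)
  obtain g where g: "smooth_on V g" "g \<in> borel_measurable borel" "AE x in lborel. x \<in> V \<longrightarrow> g x = w x"
    using E.smooth_representative[OF bk] by blast
  have wg: "(\<integral>x. w x * \<psi> x \<partial>lborel) = (\<integral>x. g x * \<psi> x \<partial>lborel)" if "compact K" "K \<subseteq> V" "tfn K \<psi>" for K \<psi>
  proof (rule integral_cong_AE)
    show "AE x in lborel. w x * \<psi> x = g x * \<psi> x"
      using g(3) by eventually_elim (use that tfn_zero[OF that(3)] in \<open>metis mult_zero_right subset_iff\<close>)
  qed (use w g(2) tfn_measurable[OF that(3)] in auto)
  have sD: "smooth_on V (Dc s p g)" unfolding Dc_def cderiv_def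
    by (intro smooth_on_sum smooth_on_mult openV p smooth_on_dlist g(1))
  define Q where "Q x = lam * (\<Sum>\<alpha>\<in>MI. (-1) ^ mi_order \<alpha> * cderiv (\<lambda>i. 2 * \<alpha> i) g x) + mu * Dstar s p (Dc s p g) x - c * g x" for x
  have cQ: "continuous_on V Q" unfolding Q_def Dstar_def cderiv_def
    by (intro continuous_intros smooth_on_continuous g(1) smooth_on_mult openV p sD smooth_on_continuous0)
  have int0: "(\<integral>x. Q x * \<phi> x \<partial>lborel) = 0" if K: "compact K" "K \<subseteq> V" and t: "tfn K \<phi>" for K \<phi>
  proof -
    obtain \<eta> K1 U where h: "compact K1" "K1 \<subseteq> V" "tfn K1 \<eta>" "open U" "K \<subseteq> U" "\<And>x. x \<in> U \<Longrightarrow> \<eta> x = 1"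
      using cutoff_exists[OF K openV] by metis
    \<comment> \<open>Integration by parts was proved for functions smooth on the whole space.
      Cut-off versions of \<open>g\<close> and of the coefficients are, and they coincide with the
      originals on an open set around the support of \<phi>.\<close>
    define G where "G x = g x * \<eta> x" for x
    define P where "P \<alpha> x = p \<alpha> x * \<eta> x" for \<alpha> x
    have tG: "tfn K1 G" unfolding G_def[abs_def] by (rule tfn_mult_on[OF h(1,2) openV g(1) h(3)])
    have tP: "tfn K1 (P \<alpha>)" if "\<alpha> \<in> MI" for \<alpha> unfolding P_def[abs_def] by (rule tfn_mult_on[OF h(1,2) openV p[OF that] h(3)])
    note sG = tfn_smooth[OF tG]
    note sP = tfn_smooth[OF tP]
    have GU: "G x = g x" and PU: "P \<alpha> x = p \<alpha> x" if "x \<in> U" for x \<alpha> using h(6)[OF that] by (auto simp: G_def P_def)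
    have Gint: "(\<integral>x. G x * \<psi> x \<partial>lborel) = (\<integral>x. w x * \<psi> x \<partial>lborel)" if "tfn K \<psi>" for \<psi>
    proof -
      have "(\<lambda>x. G x * \<psi> x) = (\<lambda>x. g x * \<psi> x)"
      proof
        fix x show "G x * \<psi> x = g x * \<psi> x" using GU[of x] h(5) tfn_zero[OF that, of x] by (cases "x \<in> K") auto
      qed
      then show ?thesis using wg[OF K that] by simp
    qed
    define DG where "DG x = (\<Sum>\<beta>\<in>MI. P \<beta> x * cderiv \<beta> G x)" for x
    have sDG: "smooth_on UNIV DG" unfolding DG_def[abs_def] cderiv_def
      by (intro smooth_on_sum smooth_on_mult sP smooth_on_dlist sG) auto
    have DGU: "DG x = Dc s p g x" if "x \<in> U" for x
      unfolding DG_def Dc_def cderiv_def using PU[OF that] dlist_cong[OF h(4) GU that] by simp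
    \<comment> \<open>The concatenated list has the same multiset as the list of the doubled
      multi-index, so both give the same derivative of the smooth \<open>G\<close>.\<close>
    define R1 where "R1 \<alpha> = dlist (alpha_list \<alpha> @ alpha_list \<alpha>) G" for \<alpha> :: "'n \<Rightarrow> nat"
    define R2 where "R2 \<alpha> = dlist (alpha_list \<alpha>) (\<lambda>x. P \<alpha> x * DG x)" for \<alpha>
    have QU: "Q x * \<phi> x = lam * (\<Sum>\<alpha>\<in>MI. (-1) ^ mi_order \<alpha> * (R1 \<alpha> x * \<phi> x)) + mu * (\<Sum>\<alpha>\<in>MI. (-1) ^ mi_order \<alpha> * (R2 \<alpha> x * \<phi> x)) - c * (G x * \<phi> x)" for x
    proof (cases "x \<in> K")
      case True
      then have x: "x \<in> U" using h(5) by auto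
      have r1: "cderiv (\<lambda>i. 2 * \<alpha> i) g x = R1 \<alpha> x" for \<alpha>
      proof -
        have "cderiv (\<lambda>i. 2 * \<alpha> i) g x = dlist (alpha_list (\<lambda>i. 2 * \<alpha> i)) G x"
          unfolding cderiv_def by (rule dlist_cong[OF h(4) _ x]) (simp add: GU)
        also have "\<dots> = R1 \<alpha> x" unfolding R1_def
          by (rule dlist_mset[OF sG]) (simp add: multiset_eq_iff count_alpha_list)
        finally show ?thesis .
      qed
      have r2: "cderiv \<alpha> (\<lambda>y. p \<alpha> y * Dc s p g y) x = R2 \<alpha> x" for \<alpha>
        unfolding cderiv_def R2_def by (rule dlist_cong[OF h(4) _ x]) (simp add: PU DGU)
      show ?thesis unfolding Q_def Dstar_def r1 r2
        by (simp add: GU[OF x] left_diff_distrib distrib_right sum_distrib_right mult.assoc)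
    next
      case False
      then show ?thesis using tfn_zero[OF t] by simp
    qed
    have sR1: "smooth_on UNIV (R1 \<alpha>)" for \<alpha> unfolding R1_def by (rule smooth_on_dlist[OF sG])
    have sR2: "smooth_on UNIV (R2 \<alpha>)" if "\<alpha> \<in> MI" for \<alpha> unfolding R2_def
      by (intro smooth_on_dlist smooth_on_mult sDG sP[OF that]) auto
    note i1 = integrable_smooth_mult_tfn[OF sR1 K(1) t]
    note i2 = integrable_smooth_mult_tfn[OF sR2 K(1) t]
    note i3 = integrable_smooth_mult_tfn[OF sG K(1) t]
    \<comment> \<open>Moving the list over twice produces no sign; one copy then returns as the weak
      derivative, with the sign on the left.\<close>
    have I1: "(-1) ^ mi_order \<alpha> * (\<integral>x. R1 \<alpha> x * \<phi> x \<partial>lborel) = (\<integral>x. gw \<alpha> x * cderiv \<alpha> \<phi> x \<partial>lborel)" if a: "\<alpha> \<in> MI" for \<alpha>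
    proof -
      let ?l = "alpha_list \<alpha>"
      have "(\<integral>x. R1 \<alpha> x * \<phi> x \<partial>lborel) = (\<integral>x. G x * dlist (rev (?l @ ?l)) \<phi> x \<partial>lborel)"
        unfolding R1_def integration_by_parts_list[OF sG K(1) t] by (simp add: power_add[symmetric] power2_eq_square[symmetric] mult_2[symmetric] power_mult)
      also have "dlist (rev (?l @ ?l)) \<phi> = dlist ?l (cderiv \<alpha> \<phi>)"
        using E.dlist_rev[OF tfn_smooth[OF t], of "?l @ ?l"] by (simp add: cderiv_def dlist_append)
      also have "(\<integral>x. G x * dlist ?l (cderiv \<alpha> \<phi>) x \<partial>lborel) = (\<integral>x. w x * dlist ?l (cderiv \<alpha> \<phi>) x \<partial>lborel)"
        by (rule Gint[OF tfn_dlist[OF compact_imp_closed[OF K(1)] tfn_cderiv[OF K(1) t]]])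
      finally show ?thesis using weak_dlist[OF a K tfn_cderiv[OF K(1) t]] by simp
    qed
    have I2: "(-1) ^ mi_order \<alpha> * (\<integral>x. R2 \<alpha> x * \<phi> x \<partial>lborel) = (\<Sum>\<beta>\<in>MI. \<integral>x. gw \<beta> x * (p \<beta> x * p \<alpha> x * cderiv \<alpha> \<phi> x) \<partial>lborel)" if a: "\<alpha> \<in> MI" for \<alpha>
    proof -
      let ?l = "alpha_list \<alpha>"
      have "(\<integral>x. R2 \<alpha> x * \<phi> x \<partial>lborel) = (-1) ^ mi_order \<alpha> * (\<integral>x. P \<alpha> x * DG x * dlist (rev ?l) \<phi> x \<partial>lborel)"
        unfolding R2_def length_alpha_list[symmetric]
        by (rule integration_by_parts_list[OF _ K(1) t]) (intro smooth_on_mult sDG sP[OF a] open_UNIV)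
      then have "(-1) ^ mi_order \<alpha> * (\<integral>x. R2 \<alpha> x * \<phi> x \<partial>lborel) = (\<integral>x. P \<alpha> x * DG x * dlist (rev ?l) \<phi> x \<partial>lborel)"
        by (simp add: mult.assoc[symmetric] power_mult_distrib[symmetric])
      also have "dlist (rev ?l) \<phi> = cderiv \<alpha> \<phi>" unfolding cderiv_def by (rule E.dlist_rev[OF tfn_smooth[OF t]])
      also have "(\<lambda>x. P \<alpha> x * DG x * cderiv \<alpha> \<phi> x) = (\<lambda>x. \<Sum>\<beta>\<in>MI. cderiv \<beta> G x * (p \<beta> x * p \<alpha> x * cderiv \<alpha> \<phi> x))"
      proof
        fix x
        show "P \<alpha> x * DG x * cderiv \<alpha> \<phi> x = (\<Sum>\<beta>\<in>MI. cderiv \<beta> G x * (p \<beta> x * p \<alpha> x * cderiv \<alpha> \<phi> x))"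
        proof (cases "x \<in> K")
          case True
          then have x: "x \<in> U" using h(5) by auto
          show ?thesis unfolding DG_def PU[OF x] by (simp add: sum_distrib_left sum_distrib_right mult_ac)
        qed (use tfn_zero[OF tfn_cderiv[OF K(1) t]] in simp)
      qed
      also have "(\<integral>x. (\<Sum>\<beta>\<in>MI. cderiv \<beta> G x * (p \<beta> x * p \<alpha> x * cderiv \<alpha> \<phi> x)) \<partial>lborel)
         = (\<Sum>\<beta>\<in>MI. \<integral>x. cderiv \<beta> G x * (p \<beta> x * p \<alpha> x * cderiv \<alpha> \<phi> x) \<partial>lborel)"
        unfolding cderiv_def[of _ G]
        by (rule Bochner_Integration.integral_sum) (intro integrable_smooth_mult_tfn[OF smooth_on_dlist[OF sG] K(1)] tfn_coeff_cderiv[OF K t] a)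
      also have "\<dots> = (\<Sum>\<beta>\<in>MI. \<integral>x. gw \<beta> x * (p \<beta> x * p \<alpha> x * cderiv \<alpha> \<phi> x) \<partial>lborel)"
      proof (rule sum.cong[OF refl])
        fix \<beta> assume b: "\<beta> \<in> MI"
        let ?k = "alpha_list \<beta>" and ?\<theta> = "\<lambda>x. p \<beta> x * p \<alpha> x * cderiv \<alpha> \<phi> x"
        have th: "tfn K ?\<theta>" by (rule tfn_coeff_cderiv[OF K t b a])
        have "(\<integral>x. cderiv \<beta> G x * ?\<theta> x \<partial>lborel) = (-1) ^ mi_order \<beta> * (\<integral>x. G x * dlist (rev ?k) ?\<theta> x \<partial>lborel)"
          unfolding cderiv_def[of \<beta> G] length_alpha_list[symmetric] by (rule integration_by_parts_list[OF sG K(1) th])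
        also have "dlist (rev ?k) ?\<theta> = dlist ?k ?\<theta>" by (rule E.dlist_rev[OF tfn_smooth[OF th]])
        also have "(\<integral>x. G x * dlist ?k ?\<theta> x \<partial>lborel) = (\<integral>x. w x * dlist ?k ?\<theta> x \<partial>lborel)"
          by (rule Gint[OF tfn_dlist[OF compact_imp_closed[OF K(1)] th]])
        finally show "(\<integral>x. cderiv \<beta> G x * ?\<theta> x \<partial>lborel) = (\<integral>x. gw \<beta> x * ?\<theta> x \<partial>lborel)"
          using weak_dlist[OF b K th] by simp
      qed
      finally show ?thesis .
    qed
    have "(\<integral>x. Q x * \<phi> x \<partial>lborel) = lam * (\<Sum>\<alpha>\<in>MI. (-1) ^ mi_order \<alpha> * (\<integral>x. R1 \<alpha> x * \<phi> x \<partial>lborel))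
        + mu * (\<Sum>\<alpha>\<in>MI. (-1) ^ mi_order \<alpha> * (\<integral>x. R2 \<alpha> x * \<phi> x \<partial>lborel)) - c * (\<integral>x. G x * \<phi> x \<partial>lborel)"
      unfolding QU using i1 i2 i3 by (simp add: Bochner_Integration.integral_sum)
    also have "\<dots> = lam * (\<Sum>\<alpha>\<in>MI. \<integral>x. gw \<alpha> x * cderiv \<alpha> \<phi> x \<partial>lborel)
        + mu * (\<Sum>\<alpha>\<in>MI. \<Sum>\<beta>\<in>MI. \<integral>x. gw \<beta> x * (p \<beta> x * p \<alpha> x * cderiv \<alpha> \<phi> x) \<partial>lborel) - c * (\<integral>x. w x * \<phi> x \<partial>lborel)"
      using I1 I2 Gint[OF t] by simp
    \<comment> \<open>In the adjoint operator the outer index belongs to the test function, in the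
      weak equation to the solution.\<close>
    also have "(\<Sum>\<alpha>\<in>MI. \<Sum>\<beta>\<in>MI. \<integral>x. gw \<beta> x * (p \<beta> x * p \<alpha> x * cderiv \<alpha> \<phi> x) \<partial>lborel)
        = (\<Sum>\<beta>\<in>MI. \<Sum>\<alpha>\<in>MI. \<integral>x. gw \<beta> x * (p \<beta> x * p \<alpha> x * cderiv \<alpha> \<phi> x) \<partial>lborel)"
      by (rule sum.swap)
    also have "lam * (\<Sum>\<alpha>\<in>MI. \<integral>x. gw \<alpha> x * cderiv \<alpha> \<phi> x \<partial>lborel) + mu * \<dots> - c * (\<integral>x. w x * \<phi> x \<partial>lborel) = 0"
      using eq[OF K t] unfolding integral_products[OF K t] by simp
    finally show ?thesis .
  qed
  have "AE x in lborel. x \<in> V \<longrightarrow> indicator V x * Q x = 0"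
  proof (rule fundamental_lemma[OF openV])
    show "(\<lambda>x. indicator V x * Q x) \<in> borel_measurable borel"
      using borel_measurable_continuous_on_indicator[OF _ cQ] openV by simp
    show "integrable lborel (\<lambda>x. indicator K x * (indicator V x * Q x))" if K: "compact K" "K \<subseteq> V" for K
    proof -
      have "(\<lambda>x. indicator K x * (indicator V x * Q x)) = (\<lambda>x. indicator K x *\<^sub>R Q x)"
        using K(2) by (auto simp: indicator_def fun_eq_iff)
      then show ?thesis using borel_integrable_compact[OF K(1) continuous_on_subset[OF cQ K(2)]] by simp
    qed
    show "(\<integral>x. indicator V x * Q x * \<phi> x \<partial>lborel) = 0" if K: "compact K" "K \<subseteq> V" "tfn K \<phi>" for K \<phi>
    proof -
      have "(\<lambda>x. indicator V x * Q x * \<phi> x) = (\<lambda>x. Q x * \<phi> x)"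
        using K(2) tfn_zero[OF K(3)] by (auto simp: indicator_def fun_eq_iff)
      then show ?thesis using int0[OF K] by simp
    qed
  qed
  then have "AE x in lborel. x \<in> V \<longrightarrow> Q x = 0" by eventually_elim auto
  from continuous_AE_zero[OF openV cQ this] have "Q x = 0" if "x \<in> V" for x using that by blast
  then show ?thesis using that[OF g(1,3)] by (simp add: Q_def)
qed

end

section \<open>Weak derivatives and Borel representatives\<close>

lemma AE_lebesgue_on_iff:
  fixes U :: "'a::euclidean_space set"
  assumes "U \<in> sets borel"
  shows "(AE x in lebesgue_on U. P x) \<longleftrightarrow> (AE x in lborel. x \<in> U \<longrightarrow> P x)"
proof -
  have "U \<inter> space lebesgue \<in> sets lebesgue" using assms by auto
  then show ?thesis by (simp add: AE_restrict_space_iff AE_completion_iff)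
qed

text \<open>The definitions use the completed measure on subsets, the analysis uses Borel functions
  on the whole space. These rules translate between the two for a Borel function that agrees almost
  everywhere.\<close>

lemma lebesgue_on_Borel:
  fixes f F :: "'a::euclidean_space \<Rightarrow> real"
  assumes U: "U \<in> sets borel" and F: "F \<in> borel_measurable borel" and eq: "AE x in lborel. x \<in> U \<longrightarrow> f x = F x"
  shows integral_lebesgue_on_Borel: "integral\<^sup>L (lebesgue_on U) f = (\<integral>x. indicator U x * F x \<partial>lborel)"
    and integrable_lebesgue_on_Borel: "integrable (lebesgue_on U) f \<longleftrightarrow> integrable lborel (\<lambda>x. indicator U x * F x)"
    and measurable_lebesgue_on_Borel: "f \<in> borel_measurable (lebesgue_on U)"
proof -
  have Us: "U \<inter> space lebesgue \<in> sets lebesgue" using U by auto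
  have m: "(\<lambda>x. indicator U x * F x) \<in> borel_measurable borel" using F U by measurable
  have ml: "(\<lambda>x. indicator U x * F x) \<in> borel_measurable lebesgue" using m by (intro measurable_completion) simp
  have ae0: "AE x in lborel. indicator U x * F x = indicator U x *\<^sub>R f x"
    using eq by eventually_elim (auto simp: indicator_def)
  then have ae: "AE x in lebesgue. indicator U x * F x = indicator U x *\<^sub>R f x" by (rule AE_completion)
  have mf: "(\<lambda>x. indicator U x *\<^sub>R f x) \<in> borel_measurable lebesgue"
    by (rule borel_measurable_AE[OF ml ae])
  show "f \<in> borel_measurable (lebesgue_on U)"
    using mf by (simp add: borel_measurable_restrict_space_iff[OF Us])
  show "integral\<^sup>L (lebesgue_on U) f = (\<integral>x. indicator U x * F x \<partial>lborel)"
    unfolding integral_restrict_space[OF Us] using integral_cong_AE[OF ml mf ae] integral_completion[of "\<lambda>x. indicator U x * F x" lborel] m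
    by simp
  show "integrable (lebesgue_on U) f \<longleftrightarrow> integrable lborel (\<lambda>x. indicator U x * F x)"
    unfolding integrable_restrict_space[OF Us] using integrable_cong_AE[OF ml mf ae] integrable_completion[of "\<lambda>x. indicator U x * F x" lborel] m
    by simp
qed

text \<open>Extension by zero makes integrability on \<open>U\<close> the same as integrability on
  the space.\<close>

lemma Borel_representative:
  fixes f :: "'a::euclidean_space \<Rightarrow> real"
  assumes U: "U \<in> sets borel" and f: "f \<in> borel_measurable (lebesgue_on U)"
  obtains F where "F \<in> borel_measurable borel" "\<And>x. x \<notin> U \<Longrightarrow> F x = 0" "AE x in lborel. x \<in> U \<longrightarrow> f x = F x"
proof -
  have Us: "U \<inter> space lebesgue \<in> sets lebesgue" using U by auto
  have "(\<lambda>x. indicator U x *\<^sub>R f x) \<in> borel_measurable lebesgue"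
    using f by (simp add: borel_measurable_restrict_space_iff[OF Us])
  then obtain G where G: "G \<in> borel_measurable lborel" "AE x in lborel. indicator U x *\<^sub>R f x = G x"
    using completion_ex_borel_measurable_real by blast
  show ?thesis
  proof (rule that[of "\<lambda>x. indicator U x * G x"])
    show "(\<lambda>x. indicator U x * G x) \<in> borel_measurable borel" using G(1) U by measurable
    show "AE x in lborel. x \<in> U \<longrightarrow> f x = indicator U x * G x"
      using G(2) by eventually_elim (auto simp: indicator_def)
  qed auto
qed

text \<open>Local integrability speaks about compact subsets only; a countable exhaustion by compact
  sets puts measurability together.\<close>

lemma loc_integrable_measurable:
  fixes f :: "real^'n::finite \<Rightarrow> real"
  assumes "open U" "loc_integrable U f" shows "f \<in> borel_measurable (lebesgue_on U)"
proof -
  obtain C where C: "\<And>n::nat. compact (C n)" "\<And>n. C n \<subseteq> U" "\<Union>(range C) = U"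
  proof (rule open_Union_compact_subsets[OF assms(1)])
    fix C assume "\<And>n::nat. compact (C n)" "\<And>n. C n \<subseteq> U" "\<Union>(range C) = U"
    then show thesis by (intro that[of C])
  qed
  show ?thesis
  proof (rule measurable_piecewise_restrict[of "range C"])
    fix K assume "K \<in> range C"
    then have K: "compact K" "K \<subseteq> U" using C by auto
    have Ks: "K \<in> sets lebesgue" using borel_closed[OF compact_imp_closed[OF K(1)]] by auto
    have Us: "U \<in> sets lebesgue" using assms(1) by auto
    show "K \<inter> space (lebesgue_on U) \<in> sets (lebesgue_on U)"
      using Ks K(2) by (auto simp: sets_restrict_space Int_absorb1 Int_commute)
    have "restrict_space (lebesgue_on U) K = lebesgue_on K"
      using Ks Us K(2) by (subst restrict_restrict_space) (auto simp: Int_absorb1)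
    moreover have "f \<in> borel_measurable (lebesgue_on K)"
      using assms(2) K unfolding loc_integrable_def by auto
    ultimately show "f \<in> borel_measurable (restrict_space (lebesgue_on U) K)" by simp
  qed (use C in auto)
qed

lemma tfn_imp_test_fn:
  assumes "compact K" "K \<subseteq> U" "tfn K \<phi>" shows "test_fn U \<phi>"
proof -
  have "{x. \<phi> x \<noteq> 0} \<subseteq> K" using tfn_zero[OF assms(3)] by auto
  then have "closure {x. \<phi> x \<noteq> 0} \<subseteq> K" using closure_minimal[OF _ compact_imp_closed[OF assms(1)]] by blast
  moreover have "compact (closure {x. \<phi> x \<noteq> 0})"
    using bounded_subset[OF compact_imp_bounded[OF assms(1)] \<open>{x. \<phi> x \<noteq> 0} \<subseteq> K\<close>] by simp
  ultimately show ?thesis using assms by (auto simp: test_fn_def tfn_def)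
qed

lemma test_fn_imp_tfn:
  assumes "test_fn U \<phi>" obtains K where "compact K" "K \<subseteq> U" "tfn K \<phi>"
proof (rule that[of "closure {x. \<phi> x \<noteq> 0}"])
  show "tfn (closure {x. \<phi> x \<noteq> 0}) \<phi>"
    using assms closure_subset[of "{x. \<phi> x \<noteq> 0}"] by (auto simp: test_fn_def tfn_def)
qed (use assms in \<open>auto simp: test_fn_def\<close>)

lemma integral_mult_tfn_Borel:
  fixes f F :: "real^'n::finite \<Rightarrow> real"
  assumes U: "open U" and F: "F \<in> borel_measurable borel" and eq: "AE x in lborel. x \<in> U \<longrightarrow> f x = F x"
    and K: "K \<subseteq> U" "tfn K \<phi>"
  shows "integral\<^sup>L (lebesgue_on U) (\<lambda>x. f x * \<phi> x) = (\<integral>x. F x * \<phi> x \<partial>lborel)"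
proof -
  have "integral\<^sup>L (lebesgue_on U) (\<lambda>x. f x * \<phi> x) = (\<integral>x. indicator U x * (F x * \<phi> x) \<partial>lborel)"
  proof (rule integral_lebesgue_on_Borel)
    show "(\<lambda>x. F x * \<phi> x) \<in> borel_measurable borel" using F tfn_measurable[OF K(2)] by measurable
    show "AE x in lborel. x \<in> U \<longrightarrow> f x * \<phi> x = F x * \<phi> x" using eq by eventually_elim auto
  qed (use U in auto)
  also have "(\<lambda>x. indicator U x * (F x * \<phi> x)) = (\<lambda>x. F x * \<phi> x)"
    using K(1) tfn_zero[OF K(2)] by (auto simp: indicator_def fun_eq_iff)
  finally show ?thesis .
qed

lemma weak_deriv_pairing:
  assumes "is_weak_deriv U \<alpha> f g" "compact K" "K \<subseteq> U" "tfn K \<phi>"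
  shows "integral\<^sup>L (lebesgue_on U) (\<lambda>x. f x * cderiv \<alpha> \<phi> x) = (-1) ^ mi_order \<alpha> * integral\<^sup>L (lebesgue_on U) (\<lambda>x. g x * \<phi> x)"
  using assms(1) tfn_imp_test_fn[OF assms(2-4)] unfolding is_weak_deriv_def by blast

lemma weak_deriv_Borel:
  fixes f g F G :: "real^'n::finite \<Rightarrow> real"
  assumes U: "open U" and d: "is_weak_deriv U \<alpha> f g"
    and F: "F \<in> borel_measurable borel" "AE x in lborel. x \<in> U \<longrightarrow> f x = F x"
    and G: "G \<in> borel_measurable borel" "AE x in lborel. x \<in> U \<longrightarrow> g x = G x"
    and K: "compact K" "K \<subseteq> U" "tfn K \<phi>"
  shows "(\<integral>x. F x * cderiv \<alpha> \<phi> x \<partial>lborel) = (-1) ^ mi_order \<alpha> * (\<integral>x. G x * \<phi> x \<partial>lborel)"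
  using weak_deriv_pairing[OF d K]
  unfolding integral_mult_tfn_Borel[OF U F K(2) tfn_cderiv[OF K(1,3)]] integral_mult_tfn_Borel[OF U G K(2,3)] .

lemma loc_integrable_Borel:
  fixes f F :: "real^'n::finite \<Rightarrow> real"
  assumes "loc_integrable U f" "F \<in> borel_measurable borel" "AE x in lborel. x \<in> U \<longrightarrow> f x = F x" "compact K" "K \<subseteq> U"
  shows "integrable lborel (\<lambda>x. indicator K x * F x)"
proof -
  have "AE x in lborel. x \<in> K \<longrightarrow> f x = F x" using assms(3) by eventually_elim (use assms(5) in auto)
  then show ?thesis
    using integrable_lebesgue_on_Borel[of K F f] assms compact_imp_closed[OF assms(4)] unfolding loc_integrable_def by auto
qed

text \<open>\<open>wd\<close> picks an arbitrary weak derivative. By the fundamental lemma any other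
  one agrees with it almost everywhere, so the choice can be replaced by a convenient
  representative.\<close>

lemma weak_deriv_unique:
  fixes f g h :: "real^'n::finite \<Rightarrow> real"
  assumes U: "open U" and g: "is_weak_deriv U \<alpha> f g" and h: "is_weak_deriv U \<alpha> f h"
  shows "AE x in lborel. x \<in> U \<longrightarrow> g x = h x"
proof -
  have Ub: "U \<in> sets borel" using U by auto
  have lg: "loc_integrable U g" and lh: "loc_integrable U h" using g h by (auto simp: is_weak_deriv_def)
  obtain G where G: "G \<in> borel_measurable borel" "AE x in lborel. x \<in> U \<longrightarrow> g x = G x"
    using Borel_representative[OF Ub loc_integrable_measurable[OF U lg]] by metis
  obtain H where H: "H \<in> borel_measurable borel" "AE x in lborel. x \<in> U \<longrightarrow> h x = H x"
    using Borel_representative[OF Ub loc_integrable_measurable[OF U lh]] by metis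
  have "AE x in lborel. x \<in> U \<longrightarrow> G x - H x = 0"
  proof (rule fundamental_lemma[OF U])
    show "(\<lambda>x. G x - H x) \<in> borel_measurable borel" using G(1) H(1) by measurable
    fix K :: "(real^'n) set" assume K: "compact K" "K \<subseteq> U"
    note i = loc_integrable_Borel[OF lg G K] loc_integrable_Borel[OF lh H K]
    then show "integrable lborel (\<lambda>x. indicator K x * (G x - H x))" by (simp add: right_diff_distrib)
    fix \<phi> assume t: "tfn K \<phi>"
    obtain B where B: "\<And>x. \<bar>\<phi> x\<bar> \<le> B" using tfn_bounded[OF K(1) t] by blast
    have zero: "(\<lambda>x. indicator K x * F x * \<phi> x) = (\<lambda>x. F x * \<phi> x)" for F :: "real^'n \<Rightarrow> real"
      using tfn_zero[OF t] by (auto simp: indicator_def fun_eq_iff)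
    have ig: "integrable lborel (\<lambda>x. G x * \<phi> x)" "integrable lborel (\<lambda>x. H x * \<phi> x)"
      using integrable_mult_bounded[OF i(1) tfn_measurable[OF t] B] integrable_mult_bounded[OF i(2) tfn_measurable[OF t] B]
      by (simp_all add: zero)
    have "integral\<^sup>L (lebesgue_on U) (\<lambda>x. g x * \<phi> x) = integral\<^sup>L (lebesgue_on U) (\<lambda>x. h x * \<phi> x)"
    proof -
      have "(-1) ^ mi_order \<alpha> * integral\<^sup>L (lebesgue_on U) (\<lambda>x. g x * \<phi> x) = (-1) ^ mi_order \<alpha> * integral\<^sup>L (lebesgue_on U) (\<lambda>x. h x * \<phi> x)"
        using weak_deriv_pairing[OF g K t] weak_deriv_pairing[OF h K t] by (rule subst)
      then show ?thesis by simp
    qed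
    then have "(\<integral>x. G x * \<phi> x \<partial>lborel) = (\<integral>x. H x * \<phi> x \<partial>lborel)"
      using integral_mult_tfn_Borel[OF U G K(2) t] integral_mult_tfn_Borel[OF U H K(2) t] by simp
    then show "(\<integral>x. (G x - H x) * \<phi> x \<partial>lborel) = 0" using ig by (simp add: left_diff_distrib)
  qed
  then show ?thesis using G(2) H(2) by eventually_elim auto
qed

section \<open>Smooth functions as elements of Sobolev spaces\<close>

lemma smooth_integrable_lebesgue_on:
  fixes \<Phi> :: "real^'n::finite \<Rightarrow> real"
  assumes s: "smooth_on UNIV \<Phi>" and U: "U \<in> sets borel" "bounded U" and f: "\<And>x. x \<in> U \<Longrightarrow> f x = \<Phi> x"
  shows "integrable (lebesgue_on U) f"
proof -
  have m: "\<Phi> \<in> borel_measurable borel" by (rule smooth_measurable[OF s])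
  have c: "compact (closure U)" using U(2) compact_closure by blast
  have "integrable lborel (\<lambda>x. indicator (closure U) x *\<^sub>R \<Phi> x)"
    by (rule borel_integrable_compact[OF c continuous_on_subset[OF smooth_on_continuous0[OF s]]]) simp
  then have "integrable lborel (\<lambda>x. indicator U x * \<Phi> x)"
  proof (rule Bochner_Integration.integrable_bound)
    show "AE x in lborel. norm (indicator U x * \<Phi> x) \<le> norm (indicator (closure U) x *\<^sub>R \<Phi> x)"
      using closure_subset[of U] by (intro AE_I2) (auto simp: indicator_def)
  qed (use m U(1) in measurable)
  moreover have "AE x in lborel. x \<in> U \<longrightarrow> f x = \<Phi> x" using f by simp
  ultimately show ?thesis using integrable_lebesgue_on_Borel[OF U(1) m] by blast
qed

lemma smooth_L2:
  fixes \<Phi> :: "real^'n::finite \<Rightarrow> real"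
  assumes s: "smooth_on UNIV \<Phi>" and U: "U \<in> sets borel" "bounded U" and f: "\<And>x. x \<in> U \<Longrightarrow> f x = \<Phi> x"
  shows "L2 U f"
  unfolding L2_def
proof
  show "f \<in> borel_measurable (lebesgue_on U)"
    using smooth_integrable_lebesgue_on[OF assms] by auto
  show "integrable (lebesgue_on U) (\<lambda>x. (f x)\<^sup>2)"
    unfolding power2_eq_square
    by (rule smooth_integrable_lebesgue_on[OF smooth_on_mult[OF open_UNIV s s] U]) (simp add: f)
qed

lemma smooth_weak_deriv:
  fixes \<Phi> :: "real^'n::finite \<Rightarrow> real"
  assumes U: "open U" and s: "smooth_on UNIV \<Phi>" and f: "\<And>x. x \<in> U \<Longrightarrow> f x = \<Phi> x"
  shows "is_weak_deriv U \<alpha> f (cderiv \<alpha> \<Phi>)"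
  unfolding is_weak_deriv_def
proof (intro conjI allI impI)
  have sd: "smooth_on UNIV (cderiv \<alpha> \<Phi>)" unfolding cderiv_def by (rule smooth_on_dlist[OF s])
  show "loc_integrable U f" "loc_integrable U (cderiv \<alpha> \<Phi>)" unfolding loc_integrable_def
    using smooth_integrable_lebesgue_on[OF s] smooth_integrable_lebesgue_on[OF sd] f
    by (auto simp: compact_imp_bounded compact_imp_closed subset_iff)
  fix \<phi> assume "test_fn U \<phi>"
  then obtain K where K: "compact K" "K \<subseteq> U" "tfn K \<phi>" using test_fn_imp_tfn by blast
  have eq1: "AE x in lborel. x \<in> U \<longrightarrow> f x = \<Phi> x" using f by simp
  have "integral\<^sup>L (lebesgue_on U) (\<lambda>x. cderiv \<alpha> \<Phi> x * \<phi> x) = (\<integral>x. dlist (alpha_list \<alpha>) \<Phi> x * \<phi> x \<partial>lborel)"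
    using integral_mult_tfn_Borel[OF U smooth_measurable[OF sd] _ K(2,3), of "cderiv \<alpha> \<Phi>"] by (simp add: cderiv_def)
  also have "\<dots> = (-1) ^ mi_order \<alpha> * (\<integral>x. \<Phi> x * dlist (rev (alpha_list \<alpha>)) \<phi> x \<partial>lborel)"
    unfolding length_alpha_list[symmetric] by (rule integration_by_parts_list[OF s K(1,3)])
  also have "dlist (rev (alpha_list \<alpha>)) \<phi> = cderiv \<alpha> \<phi>"
    unfolding cderiv_def by (intro ext dlist_mset[OF tfn_smooth[OF K(3)]]) simp
  also have "(\<integral>x. \<Phi> x * cderiv \<alpha> \<phi> x \<partial>lborel) = integral\<^sup>L (lebesgue_on U) (\<lambda>x. f x * cderiv \<alpha> \<phi> x)"
    by (rule integral_mult_tfn_Borel[OF U smooth_measurable[OF s] eq1 K(2) tfn_cderiv[OF K(1,3)], symmetric])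
  finally show "integral\<^sup>L (lebesgue_on U) (\<lambda>x. f x * cderiv \<alpha> \<phi> x) = (-1) ^ mi_order \<alpha> * integral\<^sup>L (lebesgue_on U) (\<lambda>x. cderiv \<alpha> \<Phi> x * \<phi> x)"
    by (simp add: mult.assoc[symmetric] power_mult_distrib[symmetric])
qed

lemma AE_translate:
  fixes c :: "'a::euclidean_space"
  assumes "AE x in lborel. P x" shows "AE x in lborel. P (c + x)"
proof -
  have "AE x in distr lborel borel ((+) c). P x" unfolding lborel_distr_plus by (rule assms)
  then show ?thesis by (rule AE_distrD[rotated]) simp
qed

section \<open>Periodic extension\<close>

text \<open>Half open, so that its lattice translates cover every point exactly once, in accordance
  with the floor in \<open>per_ext\<close>.\<close>

definition cell :: "real \<Rightarrow> (real^'n::finite) set" where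
  "cell L = {x. \<forall>i. - (2 * L) \<le> x $ i \<and> x $ i < 2 * L}"

definition lattice :: "real \<Rightarrow> (real^'n::finite) set" where
  "lattice L = {v. \<forall>i. \<exists>k::int. v $ i = 4 * L * of_int k}"

text \<open>The lattice vectors with coefficients -1, 0 and 1: the finitely many that can matter
  inside the open cube of half side \<open>4 * L\<close>.\<close>

definition shifts :: "real \<Rightarrow> (real^'n::finite) set" where
  "shifts L = {v. \<forall>i. v $ i \<in> {- (4 * L), 0, 4 * L}}"

text \<open>The lattice vector that \<open>per_ext\<close> subtracts to bring \<open>x\<close> into
  the cell.\<close>

definition lshift :: "real \<Rightarrow> real^'n::finite \<Rightarrow> real^'n" where
  "lshift L x = (\<chi> i. 4 * L * of_int \<lfloor>(x $ i + 2 * L) / (4 * L)\<rfloor>)"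

lemma per_ext_lshift: "per_ext L f x = f (x - lshift L x)"
proof -
  have "(\<chi> i. x $ i - 4 * L * of_int \<lfloor>(x $ i + 2 * L) / (4 * L)\<rfloor>) = x - lshift L x"
    by (simp add: vec_eq_iff lshift_def)
  then show ?thesis by (simp add: per_ext_def)
qed

lemma lshift_lattice: "lshift L x \<in> lattice L"
  by (auto simp: lshift_def lattice_def)

lemma lshift_unique:
  assumes "L > 0" "v \<in> lattice L" "x - v \<in> cell L" shows "v = lshift L x"
proof -
  have "v $ i = lshift L x $ i" for i
  proof -
    obtain k :: int where k: "v $ i = 4 * L * of_int k" using assms(2) by (auto simp: lattice_def)
    have "- (2 * L) \<le> (x - v) $ i \<and> (x - v) $ i < 2 * L" using assms(3) unfolding cell_def by blast
    then have "- (2 * L) \<le> x $ i - 4 * L * of_int k" "x $ i - 4 * L * of_int k < 2 * L"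
      by (simp_all add: k)
    then have "of_int k \<le> (x $ i + 2 * L) / (4 * L)" "(x $ i + 2 * L) / (4 * L) < of_int k + 1"
      using assms(1) by (auto simp: field_simps)
    then have "\<lfloor>(x $ i + 2 * L) / (4 * L)\<rfloor> = k" by linarith
    then show ?thesis using k by (simp add: lshift_def)
  qed
  then show ?thesis by (simp add: vec_eq_iff)
qed

lemma lshift_cell: "L > 0 \<Longrightarrow> x - lshift L x \<in> cell L"
proof -
  assume L: "L > 0"
  have "- (2 * L) \<le> x $ i - 4 * L * of_int \<lfloor>(x $ i + 2 * L) / (4 * L)\<rfloor> \<and> x $ i - 4 * L * of_int \<lfloor>(x $ i + 2 * L) / (4 * L)\<rfloor> < 2 * L" for i
  proof -
    define q where "q = (x $ i + 2 * L) / (4 * L)"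
    have x: "x $ i = 4 * L * q - 2 * L" using L by (simp add: q_def field_simps)
    have "of_int \<lfloor>q\<rfloor> \<le> q" "q < of_int \<lfloor>q\<rfloor> + 1" by linarith+
    then have "4 * L * of_int \<lfloor>q\<rfloor> \<le> 4 * L * q" "4 * L * q < 4 * L * (of_int \<lfloor>q\<rfloor> + 1)" using L by auto
    then show ?thesis unfolding q_def[symmetric] x by (simp add: algebra_simps)
  qed
  then show ?thesis by (simp add: cell_def lshift_def)
qed

lemma lattice_add: "u \<in> lattice L \<Longrightarrow> v \<in> lattice L \<Longrightarrow> u + v \<in> lattice L"
  unfolding lattice_def
proof (intro CollectI allI)
  fix i assume "u \<in> {v. \<forall>i. \<exists>k::int. v $ i = 4 * L * of_int k}" "v \<in> {v. \<forall>i. \<exists>k::int. v $ i = 4 * L * of_int k}"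
  then obtain j k :: int where "u $ i = 4 * L * of_int j" "v $ i = 4 * L * of_int k" by blast
  then show "\<exists>k::int. (u + v) $ i = 4 * L * of_int k" by (intro exI[of _ "j + k"]) (simp add: distrib_left)
qed

lemma lattice_uminus: "u \<in> lattice L \<Longrightarrow> - u \<in> lattice L"
  unfolding lattice_def
proof (intro CollectI allI)
  fix i assume "u \<in> {v. \<forall>i. \<exists>k::int. v $ i = 4 * L * of_int k}"
  then obtain j :: int where "u $ i = 4 * L * of_int j" by blast
  then show "\<exists>k::int. (- u) $ i = 4 * L * of_int k" by (intro exI[of _ "- j"]) simp
qed

lemma shifts_lattice: "shifts L \<subseteq> lattice L"
proof
  fix v :: "real^'n" assume v: "v \<in> shifts L"
  have "\<exists>k::int. v $ i = 4 * L * of_int k" for i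
  proof -
    have "v $ i = - (4 * L) \<or> v $ i = 0 \<or> v $ i = 4 * L" using v by (auto simp: shifts_def)
    then show ?thesis
      by (elim disjE) (intro exI[of _ "-1"], simp, intro exI[of _ 0], simp, intro exI[of _ 1], simp)
  qed
  then show "v \<in> lattice L" by (simp add: lattice_def)
qed

lemma finite_shifts: "finite (shifts L :: (real^'n::finite) set)"
proof -
  let ?A = "{- (4 * L), 0, 4 * L}"
  have "shifts L \<subseteq> (\<lambda>f. \<chi> i. f i) ` (Pi\<^sub>E (UNIV :: 'n set) (\<lambda>_. ?A))"
  proof
    fix v :: "real^'n" assume "v \<in> shifts L"
    then have "(\<lambda>i. v $ i) \<in> Pi\<^sub>E UNIV (\<lambda>_. ?A)" by (auto simp: shifts_def)
    moreover have "v = (\<chi> i. v $ i)" by simp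
    ultimately show "v \<in> (\<lambda>f. \<chi> i. f i) ` (Pi\<^sub>E UNIV (\<lambda>_. ?A))" by blast
  qed
  then show ?thesis by (rule finite_subset) (intro finite_imageI finite_PiE; simp)
qed

lemma lattice_small:
  assumes L: "L > 0" and v: "v \<in> lattice L" "\<And>i. \<bar>v $ i\<bar> < 8 * L" shows "v \<in> shifts L"
proof -
  have "v $ i \<in> {- (4 * L), 0, 4 * L}" for i
  proof -
    obtain k :: int where k: "v $ i = 4 * L * of_int k" using v(1) by (auto simp: lattice_def)
    have "4 * L * \<bar>of_int k\<bar> < 4 * L * 2" using v(2)[of i] L by (simp add: k abs_mult)
    then have "\<bar>of_int k :: real\<bar> < 2" using L by simp
    then have "k = -1 \<or> k = 0 \<or> k = 1" by linarith
    then show ?thesis using k by auto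
  qed
  then show ?thesis by (simp add: shifts_def)
qed

lemma per_ext_periodic:
  assumes "L > 0" "v \<in> lattice L" shows "per_ext L f (x + v) = per_ext L f x"
proof -
  have "lshift L x + v = lshift L (x + v)"
    by (rule lshift_unique[OF assms(1) lattice_add[OF lshift_lattice assms(2)]]) (simp add: lshift_cell[OF assms(1)])
  then have "x + v - lshift L (x + v) = x - lshift L x" by (simp add: algebra_simps)
  then show ?thesis unfolding per_ext_lshift by (rule arg_cong)
qed

lemma per_ext_cell:
  assumes "L > 0" "x \<in> cell L" shows "per_ext L f x = f x"
proof -
  have "0 \<in> lattice L" by (auto simp: lattice_def intro: exI[of _ 0])
  then have "0 = lshift L x" using lshift_unique[OF assms(1), of 0 x] assms(2) by simp
  then show ?thesis by (simp add: per_ext_lshift)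
qed

lemma lshift_shifts: "L > 0 \<Longrightarrow> x \<in> ocube (4 * L) \<Longrightarrow> lshift L x \<in> shifts L"
proof -
  assume L: "L > 0" and x: "x \<in> ocube (4 * L)"
  have "\<bar>lshift L x $ i\<bar> < 8 * L" for i
  proof -
    have "- (2 * L) \<le> x $ i - lshift L x $ i" "x $ i - lshift L x $ i < 2 * L"
      using lshift_cell[OF L, of x] by (auto simp: cell_def)
    moreover have "- (4 * L) < x $ i" "x $ i < 4 * L" using x by (auto simp: ocube_def)
    ultimately show ?thesis using L by linarith
  qed
  then show ?thesis by (rule lattice_small[OF L lshift_lattice])
qed

lemma cell_partition:
  assumes "L > 0" "x \<in> ocube (4 * L)"
  shows "(\<Sum>v\<in>shifts L. indicator (cell L) (x - v)) = (1::real)"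
proof -
  have "indicator (cell L) (x - v) = (if v = lshift L x then 1 else (0::real))" if "v \<in> shifts L" for v
    using lshift_unique[OF assms(1), of v x] that shifts_lattice[of L] lshift_cell[OF assms(1), of x] by (auto simp: indicator_def)
  then have "(\<Sum>v\<in>shifts L. indicator (cell L) (x - v)) = (\<Sum>v\<in>shifts L. if v = lshift L x then 1 else (0::real))"
    by (intro sum.cong) auto
  also have "\<dots> = 1" using lshift_shifts[OF assms] by (simp add: finite_shifts)
  finally show ?thesis .
qed

text \<open>A finite stand-in for the sum over the full lattice. For functions vanishing outside
  \<open>ocube (3 * L)\<close> both agree on \<open>ocube (4 * L)\<close>, the only region where the
  definition of \<open>Hs_per\<close> looks.\<close>

definition periodize :: "real \<Rightarrow> (real^'n::finite \<Rightarrow> real) \<Rightarrow> real^'n \<Rightarrow> real" where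
  "periodize L \<phi> x = (\<Sum>v\<in>shifts L. \<phi> (x + v))"

text \<open>The finite sum is not periodic by its form, since \<open>shifts\<close> is not
  translation invariant. The set \<open>A\<close> of lattice vectors with nonzero contribution is,
  and inside the large cube it is contained in \<open>shifts\<close>.\<close>

lemma periodize_shift:
  assumes L: "L > 0" and z: "\<And>y. y \<notin> ocube (3 * L) \<Longrightarrow> \<phi> y = 0"
    and x: "x \<in> ocube (4 * L)" "x - u \<in> ocube (4 * L)" and u: "u \<in> lattice L"
  shows "periodize L \<phi> (x - u) = periodize L \<phi> x"
proof -
  define A where "A y = {v \<in> lattice L. \<phi> (y + v) \<noteq> 0}" for y
  have sub: "A y \<subseteq> shifts L" if y: "y \<in> ocube (4 * L)" for y
  proof
    fix v assume v: "v \<in> A y"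
    then have "y + v \<in> ocube (3 * L)" using z by (auto simp: A_def)
    \<comment> \<open>Less than \<open>3 * L + 4 * L\<close>, so below two lattice periods.\<close>
    then have "\<bar>v $ i\<bar> < 8 * L" for i
    proof -
      have "- (3 * L) < y $ i + v $ i" "y $ i + v $ i < 3 * L" using \<open>y + v \<in> ocube (3 * L)\<close> by (auto simp: ocube_def)
      moreover have "- (4 * L) < y $ i" "y $ i < 4 * L" using y by (auto simp: ocube_def)
      ultimately show ?thesis using L by linarith
    qed
    then show "v \<in> shifts L" using v by (intro lattice_small[OF L]) (auto simp: A_def)
  qed
  have ps: "periodize L \<phi> y = (\<Sum>v\<in>A y. \<phi> (y + v))" if y: "y \<in> ocube (4 * L)" for y
    unfolding periodize_def
    by (rule sum.mono_neutral_right[OF finite_shifts sub[OF y]]) (use shifts_lattice[of L] in \<open>auto simp: A_def\<close>)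
  have "A (x - u) = (\<lambda>v. v + u) ` A x"
  proof (intro set_eqI iffI)
    fix v assume "v \<in> A (x - u)"
    then have "v - u \<in> A x" using lattice_add[OF _ lattice_uminus[OF u], of v] by (simp add: A_def algebra_simps)
    then show "v \<in> (\<lambda>v. v + u) ` A x" by (intro image_eqI[of _ _ "v - u"]) auto
  next
    fix v assume "v \<in> (\<lambda>v. v + u) ` A x"
    then show "v \<in> A (x - u)" using lattice_add[OF _ u] by (auto simp: A_def)
  qed
  then have "(\<Sum>v\<in>A (x - u). \<phi> (x - u + v)) = (\<Sum>v\<in>A x. \<phi> (x + v))"
    by (simp add: sum.reindex)
  then show ?thesis using ps x by simp
qed

section \<open>Topology and measurability of the cubes\<close>

lemma open_ocube: "open (ocube r :: (real^'n::finite) set)"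
proof -
  have eq: "ocube r = (\<Inter>i\<in>UNIV. {x :: real^'n. - r < x $ i} \<inter> {x. x $ i < r})" by (auto simp: ocube_def)
  show ?thesis unfolding eq
    by (intro open_INT finite ballI open_Int open_halfspace_component_gt_cart open_halfspace_component_lt_cart)
qed

lemma bounded_ccube: "bounded (ccube r :: (real^'n::finite) set)"
proof -
  have "norm x \<le> real CARD('n) * \<bar>r\<bar>" if "x \<in> ccube r" for x :: "real^'n"
  proof -
    have "norm x \<le> (\<Sum>i\<in>UNIV. \<bar>x $ i\<bar>)" by (rule norm_le_l1_cart)
    also have "\<dots> \<le> real CARD('n) * \<bar>r\<bar>"
    proof (rule sum_bounded_above)
      fix i show "\<bar>x $ i\<bar> \<le> \<bar>r\<bar>" using that by (simp add: ccube_def abs_le_iff) (meson abs_ge_self minus_le_iff order_trans)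
    qed
    finally show ?thesis .
  qed
  then show ?thesis unfolding bounded_iff by blast
qed

lemma ocube_ccube: "ocube r \<subseteq> ccube r"
  by (auto simp: ocube_def ccube_def less_imp_le)

lemma bounded_ocube: "bounded (ocube r :: (real^'n::finite) set)"
  by (rule bounded_subset[OF bounded_ccube ocube_ccube])

lemma closed_ccube: "closed (ccube r :: (real^'n::finite) set)"
proof -
  have "ccube r = (\<Inter>i\<in>UNIV. {x :: real^'n. x $ i \<ge> - r} \<inter> {x. x $ i \<le> r})" by (auto simp: ccube_def)
  moreover have "closed ({x :: real^'n. x $ i \<ge> - r} \<inter> {x. x $ i \<le> r})" for i
    by (intro closed_Int closed_halfspace_component_ge_cart closed_halfspace_component_le_cart)
  ultimately show ?thesis by auto
qed

lemma cell_borel: "cell L \<in> sets (borel :: (real^'n::finite) measure)"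
proof -
  have "cell L = (\<Inter>i\<in>UNIV. {x :: real^'n. x $ i \<ge> - (2 * L)} \<inter> {x. x $ i < 2 * L})" by (auto simp: cell_def)
  moreover have "({x :: real^'n. x $ i \<ge> - (2 * L)} \<inter> {x. x $ i < 2 * L}) \<in> sets borel" for i
    by (intro sets.Int borel_closed borel_open closed_halfspace_component_ge_cart open_halfspace_component_lt_cart)
  ultimately show ?thesis by (simp add: sets.finite_INT)
qed

lemma AE_ccube_cell: "AE x in lborel. x \<in> ccube (2 * L) \<longleftrightarrow> x \<in> (cell L :: (real^'n::finite) set)"
proof -
  have "AE x in lborel. x $ i \<noteq> 2 * L" for i :: 'n
  proof -
    have "negligible {x :: real^'n. x \<bullet> axis i 1 = 2 * L}"
      by (rule negligible_standard_hyperplane) (auto simp: Basis_vec_def)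
    then have "{x :: real^'n. x $ i = 2 * L} \<in> null_sets lebesgue"
      by (simp add: negligible_iff_null_sets inner_axis)
    then have "AE x in lebesgue. x \<notin> {x :: real^'n. x $ i = 2 * L}" by (rule AE_not_in)
    then show ?thesis by (simp add: AE_completion_iff)
  qed
  then have "AE x in lborel. \<forall>i. (x :: real^'n) $ i \<noteq> 2 * L" by (simp add: AE_all_countable)
  then show ?thesis by eventually_elim (auto simp: ccube_def cell_def less_le)
qed

section \<open>Periodicity of weak derivatives and unfolding of integrals over the cell\<close>

lemma tfn_translate:
  fixes \<psi> :: "real^'n::finite \<Rightarrow> real"
  assumes "tfn K \<psi>" shows "tfn ((\<lambda>x. x - v) ` K) (\<lambda>x. \<psi> (x + v))"
  unfolding tfn_def
proof (intro conjI allI impI)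
  show "smooth_on UNIV (\<lambda>x. \<psi> (x + v))" using smooth_on_affine[OF tfn_smooth[OF assms], of 1 1 v] by simp
  fix x assume "x \<notin> (\<lambda>x. x - v) ` K"
  then have "x + v \<notin> K" by (metis add_diff_cancel imageI)
  then show "\<psi> (x + v) = 0" by (rule tfn_zero[OF assms])
qed

lemma compact_translate: "compact K \<Longrightarrow> compact ((\<lambda>x. x - v) ` (K :: (real^'n::finite) set))"
  by (intro compact_continuous_image continuous_intros)

lemma cderiv_translate:
  assumes "smooth_on UNIV \<psi>" shows "cderiv \<alpha> (\<lambda>x. \<psi> (x + v)) x = cderiv \<alpha> \<psi> (x + v)"
  unfolding cderiv_def by (rule dlist_translate[OF assms])

lemma integrable_translate:
  fixes f :: "'a::euclidean_space \<Rightarrow> real"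
  assumes "integrable lborel f" shows "integrable lborel (\<lambda>x. f (x - v))"
  using integrable_reflect[OF integrable_reflect[OF assms, of 0], of v] by simp

lemma integrable_compact_L2:
  fixes G :: "'a::euclidean_space \<Rightarrow> real"
  assumes "G \<in> borel_measurable borel" "integrable lborel (\<lambda>x. (G x)\<^sup>2)" "compact K"
  shows "integrable lborel (\<lambda>x. indicator K x * G x)"
proof (rule integrable_mult_L2)
  have Kb: "K \<in> sets borel" by (rule borel_closed[OF compact_imp_closed[OF assms(3)]])
  then show "(indicator K :: 'a \<Rightarrow> real) \<in> borel_measurable lborel" by simp
  have "(\<lambda>x. (indicator K x :: real)\<^sup>2) = indicator K" by (auto simp: indicator_def)
  then show "integrable lborel (\<lambda>x. (indicator K x :: real)\<^sup>2)"
    using Kb emeasure_compact_finite[OF assms(3)] by simp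
qed (use assms in auto)

text \<open>The derivative is taken on the large cube, where nothing makes it periodic by
  definition. Testing with \<psi> and with its translate gives the same value, because the function
  differentiated is periodic; the fundamental lemma concludes on the set where both points lie in
  the cube.\<close>

lemma weak_deriv_periodic:
  fixes W G :: "real^'n::finite \<Rightarrow> real"
  assumes L: "L > 0" and Wm: "W \<in> borel_measurable borel" and Wf: "AE x in lborel. x \<in> ocube (4 * L) \<longrightarrow> per_ext L f x = W x"
    and Gm: "G \<in> borel_measurable borel" and G2: "integrable lborel (\<lambda>x. (G x)\<^sup>2)"
    and d: "\<And>K \<phi>. compact K \<Longrightarrow> K \<subseteq> ocube (4 * L) \<Longrightarrow> tfn K \<phi> \<Longrightarrow>
        (\<integral>x. W x * cderiv \<alpha> \<phi> x \<partial>lborel) = (-1) ^ mi_order \<alpha> * (\<integral>x. G x * \<phi> x \<partial>lborel)"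
    and v: "v \<in> lattice L"
  shows "AE x in lborel. x \<in> ocube (4 * L) \<and> x - v \<in> ocube (4 * L) \<longrightarrow> G (x - v) = G x"
proof -
  note [measurable] = Wm Gm
  define V where "V = ocube (4 * L) \<inter> (\<lambda>x. x - v) -` ocube (4 * L)"
  have V: "open V" unfolding V_def
    by (intro open_Int open_ocube open_vimage continuous_intros)
  have sub: "K \<subseteq> ocube (4 * L)" "(\<lambda>x. x - v) ` K \<subseteq> ocube (4 * L)" if "K \<subseteq> V" for K
    using that by (auto simp: V_def)
  have sgn: "(-1) ^ mi_order \<alpha> * ((-1) ^ mi_order \<alpha> * r) = (r::real)" for r
    by (simp add: mult.assoc[symmetric] power_mult_distrib[symmetric])
  have "AE x in lborel. x \<in> V \<longrightarrow> G (x - v) - G x = 0"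
  proof (rule fundamental_lemma[OF V])
    show "(\<lambda>x. G (x - v) - G x) \<in> borel_measurable borel" by measurable
    fix K assume K: "compact K" "K \<subseteq> V"
    have i1: "integrable lborel (\<lambda>x. indicator K x * G x)" by (rule integrable_compact_L2[OF Gm G2 K(1)])
    have "integrable lborel (\<lambda>x. indicator ((\<lambda>x. x - v) ` K) (x - v) * G (x - v))"
      using integrable_translate[OF integrable_compact_L2[OF Gm G2 compact_translate[OF K(1), of v]], of v] .
    moreover have "(\<lambda>x. indicator ((\<lambda>x. x - v) ` K) (x - v) * G (x - v)) = (\<lambda>x. indicator K x * G (x - v))"
      by (auto simp: indicator_def fun_eq_iff)
    ultimately have i2: "integrable lborel (\<lambda>x. indicator K x * G (x - v))" by simp
    show "integrable lborel (\<lambda>x. indicator K x * (G (x - v) - G x))" using i1 i2 by (simp add: right_diff_distrib)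
    fix \<psi> assume t: "tfn K \<psi>"
    note [measurable] = tfn_measurable[OF t]
    have [measurable]: "cderiv \<alpha> \<psi> \<in> borel_measurable borel" by (rule tfn_measurable[OF tfn_cderiv[OF K(1) t]])
    obtain B where B: "\<And>x. \<bar>\<psi> x\<bar> \<le> B" using tfn_bounded[OF K(1) t] by blast
    have zero: "(\<lambda>x. indicator K x * F x * \<psi> x) = (\<lambda>x. F x * \<psi> x)" for F :: "real^'n \<Rightarrow> real"
      using tfn_zero[OF t] by (auto simp: indicator_def fun_eq_iff)
    have j: "integrable lborel (\<lambda>x. G x * \<psi> x)" "integrable lborel (\<lambda>x. G (x - v) * \<psi> x)"
      using integrable_mult_bounded[OF i1 tfn_measurable[OF t] B] integrable_mult_bounded[OF i2 tfn_measurable[OF t] B]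
      by (simp_all add: zero)
    have "(\<integral>x. G (x - v) * \<psi> x \<partial>lborel) = (\<integral>x. G x * \<psi> (x + v) \<partial>lborel)"
      using lborel_integral_translate[of "\<lambda>x. G (x - v) * \<psi> x" v] by (simp add: add.commute)
    also have "\<dots> = (-1) ^ mi_order \<alpha> * (\<integral>x. W x * cderiv \<alpha> (\<lambda>x. \<psi> (x + v)) x \<partial>lborel)"
      using d[OF compact_translate[OF K(1)] sub(2)[OF K(2)] tfn_translate[OF t]] by (simp add: sgn)
    also have "(\<integral>x. W x * cderiv \<alpha> (\<lambda>x. \<psi> (x + v)) x \<partial>lborel) = (\<integral>x. W (x - v) * cderiv \<alpha> \<psi> x \<partial>lborel)"
      using lborel_integral_translate[of "\<lambda>x. W (x - v) * cderiv \<alpha> \<psi> x" v]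
      by (simp add: add.commute cderiv_translate[OF tfn_smooth[OF t]])
    also have "(\<integral>x. W (x - v) * cderiv \<alpha> \<psi> x \<partial>lborel) = (\<integral>x. W x * cderiv \<alpha> \<psi> x \<partial>lborel)"
    proof (rule integral_cong_AE)
      have "AE x in lborel. - v + x \<in> ocube (4 * L) \<longrightarrow> per_ext L f (- v + x) = W (- v + x)"
        by (rule AE_translate[OF Wf])
      with Wf show "AE x in lborel. W (x - v) * cderiv \<alpha> \<psi> x = W x * cderiv \<alpha> \<psi> x"
      proof eventually_elim
        case (elim x)
        show ?case
        proof (cases "x \<in> K")
          case True
          then have x: "x \<in> ocube (4 * L)" "x - v \<in> ocube (4 * L)" using K(2) by (auto simp: V_def)
          have "per_ext L f (x + (- v)) = per_ext L f x" by (rule per_ext_periodic[OF L lattice_uminus[OF v]])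
          then have "W (x - v) = W x" using elim x by simp
          then show ?thesis by simp
        qed (use tfn_zero[OF tfn_cderiv[OF K(1) t]] in simp)
      qed
    qed measurable
    also have "(-1) ^ mi_order \<alpha> * (\<integral>x. W x * cderiv \<alpha> \<psi> x \<partial>lborel) = (\<integral>x. G x * \<psi> x \<partial>lborel)"
      using d[OF K(1) sub(1)[OF K(2)] t] by (simp add: sgn)
    finally show "(\<integral>x. (G (x - v) - G x) * \<psi> x \<partial>lborel) = 0"
      using j by (simp add: left_diff_distrib)
  qed
  then show ?thesis by eventually_elim (auto simp: V_def)
qed

lemma cell_ocube: "L > 0 \<Longrightarrow> cell L \<subseteq> ocube (4 * L)"
proof
  fix x :: "real^'n" assume L: "L > 0" and x: "x \<in> cell L"
  have "- (4 * L) < x $ i \<and> x $ i < 4 * L" for i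
  proof -
    have "- (2 * L) \<le> x $ i \<and> x $ i < 2 * L" using x unfolding cell_def by blast
    then show ?thesis using L by linarith
  qed
  then show "x \<in> ocube (4 * L)" by (simp add: ocube_def)
qed

lemma cube_mono: "r \<le> r' \<Longrightarrow> ocube r \<subseteq> ocube r'"
  by (auto simp: ocube_def) (meson le_less_trans less_le_trans neg_le_iff_le)+

text \<open>Unfolding: the integral over the space is cut into translates of the cell and each piece
  is moved back to the cell, where periodicity leaves \<open>G\<close> unchanged and the moved
  copies of \<psi> add up to its periodization.\<close>

lemma cell_integral:
  fixes G :: "real^'n::finite \<Rightarrow> real"
  assumes L: "L > 0" and Gm: "G \<in> borel_measurable borel" and G2: "integrable lborel (\<lambda>x. (G x)\<^sup>2)"
    and per: "\<And>v. v \<in> shifts L \<Longrightarrow> AE x in lborel. x \<in> ocube (4 * L) \<and> x - v \<in> ocube (4 * L) \<longrightarrow> G (x - v) = G x"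
    and K: "compact K" "K \<subseteq> ocube (3 * L)" and t: "tfn K \<psi>"
  shows "(\<integral>x. indicator (ccube (2 * L)) x * (G x * periodize L \<psi> x) \<partial>lborel) = (\<integral>x. G x * \<psi> x \<partial>lborel)"
proof -
  note [measurable] = Gm cell_borel tfn_measurable[OF t]
  have Q3: "ocube (3 * L) \<subseteq> (ocube (4 * L) :: (real^'n) set)" by (rule cube_mono) (use L in simp)
  have pi: "integrable lborel (\<lambda>x. indicator (cell L) (x - u) * (G x * \<psi>' x))" if p: "compact K'" "tfn K' \<psi>'" for u K' \<psi>'
  proof -
    note [measurable] = tfn_measurable[OF p(2)]
    have "integrable lborel (\<lambda>x. G x * \<psi>' x)"
      by (rule integrable_mult_L2) (use G2 tfn_sq_integrable[OF p] in auto)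
    from integrable_mult_bounded[OF this, of "\<lambda>x. indicator (cell L) (x - u)" 1]
    show ?thesis by (simp add: mult.commute indicator_def)
  qed
  have m: "(\<lambda>x. indicator (cell L) (x - v) * (G x * \<psi> x)) \<in> borel_measurable borel" for v by measurable
  have "(\<lambda>x. G x * \<psi> x) = (\<lambda>x. \<Sum>v\<in>shifts L. indicator (cell L) (x - v) * (G x * \<psi> x))"
  proof
    fix x
    show "G x * \<psi> x = (\<Sum>v\<in>shifts L. indicator (cell L) (x - v) * (G x * \<psi> x))"
    proof (cases "x \<in> K")
      case True
      then have "x \<in> ocube (4 * L)" using K(2) Q3 by auto
      then show ?thesis using cell_partition[OF L, of x] by (simp add: sum_distrib_right[symmetric])
    qed (use tfn_zero[OF t] in simp)
  qed
  then have "(\<integral>x. G x * \<psi> x \<partial>lborel) = (\<Sum>v\<in>shifts L. \<integral>x. indicator (cell L) (x - v) * (G x * \<psi> x) \<partial>lborel)"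
    using pi[OF K(1) t] by (simp add: Bochner_Integration.integral_sum)
  also have "\<dots> = (\<Sum>v\<in>shifts L. \<integral>x. indicator (cell L) (x - 0) * (G x * \<psi> (x + v)) \<partial>lborel)"
  proof (rule sum.cong[OF refl])
    fix v :: "real^'n" assume v: "v \<in> shifts L"
    have "(\<integral>x. indicator (cell L) (x - v) * (G x * \<psi> x) \<partial>lborel) = (\<integral>x. indicator (cell L) (v + x - v) * (G (v + x) * \<psi> (v + x)) \<partial>lborel)"
      using lborel_integral_translate[OF m[of v], of v] by simp
    also have "\<dots> = (\<integral>x. indicator (cell L) (x - 0) * (G x * \<psi> (x + v)) \<partial>lborel)"
    proof (rule integral_cong_AE)
      show "AE x in lborel. indicator (cell L) (v + x - v) * (G (v + x) * \<psi> (v + x)) = indicator (cell L) (x - 0) * (G x * \<psi> (x + v))"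
        using AE_translate[OF per[OF v], of v]
      proof eventually_elim
        case (elim x)
        show ?case
        proof (cases "x \<in> cell L \<and> x + v \<in> K")
          case True
          then have "v + x \<in> ocube (4 * L)" "x \<in> ocube (4 * L)" using K(2) Q3 cell_ocube[OF L] by (auto simp: add.commute)
          then have "G (v + x) = G x" using elim by simp
          then show ?thesis by (simp add: add.commute)
        next
          case False
          then show ?thesis using tfn_zero[OF t, of "x + v"] by (auto simp: indicator_def add.commute)
        qed
      qed
    qed measurable
    finally show "(\<integral>x. indicator (cell L) (x - v) * (G x * \<psi> x) \<partial>lborel) = (\<integral>x. indicator (cell L) (x - 0) * (G x * \<psi> (x + v)) \<partial>lborel)" .
  qed
  also have "\<dots> = (\<integral>x. (\<Sum>v\<in>shifts L. indicator (cell L) (x - 0) * (G x * \<psi> (x + v))) \<partial>lborel)"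
    by (rule Bochner_Integration.integral_sum[symmetric]) (rule pi[OF compact_translate[OF K(1)] tfn_translate[OF t]])
  also have "\<dots> = (\<integral>x. indicator (ccube (2 * L)) x * (G x * periodize L \<psi> x) \<partial>lborel)"
  proof (rule integral_cong_AE)
    show "AE x in lborel. (\<Sum>v\<in>shifts L. indicator (cell L) (x - 0) * (G x * \<psi> (x + v))) = indicator (ccube (2 * L)) x * (G x * periodize L \<psi> x)"
      using AE_ccube_cell[of L]
      by eventually_elim (auto simp: periodize_def sum_distrib_left indicator_def)
    have [measurable]: "ccube (2 * L) \<in> sets (borel :: (real^'n) measure)" by (rule borel_closed[OF closed_ccube])
    show "(\<lambda>x. indicator (ccube (2 * L)) x * (G x * periodize L \<psi> x)) \<in> borel_measurable lborel"
      unfolding periodize_def by measurable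
    show "(\<lambda>x. \<Sum>v\<in>shifts L. indicator (cell L) (x - 0) * (G x * \<psi> (x + v))) \<in> borel_measurable lborel"
      by measurable
  qed
  finally show ?thesis by simp
qed

lemma periodize_smooth: "smooth_on UNIV \<phi> \<Longrightarrow> smooth_on UNIV (periodize L \<phi>)"
  unfolding periodize_def
proof (intro smooth_on_sum)
  fix v :: "real^'a" assume "smooth_on UNIV \<phi>"
  from smooth_on_affine[OF this, of 1 1 v] show "smooth_on UNIV (\<lambda>x. \<phi> (x + v))" by simp
qed simp

lemma cderiv_periodize:
  fixes \<phi> :: "real^'n::finite \<Rightarrow> real"
  assumes s: "smooth_on UNIV \<phi>" shows "cderiv \<alpha> (periodize L \<phi>) x = periodize L (cderiv \<alpha> \<phi>) x"
proof -
  have "smooth_on UNIV (\<lambda>x. \<phi> (x + v))" for v using smooth_on_affine[OF s, of 1 1 v] by simp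
  then have "dlist (alpha_list \<alpha>) (\<lambda>x. \<Sum>v\<in>shifts L. \<phi> (x + v)) x = (\<Sum>v\<in>shifts L. dlist (alpha_list \<alpha>) (\<lambda>x. \<phi> (x + v)) x)"
    by (intro dlist_sum[of UNIV]) auto
  then show ?thesis by (simp add: cderiv_def periodize_def[abs_def] dlist_translate[OF s])
qed

text \<open>Here the radius \<open>3 * L\<close> is decided: a nonzero shift moves some coordinate
  by \<open>4 * L\<close>, so a point of \<open>ccube L\<close> lands at distance at least
  \<open>3 * L\<close>, outside the open cube. On \<Omega> the periodization is therefore the test
  function itself.\<close>

lemma periodize_ccube:
  assumes L: "L > 0" and z: "\<And>y. y \<notin> ocube (3 * L) \<Longrightarrow> \<phi> y = 0" and x: "x \<in> ccube L"
  shows "periodize L \<phi> x = \<phi> x"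
proof -
  have "\<phi> (x + v) = 0" if v: "v \<in> shifts L" "v \<noteq> 0" for v
  proof (rule z)
    obtain i where "v $ i \<noteq> 0" using v(2) by (auto simp: vec_eq_iff)
    then have vi: "v $ i = - (4 * L) \<or> v $ i = 4 * L" using v(1) by (auto simp: shifts_def)
    have xi: "- L \<le> x $ i" "x $ i \<le> L" using x by (auto simp: ccube_def)
    show "x + v \<notin> ocube (3 * L)"
    proof
      assume "x + v \<in> ocube (3 * L)"
      then have "- (3 * L) < (x + v) $ i \<and> (x + v) $ i < 3 * L" unfolding ocube_def by blast
      then show False using vi xi by auto
    qed
  qed
  then have "(\<Sum>v\<in>shifts L. \<phi> (x + v)) = (\<Sum>v\<in>{0}. \<phi> (x + v))"
    by (intro sum.mono_neutral_right finite_shifts) (auto simp: shifts_def)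
  then show ?thesis by (simp add: periodize_def)
qed

lemma per_ext_periodize:
  assumes L: "L > 0" and z: "\<And>y. y \<notin> ocube (3 * L) \<Longrightarrow> \<phi> y = 0" and x: "x \<in> ocube (4 * L)"
  shows "per_ext L (periodize L \<phi>) x = periodize L \<phi> x"
  unfolding per_ext_lshift
proof (rule periodize_shift[OF L _ x _ lshift_lattice])
  show "x - lshift L x \<in> ocube (4 * L)" using cell_ocube[OF L] lshift_cell[OF L, of x] by (rule subsetD)
qed (rule z)

text \<open>Inside the open cube of half side \<open>4 * L\<close> the periodic extension coincides
  with a smooth function, so its classical derivatives are weak ones; the chosen \<open>pder\<close>
  agrees with them almost everywhere.\<close>

lemma periodize_Hs_per:
  assumes L: "L > 0" and K: "compact K" "K \<subseteq> ocube (3 * L)" and t: "tfn K \<phi>"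
  shows "periodize L \<phi> \<in> Hs_per s L"
    and "AE x in lborel. x \<in> ocube (4 * L) \<longrightarrow> pder L \<alpha> (periodize L \<phi>) x = periodize L (cderiv \<alpha> \<phi>) x"
proof -
  let ?Q = "ocube (4 * L) :: (real^'a) set"
  have z: "\<phi> y = 0" if "y \<notin> ocube (3 * L)" for y using tfn_zero[OF t] K(2) that by auto
  note sP = periodize_smooth[OF tfn_smooth[OF t], of L]
  have ext: "per_ext L (periodize L \<phi>) x = periodize L \<phi> x" if "x \<in> ?Q" for x
    by (rule per_ext_periodize[OF L z that])
  have Qb: "?Q \<in> sets borel" by (rule borel_open[OF open_ocube])
  have wd: "is_weak_deriv ?Q \<beta> (per_ext L (periodize L \<phi>)) (cderiv \<beta> (periodize L \<phi>))" for \<beta>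
    by (rule smooth_weak_deriv[OF open_ocube sP ext])
  have "L2 (ccube (2 * L)) (periodize L \<phi>)"
    by (rule smooth_L2[OF sP borel_closed[OF closed_ccube] bounded_ccube]) simp
  moreover have "L2 ?Q (per_ext L (periodize L \<phi>))"
    by (rule smooth_L2[OF sP Qb bounded_ocube ext])
  moreover have "L2 ?Q (cderiv \<beta> (periodize L \<phi>))" for \<beta>
    unfolding cderiv_def by (rule smooth_L2[OF smooth_on_dlist[OF sP] Qb bounded_ocube]) simp
  ultimately show "periodize L \<phi> \<in> Hs_per s L"
    unfolding Hs_per_def sobolev_def using wd by blast
  have "is_weak_deriv ?Q \<alpha> (per_ext L (periodize L \<phi>)) (pder L \<alpha> (periodize L \<phi>))"
    unfolding pder_def wd_def by (rule someI[of "is_weak_deriv ?Q \<alpha> (per_ext L (periodize L \<phi>))", OF wd])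
  from weak_deriv_unique[OF open_ocube this wd]
  show "AE x in lborel. x \<in> ?Q \<longrightarrow> pder L \<alpha> (periodize L \<phi>) x = periodize L (cderiv \<alpha> \<phi>) x"
    by eventually_elim (simp add: cderiv_periodize[OF tfn_smooth[OF t]])
qed

lemma L2_square_integrable:
  fixes f F :: "real^'n::finite \<Rightarrow> real"
  assumes U: "U \<in> sets borel" and f: "L2 U f" and F: "F \<in> borel_measurable borel" "\<And>x. x \<notin> U \<Longrightarrow> F x = 0" "AE x in lborel. x \<in> U \<longrightarrow> f x = F x"
  shows "integrable lborel (\<lambda>x. (F x)\<^sup>2)"
proof -
  have "AE x in lborel. x \<in> U \<longrightarrow> (f x)\<^sup>2 = (F x)\<^sup>2" using F(3) by eventually_elim auto
  then have "integrable lborel (\<lambda>x. indicator U x * (F x)\<^sup>2)"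
    using integrable_lebesgue_on_Borel[OF U, of "\<lambda>x. (F x)\<^sup>2" "\<lambda>x. (f x)\<^sup>2"] f F(1) by (simp add: L2_def)
  moreover have "(\<lambda>x. indicator U x * (F x)\<^sup>2) = (\<lambda>x. (F x)\<^sup>2)" using F(2) by (auto simp: indicator_def fun_eq_iff)
  ultimately show ?thesis by simp
qed

text \<open>Everything the regularity theory needs from membership in \<open>Hs_per\<close>: Borel
  representatives of the extension and of its derivatives, the weak derivative relation on the large
  cube, and the first term of the form against a periodized test function, unfolded to the whole
  space.\<close>

lemma Hs_per_representatives:
  fixes f :: "real^'n::finite \<Rightarrow> real"
  assumes L: "L > 0" and f: "f \<in> Hs_per s L"
  obtains W G where "W \<in> borel_measurable borel" "integrable lborel W"
    "AE x in lborel. x \<in> ocube (4 * L) \<longrightarrow> per_ext L f x = W x"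
    "\<And>\<alpha>. \<alpha> \<in> multi_indices s \<Longrightarrow> G \<alpha> \<in> borel_measurable borel"
    "\<And>\<alpha>. \<alpha> \<in> multi_indices s \<Longrightarrow> integrable lborel (\<lambda>x. (G \<alpha> x)\<^sup>2)"
    "\<And>\<alpha>. \<alpha> \<in> multi_indices s \<Longrightarrow> AE x in lborel. x \<in> ocube (4 * L) \<longrightarrow> pder L \<alpha> f x = G \<alpha> x"
    "\<And>\<alpha> K \<phi>. \<alpha> \<in> multi_indices s \<Longrightarrow> compact K \<Longrightarrow> K \<subseteq> ocube (4 * L) \<Longrightarrow> tfn K \<phi> \<Longrightarrow>
        (\<integral>x. W x * cderiv \<alpha> \<phi> x \<partial>lborel) = (-1) ^ mi_order \<alpha> * (\<integral>x. G \<alpha> x * \<phi> x \<partial>lborel)"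
    "\<And>\<alpha> K \<phi>. \<alpha> \<in> multi_indices s \<Longrightarrow> compact K \<Longrightarrow> K \<subseteq> ocube (3 * L) \<Longrightarrow> tfn K \<phi> \<Longrightarrow>
        integral\<^sup>L (lebesgue_on (ccube (2 * L))) (\<lambda>x. pder L \<alpha> f x * pder L \<alpha> (periodize L \<phi>) x) = (\<integral>x. G \<alpha> x * cderiv \<alpha> \<phi> x \<partial>lborel)"
proof -
  let ?Q = "ocube (4 * L) :: (real^'n) set"
  have Qb: "?Q \<in> sets borel" by (rule borel_open[OF open_ocube])
  have sob: "L2 ?Q (per_ext L f)" "\<And>\<alpha>. \<alpha> \<in> multi_indices s \<Longrightarrow> \<exists>g. is_weak_deriv ?Q \<alpha> (per_ext L f) g \<and> L2 ?Q g"
    using f by (auto simp: Hs_per_def sobolev_def)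
  obtain W where W: "W \<in> borel_measurable borel" "\<And>x. x \<notin> ?Q \<Longrightarrow> W x = 0" "AE x in lborel. x \<in> ?Q \<longrightarrow> per_ext L f x = W x"
  proof (rule Borel_representative[OF Qb])
    show "per_ext L f \<in> borel_measurable (lebesgue_on ?Q)" using sob(1) by (simp add: L2_def)
    fix F assume "F \<in> borel_measurable borel" "\<And>x. x \<notin> ?Q \<Longrightarrow> F x = 0" "AE x in lborel. x \<in> ?Q \<longrightarrow> per_ext L f x = F x"
    then show thesis by (intro that[of F])
  qed
  have W2: "integrable lborel (\<lambda>x. (W x)\<^sup>2)" by (rule L2_square_integrable[OF Qb sob(1) W])
  have Wi: "integrable lborel W"
  proof -
    have "compact (closure ?Q)" using bounded_ocube by simp
    then have "integrable lborel (\<lambda>x. indicator (closure ?Q) x * W x)" by (rule integrable_compact_L2[OF W(1) W2])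
    moreover have "(\<lambda>x. indicator (closure ?Q) x * W x) = W"
      using W(2) closure_subset[of ?Q] by (auto simp: indicator_def fun_eq_iff)
    ultimately show ?thesis by simp
  qed
  have "\<exists>H. H \<in> borel_measurable borel \<and> integrable lborel (\<lambda>x. (H x)\<^sup>2) \<and> (AE x in lborel. x \<in> ?Q \<longrightarrow> pder L \<alpha> f x = H x) \<and>
     is_weak_deriv ?Q \<alpha> (per_ext L f) (pder L \<alpha> f)"
    if a: "\<alpha> \<in> multi_indices s" for \<alpha>
  proof -
    obtain g where g: "is_weak_deriv ?Q \<alpha> (per_ext L f) g" "L2 ?Q g" using sob(2)[OF a] by blast
    have wd: "is_weak_deriv ?Q \<alpha> (per_ext L f) (pder L \<alpha> f)"
      unfolding pder_def wd_def by (rule someI[of "is_weak_deriv ?Q \<alpha> (per_ext L f)", OF g(1)])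
    obtain H where H: "H \<in> borel_measurable borel" "\<And>x. x \<notin> ?Q \<Longrightarrow> H x = 0" "AE x in lborel. x \<in> ?Q \<longrightarrow> g x = H x"
    proof (rule Borel_representative[OF Qb])
      show "g \<in> borel_measurable (lebesgue_on ?Q)" using g(2) by (simp add: L2_def)
      fix F assume "F \<in> borel_measurable borel" "\<And>x. x \<notin> ?Q \<Longrightarrow> F x = 0" "AE x in lborel. x \<in> ?Q \<longrightarrow> g x = F x"
      then show thesis by (intro that[of F])
    qed
    have "AE x in lborel. x \<in> ?Q \<longrightarrow> pder L \<alpha> f x = H x"
      using weak_deriv_unique[OF open_ocube wd g(1)] H(3) by eventually_elim auto
    then show ?thesis using H(1) L2_square_integrable[OF Qb g(2) H] wd by blast
  qed
  then have "\<forall>\<alpha>. \<exists>H. \<alpha> \<in> multi_indices s \<longrightarrow> H \<in> borel_measurable borel \<and> integrable lborel (\<lambda>x. (H x)\<^sup>2) \<and> (AE x in lborel. x \<in> ?Q \<longrightarrow> pder L \<alpha> f x = H x) \<and>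
     is_weak_deriv ?Q \<alpha> (per_ext L f) (pder L \<alpha> f)"
    by blast
  from choice[OF this] obtain G where G0: "\<forall>\<alpha>. \<alpha> \<in> multi_indices s \<longrightarrow> G \<alpha> \<in> borel_measurable borel \<and> integrable lborel (\<lambda>x. (G \<alpha> x)\<^sup>2) \<and> (AE x in lborel. x \<in> ?Q \<longrightarrow> pder L \<alpha> f x = G \<alpha> x) \<and>
     is_weak_deriv ?Q \<alpha> (per_ext L f) (pder L \<alpha> f)" ..
  then have G: "\<And>\<alpha>. \<alpha> \<in> multi_indices s \<Longrightarrow> G \<alpha> \<in> borel_measurable borel"
    "\<And>\<alpha>. \<alpha> \<in> multi_indices s \<Longrightarrow> integrable lborel (\<lambda>x. (G \<alpha> x)\<^sup>2)"
    "\<And>\<alpha>. \<alpha> \<in> multi_indices s \<Longrightarrow> AE x in lborel. x \<in> ?Q \<longrightarrow> pder L \<alpha> f x = G \<alpha> x"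
    "\<And>\<alpha>. \<alpha> \<in> multi_indices s \<Longrightarrow> is_weak_deriv ?Q \<alpha> (per_ext L f) (pder L \<alpha> f)" by auto
  have D: "(\<integral>x. W x * cderiv \<alpha> \<phi> x \<partial>lborel) = (-1) ^ mi_order \<alpha> * (\<integral>x. G \<alpha> x * \<phi> x \<partial>lborel)"
    if "\<alpha> \<in> multi_indices s" "compact K" "K \<subseteq> ?Q" "tfn K \<phi>" for \<alpha> K \<phi>
    by (rule weak_deriv_Borel[OF open_ocube G(4)[OF that(1)] W(1,3) G(1)[OF that(1)] G(3)[OF that(1)] that(2-4)])
  have I: "integral\<^sup>L (lebesgue_on (ccube (2 * L))) (\<lambda>x. pder L \<alpha> f x * pder L \<alpha> (periodize L \<phi>) x) = (\<integral>x. G \<alpha> x * cderiv \<alpha> \<phi> x \<partial>lborel)"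
    if a: "\<alpha> \<in> multi_indices s" and K: "compact K" "K \<subseteq> ocube (3 * L)" and t: "tfn K \<phi>" for \<alpha> K \<phi>
  proof -
    have tc: "tfn K (cderiv \<alpha> \<phi>)" by (rule tfn_cderiv[OF K(1) t])
    have CQ: "ccube (2 * L) \<subseteq> ?Q"
    proof
      fix x :: "real^'n" assume x: "x \<in> ccube (2 * L)"
      have "- (4 * L) < x $ i \<and> x $ i < 4 * L" for i
      proof -
        have "- (2 * L) \<le> x $ i \<and> x $ i \<le> 2 * L" using x unfolding ccube_def by blast
        then show ?thesis using L by linarith
      qed
      then show "x \<in> ?Q" by (simp add: ocube_def)
    qed
    have "integral\<^sup>L (lebesgue_on (ccube (2 * L))) (\<lambda>x. pder L \<alpha> f x * pder L \<alpha> (periodize L \<phi>) x)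
       = (\<integral>x. indicator (ccube (2 * L)) x * (G \<alpha> x * periodize L (cderiv \<alpha> \<phi>) x) \<partial>lborel)"
    proof (rule integral_lebesgue_on_Borel)
      show "ccube (2 * L) \<in> sets (borel :: (real^'n) measure)" by (rule borel_closed[OF closed_ccube])
      show "(\<lambda>x. G \<alpha> x * periodize L (cderiv \<alpha> \<phi>) x) \<in> borel_measurable borel"
        using G(1)[OF a] smooth_measurable[OF periodize_smooth[OF tfn_smooth[OF tc], of L]] by measurable
      show "AE x in lborel. x \<in> ccube (2 * L) \<longrightarrow> pder L \<alpha> f x * pder L \<alpha> (periodize L \<phi>) x = G \<alpha> x * periodize L (cderiv \<alpha> \<phi>) x"
        using G(3)[OF a] periodize_Hs_per(2)[OF L K t, of \<alpha>] by eventually_elim (use CQ in auto)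
    qed
    also have "\<dots> = (\<integral>x. G \<alpha> x * cderiv \<alpha> \<phi> x \<partial>lborel)"
      by (rule cell_integral[OF L G(1)[OF a] G(2)[OF a] _ K tc])
        (rule weak_deriv_periodic[OF L W(1,3) G(1)[OF a] G(2)[OF a] D[OF a]], use shifts_lattice in auto)
    finally show ?thesis .
  qed
  show ?thesis using W(1) Wi W(3) G(1-3) D I by (rule that)
qed

section \<open>The eigenvalue problem\<close>

lemma ccube_ocube: "r < r' \<Longrightarrow> ccube r \<subseteq> (ocube r' :: (real^'n::finite) set)"
proof
  fix x :: "real^'n" assume r: "r < r'" and x: "x \<in> ccube r"
  have "- r' < x $ i \<and> x $ i < r'" for i
  proof -
    have "- r \<le> x $ i \<and> x $ i \<le> r" using x unfolding ccube_def by blast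
    then show ?thesis using r by linarith
  qed
  then show "x \<in> ocube r'" by (simp add: ocube_def)
qed

lemma ccube_cell: "L > 0 \<Longrightarrow> ccube L \<subseteq> (cell L :: (real^'n::finite) set)"
proof
  fix x :: "real^'n" assume L: "L > 0" and x: "x \<in> ccube L"
  have "- (2 * L) \<le> x $ i \<and> x $ i < 2 * L" for i
  proof -
    have "- L \<le> x $ i \<and> x $ i \<le> L" using x unfolding ccube_def by blast
    then show ?thesis using L by linarith
  qed
  then show "x \<in> cell L" by (simp add: cell_def)
qed

lemma Dop_AE:
  fixes f :: "real^'n::finite \<Rightarrow> real"
  assumes "\<And>\<alpha>. \<alpha> \<in> multi_indices s \<Longrightarrow> AE x in lborel. x \<in> U \<longrightarrow> pder L \<alpha> f x = h \<alpha> x"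
  shows "AE x in lborel. x \<in> U \<longrightarrow> Dop s L p f x = (\<Sum>\<alpha>\<in>multi_indices s. p \<alpha> x * h \<alpha> x)"
proof -
  have "AE x in lborel. \<forall>\<alpha>\<in>multi_indices s. x \<in> U \<longrightarrow> pder L \<alpha> f x = h \<alpha> x"
    unfolding AE_ball_countable[OF countable_finite[OF finite_multi_indices]] using assms by blast
  then show ?thesis
  proof eventually_elim
    case (elim x)
    show ?case unfolding Dop_def using elim by (intro impI sum.cong) auto
  qed
qed

text \<open>On a subset of \<open>ccube L\<close> no translate interferes, so the operator acts on
  the original test function.\<close>

lemma Dop_periodize:
  fixes \<phi> :: "real^'n::finite \<Rightarrow> real"
  assumes L: "L > 0" and U: "U \<subseteq> ccube L" and K: "compact K" "K \<subseteq> ocube (3 * L)" and t: "tfn K \<phi>"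
  shows "AE x in lborel. x \<in> U \<longrightarrow> Dop s L p (periodize L \<phi>) x = (\<Sum>\<beta>\<in>multi_indices s. p \<beta> x * cderiv \<beta> \<phi> x)"
proof (rule Dop_AE)
  fix \<alpha> :: "'n \<Rightarrow> nat"
  have z: "cderiv \<alpha> \<phi> y = 0" if "y \<notin> ocube (3 * L)" for y
    using tfn_zero[OF tfn_cderiv[OF K(1) t]] K(2) that by blast
  have UQ: "U \<subseteq> ocube (4 * L)" using U ccube_ocube[of L "4 * L"] L by force
  show "AE x in lborel. x \<in> U \<longrightarrow> pder L \<alpha> (periodize L \<phi>) x = cderiv \<alpha> \<phi> x"
    using periodize_Hs_per(2)[OF L K t, of \<alpha>]
  proof eventually_elim
    case (elim x)
    show ?case
    proof
      assume x: "x \<in> U"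
      have "periodize L (cderiv \<alpha> \<phi>) x = cderiv \<alpha> \<phi> x"
        by (rule periodize_ccube[OF L z]) (use x U in auto)
      then show "pder L \<alpha> (periodize L \<phi>) x = cderiv \<alpha> \<phi> x" using elim x UQ by auto
    qed
  qed
qed

text \<open>Test functions supported in \<Omega> lie in the cube of half side \<open>3 * L\<close>;
  their periodizations are admissible in the equation and equal them on \<Omega>. So
  \<open>W\<close> and \<open>G\<close> satisfy the equation of \<open>weak_solution\<close>
  there.\<close>

lemma interior_regularity:
  fixes \<Omega> :: "(real^'n::finite) set"
  assumes L: "L > 0" and om: "open \<Omega>" "\<Omega> \<subseteq> ccube L" and s: "s \<ge> 1" and lam: "lam > 0" and mu: "mu \<ge> 0"
    and p: "\<And>\<alpha>. \<alpha> \<in> multi_indices s \<Longrightarrow> smooth_on \<Omega> (p \<alpha>)"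
    and f: "f \<in> Hs_per s L"
    and eq: "\<And>\<phi>. \<phi> \<in> Hs_per s L \<Longrightarrow> Bform s L \<Omega> p lam mu f \<phi> = c * integral\<^sup>L (lebesgue_on \<Omega>) (\<lambda>x. f x * \<phi> x)"
  shows "\<exists>g. smooth_on \<Omega> g \<and> (AE x in lebesgue_on \<Omega>. g x = f x) \<and>
     (\<forall>x\<in>\<Omega>. lam * (\<Sum>\<alpha>\<in>multi_indices s. (-1) ^ mi_order \<alpha> * cderiv (\<lambda>i. 2 * \<alpha> i) g x) + mu * Dstar s p (Dc s p g) x = c * g x)"
proof -
  have omb: "\<Omega> \<in> sets borel" using om(1) by auto
  have omQ: "\<Omega> \<subseteq> ocube (4 * L)" and om3: "\<Omega> \<subseteq> ocube (3 * L)"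
    using om(2) ccube_ocube[of L "4 * L"] ccube_ocube[of L "3 * L"] L by force+
  show ?thesis
  proof (rule Hs_per_representatives[OF L f])
    fix W G
    assume W: "W \<in> borel_measurable borel" "integrable lborel W" "AE x in lborel. x \<in> ocube (4 * L) \<longrightarrow> per_ext L f x = W x"
      and G: "\<And>\<alpha>. \<alpha> \<in> multi_indices s \<Longrightarrow> G \<alpha> \<in> borel_measurable borel"
        "\<And>\<alpha>. \<alpha> \<in> multi_indices s \<Longrightarrow> integrable lborel (\<lambda>x. (G \<alpha> x)\<^sup>2)"
        "\<And>\<alpha>. \<alpha> \<in> multi_indices s \<Longrightarrow> AE x in lborel. x \<in> ocube (4 * L) \<longrightarrow> pder L \<alpha> f x = G \<alpha> x"
      and D: "\<And>\<alpha> K \<phi>. \<alpha> \<in> multi_indices s \<Longrightarrow> compact K \<Longrightarrow> K \<subseteq> ocube (4 * L) \<Longrightarrow> tfn K \<phi> \<Longrightarrow>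
        (\<integral>x. W x * cderiv \<alpha> \<phi> x \<partial>lborel) = (-1) ^ mi_order \<alpha> * (\<integral>x. G \<alpha> x * \<phi> x \<partial>lborel)"
      and I: "\<And>\<alpha> K \<phi>. \<alpha> \<in> multi_indices s \<Longrightarrow> compact K \<Longrightarrow> K \<subseteq> ocube (3 * L) \<Longrightarrow> tfn K \<phi> \<Longrightarrow>
        integral\<^sup>L (lebesgue_on (ccube (2 * L))) (\<lambda>x. pder L \<alpha> f x * pder L \<alpha> (periodize L \<phi>) x) = (\<integral>x. G \<alpha> x * cderiv \<alpha> \<phi> x \<partial>lborel)"
    have fW: "AE x in lborel. x \<in> \<Omega> \<longrightarrow> f x = W x"
      using W(3) by eventually_elim (use omQ om(2) ccube_cell[OF L] per_ext_cell[OF L, of _ f] in \<open>auto simp: subset_iff\<close>)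
    have DG: "AE x in lborel. x \<in> \<Omega> \<longrightarrow> Dop s L p f x = (\<Sum>\<alpha>\<in>multi_indices s. p \<alpha> x * G \<alpha> x)"
    proof (rule Dop_AE)
      fix \<alpha> :: "'n \<Rightarrow> nat" assume "\<alpha> \<in> multi_indices s"
      from G(3)[OF this] show "AE x in lborel. x \<in> \<Omega> \<longrightarrow> pder L \<alpha> f x = G \<alpha> x"
        by eventually_elim (use omQ in auto)
    qed
    interpret weak_solution \<Omega> s lam mu c p W G
    proof
      fix K and \<phi> :: "real^'n \<Rightarrow> real" assume K: "compact K" "K \<subseteq> \<Omega>" and t: "tfn K \<phi>"
      have K3: "K \<subseteq> ocube (3 * L)" using K(2) om3 by auto
      define F where "F x = (\<Sum>\<alpha>\<in>multi_indices s. p \<alpha> x * G \<alpha> x) * (\<Sum>\<beta>\<in>multi_indices s. p \<beta> x * cderiv \<beta> \<phi> x)" for x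
      have tc: "tfn K (cderiv \<beta> \<phi>)" for \<beta> by (rule tfn_cderiv[OF K(1) t])
      have "F = (\<lambda>x. \<Sum>\<alpha>\<in>multi_indices s. \<Sum>\<beta>\<in>multi_indices s. G \<alpha> x * ((p \<alpha> x * p \<beta> x) * cderiv \<beta> \<phi> x))"
        unfolding F_def by (simp add: sum_product mult_ac)
      moreover have "tfn K (\<lambda>x. (p \<alpha> x * p \<beta> x) * cderiv \<beta> \<phi> x)" if "\<alpha> \<in> multi_indices s" "\<beta> \<in> multi_indices s" for \<alpha> \<beta>
        by (rule tfn_mult_on[OF K om(1) smooth_on_mult[OF om(1) p[OF that(1)] p[OF that(2)]] tc])
      ultimately have Fm: "F \<in> borel_measurable borel"
        by (simp only:) (intro borel_measurable_sum borel_measurable_times G(1) tfn_measurable; assumption)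
      have F0: "F x = 0" if "x \<notin> K" for x unfolding F_def using tfn_zero[OF tc that] by simp
      have mu_term: "integral\<^sup>L (lebesgue_on \<Omega>) (\<lambda>x. Dop s L p f x * Dop s L p (periodize L \<phi>) x) = (\<integral>x. F x \<partial>lborel)"
      proof -
        have "integral\<^sup>L (lebesgue_on \<Omega>) (\<lambda>x. Dop s L p f x * Dop s L p (periodize L \<phi>) x) = (\<integral>x. indicator \<Omega> x * F x \<partial>lborel)"
        proof (rule integral_lebesgue_on_Borel[OF omb Fm])
          show "AE x in lborel. x \<in> \<Omega> \<longrightarrow> Dop s L p f x * Dop s L p (periodize L \<phi>) x = F x"
            using DG Dop_periodize[OF L om(2) K(1) K3 t, of s p] unfolding F_def by eventually_elim auto
        qed
        also have "(\<lambda>x. indicator \<Omega> x * F x) = F" using F0 K(2) by (auto simp: indicator_def fun_eq_iff)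
        finally show ?thesis .
      qed
      have rhs: "integral\<^sup>L (lebesgue_on \<Omega>) (\<lambda>x. f x * periodize L \<phi> x) = (\<integral>x. W x * \<phi> x \<partial>lborel)"
      proof -
        have "integral\<^sup>L (lebesgue_on \<Omega>) (\<lambda>x. f x * periodize L \<phi> x) = (\<integral>x. indicator \<Omega> x * (W x * \<phi> x) \<partial>lborel)"
        proof (rule integral_lebesgue_on_Borel[OF omb])
          show "(\<lambda>x. W x * \<phi> x) \<in> borel_measurable borel" using W(1) tfn_measurable[OF t] by measurable
          have z: "\<phi> y = 0" if "y \<notin> ocube (3 * L)" for y using tfn_zero[OF t] K3 that by blast
          show "AE x in lborel. x \<in> \<Omega> \<longrightarrow> f x * periodize L \<phi> x = W x * \<phi> x"
            using fW
          proof eventually_elim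
            case (elim x)
            show ?case
            proof
              assume x: "x \<in> \<Omega>"
              have "periodize L \<phi> x = \<phi> x" by (rule periodize_ccube[OF L z]) (use x om in auto)
              then show "f x * periodize L \<phi> x = W x * \<phi> x" using elim x by simp
            qed
          qed
        qed
        also have "(\<lambda>x. indicator \<Omega> x * (W x * \<phi> x)) = (\<lambda>x. W x * \<phi> x)"
          using K(2) tfn_zero[OF t] by (auto simp: indicator_def fun_eq_iff)
        finally show ?thesis .
      qed
      show "lam * (\<Sum>\<alpha>\<in>multi_indices s. \<integral>x. G \<alpha> x * cderiv \<alpha> \<phi> x \<partial>lborel)
         + mu * (\<integral>x. (\<Sum>\<alpha>\<in>multi_indices s. p \<alpha> x * G \<alpha> x) * (\<Sum>\<beta>\<in>multi_indices s. p \<beta> x * cderiv \<beta> \<phi> x) \<partial>lborel)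
         = c * (\<integral>x. W x * \<phi> x \<partial>lborel)"
        using eq[OF periodize_Hs_per(1)[OF L K(1) K3 t, of s]] I[OF _ K(1) K3 t] mu_term rhs
        unfolding Bform_def F_def by simp
    next
      fix \<alpha> :: "'n \<Rightarrow> nat" and K and \<phi> :: "real^'n \<Rightarrow> real" assume "\<alpha> \<in> multi_indices s" "compact K" "K \<subseteq> \<Omega>" "tfn K \<phi>"
      then show "(\<integral>x. W x * cderiv \<alpha> \<phi> x \<partial>lborel) = (-1) ^ mi_order \<alpha> * (\<integral>x. G \<alpha> x * \<phi> x \<partial>lborel)"
        using omQ by (intro D) auto
    qed (use om s lam mu p W G in auto)
    show ?thesis
    proof (rule regularity)
      fix g assume g: "smooth_on \<Omega> g" "AE x in lborel. x \<in> \<Omega> \<longrightarrow> g x = W x"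
        and e: "\<And>x. x \<in> \<Omega> \<Longrightarrow> lam * (\<Sum>\<alpha>\<in>multi_indices s. (-1) ^ mi_order \<alpha> * cderiv (\<lambda>i. 2 * \<alpha> i) g x) + mu * Dstar s p (Dc s p g) x = c * g x"
      have "AE x in lborel. x \<in> \<Omega> \<longrightarrow> g x = f x" using g(2) fW by eventually_elim auto
      then show ?thesis using g(1) e by (intro exI[of _ g]) (auto simp: AE_lebesgue_on_iff[OF omb])
    qed
  qed
qed

text \<open>A test function supported away from the closure of \<Omega> has a periodization
  vanishing on \<Omega>, which removes the term with the operator and the right-hand side. What
  remains is the same equation with zero data, and \<open>lam > 0\<close> is divided out.\<close>

lemma exterior_regularity:
  fixes \<Omega> :: "(real^'n::finite) set"
  assumes L: "L > 0" and om: "open \<Omega>" "\<Omega> \<subseteq> ccube L" and s: "s \<ge> 1" and lam: "lam > 0"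
    and f: "f \<in> Hs_per s L"
    and eq: "\<And>\<phi>. \<phi> \<in> Hs_per s L \<Longrightarrow> Bform s L \<Omega> p lam mu f \<phi> = c * integral\<^sup>L (lebesgue_on \<Omega>) (\<lambda>x. f x * \<phi> x)"
  shows "\<exists>g U. open U \<and> ccube (2 * L) - closure \<Omega> \<subseteq> U \<and> smooth_on U g \<and> (AE x in lebesgue_on U. g x = per_ext L f x) \<and>
     (\<forall>x\<in>ccube (2 * L) - closure \<Omega>. (\<Sum>\<alpha>\<in>multi_indices s. (-1) ^ mi_order \<alpha> * cderiv (\<lambda>i. 2 * \<alpha> i) g x) = 0)"
proof -
  \<comment> \<open>Contains the closed cube of half side \<open>2 * L\<close> apart from the
    closure of \<Omega>, so its faces are interior; proper translates of \<Omega> stay outside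
    \<open>ocube (3 * L)\<close>.\<close>
  define V where "V = ocube (3 * L) - closure \<Omega>"
  have oV: "open V" unfolding V_def by (intro open_Diff open_ocube closed_closure)
  have V3: "V \<subseteq> ocube (3 * L)" by (auto simp: V_def)
  have V4: "V \<subseteq> ocube (4 * L)" using V3 cube_mono[of "3 * L" "4 * L"] L by force
  have CV: "ccube (2 * L) - closure \<Omega> \<subseteq> V" unfolding V_def using ccube_ocube[of "2 * L" "3 * L"] L by force
  have Vb: "V \<in> sets borel" using oV by auto
  have omb: "\<Omega> \<in> sets borel" using om(1) by auto
  show ?thesis
  proof (rule Hs_per_representatives[OF L f])
    fix W G
    assume W: "W \<in> borel_measurable borel" "integrable lborel W" "AE x in lborel. x \<in> ocube (4 * L) \<longrightarrow> per_ext L f x = W x"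
      and G: "\<And>\<alpha>. \<alpha> \<in> multi_indices s \<Longrightarrow> G \<alpha> \<in> borel_measurable borel"
        "\<And>\<alpha>. \<alpha> \<in> multi_indices s \<Longrightarrow> integrable lborel (\<lambda>x. (G \<alpha> x)\<^sup>2)"
      and D: "\<And>\<alpha> K \<phi>. \<alpha> \<in> multi_indices s \<Longrightarrow> compact K \<Longrightarrow> K \<subseteq> ocube (4 * L) \<Longrightarrow> tfn K \<phi> \<Longrightarrow>
        (\<integral>x. W x * cderiv \<alpha> \<phi> x \<partial>lborel) = (-1) ^ mi_order \<alpha> * (\<integral>x. G \<alpha> x * \<phi> x \<partial>lborel)"
      and I: "\<And>\<alpha> K \<phi>. \<alpha> \<in> multi_indices s \<Longrightarrow> compact K \<Longrightarrow> K \<subseteq> ocube (3 * L) \<Longrightarrow> tfn K \<phi> \<Longrightarrow>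
        integral\<^sup>L (lebesgue_on (ccube (2 * L))) (\<lambda>x. pder L \<alpha> f x * pder L \<alpha> (periodize L \<phi>) x) = (\<integral>x. G \<alpha> x * cderiv \<alpha> \<phi> x \<partial>lborel)"
    interpret weak_solution V s lam 0 0 "\<lambda>_ _. 0" W G
    proof
      fix K and \<phi> :: "real^'n \<Rightarrow> real" assume K: "compact K" "K \<subseteq> V" and t: "tfn K \<phi>"
      have K3: "K \<subseteq> ocube (3 * L)" using K(2) V3 by auto
      have dj: "x \<notin> K" if "x \<in> \<Omega>" for x using that K(2) closure_subset[of \<Omega>] by (auto simp: V_def)
      have z: "\<phi> y = 0" if "y \<notin> ocube (3 * L)" for y using tfn_zero[OF t] K3 that by blast
      have "integral\<^sup>L (lebesgue_on \<Omega>) (\<lambda>x. Dop s L p f x * Dop s L p (periodize L \<phi>) x) = (\<integral>x. indicator \<Omega> x * 0 \<partial>lborel)"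
      proof (rule integral_lebesgue_on_Borel[OF omb])
        show "AE x in lborel. x \<in> \<Omega> \<longrightarrow> Dop s L p f x * Dop s L p (periodize L \<phi>) x = 0"
          using Dop_periodize[OF L om(2) K(1) K3 t, of s p]
        proof eventually_elim
          case (elim x)
          show ?case using elim tfn_zero[OF tfn_cderiv[OF K(1) t]] dj by auto
        qed
      qed simp
      moreover have "integral\<^sup>L (lebesgue_on \<Omega>) (\<lambda>x. f x * periodize L \<phi> x) = (\<integral>x. indicator \<Omega> x * 0 \<partial>lborel)"
      proof (rule integral_lebesgue_on_Borel[OF omb])
        have "f x * periodize L \<phi> x = 0" if x: "x \<in> \<Omega>" for x
        proof -
          have "periodize L \<phi> x = \<phi> x" by (rule periodize_ccube[OF L z]) (use x om in auto)
          then show ?thesis using tfn_zero[OF t dj[OF x]] by simp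
        qed
        then show "AE x in lborel. x \<in> \<Omega> \<longrightarrow> f x * periodize L \<phi> x = 0" by auto
      qed simp
      ultimately show "lam * (\<Sum>\<alpha>\<in>multi_indices s. \<integral>x. G \<alpha> x * cderiv \<alpha> \<phi> x \<partial>lborel)
         + 0 * (\<integral>x. (\<Sum>\<alpha>\<in>multi_indices s. 0 * G \<alpha> x) * (\<Sum>\<beta>\<in>multi_indices s. 0 * cderiv \<beta> \<phi> x) \<partial>lborel)
         = 0 * (\<integral>x. W x * \<phi> x \<partial>lborel)"
        using eq[OF periodize_Hs_per(1)[OF L K(1) K3 t, of s]] I[OF _ K(1) K3 t]
        unfolding Bform_def by simp
    next
      fix \<alpha> :: "'n \<Rightarrow> nat" and K and \<phi> :: "real^'n \<Rightarrow> real" assume "\<alpha> \<in> multi_indices s" "compact K" "K \<subseteq> V" "tfn K \<phi>"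
      then show "(\<integral>x. W x * cderiv \<alpha> \<phi> x \<partial>lborel) = (-1) ^ mi_order \<alpha> * (\<integral>x. G \<alpha> x * \<phi> x \<partial>lborel)"
        using V4 by (intro D) auto
    qed (use oV s lam W G smooth_on_const[OF oV] in auto)
    show ?thesis
    proof (rule regularity)
      fix g assume g: "smooth_on V g" "AE x in lborel. x \<in> V \<longrightarrow> g x = W x"
        and e: "\<And>x. x \<in> V \<Longrightarrow> lam * (\<Sum>\<alpha>\<in>multi_indices s. (-1) ^ mi_order \<alpha> * cderiv (\<lambda>i. 2 * \<alpha> i) g x)
          + 0 * Dstar s (\<lambda>_ _. 0) (Dc s (\<lambda>_ _. 0) g) x = 0 * g x"
      have "AE x in lborel. x \<in> V \<longrightarrow> g x = per_ext L f x"
        using g(2) W(3) by eventually_elim (use V4 in auto)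
      moreover have "(\<Sum>\<alpha>\<in>multi_indices s. (-1) ^ mi_order \<alpha> * cderiv (\<lambda>i. 2 * \<alpha> i) g x) = 0" if "x \<in> V" for x
        using e[OF that] lam by simp
      ultimately show ?thesis using g(1) oV CV by (intro exI[of _ g] exI[of _ V]) (auto simp: AE_lebesgue_on_iff[OF Vb])
    qed
  qed
qed

text \<open>The right-hand side of the problem solved by \<open>u\<close> is \<open>v\<close>
  restricted to \<Omega>, and there the eigenvalue relation replaces \<open>v\<close> by
  \<open>u / am\<close>.\<close>

lemma eigenfunction_weak_form:
  fixes \<Omega> :: "(real^'n::finite) set"
  assumes om: "open \<Omega>" "\<Omega> \<subseteq> ccube (2 * L)" and am: "am > 0"
    and u: "O_rel s L \<Omega> p lam mu (Cop \<Omega> v) u" and v: "L2 (ccube (2 * L)) v"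
    and eig: "AE x in lebesgue_on (ccube (2 * L)). Cop \<Omega> u x = am * v x" and \<phi>: "\<phi> \<in> Hs_per s L"
  shows "Bform s L \<Omega> p lam mu u \<phi> = (1 / am) * integral\<^sup>L (lebesgue_on \<Omega>) (\<lambda>x. u x * \<phi> x)"
proof -
  let ?C = "ccube (2 * L) :: (real^'n) set"
  have Cs: "?C \<inter> space lebesgue \<in> sets lebesgue" and Os: "\<Omega> \<inter> space lebesgue \<in> sets lebesgue"
  proof -
    have "?C \<in> sets borel" by (rule borel_closed[OF closed_ccube])
    moreover have "\<Omega> \<in> sets borel" using om(1) by auto
    ultimately show "?C \<inter> space lebesgue \<in> sets lebesgue" "\<Omega> \<inter> space lebesgue \<in> sets lebesgue" by auto
  qed
  have [measurable]: "u \<in> borel_measurable (lebesgue_on ?C)" "v \<in> borel_measurable (lebesgue_on ?C)" "\<phi> \<in> borel_measurable (lebesgue_on ?C)"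
    using u v \<phi> by (auto simp: O_rel_def Hs_per_def L2_def)
  have "(indicator \<Omega> :: _ \<Rightarrow> real) \<in> borel_measurable lebesgue" using Os by (intro borel_measurable_indicator) simp
  then have [measurable]: "(indicator \<Omega> :: _ \<Rightarrow> real) \<in> borel_measurable (lebesgue_on ?C)"
    by (rule measurable_restrict_space1)
  have "Bform s L \<Omega> p lam mu u \<phi> = integral\<^sup>L (lebesgue_on ?C) (\<lambda>x. \<phi> x * (indicator \<Omega> x * v x))"
    using u \<phi> by (simp add: O_rel_def Cop_def)
  also have "\<dots> = integral\<^sup>L (lebesgue_on ?C) (\<lambda>x. (1 / am) * (indicator \<Omega> x * (u x * \<phi> x)))"
  proof (rule integral_cong_AE)
    show "AE x in lebesgue_on ?C. \<phi> x * (indicator \<Omega> x * v x) = (1 / am) * (indicator \<Omega> x * (u x * \<phi> x))"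
      using eig by eventually_elim (use am in \<open>auto simp: Cop_def indicator_def\<close>)
  qed measurable
  also have "\<dots> = (1 / am) * integral\<^sup>L (lebesgue_on ?C) (\<lambda>x. indicator \<Omega> x * (u x * \<phi> x))" by simp
  also have "integral\<^sup>L (lebesgue_on ?C) (\<lambda>x. indicator \<Omega> x * (u x * \<phi> x)) = integral\<^sup>L (lebesgue_on \<Omega>) (\<lambda>x. u x * \<phi> x)"
  proof -
    have "(\<lambda>x. indicator ?C x *\<^sub>R (indicator \<Omega> x * (u x * \<phi> x))) = (\<lambda>x. indicator \<Omega> x *\<^sub>R (u x * \<phi> x))"
      using om(2) by (auto simp: indicator_def fun_eq_iff)
    then show ?thesis unfolding integral_restrict_space[OF Cs] integral_restrict_space[OF Os] by simp
  qed
  finally show ?thesis .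
qed

text \<open>Members of \<open>Hs_per\<close> are functions rather than classes, so smoothness is a
  statement about a representative \<open>g\<close>. The exterior set contains points on faces of
  the cube, where derivatives make sense only through the periodic extension and an open set
  \<open>U\<close> around them.\<close>

theorem mainTheorem7:
  fixes L lamn mun am :: real
    and s :: nat
    and \<Omega> :: "(real^'n::finite) set"
    and p :: "('n \<Rightarrow> nat) \<Rightarrow> real^'n \<Rightarrow> real"
    and vm :: "real^'n \<Rightarrow> real"
  assumes L_pos: "L > 0"
    and dom: "lipschitz_domain \<Omega>" and dom_sub: "\<Omega> \<subseteq> ccube L"
    and s_pos: "s \<ge> 1" and s_big: "real s > real CARD('n) / 2"
    and lam_pos: "lamn > 0" and mu_nn: "mun \<ge> 0"
    and p_smooth: "\<forall>\<alpha>\<in>multi_indices s. smooth_on \<Omega> (p \<alpha>)"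
    and p_bdd: "\<exists>M. \<forall>\<alpha>\<in>multi_indices s. \<forall>x\<in>\<Omega>. \<bar>p \<alpha> x\<bar> \<le> M"
    and am_pos: "am > 0"
    and vm_L2: "L2 (ccube (2 * L)) vm"
    and vm_nz: "\<not> (AE x in lebesgue_on (ccube (2 * L)). vm x = 0)"
    and eig: "\<exists>u. O_rel s L \<Omega> p lamn mun (Cop \<Omega> vm) u \<and>
                 (AE x in lebesgue_on (ccube (2 * L)). Cop \<Omega> u x = am * vm x)"
  shows "(\<exists>wm\<in>Hs_per s L.
            (AE x in lebesgue_on (ccube (2 * L)). vm x = (1 / am) * Cop \<Omega> wm x) \<and>
            (\<forall>\<phi>\<in>Hs_per s L. Bform s L \<Omega> p lamn mun wm \<phi>
                = (1 / am) * integral\<^sup>L (lebesgue_on \<Omega>) (\<lambda>x. wm x * \<phi> x)))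
       \<and> (\<forall>wm\<in>Hs_per s L.
            (\<forall>\<phi>\<in>Hs_per s L. Bform s L \<Omega> p lamn mun wm \<phi>
                = (1 / am) * integral\<^sup>L (lebesgue_on \<Omega>) (\<lambda>x. wm x * \<phi> x)) \<longrightarrow>
            (\<exists>g. smooth_on \<Omega> g \<and> (AE x in lebesgue_on \<Omega>. g x = wm x) \<and>
               (\<forall>x\<in>\<Omega>. lamn * (\<Sum>\<alpha>\<in>multi_indices s.
                           (-1) ^ mi_order \<alpha> * cderiv (\<lambda>i. 2 * \<alpha> i) g x)
                       + mun * Dstar s p (Dc s p g) x = (1 / am) * g x))
          \<and> (\<exists>g U. open U \<and> ccube (2 * L) - closure \<Omega> \<subseteq> U \<and> smooth_on U g \<and>
               (AE x in lebesgue_on U. g x = per_ext L wm x) \<and>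
               (\<forall>x\<in>ccube (2 * L) - closure \<Omega>.
                  (\<Sum>\<alpha>\<in>multi_indices s. (-1) ^ mi_order \<alpha> * cderiv (\<lambda>i. 2 * \<alpha> i) g x) = 0)))"
proof (intro conjI ballI impI)
  have om: "open \<Omega>" using dom by (simp add: lipschitz_domain_def)
  have om2: "\<Omega> \<subseteq> ccube (2 * L)"
    using dom_sub ccube_ocube[of L "2 * L"] ocube_ccube[of "2 * L"] L_pos by force
  obtain u where u: "O_rel s L \<Omega> p lamn mun (Cop \<Omega> vm) u"
    "AE x in lebesgue_on (ccube (2 * L)). Cop \<Omega> u x = am * vm x"
    using eig by blast
  show "\<exists>wm\<in>Hs_per s L.
            (AE x in lebesgue_on (ccube (2 * L)). vm x = (1 / am) * Cop \<Omega> wm x) \<and>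
            (\<forall>\<phi>\<in>Hs_per s L. Bform s L \<Omega> p lamn mun wm \<phi>
                = (1 / am) * integral\<^sup>L (lebesgue_on \<Omega>) (\<lambda>x. wm x * \<phi> x))"
  \<comment> \<open>The witness is the solution operator applied to the restricted eigenfunction,
    without a final restriction to \<Omega>.\<close>
  proof (rule bexI[of _ u], intro conjI ballI)
    show "AE x in lebesgue_on (ccube (2 * L)). vm x = (1 / am) * Cop \<Omega> u x"
      using u(2) by eventually_elim (use am_pos in simp)
    show "u \<in> Hs_per s L" using u(1) by (simp add: O_rel_def)
    fix \<phi> :: "real^'n \<Rightarrow> real" assume "\<phi> \<in> Hs_per s L"
    then show "Bform s L \<Omega> p lamn mun u \<phi> = (1 / am) * integral\<^sup>L (lebesgue_on \<Omega>) (\<lambda>x. u x * \<phi> x)"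
      by (rule eigenfunction_weak_form[OF om om2 am_pos u(1) vm_L2 u(2)])
  qed
  fix wm assume wm: "wm \<in> Hs_per s L"
    and eq: "\<forall>\<phi>\<in>Hs_per s L. Bform s L \<Omega> p lamn mun wm \<phi> = (1 / am) * integral\<^sup>L (lebesgue_on \<Omega>) (\<lambda>x. wm x * \<phi> x)"
  show "\<exists>g. smooth_on \<Omega> g \<and> (AE x in lebesgue_on \<Omega>. g x = wm x) \<and>
               (\<forall>x\<in>\<Omega>. lamn * (\<Sum>\<alpha>\<in>multi_indices s.
                           (-1) ^ mi_order \<alpha> * cderiv (\<lambda>i. 2 * \<alpha> i) g x)
                       + mun * Dstar s p (Dc s p g) x = (1 / am) * g x)"
    using p_smooth eq by (intro interior_regularity[OF L_pos om dom_sub s_pos lam_pos mu_nn _ wm]) blast+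
  show "\<exists>g U. open U \<and> ccube (2 * L) - closure \<Omega> \<subseteq> U \<and> smooth_on U g \<and>
               (AE x in lebesgue_on U. g x = per_ext L wm x) \<and>
               (\<forall>x\<in>ccube (2 * L) - closure \<Omega>.
                  (\<Sum>\<alpha>\<in>multi_indices s. (-1) ^ mi_order \<alpha> * cderiv (\<lambda>i. 2 * \<alpha> i) g x) = 0)"
    using eq by (intro exterior_regularity[where p = p and mu = mun and c = "1 / am", OF L_pos om dom_sub s_pos lam_pos wm]) blast
qed

end
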